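(* Let $X$ be a compact convex set and let $H=A_{sa}(X)\cap\mathrm{Ba}(X)$ be the space of strongly affine Baire functions on $X$. Then we have the following. (a) $$\mathcal A_H=\mathcal A_H^s=\mathcal S_H=\{F\cap\operatorname{ext}X: F\text{ is a split face of }X,\ F\text{ and }F'\text{ are Baire and measure convex}\}.$$ If $X$ is a simplex, then $$\mathcal A_H=\mathcal Z_H=\{[f=1]\cap\operatorname{ext}X: f\in A_{sa}(X)\cap\mathrm{Ba}(X),\ f(\operatorname{ext}X)\subset\{0,1\}\}.$$ (b) $M(H')\subset M(H)$ for each intermediate function space $H'\subset H$.
   Context: A compact convex set is a compact convex subset of a (Hausdorff) locally convex real topological vector space; $\operatorname{ext}X$ is the set of its extreme points. $A_c(X)$ is the space of continuous affine real functions on $X$ and $A_b(X)$ the space of bounded affine real functions on $X$ with the supremum norm. An intermediate function space on $X$ is a (norm-)closed linear subspace $H\subset A_b(X)$ with $A_c(X)\subset H$. $M_1(X)$ is the set of (complete) Radon probability measures on $X$; $r(\mu)\in X$ is the barycenter of $\mu\in M_1(X)$, i.e. $a(r(\mu))=\int a\,d\mu$ for all $a\in A_c(X)$. For $\mu,\nu\in M_1(X)$, $\mu\prec\nu$ means $\int f\,d\mu\le\int f\,d\nu$ for every convex continuous $f:X\to\mathbb R$; $\mu$ is maximal if it is maximal with respect to $\prec$. $X$ is a simplex if each point of $X$ is the barycenter of a unique maximal $\mu\in M_1(X)$. A set or function on $X$ is universally measurable if it is measurable with respect to every $\mu\in M_1(X)$. $A_{sa}(X)$ is the space of strongly affine functions: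 universally measurable $f:X\to\mathbb R$ with $\int f\,d\mu=f(r(\mu))$ for each $\mu\in M_1(X)$ (these are automatically bounded and affine). Baire sets are the elements of the $\sigma$-algebra generated by zero sets of continuous functions, and $\mathrm{Ba}(X)$ is the space of real functions on $X$ measurable with respect to this $\sigma$-algebra. A universally measurable set $F\subset X$ is measure convex if $r(\mu)\in F$ whenever $\mu\in M_1(X)$ and $\mu(F)=1$. A set $A\subset X$ is extremal if $y,z\in A$ whenever $y,z\in X$ and $\frac12(y+z)\in A$; a face is a convex extremal set. For a face $A$, the complementary set $A'$ is the union of all faces disjoint from $A$. A face $A$ is split if $A'$ is convex and for each $x\in X\setminus(A\cup A')$ there is a unique $\lambda\in(0,1)$ and a unique pair $a\in A$, $a'\in A'$ with $x=\lambda a+(1-\lambda)a'$. For a split face $A$, $\lambda_A:X\to[0,1]$ is the affine function assigning to $x\in X\setminus(A\cup A')$ this $\lambda$, with $\lambda_A=1$ on $A$ and $\lambda_A=0$ on $A'$. Multipliers: $M(H)=\{u\in H:\forall a\in H\ \exists b\in H\colon b=u\cdot a\text{ on }\operatorname{ext}X\}$. Strong multipliers: $M^s(H)=\{u\in H:\forall a\in H\ \exists b\in H\colon b=u\cdot a\ \mu\text{-a.e. for each maximal }\mu\in M_1(X)\}$. $H^\uparrow$ is the set of pointwise limits of bounded non-decreasing sequences from $H$. With $[m>0]=\{x\in X:m(x)>0\}$ etc., $\mathcal A_H=\{[m>0]\cap\operatorname{ext}X:m\in M(H)\}$, $\mathcal A_H^s=\{[m>0]\cap\operatorname{ext}X:m\in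 M^s(H)\}$, $\mathcal S_H=\{F\cap\operatorname{ext}X: F\text{ is a split face with }\lambda_F\in H^\uparrow\}$, $\mathcal Z_H=\{[f=1]\cap\operatorname{ext}X:f\in H^\uparrow,\ f(\operatorname{ext}X)\subset\{0,1\}\}$. (Since the present $H$ is closed under pointwise limits of bounded monotone sequences, $\mathcal A_H$ and $\mathcal A^s_H$ are also the families of $E\subset\operatorname{ext}X$ such that some $m\in M(H)$, resp. $m\in M^s(H)$, equals $1$ on $E$ and $0$ on $\operatorname{ext}X\setminus E$.) *)

theory Defs
  imports "HOL-Probability.Probability"
begin

section \<open>Hausdorff locally convex spaces\<close>

class topological_real_vector = real_vector + topological_ab_group_add +
  assumes tendsto_scaleR_Pair:
    "LIM p (nhds c \<times>\<^sub>F nhds x). fst p *\<^sub>R snd p :> nhds (c *\<^sub>R x)"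

text \<open>The constant \<^const>\<open>convex\<close> cannot be used inside the class specification, so its
  definition is written out there; see the lemma \<open>locally_convex\<close> below.\<close>

class locally_convex_space = topological_real_vector + t2_space +
  assumes ex_open_convex_subset:
    "open U \<Longrightarrow> 0 \<in> U \<Longrightarrow>
       \<exists>V. open V \<and> 0 \<in> V \<and> V \<subseteq> U \<and>
         (\<forall>x\<in>V. \<forall>y\<in>V. \<forall>u\<ge>0. \<forall>v\<ge>0. u + v = 1 \<longrightarrow> u *\<^sub>R x + v *\<^sub>R y \<in> V)"

lemma locally_convex:
  fixes U :: "'a::locally_convex_space set"
  assumes "open U" and "0 \<in> U"
  shows "\<exists>V. open V \<and> convex V \<and> 0 \<in> V \<and> V \<subseteq> U"
  using ex_open_convex_subset[OF assms] unfolding convex_def by blast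

instance real_normed_vector \<subseteq> locally_convex_space
proof
  show "LIM p (nhds c \<times>\<^sub>F nhds x). fst p *\<^sub>R snd p :> nhds (c *\<^sub>R x)" for c :: real and x :: 'a
    by (intro tendsto_scaleR filterlim_fst filterlim_snd)
  show "\<exists>V. open V \<and> 0 \<in> V \<and> V \<subseteq> U \<and>
      (\<forall>x\<in>V. \<forall>y\<in>V. \<forall>u\<ge>0. \<forall>v\<ge>0. u + v = 1 \<longrightarrow> u *\<^sub>R x + v *\<^sub>R y \<in> V)"
    if "open U" "0 \<in> U" for U :: "'a set"
    unfolding convex_def[symmetric]
    using that by (metis open_ball convex_ball centre_in_ball open_contains_ball)
qed

abbreviation ext_points :: "'a::real_vector set \<Rightarrow> 'a set" where
  "ext_points X \<equiv> {x. x extreme_point_of X}"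


section \<open>Functions on \<open>X\<close>\<close>

text \<open>Real functions on \<open>X\<close> are represented by elements of \<^term>\<open>extensional X\<close>, i.e.\ they
  are \<^term>\<open>undefined\<close> outside \<open>X\<close>; thus equality of representatives is equality on \<open>X\<close>.\<close>

definition affine_fun_on :: "'a::real_vector set \<Rightarrow> ('a \<Rightarrow> real) \<Rightarrow> bool" where
  "affine_fun_on X f \<longleftrightarrow>
     (\<forall>x\<in>X. \<forall>y\<in>X. \<forall>t\<in>{0..1}. f ((1 - t) *\<^sub>R x + t *\<^sub>R y) = (1 - t) * f x + t * f y)"

definition A_c :: "'a::locally_convex_space set \<Rightarrow> ('a \<Rightarrow> real) set" where
  "A_c X = {f \<in> extensional X. affine_fun_on X f \<and> continuous_on X f}"

definition A_b :: "'a::real_vector set \<Rightarrow> ('a \<Rightarrow> real) set" where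
  "A_b X = {f \<in> extensional X. affine_fun_on X f \<and> bounded (f ` X)}"

text \<open>In the last conjunct, \<^const>\<open>uniform_limit\<close> is convergence in the supremum norm of \<open>A_b X\<close>,
  so this conjunct says that \<open>H\<close> is norm-closed. The zero function lies in \<open>A_c X\<close>.\<close>

definition intermediate_function_space ::
    "'a::locally_convex_space set \<Rightarrow> ('a \<Rightarrow> real) set \<Rightarrow> bool" where
  "intermediate_function_space X H \<longleftrightarrow>
     A_c X \<subseteq> H \<and> H \<subseteq> A_b X \<and>
     (\<forall>f\<in>H. \<forall>g\<in>H. (\<lambda>x\<in>X. f x + g x) \<in> H) \<and>
     (\<forall>c. \<forall>f\<in>H. (\<lambda>x\<in>X. c * f x) \<in> H) \<and>
     (\<forall>s f. (\<forall>n::nat. s n \<in> H) \<and> f \<in> A_b X \<and> uniform_limit X s f sequentially \<longrightarrow> f \<in> H)"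

definition monotone_limits :: "'a set \<Rightarrow> ('a \<Rightarrow> real) set \<Rightarrow> ('a \<Rightarrow> real) set" where
  "monotone_limits X H =
     {f \<in> extensional X. \<exists>s::nat \<Rightarrow> 'a \<Rightarrow> real.
        (\<forall>n. s n \<in> H) \<and>
        (\<exists>C. \<forall>n. \<forall>x\<in>X. \<bar>s n x\<bar> \<le> C) \<and>
        (\<forall>x\<in>X. incseq (\<lambda>n. s n x) \<and> (\<lambda>n. s n x) \<longlonglongrightarrow> f x)}"


section \<open>Radon probability measures and the Choquet order\<close>

text \<open>Radon measures are taken complete: each is the completion of a Borel measure on \<open>X\<close> that is
  inner regular with respect to compact sets.\<close>

definition M1 :: "'a::t2_space set \<Rightarrow> 'a measure set" where
  "M1 X = {completion N | N.
     prob_space N \<and> sets N = sets (restrict_space borel X) \<and>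
     (\<forall>B\<in>sets N. emeasure N B = (SUP K\<in>{K. compact K \<and> K \<subseteq> B}. emeasure N K))}"

text \<open>\<open>barycenter X \<mu> x\<close> means \<open>x = r(\<mu>)\<close>.\<close>

definition barycenter :: "'a::locally_convex_space set \<Rightarrow> 'a measure \<Rightarrow> 'a \<Rightarrow> bool" where
  "barycenter X \<mu> x \<longleftrightarrow> x \<in> X \<and> (\<forall>a\<in>A_c X. a x = (\<integral>y. a y \<partial>\<mu>))"

definition choquet_le :: "'a::locally_convex_space set \<Rightarrow> 'a measure \<Rightarrow> 'a measure \<Rightarrow> bool" where
  "choquet_le X \<mu> \<nu> \<longleftrightarrow>
     (\<forall>f. continuous_on X f \<and> convex_on X f \<longrightarrow> (\<integral>x. f x \<partial>\<mu>) \<le> (\<integral>x. f x \<partial>\<nu>))"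

definition maximal_measures :: "'a::locally_convex_space set \<Rightarrow> 'a measure set" where
  "maximal_measures X = {\<mu> \<in> M1 X. \<forall>\<nu>\<in>M1 X. choquet_le X \<mu> \<nu> \<longrightarrow> \<nu> = \<mu>}"

definition choquet_simplex :: "'a::locally_convex_space set \<Rightarrow> bool" where
  "choquet_simplex X \<longleftrightarrow> (\<forall>x\<in>X. \<exists>!\<mu>. \<mu> \<in> maximal_measures X \<and> barycenter X \<mu> x)"


section \<open>Strongly affine and Baire functions\<close>

text \<open>\<^const>\<open>has_bochner_integral\<close> makes integrability explicit, as the integral of a
  non-integrable function is \<open>0\<close> by convention.\<close>

definition A_sa :: "'a::locally_convex_space set \<Rightarrow> ('a \<Rightarrow> real) set" where
  "A_sa X = {f \<in> extensional X.
     (\<forall>\<mu>\<in>M1 X. f \<in> borel_measurable \<mu>) \<and>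
     (\<forall>\<mu>\<in>M1 X. \<forall>x. barycenter X \<mu> x \<longrightarrow> has_bochner_integral \<mu> f (f x))}"

definition baire :: "'a::topological_space set \<Rightarrow> 'a measure" where
  "baire X = sigma X {{x \<in> X. f x = 0} | f :: 'a \<Rightarrow> real. continuous_on X f}"

definition Ba :: "'a::topological_space set \<Rightarrow> ('a \<Rightarrow> real) set" where
  "Ba X = {f \<in> extensional X. f \<in> borel_measurable (baire X)}"

definition measure_convex :: "'a::locally_convex_space set \<Rightarrow> 'a set \<Rightarrow> bool" where
  "measure_convex X F \<longleftrightarrow>
     F \<subseteq> X \<and> (\<forall>\<mu>\<in>M1 X. F \<in> sets \<mu>) \<and>
     (\<forall>\<mu>\<in>M1 X. \<forall>x. measure \<mu> F = 1 \<and> barycenter X \<mu> x \<longrightarrow> x \<in> F)"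


section \<open>Split faces\<close>

definition extremal :: "'a::real_vector set \<Rightarrow> 'a set \<Rightarrow> bool" where
  "extremal X A \<longleftrightarrow>
     A \<subseteq> X \<and> (\<forall>y\<in>X. \<forall>z\<in>X. (1/2) *\<^sub>R (y + z) \<in> A \<longrightarrow> y \<in> A \<and> z \<in> A)"

definition face :: "'a::real_vector set \<Rightarrow> 'a set \<Rightarrow> bool" where
  "face X A \<longleftrightarrow> convex A \<and> extremal X A"

definition compl_face :: "'a::real_vector set \<Rightarrow> 'a set \<Rightarrow> 'a set" where
  "compl_face X A = \<Union>{B. face X B \<and> B \<inter> A = {}}"

definition split_face :: "'a::real_vector set \<Rightarrow> 'a set \<Rightarrow> bool" where
  "split_face X A \<longleftrightarrow>
     face X A \<and> convex (compl_face X A) \<and>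
     (\<forall>x \<in> X - (A \<union> compl_face X A).
        \<exists>!(t, a, a'). t \<in> {0<..<1} \<and> a \<in> A \<and> a' \<in> compl_face X A \<and>
                     x = t *\<^sub>R a + (1 - t) *\<^sub>R a')"

definition split_lambda :: "'a::real_vector set \<Rightarrow> 'a set \<Rightarrow> 'a \<Rightarrow> real" where
  "split_lambda X A =
     (\<lambda>x\<in>X. if x \<in> A then 1 else if x \<in> compl_face X A then 0
            else THE t. t \<in> {0<..<1} \<and> (\<exists>a\<in>A. \<exists>a'\<in>compl_face X A. x = t *\<^sub>R a + (1 - t) *\<^sub>R a'))"


section \<open>Multipliers and the associated families of subsets of \<open>ext X\<close>\<close>

definition multipliers :: "'a::real_vector set \<Rightarrow> ('a \<Rightarrow> real) set \<Rightarrow> ('a \<Rightarrow> real) set" where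
  "multipliers X H =
     {u \<in> H. \<forall>a\<in>H. \<exists>b\<in>H. \<forall>x \<in> ext_points X. b x = u x * a x}"

definition strong_multipliers ::
    "'a::locally_convex_space set \<Rightarrow> ('a \<Rightarrow> real) set \<Rightarrow> ('a \<Rightarrow> real) set" where
  "strong_multipliers X H =
     {u \<in> H. \<forall>a\<in>H. \<exists>b\<in>H. \<forall>\<mu> \<in> maximal_measures X. AE x in \<mu>. b x = u x * a x}"

definition fam_A :: "'a::real_vector set \<Rightarrow> ('a \<Rightarrow> real) set \<Rightarrow> 'a set set" where
  "fam_A X H = {{x \<in> X. m x > 0} \<inter> ext_points X | m. m \<in> multipliers X H}"

definition fam_A_s :: "'a::locally_convex_space set \<Rightarrow> ('a \<Rightarrow> real) set \<Rightarrow> 'a set set" where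
  "fam_A_s X H = {{x \<in> X. m x > 0} \<inter> ext_points X | m. m \<in> strong_multipliers X H}"

definition fam_S :: "'a::real_vector set \<Rightarrow> ('a \<Rightarrow> real) set \<Rightarrow> 'a set set" where
  "fam_S X H =
     {F \<inter> ext_points X | F. split_face X F \<and> split_lambda X F \<in> monotone_limits X H}"

definition fam_Z :: "'a::real_vector set \<Rightarrow> ('a \<Rightarrow> real) set \<Rightarrow> 'a set set" where
  "fam_Z X H =
     {{x \<in> X. f x = 1} \<inter> ext_points X | f.
        f \<in> monotone_limits X H \<and> f ` ext_points X \<subseteq> {0, 1}}"

end

theory Submission
  imports Defs "HOL-Library.Function_Algebras"
begin

text \<open>Maximal measures come from minimal sublinear functionals, and Simons' inequality together with Bauer's
  maximum principle shows that they give measure zero to every Baire set disjoint from the extreme points. Hence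
  the Baire functions in \<open>H\<close> are determined by their values on the extreme points, multipliers and strong multipliers
  agree, and a bounded sequence in \<open>H\<close> converging on the extreme points has its limit extended by an element of \<open>H\<close>.

  If \<open>u\<close> is a multiplier, approximation of indicators by polynomials in \<open>u\<close> yields \<open>f \<in> H\<close> with values \<open>0\<close> and \<open>1\<close>
  on the extreme points; decomposing maximal measures along \<open>{f = 1}\<close> and \<open>{f = 0}\<close> shows that these sets are
  complementary split faces. Conversely, for a split face \<open>F\<close> with \<open>F\<close> and \<open>F'\<close> Baire and measure convex, the
  decomposition \<open>x = \<lambda> y + (1 - \<lambda>) z\<close> has a Baire graph, so Lusin's separation theorem makes \<open>\<lambda> \<cdot> a(y)\<close> a Baire
  function for \<open>a \<in> H\<close>, and measure convexity makes it strongly affine. It equals \<open>\<lambda> \<cdot> a\<close> on the extreme points, so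
  \<open>\<lambda>\<close> is a multiplier. Part (b) follows because a multiplier of a smaller space is a uniform limit of linear
  combinations of such functions on the extreme points.\<close>

section \<open>Minimal sublinear functionals\<close>

text \<open>Without metrizability the extreme points need not form a Borel set, so "carried by the
  extreme points" is replaced throughout by "null on every Baire set that misses them". Baire sets
  are controlled from inside by zero sets of continuous functions; images and densities are formed
  on the Baire sigma-algebra only and are then extended to Radon measures. Zorn's lemma is applied
  to sublinear functionals rather than to measures: minimality yields at once linearity and the
  concave-majorant form of maximality. Choosing a decomposition of each point with respect to a
  split face gives no measurability by itself. Uniqueness turns sublevel and superlevel sets into
  complementary projections of Baire sets, which is exactly the situation of a separation theorem.
  Part (b) is not formal: a multiplier of a subspace is only known to multiply that subspace. The
  detour through faces works because their description (split, Baire, measure convex) does not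
  mention the subspace.\<close>

instantiation "fun" :: (type, real_vector) real_vector
begin

text \<open>Pointwise scaling turns function spaces into real vector spaces, so that
  \<open>subspace\<close>, \<open>convex hull\<close> and the abstract lemmas on sublinear
  functionals apply to them.\<close>

definition scaleR_fun :: "real \<Rightarrow> ('a \<Rightarrow> 'b) \<Rightarrow> 'a \<Rightarrow> 'b"
  where "scaleR_fun c f = (\<lambda>x. c *\<^sub>R f x)"

instance
  by standard (auto simp: scaleR_fun_def fun_eq_iff algebra_simps)

end

lemma scaleR_fun_apply [simp]: "(c *\<^sub>R f) x = c *\<^sub>R f x"
  by (simp add: scaleR_fun_def)

definition sublinear_on :: "'v::real_vector set \<Rightarrow> ('v \<Rightarrow> real) \<Rightarrow> bool" where
  "sublinear_on V p \<longleftrightarrow>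
     (\<forall>f\<in>V. \<forall>g\<in>V. p (f + g) \<le> p f + p g) \<and> (\<forall>c\<ge>0. \<forall>f\<in>V. p (c *\<^sub>R f) = c * p f)"

text \<open>Applied with \<open>K\<close> the convex continuous functions and \<open>Q\<close> the nonnegative ones: \<open>p f\<close> is approximated by the values of
  \<open>p\<close> at concave majorants of \<open>f\<close>. The property is stable under decreasing limits of \<open>p\<close>, and at a minimal \<open>p\<close> it turns
  into Mokobodzki's criterion.\<close>

definition approx_from :: "'v::real_vector set \<Rightarrow> 'v set \<Rightarrow> 'v set \<Rightarrow> ('v \<Rightarrow> real) \<Rightarrow> bool" where
  "approx_from V K Q p \<longleftrightarrow>
     (\<forall>f\<in>V. \<forall>e>0. \<exists>h. - h \<in> K \<and> h - f \<in> Q \<and> p h \<le> p f + e)"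

lemma approx_fromD:
  assumes "approx_from V K Q p" "f \<in> V" "e > 0"
  obtains h where "- h \<in> K" "h - f \<in> Q" "p h \<le> p f + e"
  using assms unfolding approx_from_def by blast

lemma sublinear_onD:
  assumes "sublinear_on V p"
  shows "f \<in> V \<Longrightarrow> g \<in> V \<Longrightarrow> p (f + g) \<le> p f + p g"
    and "f \<in> V \<Longrightarrow> c \<ge> 0 \<Longrightarrow> p (c *\<^sub>R f) = c * p f"
  using assms unfolding sublinear_on_def by auto

lemma sublinear_on_zero: "sublinear_on V p \<Longrightarrow> subspace V \<Longrightarrow> p 0 = 0"
  using sublinear_onD(2)[of V p 0 0] subspace_0[of V] by auto

lemma sublinear_on_minus:
  assumes "sublinear_on V p" "subspace V" "f \<in> V"
  shows "- p (- f) \<le> p f"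
  using sublinear_onD(1)[OF assms(1), of f "- f"] sublinear_on_zero[OF assms(1,2)]
    subspace_neg[OF assms(2,3)] assms(3) by simp

text \<open>Zorn's lemma, downwards. Along a chain the infimum is finite because every sublinear
  \<open>p\<close> below \<open>p0\<close> satisfies \<open>p f \<ge> - p0 (- f)\<close>, and it
  stays subadditive because two members of the chain can be replaced by the smaller one. Candidates
  are taken extensional on \<open>V\<close> so that the order is antisymmetric.\<close>

lemma ex_minimal_sublinear:
  fixes V :: "'v::real_vector set"
  assumes V: "subspace V" and p0: "sublinear_on V p0" and a0: "approx_from V K Q p0" and KV: "K \<subseteq> V"
  obtains p where "sublinear_on V p" "approx_from V K Q p" "\<And>f. f \<in> V \<Longrightarrow> p f \<le> p0 f"
    "\<forall>q. sublinear_on V q \<and> approx_from V K Q q \<and> (\<forall>f\<in>V. q f \<le> p f) \<longrightarrow> (\<forall>f\<in>V. q f = p f)"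
proof -
  define A where "A = {p \<in> extensional V. sublinear_on V p \<and> approx_from V K Q p \<and> (\<forall>f\<in>V. p f \<le> p0 f)}"
  define P where "P = (\<lambda>p q :: 'v \<Rightarrow> real. \<forall>f\<in>V. q f \<le> p f)"
  have V': "f \<in> V \<Longrightarrow> g \<in> V \<Longrightarrow> f + g \<in> V" "f \<in> V \<Longrightarrow> c *\<^sub>R f \<in> V" "f \<in> V \<Longrightarrow> - f \<in> V" for f g c
    using V by (auto simp: subspace_add subspace_scale subspace_neg)
  have hV: "h \<in> V" if "- h \<in> K" for h
    using V'(3)[of "- h"] that KV by auto
  have restr: "restrict p V \<in> A"
    if su: "sublinear_on V p" and ap: "approx_from V K Q p" and le: "\<And>f. f \<in> V \<Longrightarrow> p f \<le> p0 f" for p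
  proof -
    have "approx_from V K Q (restrict p V)"
      unfolding approx_from_def
    proof (intro ballI allI impI)
      fix f and e :: real assume "f \<in> V" "e > 0"
      then obtain h where h: "- h \<in> K" "h - f \<in> Q" "p h \<le> p f + e"
        by (elim approx_fromD[OF ap]) auto
      then show "\<exists>h. - h \<in> K \<and> h - f \<in> Q \<and> restrict p V h \<le> restrict p V f + e"
        using \<open>f \<in> V\<close> hV[of h] by auto
    qed
    moreover have "sublinear_on V (restrict p V)"
      using su V' unfolding sublinear_on_def by auto
    ultimately show ?thesis
      using le unfolding A_def by auto
  qed
  have "\<exists>m\<in>A. \<forall>a\<in>A. P m a \<longrightarrow> a = m"
  proof (rule predicate_Zorn)
    show "partial_order_on A (relation_of P A)"
    proof (rule partial_order_on_relation_ofI)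
      show "a = b" if "a \<in> A" "b \<in> A" "P a b" "P b a" for a b
        using that by (intro extensionalityI[of a V b]) (auto simp: P_def A_def intro!: order_antisym)
      show "P a c" if "P a b" "P b c" for a b c
        using that unfolding P_def by (meson order_trans)
      show "P a a" for a
        unfolding P_def by simp
    qed
  next
    fix C assume C: "C \<in> Chains (relation_of P A)"
    then have CA: "C \<subseteq> A" by (auto simp: Chains_def relation_of_def)
    have Ctot: "P p q \<or> P q p" if "p \<in> C" "q \<in> C" for p q
      using C that by (auto simp: Chains_def relation_of_def)
    show "\<exists>u\<in>A. \<forall>a\<in>C. P a u"
    proof (cases "C = {}")
      case True
      then show ?thesis using restr[OF p0 a0] by auto
    next
      case False
      define u where "u = (\<lambda>f. INF p\<in>C. p f)"
      have lower: "- p0 (- f) \<le> p f" if "p \<in> C" "f \<in> V" for p f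
      proof -
        have "p \<in> A" using CA that by auto
        then show ?thesis
          using sublinear_on_minus[of V p f] V that V'(3)[of f] unfolding A_def by force
      qed
      have bdd: "bdd_below ((\<lambda>p. p f) ` C)" if "f \<in> V" for f
        using lower that by (intro bdd_belowI[of _ "- p0 (- f)"]) auto
      have ule: "u f \<le> p f" if "p \<in> C" "f \<in> V" for p f
        unfolding u_def using bdd that by (intro cINF_lower) auto
      have uge: "c \<le> u f" if "\<And>p. p \<in> C \<Longrightarrow> c \<le> p f" for c f
        unfolding u_def using that False by (intro cINF_greatest) auto
      have uapp: "\<exists>p\<in>C. p f < u f + e" if "f \<in> V" "e > 0" for f e
        using uge[of "u f + e" f] that by (meson less_add_same_cancel1 not_le)
      have sub: "u (f + g) \<le> u f + u g" if fg: "f \<in> V" "g \<in> V" for f g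
      proof (rule field_le_epsilon)
        fix e :: real assume "e > 0"
        obtain p q where p: "p \<in> C" "p f < u f + e/2" and q: "q \<in> C" "q g < u g + e/2"
          using uapp[of f "e/2"] uapp[of g "e/2"] fg \<open>e > 0\<close> by auto
        obtain r where r: "r \<in> C" "r f \<le> p f" "r g \<le> q g"
          using Ctot[OF p(1) q(1)] p(1) q(1) fg unfolding P_def by blast
        have "u (f + g) \<le> r (f + g)" using ule r V' that by auto
        also have "\<dots> \<le> r f + r g"
          using CA r(1) that by (auto simp: A_def sublinear_on_def)
        finally show "u (f + g) \<le> u f + u g + e" using r p q by linarith
      qed
      have hom: "u (c *\<^sub>R f) = c * u f" if "f \<in> V" "c \<ge> 0" for f c
      proof -
        have *: "p (c *\<^sub>R f) = c * p f" if "p \<in> C" for p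
          using CA that \<open>f \<in> V\<close> \<open>c \<ge> 0\<close> by (auto simp: A_def sublinear_on_def)
        show ?thesis
        proof (cases "c = 0")
          case True
          have "(\<lambda>p. p (c *\<^sub>R f)) ` C = {0}" using * True False by force
          then show ?thesis using True unfolding u_def by simp
        next
          case False
          then have "c > 0" using that by simp
          show ?thesis
          proof (rule order_antisym)
            have "u (c *\<^sub>R f) / c \<le> u f"
              using ule[of _ "c *\<^sub>R f"] V'(2)[of f c] * \<open>c > 0\<close> that
              by (intro uge) (auto simp: field_simps)
            then show "u (c *\<^sub>R f) \<le> c * u f" using \<open>c > 0\<close> by (simp add: field_simps)
            show "c * u f \<le> u (c *\<^sub>R f)"
            proof (rule uge)
              fix p assume "p \<in> C"
              then show "c * u f \<le> p (c *\<^sub>R f)"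
                using *[of p] mult_left_mono[OF ule[of p f] that(2)] that(1) by simp
            qed
          qed
        qed
      qed
      have "approx_from V K Q u"
        unfolding approx_from_def
      proof (intro ballI allI impI)
        fix f and e :: real assume f: "f \<in> V" and "e > 0"
        obtain p where p: "p \<in> C" "p f < u f + e/2" using uapp[of f "e/2"] f \<open>e > 0\<close> by auto
        then have "approx_from V K Q p" using CA by (auto simp: A_def)
        then obtain h where h: "- h \<in> K" "h - f \<in> Q" "p h \<le> p f + e/2"
          using f \<open>e > 0\<close> by (elim approx_fromD[of V K Q p f "e/2"]) auto
        have "u h \<le> p h" using ule p(1) hV h(1) by auto
        then show "\<exists>h. - h \<in> K \<and> h - f \<in> Q \<and> u h \<le> u f + e"
          using h p by (intro exI[of _ h]) auto
      qed
      moreover have "u f \<le> p0 f" if "f \<in> V" for f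
      proof -
        obtain p where "p \<in> C" using False by auto
        then show ?thesis using ule[of p f] that CA unfolding A_def by force
      qed
      ultimately have "restrict u V \<in> A"
        using sub hom by (intro restr) (auto simp: sublinear_on_def)
      moreover have "P a (restrict u V)" if "a \<in> C" for a
        using ule that by (auto simp: P_def)
      ultimately show ?thesis by blast
    qed
  qed
  then obtain m where m: "m \<in> A" "\<And>a. a \<in> A \<Longrightarrow> P m a \<Longrightarrow> a = m" by blast
  show thesis
  proof (rule that)
    show "sublinear_on V m" "approx_from V K Q m" "\<And>f. f \<in> V \<Longrightarrow> m f \<le> p0 f"
      using m(1) unfolding A_def by auto
    have "q f = m f" if q: "sublinear_on V q" "approx_from V K Q q" "\<forall>f\<in>V. q f \<le> m f" and f: "f \<in> V" for q f
    proof -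
      have "restrict q V \<in> A"
        using q m(1) by (intro restr) (force simp: A_def)+
      then have "restrict q V = m" using m(2) q by (auto simp: P_def)
      then show "q f = m f" using f by auto
    qed
    then show "\<forall>q. sublinear_on V q \<and> approx_from V K Q q \<and> (\<forall>f\<in>V. q f \<le> m f) \<longrightarrow> (\<forall>f\<in>V. q f = m f)"
      by blast
  qed
qed

text \<open>For sublinear \<open>p\<close> this is the largest sublinear functional below
  \<open>p\<close> whose value at \<open>- g\<close> is at most \<open>- p g\<close>: any such
  \<open>q\<close> satisfies \<open>q f \<le> q (f + t *\<^sub>R g) + t * q (- g)\<close>.\<close>

definition inf_ray :: "('v::real_vector \<Rightarrow> real) \<Rightarrow> 'v \<Rightarrow> 'v \<Rightarrow> real" where
  "inf_ray p g f = (INF t\<in>{0..}. p (f + t *\<^sub>R g) - t * p g)"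

text \<open>Finiteness of the infimum comes from
  \<open>t * p g \<le> p (f + t *\<^sub>R g) + p (- f)\<close>. Subadditivity adds the parameters of
  nearly optimal points, homogeneity rescales them.\<close>

lemma sublinear_on_inf_ray:
  fixes V :: "'v::real_vector set"
  assumes V: "subspace V" and p: "sublinear_on V p" and gV: "g \<in> V"
  defines "q \<equiv> inf_ray p g"
  shows "sublinear_on V q" and "f \<in> V \<Longrightarrow> q f \<le> p f" and "q (- g) \<le> - p g"
    and "f \<in> V \<Longrightarrow> t \<ge> 0 \<Longrightarrow> q f \<le> p (f + t *\<^sub>R g) - t * p g"
    and "f \<in> V \<Longrightarrow> e > 0 \<Longrightarrow> \<exists>t\<ge>0. p (f + t *\<^sub>R g) - t * p g < q f + e"
proof -
  have V': "f \<in> V \<Longrightarrow> g \<in> V \<Longrightarrow> f + g \<in> V" "f \<in> V \<Longrightarrow> c *\<^sub>R f \<in> V" "f \<in> V \<Longrightarrow> - f \<in> V" for f g c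
    using V by (auto simp: subspace_add subspace_scale subspace_neg)
  note sub = sublinear_onD(1)[OF p] and hom = sublinear_onD(2)[OF p]
  have lower: "- p (- f) \<le> p (f + t *\<^sub>R g) - t * p g" if "f \<in> V" "t \<ge> 0" for f t
  proof -
    have "p (t *\<^sub>R g) \<le> p (f + t *\<^sub>R g) + p (- f)"
      using sub[of "f + t *\<^sub>R g" "- f"] V' gV that by auto
    then show ?thesis using hom[OF gV that(2)] by linarith
  qed
  have bdd: "bdd_below ((\<lambda>t. p (f + t *\<^sub>R g) - t * p g) ` {0..})" if "f \<in> V" for f
    using lower that by (intro bdd_belowI[of _ "- p (- f)"]) auto
  have qle: "q f \<le> p (f + t *\<^sub>R g) - t * p g" if "t \<ge> 0" "f \<in> V" for f t
    unfolding q_def inf_ray_def using bdd that by (intro cINF_lower) auto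
  have qge: "c \<le> q f" if "\<And>t. t \<ge> 0 \<Longrightarrow> c \<le> p (f + t *\<^sub>R g) - t * p g" for c f
    unfolding q_def inf_ray_def using that by (intro cINF_greatest) auto
  have qapp: "\<exists>t\<ge>0. p (f + t *\<^sub>R g) - t * p g < q f + e" if "e > 0" for f e
    using qge[of "q f + e" f] that by (meson less_add_same_cancel1 not_le)
  have qp: "q f \<le> p f" if "f \<in> V" for f
    using qle[of 0 f] that by simp
  have qsub: "q (f + h) \<le> q f + q h" if fh: "f \<in> V" "h \<in> V" for f h
  proof (rule field_le_epsilon)
    fix e :: real assume "e > 0"
    obtain s t where s: "s \<ge> 0" "p (f + s *\<^sub>R g) - s * p g < q f + e/2"
      and t: "t \<ge> 0" "p (h + t *\<^sub>R g) - t * p g < q h + e/2"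
      using qapp[of "e/2" f] qapp[of "e/2" h] \<open>e > 0\<close> by auto
    have "q (f + h) \<le> p ((f + h) + (s + t) *\<^sub>R g) - (s + t) * p g"
      using s t fh V' by (intro qle) auto
    also have "(f + h) + (s + t) *\<^sub>R g = (f + s *\<^sub>R g) + (h + t *\<^sub>R g)"
      by (simp add: algebra_simps)
    also have "p \<dots> \<le> p (f + s *\<^sub>R g) + p (h + t *\<^sub>R g)"
      using fh gV V' by (intro sub) auto
    finally show "q (f + h) \<le> q f + q h + e" using s t by (simp add: algebra_simps)
  qed
  have qhom: "q (c *\<^sub>R f) = c * q f" if f: "f \<in> V" and c: "c \<ge> 0" for c f
  proof (cases "c = 0")
    case True
    have "0 \<le> q 0" using hom gV by (intro qge) auto
    moreover have "q 0 \<le> 0" using qp[of 0] sublinear_on_zero[OF p V] subspace_0[OF V] by auto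
    ultimately show ?thesis using True by simp
  next
    case False
    then have c: "c > 0" using c by simp
    show ?thesis
    proof (rule order_antisym)
      have "q (c *\<^sub>R f) / c \<le> q f"
      proof (rule qge)
        fix t :: real assume t: "t \<ge> 0"
        have "q (c *\<^sub>R f) \<le> p (c *\<^sub>R f + (c * t) *\<^sub>R g) - (c * t) * p g"
          using c t f V' by (intro qle) auto
        also have "c *\<^sub>R f + (c * t) *\<^sub>R g = c *\<^sub>R (f + t *\<^sub>R g)" by (simp add: algebra_simps)
        also have "p \<dots> = c * p (f + t *\<^sub>R g)" using c f gV V' by (intro hom) auto
        finally show "q (c *\<^sub>R f) / c \<le> p (f + t *\<^sub>R g) - t * p g"
          using c by (simp add: field_simps)
      qed
      then show "q (c *\<^sub>R f) \<le> c * q f" using c by (simp add: field_simps)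
      show "c * q f \<le> q (c *\<^sub>R f)"
      proof (rule qge)
        fix t :: real assume t: "t \<ge> 0"
        have "q f \<le> p (f + (t / c) *\<^sub>R g) - (t / c) * p g" using c t f by (intro qle) auto
        then have "c * q f \<le> c * p (f + (t / c) *\<^sub>R g) - t * p g"
          using c by (simp add: field_simps)
        also have "c * p (f + (t / c) *\<^sub>R g) = p (c *\<^sub>R (f + (t / c) *\<^sub>R g))"
          using c f gV V' by (intro hom[symmetric]) auto
        also have "c *\<^sub>R (f + (t / c) *\<^sub>R g) = c *\<^sub>R f + t *\<^sub>R g" using c by (simp add: algebra_simps)
        finally show "c * q f \<le> p (c *\<^sub>R f + t *\<^sub>R g) - t * p g" .
      qed
    qed
  qed
  show "sublinear_on V q" using qsub qhom unfolding sublinear_on_def by blast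
  show "f \<in> V \<Longrightarrow> q f \<le> p f" by (rule qp)
  show "q (- g) \<le> - p g"
    using qle[of 1 "- g"] V'(3)[OF gV] sublinear_on_zero[OF p V] by auto
  show "f \<in> V \<Longrightarrow> t \<ge> 0 \<Longrightarrow> q f \<le> p (f + t *\<^sub>R g) - t * p g" by (rule qle)
  show "f \<in> V \<Longrightarrow> e > 0 \<Longrightarrow> \<exists>t\<ge>0. p (f + t *\<^sub>R g) - t * p g < q f + e" by (rule qapp)
qed

text \<open>The minimal functional \<open>p\<close> equals its infimum along the ray through any \<open>g\<close> in \<open>K\<close>, which forces
  \<open>p (- g) = - p g\<close>; since \<open>h - t *\<^sub>R g\<close> stays in \<open>- K\<close>, that infimum is still approximable from \<open>- K\<close>.\<close>

lemma minimal_sublinear_linear: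
  fixes V :: "'v::real_vector set"
  assumes V: "subspace V" and p0: "sublinear_on V p0" and a0: "approx_from V K Q p0"
    and K: "K \<subseteq> V" "\<And>f g. f \<in> K \<Longrightarrow> g \<in> K \<Longrightarrow> f + g \<in> K" "\<And>c f. c \<ge> 0 \<Longrightarrow> f \<in> K \<Longrightarrow> c *\<^sub>R f \<in> K"
  obtains p where "sublinear_on V p" "approx_from V K Q p" "\<And>f. f \<in> V \<Longrightarrow> p f \<le> p0 f"
    "\<And>g. g \<in> K \<Longrightarrow> p (- g) = - p g"
proof -
  obtain p where p: "sublinear_on V p" "approx_from V K Q p" "\<And>f. f \<in> V \<Longrightarrow> p f \<le> p0 f"
    and pmin: "\<forall>q. sublinear_on V q \<and> approx_from V K Q q \<and> (\<forall>f\<in>V. q f \<le> p f) \<longrightarrow> (\<forall>f\<in>V. q f = p f)"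
    using ex_minimal_sublinear[OF V p0 a0 K(1)] by blast
  have V': "f \<in> V \<Longrightarrow> g \<in> V \<Longrightarrow> f + g \<in> V" "f \<in> V \<Longrightarrow> c *\<^sub>R f \<in> V" "f \<in> V \<Longrightarrow> - f \<in> V" for f g c
    using V by (auto simp: subspace_add subspace_scale subspace_neg)
  have hV: "h \<in> V" if "- h \<in> K" for h
    using V'(3)[of "- h"] that K(1) by auto
  have "p (- g) = - p g" if g: "g \<in> K" for g
  proof -
    have gV: "g \<in> V" using g K by auto
    define q where "q = inf_ray p g"
    note ray = sublinear_on_inf_ray[OF V p(1) gV, folded q_def]
    have "approx_from V K Q q"
      unfolding approx_from_def
    proof (intro ballI allI impI)
      fix f and e :: real assume f: "f \<in> V" and "e > 0"
      obtain t where t: "t \<ge> 0" "p (f + t *\<^sub>R g) - t * p g < q f + e/2"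
        using ray(5)[of f "e/2"] f \<open>e > 0\<close> by auto
      obtain h where h: "- h \<in> K" "h - (f + t *\<^sub>R g) \<in> Q" "p h \<le> p (f + t *\<^sub>R g) + e/2"
        by (rule approx_fromD[OF p(2) V'(1)[OF f V'(2)[OF gV]] half_gt_zero[OF \<open>e > 0\<close>]])
      have hK: "- (h - t *\<^sub>R g) \<in> K"
        using K(2)[OF h(1) K(3)[OF t(1) g]] by (simp add: algebra_simps)
      moreover have "(h - t *\<^sub>R g) - f \<in> Q" using h(2) by (simp add: algebra_simps)
      moreover have "q (h - t *\<^sub>R g) \<le> q f + e"
        using ray(4)[OF hV[OF hK] t(1)] h(3) t(2) by simp
      ultimately show "\<exists>h. - h \<in> K \<and> h - f \<in> Q \<and> q h \<le> q f + e" by blast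
    qed
    then have "q (- g) = p (- g)"
      using pmin ray(1,2) V'(3)[OF gV] by blast
    then show ?thesis
      using ray(3) sublinear_on_minus[OF p(1) V V'(3)[OF gV]] by simp
  qed
  then show thesis using that p by blast
qed

lemma sublinear_on_additive:
  assumes p: "sublinear_on V p" and V: "subspace V" and fg: "f \<in> V" "g \<in> V"
    and neg: "p (- f) = - p f" "p (- g) = - p g"
  shows "p (f + g) = p f + p g" "p (- (f + g)) = - p (f + g)"
proof -
  have *: "- f \<in> V" "- g \<in> V" "f + g \<in> V"
    using V fg by (auto simp: subspace_add subspace_neg)
  have "p (- f + - g) \<le> p (- f) + p (- g)"
    using sublinear_onD(1)[OF p] * by blast
  moreover have "p (f + g) \<le> p f + p g"
    using sublinear_onD(1)[OF p] fg by blast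
  moreover have "- p (- (f + g)) \<le> p (f + g)"
    using sublinear_on_minus[OF p V] * by blast
  moreover have "- f + - g = - (f + g)" by simp
  ultimately show "p (f + g) = p f + p g" "p (- (f + g)) = - p (f + g)" using neg by auto
qed

text \<open>With \<open>K\<close> everything and \<open>Q = {0}\<close> approximability is trivial,
  so the minimal functional is odd and hence linear. Starting from \<open>inf_ray p z\<close>
  instead of \<open>p\<close> forces the value at \<open>z\<close>.\<close>

lemma Hahn_Banach_sublinear:
  fixes p :: "'v::real_vector \<Rightarrow> real"
  assumes p: "sublinear_on UNIV p"
  obtains l where "linear l" "\<And>x. l x \<le> p x" "l z = p z"
proof -
  note ray = sublinear_on_inf_ray[OF subspace_UNIV p UNIV_I[of z]]
  let ?q = "inf_ray p z"
  have "approx_from UNIV UNIV {0} ?q"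
    unfolding approx_from_def by (auto intro!: exI less_imp_le)
  then obtain l where l: "sublinear_on UNIV l" "\<And>f. l f \<le> ?q f" "\<And>g. l (- g) = - l g"
    by (elim minimal_sublinear_linear[OF subspace_UNIV ray(1)]) auto
  have add: "l (x + y) = l x + l y" for x y
    using sublinear_on_additive(1)[OF l(1) subspace_UNIV] l(3) by auto
  have hom: "l (c *\<^sub>R x) = c * l x" for c x
  proof (cases "c \<ge> 0")
    case True
    then show ?thesis using sublinear_onD(2)[OF l(1)] by auto
  next
    case False
    then have "l ((- c) *\<^sub>R x) = - c * l x" using sublinear_onD(2)[OF l(1), of x "- c"] by auto
    then show ?thesis using l(3)[of "c *\<^sub>R x"] by simp
  qed
  have lp: "l x \<le> p x" for x
    using l(2)[of x] ray(2)[of x] by simp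
  have "l (- z) \<le> - p z"
    using l(2)[of "- z"] ray(3) by linarith
  then have "l z = p z" using l(3)[of z] lp[of z] by linarith
  moreover have "linear l" using add hom by (intro linearI) auto
  ultimately show thesis using that lp by blast
qed


section \<open>Continuous affine functions separate points\<close>

lemma tendsto_scaleR_tvs:
  fixes g :: "'b \<Rightarrow> 'a::topological_real_vector"
  assumes "(f \<longlongrightarrow> c) F" "(g \<longlongrightarrow> x) F"
  shows "((\<lambda>y. f y *\<^sub>R g y) \<longlongrightarrow> c *\<^sub>R x) F"
  using filterlim_compose[OF tendsto_scaleR_Pair, of "\<lambda>y. (f y, g y)" c x F] assms
  by (simp add: nhds_prod[symmetric] tendsto_Pair)

lemma continuous_on_scaleR_tvs:
  fixes g :: "'b::topological_space \<Rightarrow> 'a::topological_real_vector"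
  shows "continuous_on S f \<Longrightarrow> continuous_on S g \<Longrightarrow> continuous_on S (\<lambda>y. f y *\<^sub>R g y)"
  unfolding continuous_on_def by (auto intro: tendsto_scaleR_tvs)

text \<open>Neighbourhoods of 0 are absorbing, which makes the infimum defining the gauge range over
  a nonempty set.\<close>

lemma eventually_nhds_0_scaleR:
  fixes U :: "'a::topological_real_vector set"
  assumes "open U" "0 \<in> U"
  shows "\<exists>t>0. (1/t) *\<^sub>R v \<in> U"
proof -
  have "(\<lambda>n. inverse (real (Suc n))) \<longlonglongrightarrow> 0" by (rule LIMSEQ_inverse_real_of_nat)
  then have "((\<lambda>n. inverse (real (Suc n)) *\<^sub>R v) \<longlonglongrightarrow> 0 *\<^sub>R v)"
    by (intro tendsto_scaleR_tvs tendsto_const)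
  then have "\<forall>\<^sub>F n in sequentially. inverse (real (Suc n)) *\<^sub>R v \<in> U"
    using assms by (intro topological_tendstoD[of _ "0 *\<^sub>R v"]) auto
  then obtain n where "inverse (real (Suc n)) *\<^sub>R v \<in> U"
    by (auto simp: eventually_sequentially)
  then show ?thesis by (intro exI[of _ "real (Suc n)"]) (auto simp: inverse_eq_divide)
qed

text \<open>The Minkowski functional. \<open>U\<close> is not assumed symmetric, so it need not be
  even.\<close>

definition gauge_fun :: "'a::real_vector set \<Rightarrow> 'a \<Rightarrow> real" where
  "gauge_fun U v = Inf {t. t > 0 \<and> (1/t) *\<^sub>R v \<in> U}"

lemma
  fixes U :: "'a::topological_real_vector set"
  assumes U: "open U" "0 \<in> U" "convex U"
  shows sublinear_on_gauge_fun: "sublinear_on UNIV (gauge_fun U)"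
    and gauge_fun_le_1: "v \<in> U \<Longrightarrow> gauge_fun U v \<le> 1"
    and gauge_fun_ge_1: "v \<notin> U \<Longrightarrow> gauge_fun U v \<ge> 1"
proof -
  let ?S = "\<lambda>v. {t. t > 0 \<and> (1/t) *\<^sub>R v \<in> U}"
  have ne: "?S v \<noteq> {}" for v using eventually_nhds_0_scaleR[OF U(1,2), of v] by auto
  have le: "gauge_fun U v \<le> t" if "t > 0" "(1/t) *\<^sub>R v \<in> U" for t v
    unfolding gauge_fun_def using that by (intro cInf_lower bdd_belowI[of _ 0]) auto
  have ge: "c \<le> gauge_fun U v" if "\<And>t. t > 0 \<Longrightarrow> (1/t) *\<^sub>R v \<in> U \<Longrightarrow> c \<le> t" for c v
    unfolding gauge_fun_def using that ne by (intro cInf_greatest) auto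
  have sub: "gauge_fun U (v + w) \<le> gauge_fun U v + gauge_fun U w" for v w
  proof -
    have "gauge_fun U (v + w) \<le> s + t"
      if s: "s > 0" "(1/s) *\<^sub>R v \<in> U" and t: "t > 0" "(1/t) *\<^sub>R w \<in> U" for s t
    proof (rule le)
      have "(s/(s+t)) *\<^sub>R ((1/s) *\<^sub>R v) + (t/(s+t)) *\<^sub>R ((1/t) *\<^sub>R w) \<in> U"
        using s t by (intro convexD[OF U(3)]) (auto simp: add_divide_distrib[symmetric])
      then show "(1/(s+t)) *\<^sub>R (v + w) \<in> U"
        using s t by (simp add: algebra_simps)
    qed (use s t in auto)
    then have "gauge_fun U (v + w) - t \<le> gauge_fun U v" if "t > 0" "(1/t) *\<^sub>R w \<in> U" for t
      using that by (intro ge) (simp add: algebra_simps)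
    then have "gauge_fun U (v + w) - gauge_fun U v \<le> gauge_fun U w"
      by (intro ge) (simp add: algebra_simps)
    then show ?thesis by simp
  qed
  have hom_le: "gauge_fun U (c *\<^sub>R v) \<le> c * gauge_fun U v" if c: "c > 0" for c v
  proof -
    have "gauge_fun U (c *\<^sub>R v) / c \<le> gauge_fun U v"
    proof (rule ge)
      fix t :: real assume "t > 0" "(1/t) *\<^sub>R v \<in> U"
      then have "gauge_fun U (c *\<^sub>R v) \<le> c * t" using c by (intro le) auto
      then show "gauge_fun U (c *\<^sub>R v) / c \<le> t" using c by (simp add: field_simps)
    qed
    then show ?thesis using c by (simp add: field_simps)
  qed
  have hom: "gauge_fun U (c *\<^sub>R v) = c * gauge_fun U v" if "c \<ge> 0" for c v
  proof (cases "c = 0")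
    case True
    have "gauge_fun U (0::'a) = 0"
    proof (rule order_antisym)
      show "gauge_fun U (0::'a) \<le> 0"
        by (rule field_le_epsilon) (use le[of _ "0::'a"] U in auto)
      show "0 \<le> gauge_fun U (0::'a)" by (intro ge) auto
    qed
    then show ?thesis using True by simp
  next
    case False
    then have c: "c > 0" using that by simp
    have "gauge_fun U ((1/c) *\<^sub>R (c *\<^sub>R v)) \<le> (1/c) * gauge_fun U (c *\<^sub>R v)"
      using c by (intro hom_le) simp
    then have "c * gauge_fun U v \<le> gauge_fun U (c *\<^sub>R v)" using c by (simp add: field_simps)
    then show ?thesis using hom_le[OF c, of v] by simp
  qed
  show "sublinear_on UNIV (gauge_fun U)" using sub hom unfolding sublinear_on_def by auto
  show "v \<in> U \<Longrightarrow> gauge_fun U v \<le> 1" using le[of 1 v] by simp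
  show "v \<notin> U \<Longrightarrow> gauge_fun U v \<ge> 1"
  proof (rule ge, rule ccontr)
    fix t :: real assume *: "v \<notin> U" "t > 0" "(1/t) *\<^sub>R v \<in> U" "\<not> 1 \<le> t"
    then have "t *\<^sub>R ((1/t) *\<^sub>R v) + (1 - t) *\<^sub>R 0 \<in> U"
      using U by (intro convexD[OF U(3)]) auto
    then show False using * by simp
  qed
qed

text \<open>Choose a convex open \<open>V\<close> around 0 that misses \<open>y - x\<close>. A
  linear functional below the gauge of \<open>V\<close> and equal to it at \<open>y - x\<close> is
  at least 1 there, and it is continuous because it is at most 1 on \<open>V\<close>.\<close>

lemma ex_continuous_linear_separating:
  fixes x y :: "'a::locally_convex_space"
  assumes "x \<noteq> y"
  obtains l :: "'a \<Rightarrow> real" where "linear l" "continuous_on UNIV l" "l x < l y"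
proof -
  obtain V where V: "open V" "convex V" "0 \<in> V" "V \<subseteq> - {y - x}"
    using locally_convex[of "- {y - x}"] assms by auto
  obtain l where l: "linear l" "\<And>v. l v \<le> gauge_fun V v" "l (y - x) = gauge_fun V (y - x)"
    using Hahn_Banach_sublinear[OF sublinear_on_gauge_fun[OF V(1,3,2)]] by metis
  have "l (y - x) \<ge> 1" using gauge_fun_ge_1[OF V(1,3,2), of "y - x"] V(4) l(3) by auto
  then have "l x < l y" using linear_diff[OF l(1)] by simp
  moreover have "(l \<longlongrightarrow> l a) (nhds a)" for a
  proof (rule tendstoI)
    fix e :: real assume e: "e > 0"
    have "((\<lambda>v. (2/e) *\<^sub>R (v - a)) \<longlongrightarrow> (2/e) *\<^sub>R (a - a)) (nhds a)"
      by (intro tendsto_scaleR_tvs tendsto_const tendsto_diff filterlim_ident)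
    then have 1: "\<forall>\<^sub>F v in nhds a. (2/e) *\<^sub>R (v - a) \<in> V"
      using V by (intro topological_tendstoD[of _ "(2/e) *\<^sub>R (a - a)"]) auto
    \<comment> \<open>As \<open>V\<close> need not be symmetric, both differences must lie in the
      scaled neighbourhood. The factor 2 gives a bound by \<open>e/2\<close>, hence the strict
      inequality.\<close>
    have "((\<lambda>v. (2/e) *\<^sub>R (a - v)) \<longlongrightarrow> (2/e) *\<^sub>R (a - a)) (nhds a)"
      by (intro tendsto_scaleR_tvs tendsto_const tendsto_diff filterlim_ident)
    then have 2: "\<forall>\<^sub>F v in nhds a. (2/e) *\<^sub>R (a - v) \<in> V"
      using V by (intro topological_tendstoD[of _ "(2/e) *\<^sub>R (a - a)"]) auto
    show "\<forall>\<^sub>F v in nhds a. dist (l v) (l a) < e"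
      using 1 2
    proof eventually_elim
      case (elim v)
      have "l w \<le> 1" if "w \<in> V" for w
        using l(2)[of w] gauge_fun_le_1[OF V(1,3,2) that] by linarith
      then have "l ((2/e) *\<^sub>R (v - a)) \<le> 1" "l ((2/e) *\<^sub>R (a - v)) \<le> 1" using elim by auto
      then have "2 * (l v - l a) \<le> e" "2 * (l a - l v) \<le> e"
        using e l(1) by (simp_all add: linear_cmul linear_diff field_simps)
      then show ?case using e by (simp add: dist_real_def)
    qed
  qed
  then have "continuous_on UNIV l"
    unfolding continuous_on_def by (auto simp: tendsto_at_iff_tendsto_nhds)
  ultimately show thesis using that l(1) by blast
qed

lemma A_c_separating:
  assumes "convex X" "x \<in> X" "y \<in> X" "x \<noteq> y"
  obtains a where "a \<in> A_c X" "a x < a y"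
proof -
  obtain l :: "'a \<Rightarrow> real" where l: "linear l" "continuous_on UNIV l" "l x < l y"
    using ex_continuous_linear_separating[OF assms(4)] by metis
  have "continuous_on X (restrict l X)"
    using continuous_on_subset[OF l(2)] by (subst continuous_on_cong[OF refl, of _ _ l]) auto
  moreover have "affine_fun_on X (restrict l X)"
    using l(1) convexD_alt[OF assms(1)] by (auto simp: affine_fun_on_def linear_add linear_cmul)
  ultimately have "restrict l X \<in> A_c X" by (simp add: A_c_def)
  then show thesis using that l(3) assms by auto
qed

section \<open>The Riesz representation theorem on compact Hausdorff spaces\<close>

lemma normal_space_top_of_set_compact:
  fixes X :: "'a::t2_space set"
  assumes "compact X"
  shows "normal_space (top_of_set X)"
proof (intro compact_Hausdorff_or_regular_imp_normal_space disjI1)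
  show "compact_space (top_of_set X)" using assms by (simp add: compact_space_subtopology)
  have "Hausdorff_space (euclidean :: 'a topology)"
    using hausdorff by (fastforce simp: Hausdorff_space_def disjnt_def)
  then show "Hausdorff_space (top_of_set X)" by (rule Hausdorff_space_subtopology)
qed

lemma Urysohn_compact:
  fixes X :: "'a::t2_space set"
  assumes "compact X" "closedin (top_of_set X) S" "closedin (top_of_set X) T" "S \<inter> T = {}"
  obtains f :: "'a \<Rightarrow> real" where "continuous_on X f" "\<And>x. x \<in> X \<Longrightarrow> 0 \<le> f x \<and> f x \<le> 1"
    "\<And>x. x \<in> S \<Longrightarrow> f x = 0" "\<And>x. x \<in> T \<Longrightarrow> f x = 1"
proof -
  obtain f where f: "continuous_map (top_of_set X) (top_of_set {0..1::real}) f" "f ` S \<subseteq> {0}" "f ` T \<subseteq> {1}"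
    by (rule Urysohn_lemma[OF normal_space_top_of_set_compact[OF assms(1)] assms(2,3), of 0 1])
       (use assms in \<open>auto simp: disjnt_def\<close>)
  show thesis
    by (rule that[of f]) (use f in \<open>auto simp: continuous_map_in_subtopology image_subset_iff\<close>)
qed

text \<open>Functions are total, but by \<open>L_pos\<close> and linearity only their values on
  \<open>X\<close> matter: functions that agree on \<open>X\<close> have the same
  \<open>L\<close>.\<close>

locale positive_functional =
  fixes X :: "'a::t2_space set" and L :: "('a \<Rightarrow> real) \<Rightarrow> real"
  assumes compact: "compact X"
    and L_add: "\<And>f g. continuous_on X f \<Longrightarrow> continuous_on X g \<Longrightarrow> L (\<lambda>x. f x + g x) = L f + L g"
    and L_scale: "\<And>c f. continuous_on X f \<Longrightarrow> L (\<lambda>x. c * f x) = c * L f"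
    and L_pos: "\<And>f. continuous_on X f \<Longrightarrow> (\<And>x. x \<in> X \<Longrightarrow> 0 \<le> f x) \<Longrightarrow> 0 \<le> L f"
    and L_one: "L (\<lambda>_. 1) = 1"
begin

lemma L_diff: "continuous_on X f \<Longrightarrow> continuous_on X g \<Longrightarrow> L (\<lambda>x. f x - g x) = L f - L g"
  using L_add[of f "\<lambda>x. -1 * g x"] L_scale[of g "-1"] by (simp add: continuous_on_minus)

lemma L_mono:
  "continuous_on X f \<Longrightarrow> continuous_on X g \<Longrightarrow> (\<And>x. x \<in> X \<Longrightarrow> f x \<le> g x) \<Longrightarrow> L f \<le> L g"
  using L_pos[of "\<lambda>x. g x - f x"] L_diff[of g f] by (simp add: continuous_on_diff)

lemma L_const: "L (\<lambda>_. c) = c"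
  using L_scale[of "\<lambda>_. 1" c] L_one by simp

lemma L_sum:
  assumes "finite I" "\<And>i. i \<in> I \<Longrightarrow> continuous_on X (f i)"
  shows "L (\<lambda>x. \<Sum>i\<in>I. f i x) = (\<Sum>i\<in>I. L (f i))"
  using assms
proof (induction I rule: finite_induct)
  case empty
  then show ?case using L_const[of 0] by simp
next
  case (insert i I)
  then show ?case by (simp add: L_add continuous_on_sum)
qed

text \<open>Only vanishing off \<open>U\<close> is required, not support inside \<open>U\<close>.
  The truncation \<open>max 0 (f - e)\<close> replaces the support condition at the cost of
  \<open>e\<close>, see \<open>L_le_shift\<close>.\<close>

definition under :: "'a set \<Rightarrow> ('a \<Rightarrow> real) set" where
  "under U = {f. continuous_on X f \<and> (\<forall>x\<in>X. 0 \<le> f x \<and> f x \<le> indicator U x)}"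

definition m :: "'a set \<Rightarrow> real" where
  "m U = (SUP f\<in>under U. L f)"

definition outer :: "'a set \<Rightarrow> real" where
  "outer A = (INF U\<in>{U. openin (top_of_set X) U \<and> A \<subseteq> U}. m U)"

lemma underD:
  assumes "f \<in> under U"
  shows "continuous_on X f" "x \<in> X \<Longrightarrow> 0 \<le> f x" "x \<in> X \<Longrightarrow> f x \<le> 1"
    "x \<in> X \<Longrightarrow> x \<notin> U \<Longrightarrow> f x = 0"
proof -
  have *: "continuous_on X f" "\<And>x. x \<in> X \<Longrightarrow> 0 \<le> f x \<and> f x \<le> indicator U x"
    using assms unfolding under_def by auto
  show "continuous_on X f" by (rule *)
  show "0 \<le> f x" "f x \<le> 1" if "x \<in> X" for x
    using *(2)[OF that] by (cases "x \<in> U", auto)+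
  show "f x = 0" if "x \<in> X" "x \<notin> U" for x
    using *(2)[OF that(1)] that(2) by simp
qed

lemma underI:
  assumes "continuous_on X f" "\<And>x. x \<in> X \<Longrightarrow> 0 \<le> f x" "\<And>x. x \<in> X \<Longrightarrow> x \<in> U \<Longrightarrow> f x \<le> 1"
    "\<And>x. x \<in> X \<Longrightarrow> x \<notin> U \<Longrightarrow> f x = 0"
  shows "f \<in> under U"
  using assms unfolding under_def by (auto simp: indicator_def)

lemma zero_in_under: "(\<lambda>_. 0) \<in> under U"
  by (intro underI) auto

lemma L_le_1: "f \<in> under U \<Longrightarrow> L f \<le> 1"
  using L_mono[of f "\<lambda>_. 1"] L_one underD(1,3)[of f U] by auto

lemma bdd_above_under: "bdd_above (L ` under U)"
  using L_le_1 by (intro bdd_aboveI[of _ 1]) auto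

lemma L_le_m: "f \<in> under U \<Longrightarrow> L f \<le> m U"
  unfolding m_def by (intro cSUP_upper bdd_above_under)

lemma m_le: "(\<And>f. f \<in> under U \<Longrightarrow> L f \<le> c) \<Longrightarrow> m U \<le> c"
  unfolding m_def using zero_in_under by (intro cSUP_least) auto

lemma m_approx: "e > 0 \<Longrightarrow> \<exists>f\<in>under U. m U - e < L f"
  using m_le[of U "m U - e"] by (meson diff_less_eq less_add_same_cancel1 not_le)

lemma m_nonneg: "0 \<le> m U"
  using L_le_m[OF zero_in_under] L_const[of 0] by simp

lemma m_mono: "U \<subseteq> V \<Longrightarrow> m U \<le> m V"
proof (rule m_le)
  fix f assume "U \<subseteq> V" "f \<in> under U"
  then have "f \<in> under V" by (intro underI) (auto dest: underD intro: underD(3))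
  then show "L f \<le> m V" by (rule L_le_m)
qed

lemma m_empty: "m {} = 0"
proof (rule order_antisym[OF m_le m_nonneg])
  fix f assume f: "f \<in> under {}"
  then show "L f \<le> 0" using L_mono[of f "\<lambda>_. 0"] L_const[of 0] underD[OF f] by auto
qed

lemma m_X: "m X = 1"
proof (rule order_antisym[OF m_le])
  show "1 \<le> m X" using L_le_m[of "\<lambda>_. 1" X] L_one by (auto simp: under_def)
qed (rule L_le_1)

lemma L_le_shift:
  assumes "f \<in> under U" "e > 0"
  shows "L f \<le> L (\<lambda>x. max 0 (f x - e)) + e"
proof -
  have "L f \<le> L (\<lambda>x. max 0 (f x - e) + e)"
    using underD(1)[OF assms(1)] by (intro L_mono continuous_intros) auto
  also have "\<dots> = L (\<lambda>x. max 0 (f x - e)) + e"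
    using underD(1)[OF assms(1)] L_const[of e] by (subst L_add) (auto intro!: continuous_intros)
  finally show ?thesis .
qed

lemma closedin_level:
  assumes "continuous_on X f"
  shows "closedin (top_of_set X) {x \<in> X. (e::real) \<le> f x}"
  using continuous_closedin_preimage[OF assms, of "{e..}"]
  by (simp add: vimage_def Int_def conj_commute)

text \<open>The compact set \<open>K = {f \<ge> e}\<close> lies in \<open>U \<union> V\<close>. A
  Urysohn function that is 0 off \<open>U\<close> and 1 on \<open>K - V\<close> splits the truncated
  \<open>f\<close> into a summand vanishing off \<open>U\<close> and one vanishing off
  \<open>V\<close>.\<close>

lemma m_Un_le:
  assumes U: "openin (top_of_set X) U" and V: "openin (top_of_set X) V"
  shows "m (U \<union> V) \<le> m U + m V"
proof (rule m_le, rule field_le_epsilon)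
  fix f and e :: real assume f: "f \<in> under (U \<union> V)" and e: "e > 0"
  note f' = underD[OF f]
  define K where "K = {x \<in> X. e \<le> f x}"
  have K: "closedin (top_of_set X) K" unfolding K_def by (rule closedin_level[OF f'(1)])
  have c: "closedin (top_of_set X) (X - U)" "closedin (top_of_set X) (K - V)"
    using U V K by (auto intro: closedin_diff)
  have "x \<in> U \<union> V" if "x \<in> K" for x
    using f'(4)[of x] that e by (auto simp: K_def)
  then have "(X - U) \<inter> (K - V) = {}" by auto
  then obtain u :: "'a \<Rightarrow> real" where u: "continuous_on X u" "\<And>x. x \<in> X \<Longrightarrow> 0 \<le> u x \<and> u x \<le> 1"
    "\<And>x. x \<in> X - U \<Longrightarrow> u x = 0" "\<And>x. x \<in> K - V \<Longrightarrow> u x = 1"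
    using Urysohn_compact[OF compact c] by metis
  define f1 where "f1 = (\<lambda>x. max 0 (f x - e) * u x)"
  define f2 where "f2 = (\<lambda>x. max 0 (f x - e) * (1 - u x))"
  have le1: "max 0 (f x - e) * t \<le> 1" if "x \<in> X" "0 \<le> t" "t \<le> 1" for x t
    using f'(2,3)[of x] that e mult_le_one[of "max 0 (f x - e)" t] by auto
  have f1: "f1 \<in> under U" unfolding f1_def
    using f'(1) u le1 by (intro underI) (auto intro!: continuous_intros)
  have f2: "f2 \<in> under V" unfolding f2_def
    using f'(1) u le1
  proof (intro underI)
    fix x assume x: "x \<in> X" "x \<notin> V"
    show "max 0 (f x - e) * (1 - u x) = 0"
      using u(4)[of x] x by (cases "x \<in> K") (auto simp: K_def)
  qed (auto intro!: continuous_intros)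
  have "L f \<le> L (\<lambda>x. max 0 (f x - e)) + e" by (rule L_le_shift[OF f e])
  also have "(\<lambda>x. max 0 (f x - e)) = (\<lambda>x. f1 x + f2 x)"
    by (auto simp: f1_def f2_def algebra_simps)
  also have "L \<dots> = L f1 + L f2" using f1 f2 by (intro L_add) (auto dest: underD)
  also have "\<dots> \<le> m U + m V" using L_le_m[OF f1] L_le_m[OF f2] by simp
  finally show "L f \<le> m U + m V + e" by simp
qed

lemma m_UN_lessThan_le:
  fixes U :: "nat \<Rightarrow> 'a set"
  assumes "\<And>n. openin (top_of_set X) (U n)"
  shows "m (\<Union>n<N. U n) \<le> (\<Sum>n<N. m (U n))"
proof (induction N)
  case 0
  then show ?case by (simp add: m_empty)
next
  case (Suc N)
  have "m (\<Union>n<Suc N. U n) = m ((\<Union>n<N. U n) \<union> U N)"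
    by (simp add: lessThan_Suc Un_commute)
  also have "\<dots> \<le> m (\<Union>n<N. U n) + m (U N)"
    using assms by (intro m_Un_le) auto
  finally show ?case using Suc by simp
qed

text \<open>A truncated, nearly optimal \<open>f\<close> vanishes off a compact set, which finitely
  many \<open>U n\<close> cover, so finite subadditivity suffices. The bound is in
  \<open>ennreal\<close> because the series may diverge.\<close>

lemma m_UN_le:
  fixes U :: "nat \<Rightarrow> 'a set"
  assumes U: "\<And>n. openin (top_of_set X) (U n)"
  shows "ennreal (m (\<Union>n. U n)) \<le> (\<Sum>n. ennreal (m (U n)))"
proof (rule ennreal_le_epsilon)
  fix e :: real assume "e > 0"
  then have e: "e/2 > 0" by simp
  obtain f where f: "f \<in> under (\<Union>n. U n)" "m (\<Union>n. U n) - e/2 < L f"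
    using m_approx[OF e] by blast
  note f' = underD[OF f(1)]
  define K where "K = {x \<in> X. e/2 \<le> f x}"
  have "closedin (top_of_set X) K" unfolding K_def by (rule closedin_level[OF f'(1)])
  then have "compact K" using compact closedin_compact by blast
  moreover have "K \<subseteq> (\<Union>n. U n)" using f'(4) e by (force simp: K_def)
  moreover have "\<exists>V. open V \<and> U n = X \<inter> V" for n using U[of n] by (auto simp: openin_open)
  then obtain V where V: "\<And>n. open (V n)" "\<And>n. U n = X \<inter> V n" by metis
  ultimately have "compact K" "K \<subseteq> (\<Union>n. V n)" by auto
  then obtain C where C: "finite C" "K \<subseteq> (\<Union>n\<in>C. V n)"
    using compactE_image[of K UNIV V] V(1) by (metis subset_UNIV)
  obtain N where N: "C \<subseteq> {..<N}" using finite_nat_iff_bounded C(1) by auto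
  have "K \<subseteq> (\<Union>n<N. U n)" using C(2) N V(2) K_def by fastforce
  then have g: "(\<lambda>x. max 0 (f x - e/2)) \<in> under (\<Union>n<N. U n)"
  proof (intro underI)
    fix x assume x: "x \<in> X"
    show "max 0 (f x - e/2) \<le> 1" using f'(3)[OF x] e by auto
    show "max 0 (f x - e/2) = 0" if "x \<notin> (\<Union>n<N. U n)" using that x \<open>K \<subseteq> (\<Union>n<N. U n)\<close> by (auto simp: K_def)
  qed (use f'(1) in \<open>auto intro!: continuous_intros\<close>)
  have "m (\<Union>n. U n) \<le> L (\<lambda>x. max 0 (f x - e/2)) + e"
    using f(2) L_le_shift[OF f(1) e] by simp
  also have "L (\<lambda>x. max 0 (f x - e/2)) \<le> (\<Sum>n<N. m (U n))"
    using L_le_m[OF g] m_UN_lessThan_le[of U N, OF U] by linarith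
  finally have "ennreal (m (\<Union>n. U n)) \<le> ennreal ((\<Sum>n<N. m (U n)) + e)" by (intro ennreal_leI) simp
  also have "\<dots> = (\<Sum>n<N. ennreal (m (U n))) + ennreal e"
    using \<open>e > 0\<close> m_nonneg by (simp add: sum_nonneg sum_ennreal)
  also have "\<dots> \<le> (\<Sum>n. ennreal (m (U n))) + ennreal e"
    by (intro add_right_mono sum_le_suminf) auto
  finally show "ennreal (m (\<Union>n. U n)) \<le> (\<Sum>n. ennreal (m (U n))) + ennreal e" .
qed

lemma outer_le: "openin (top_of_set X) U \<Longrightarrow> A \<subseteq> U \<Longrightarrow> outer A \<le> m U"
  unfolding outer_def using m_nonneg by (intro cINF_lower bdd_belowI[of _ 0]) auto

lemma le_outer:
  "A \<subseteq> X \<Longrightarrow> (\<And>U. openin (top_of_set X) U \<Longrightarrow> A \<subseteq> U \<Longrightarrow> c \<le> m U) \<Longrightarrow> c \<le> outer A"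
  unfolding outer_def by (intro cINF_greatest) (auto intro!: exI[of _ X])

lemma outer_approx:
  "A \<subseteq> X \<Longrightarrow> e > 0 \<Longrightarrow> \<exists>U. openin (top_of_set X) U \<and> A \<subseteq> U \<and> m U < outer A + e"
  using le_outer[of A "outer A + e"] by (meson less_add_same_cancel1 not_le)

lemma outer_open: "openin (top_of_set X) U \<Longrightarrow> outer U = m U"
  by (intro order_antisym outer_le le_outer m_mono) (auto dest: openin_imp_subset)

lemma outer_nonneg: "A \<subseteq> X \<Longrightarrow> 0 \<le> outer A"
  by (intro le_outer m_nonneg)

lemma outer_mono: "A \<subseteq> B \<Longrightarrow> B \<subseteq> X \<Longrightarrow> outer A \<le> outer B"
  by (intro le_outer outer_le) auto

lemma outer_measure_space_outer: "outer_measure_space (Pow X) (\<lambda>A. ennreal (outer A))"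
  unfolding outer_measure_space_def
proof (intro conjI)
  show "positive (Pow X) (\<lambda>A. ennreal (outer A))"
    using outer_open[of "{}"] m_empty by (simp add: positive_def)
  show "increasing (Pow X) (\<lambda>A. ennreal (outer A))"
    by (auto simp: increasing_def intro!: ennreal_leI outer_mono)
  show "countably_subadditive (Pow X) (\<lambda>A. ennreal (outer A))"
    unfolding countably_subadditive_def
  proof (intro allI impI)
    fix A :: "nat \<Rightarrow> 'a set" assume A: "range A \<subseteq> Pow X"
    show "ennreal (outer (\<Union>i. A i)) \<le> (\<Sum>i. ennreal (outer (A i)))"
    proof (rule ennreal_le_epsilon)
      fix e :: real assume e: "e > 0"
      have AX: "A i \<subseteq> X" for i using A by auto
      have "\<exists>U. openin (top_of_set X) U \<and> A i \<subseteq> U \<and> m U < outer (A i) + e * (1/2)^Suc i" for i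
        using e by (intro outer_approx AX) auto
      then obtain U where U: "\<And>i. openin (top_of_set X) (U i)" "\<And>i. A i \<subseteq> U i"
        "\<And>i. m (U i) < outer (A i) + e * (1/2)^Suc i" by metis
      have "ennreal (outer (\<Union>i. A i)) \<le> ennreal (m (\<Union>i. U i))"
        using U by (intro ennreal_leI outer_le) auto
      also have "\<dots> \<le> (\<Sum>i. ennreal (m (U i)))" by (rule m_UN_le[OF U(1)])
      also have "\<dots> \<le> (\<Sum>i. ennreal (outer (A i)) + ennreal e * ennreal ((1/2)^Suc i))"
        using U(3) e outer_nonneg[OF AX]
        by (intro suminf_le) (auto simp: ennreal_mult[symmetric] ennreal_plus[symmetric]
            simp del: ennreal_plus intro!: ennreal_leI less_imp_le)
      also have "\<dots> = (\<Sum>i. ennreal (outer (A i))) + (\<Sum>i. ennreal e * ennreal ((1/2)^Suc i))"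
        by (subst suminf_add) auto
      also have "(\<Sum>i. ennreal e * ennreal ((1/2)^Suc i)) = ennreal e"
        unfolding ennreal_suminf_cmult
        by (subst suminf_ennreal_eq[OF zero_le_power power_half_series]) auto
      finally show "ennreal (outer (\<Union>i. A i)) \<le> (\<Sum>i. ennreal (outer (A i))) + ennreal e" .
    qed
  qed
qed

text \<open>Let \<open>f\<close> be nearly optimal for \<open>U \<inter> V\<close> and
  \<open>K = {f \<ge> e/3}\<close>, then \<open>g\<close> nearly optimal for \<open>V - K\<close>.
  The truncated \<open>f\<close> lives on \<open>K\<close> and \<open>g\<close> off
  \<open>K\<close>, so their sum still competes for \<open>V\<close>, and \<open>V - K\<close>
  contains \<open>V - U\<close>.\<close>

lemma m_split_le:
  assumes U: "openin (top_of_set X) U" and V: "openin (top_of_set X) V"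
  shows "m (U \<inter> V) + outer (V - U) \<le> m V"
proof (rule field_le_epsilon)
  fix e :: real assume "e > 0"
  then have e: "e/3 > 0" by simp
  obtain f where f: "f \<in> under (U \<inter> V)" "m (U \<inter> V) - e/3 < L f"
    using m_approx[OF e] by blast
  note f' = underD[OF f(1)]
  define K where "K = {x \<in> X. e/3 \<le> f x}"
  have K: "closedin (top_of_set X) K" unfolding K_def by (rule closedin_level[OF f'(1)])
  have W: "openin (top_of_set X) (V - K)" using V K by (rule openin_diff)
  have "V - U \<subseteq> V - K" using f'(4) e openin_imp_subset[OF V] by (force simp: K_def)
  then have 1: "outer (V - U) \<le> m (V - K)" by (rule outer_le[OF W])
  obtain g where g: "g \<in> under (V - K)" "m (V - K) - e/3 < L g"
    using m_approx[OF e] by blast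
  note g' = underD[OF g(1)]
  have "(\<lambda>x. max 0 (f x - e/3) + g x) \<in> under V"
  proof (rule underI)
    fix x assume x: "x \<in> X"
    show "max 0 (f x - e/3) + g x \<le> 1"
      using f'(2,3)[OF x] g'(2,3)[OF x] g'(4)[OF x] e x by (cases "x \<in> K") (auto simp: K_def)
    show "0 \<le> max 0 (f x - e/3) + g x" using g'(2)[OF x] by simp
    show "max 0 (f x - e/3) + g x = 0" if "x \<notin> V"
      using f'(4)[OF x] g'(4)[OF x] e that by auto
  qed (use f'(1) g'(1) in \<open>auto intro!: continuous_intros\<close>)
  then have "L (\<lambda>x. max 0 (f x - e/3) + g x) \<le> m V" by (rule L_le_m)
  then have "L (\<lambda>x. max 0 (f x - e/3)) + L g \<le> m V"
    using f'(1) g'(1) by (subst (asm) L_add) (auto intro!: continuous_intros)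
  then show "m (U \<inter> V) + outer (V - U) \<le> m V + e"
    using L_le_shift[OF f(1) e] f(2) g(2) 1 by linarith
qed

section \<open>Caratheodory extension to the Borel sets and inner regularity\<close>

definition radon :: "'a measure" where
  "radon = measure_of X (sets (restrict_space borel X)) (\<lambda>A. ennreal (outer A))"

lemma sets_restrict_borel_subset_lambda_system:
  "sets (restrict_space borel X) \<subseteq> lambda_system X (Pow X) (\<lambda>A. ennreal (outer A))" (is "_ \<subseteq> ?\<Lambda>")
proof -
  interpret S: sigma_algebra X "Pow X" by (rule sigma_algebra_Pow)
  have "measure_space X ?\<Lambda> (\<lambda>A. ennreal (outer A))"
    by (rule S.caratheodory_lemma[OF outer_measure_space_outer])
  then interpret \<Lambda>: sigma_algebra X ?\<Lambda> by (simp add: measure_space_def)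
  have op: "U \<in> ?\<Lambda>" if U: "openin (top_of_set X) U" for U
    unfolding S.lambda_system_eq
  proof (intro CollectI conjI ballI)
    show "U \<in> Pow X" using openin_imp_subset[OF U] by auto
    fix A assume A: "A \<in> Pow X"
    have "outer (A \<inter> U) + outer (A - U) \<le> outer A"
    proof (rule le_outer)
      fix V assume V: "openin (top_of_set X) V" "A \<subseteq> V"
      have "outer (A \<inter> U) \<le> m (U \<inter> V)" using U V by (intro outer_le) auto
      moreover have "outer (A - U) \<le> outer (V - U)"
        using V openin_imp_subset[OF V(1)] by (intro outer_mono) auto
      ultimately show "outer (A \<inter> U) + outer (A - U) \<le> m V" using m_split_le[OF U V(1)] by simp
    qed (use A in auto)
    then have "ennreal (outer (A \<inter> U)) + ennreal (outer (A - U)) \<le> ennreal (outer A)"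
      using A by (subst ennreal_plus[symmetric]) (auto intro!: ennreal_leI outer_nonneg)
    moreover have "ennreal (outer A) \<le> ennreal (outer (A \<inter> U)) + ennreal (outer (A - U))"
    proof -
      have "subadditive (Pow X) (\<lambda>A. ennreal (outer A))"
        using outer_measure_space_outer S.countably_subadditive_subadditive
        unfolding outer_measure_space_def by blast
      then have "ennreal (outer ((A \<inter> U) \<union> (A - U))) \<le> ennreal (outer (A \<inter> U)) + ennreal (outer (A - U))"
        using A by (intro subadditiveD) auto
      moreover have "(A \<inter> U) \<union> (A - U) = A" by auto
      ultimately show ?thesis by simp
    qed
    ultimately show "ennreal (outer (A \<inter> U)) + ennreal (outer (A - U)) = ennreal (outer A)"
      by (rule order_antisym)
  qed
  have "X \<inter> B \<in> ?\<Lambda>" if "B \<in> sigma_sets UNIV {S. open S}" for B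
    using that
  proof induction
    case (Basic a)
    then show ?case by (intro op) (auto simp: openin_open)
  next
    case (Compl a)
    have "X \<inter> (UNIV - a) = X - X \<inter> a" by auto
    then show ?case using Compl by auto
  next
    case (Union a)
    have "X \<inter> \<Union> (range a) = (\<Union>i. X \<inter> a i)" by auto
    then show ?case using \<Lambda>.countable_UN[of "\<lambda>i. X \<inter> a i" UNIV] Union by (simp add: image_subset_iff)
  qed auto
  then show ?thesis by (auto simp: sets_restrict_space borel_def)
qed

lemma
  shows space_radon: "space radon = X"
    and sets_radon: "sets radon = sets (restrict_space borel X)"
    and emeasure_radon: "A \<in> sets radon \<Longrightarrow> emeasure radon A = ennreal (outer A)"
proof -
  have sa: "sigma_algebra X (sets (restrict_space borel X))"
    using sets.sigma_algebra_axioms[of "restrict_space borel X"] by (simp add: space_restrict_space)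
  interpret sigma_algebra X "sets (restrict_space borel X)" by (rule sa)
  have "measure_space X (lambda_system X (Pow X) (\<lambda>A. ennreal (outer A))) (\<lambda>A. ennreal (outer A))"
    by (rule sigma_algebra.caratheodory_lemma[OF sigma_algebra_Pow outer_measure_space_outer])
  then have ms: "measure_space X (sets (restrict_space borel X)) (\<lambda>A. ennreal (outer A))"
    by (rule measure_down[OF _ sa sets_restrict_borel_subset_lambda_system])
  show 1: "space radon = X" unfolding radon_def by (rule space_measure_of[OF space_closed])
  show 2: "sets radon = sets (restrict_space borel X)"
    unfolding radon_def by (rule sets_measure_of_eq)
  show "emeasure radon A = ennreal (outer A)" if "A \<in> sets radon"
    using that ms unfolding radon_def 2[unfolded radon_def]
    by (intro emeasure_measure_of_sigma[OF sa]) (auto simp: measure_space_def)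
qed

sublocale radon: prob_space radon
proof
  have "outer X = 1" using outer_open[of X] m_X by auto
  moreover have "X \<in> sets radon" using sets.top[of radon] by (simp add: space_radon)
  ultimately show "emeasure radon (space radon) = 1" by (simp add: space_radon emeasure_radon)
qed

lemma measure_radon: "A \<in> sets radon \<Longrightarrow> measure radon A = outer A"
  using emeasure_radon[of A] outer_nonneg[of A] sets.sets_into_space[of A radon]
  by (simp add: measure_def space_radon)

lemma openin_sets_radon: "openin (top_of_set X) U \<Longrightarrow> U \<in> sets radon"
  by (auto simp: sets_radon sets_restrict_space openin_open)

text \<open>This is outer regularity of the complement: if a relatively open set contains
  \<open>X - B\<close>, its complement in \<open>X\<close> is compact and lies in
  \<open>B\<close>.\<close>

lemma inner_regular_radon:
  assumes B: "B \<in> sets radon"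
  shows "emeasure radon B = (SUP K\<in>{K. compact K \<and> K \<subseteq> B}. emeasure radon K)"
proof (rule order_antisym)
  show "(SUP K\<in>{K. compact K \<and> K \<subseteq> B}. emeasure radon K) \<le> emeasure radon B"
    using B by (intro SUP_least emeasure_mono) auto
  have BX: "B \<subseteq> X" using sets.sets_into_space[OF B] by (simp add: space_radon)
  show "emeasure radon B \<le> (SUP K\<in>{K. compact K \<and> K \<subseteq> B}. emeasure radon K)"
  proof (rule ennreal_le_epsilon)
    fix e :: real assume e: "e > 0"
    obtain U where U: "openin (top_of_set X) U" "X - B \<subseteq> U" "m U < outer (X - B) + e"
      using outer_approx[OF Diff_subset e] by blast
    have "closedin (top_of_set X) (X - U)" using U(1) by (intro closedin_diff) auto
    then have K: "compact (X - U)" using compact closedin_compact by blast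
    have "measure radon U \<le> measure radon (X - B) + e"
      using U openin_sets_radon[OF U(1)] measure_radon[of "X - B"] measure_radon[of U] outer_open[OF U(1)]
        sets.compl_sets[OF B] by (simp add: space_radon)
    then have "measure radon B \<le> measure radon (X - U) + e"
      using radon.prob_compl[OF B] radon.prob_compl[OF openin_sets_radon[OF U(1)]]
      by (simp add: space_radon)
    then have "ennreal (measure radon B) \<le> ennreal (measure radon (X - U) + e)" by (rule ennreal_leI)
    then have "emeasure radon B \<le> emeasure radon (X - U) + ennreal e"
      using e by (simp add: radon.emeasure_eq_measure)
    also have "emeasure radon (X - U) \<le> (SUP K\<in>{K. compact K \<and> K \<subseteq> B}. emeasure radon K)"
      using K U BX by (intro SUP_upper) auto
    finally show "emeasure radon B \<le> (SUP K\<in>{K. compact K \<and> K \<subseteq> B}. emeasure radon K) + ennreal e"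
      by (simp add: add_right_mono)
  qed
qed


section \<open>Integration against the constructed measure\<close>

lemma continuous_borel_measurable_radon: "continuous_on X f \<Longrightarrow> f \<in> borel_measurable radon"
  by (subst measurable_cong_sets[OF sets_radon refl]) (rule borel_measurable_continuous_on_restrict)

lemma integrable_radon:
  fixes f :: "'a \<Rightarrow> real"
  assumes "continuous_on X f"
  shows "integrable radon f"
proof -
  have "bounded (f ` X)"
    using compact_continuous_image[OF assms compact] by (rule compact_imp_bounded)
  then obtain B where "\<And>x. x \<in> X \<Longrightarrow> norm (f x) \<le> B" by (auto simp: bounded_iff)
  then show ?thesis
    using assms by (intro radon.integrable_const_bound[of _ B] continuous_borel_measurable_radon)
      (auto simp: space_radon)
qed

text \<open>The layers \<open>min (f - k/n) (1/n)\<close>, cut off below at \<open>0\<close>, add up to \<open>f\<close>, and \<open>n\<close> times the \<open>k\<close>-th layer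
  is below the indicator of \<open>{f > k/n}\<close>.\<close>

lemma L_le_integral_unit:
  assumes f: "continuous_on X f" and f01: "\<And>x. x \<in> X \<Longrightarrow> 0 \<le> f x \<and> f x \<le> 1"
  shows "L f \<le> (\<integral>x. f x \<partial>radon)"
proof (rule field_le_epsilon)
  fix e :: real assume e: "e > 0"
  then obtain n :: nat where n: "inverse (real (Suc n)) < e" using reals_Archimedean by blast
  define d where "d = inverse (real (Suc n))"
  have d: "d > 0" "real (Suc n) * d = 1" by (simp_all add: d_def)
  define g where "g = (\<lambda>k x. max 0 (min (f x - real k * d) d))"
  define U where "U = (\<lambda>k. {x \<in> X. f x > real k * d})"
  have U: "openin (top_of_set X) (U k)" for k
    using continuous_openin_preimage[OF f _, of UNIV "{real k * d<..}"] unfolding U_def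
    by (simp add: vimage_def Int_def conj_commute)
  have cg: "continuous_on X (g k)" for k unfolding g_def by (intro continuous_intros f)
  have Lg: "L (g k) \<le> d * measure radon (U k)" for k
  proof -
    have "(\<lambda>x. (1/d) * g k x) \<in> under (U k)"
      using d(1) by (intro underI continuous_intros cg) (auto simp: g_def U_def field_simps)
    then have "L (\<lambda>x. (1/d) * g k x) \<le> m (U k)" by (rule L_le_m)
    moreover have "m (U k) = measure radon (U k)"
      using measure_radon[OF openin_sets_radon[OF U]] outer_open[OF U] by simp
    ultimately have "(1/d) * L (g k) \<le> measure radon (U k)" by (simp only: L_scale[OF cg])
    then show ?thesis using d(1) by (simp add: field_simps)
  qed
  have part: "(\<Sum>k<j. g k x) = min (f x) (real j * d)" if "x \<in> X" for x j
    using f01[OF that] d(1)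
    by (induction j) (auto simp: g_def algebra_simps min_def max_def)
  have fsum: "f x = (\<Sum>k<Suc n. g k x)" if "x \<in> X" for x
    using part[OF that, of "Suc n"] f01[OF that] d(2) by (simp add: min_def)
  have cgsum: "continuous_on X (\<lambda>x. \<Sum>k<Suc n. g k x)" by (intro continuous_intros cg)
  have "L f \<le> L (\<lambda>x. \<Sum>k<Suc n. g k x)"
    by (intro L_mono f cgsum) (simp add: fsum del: sum.lessThan_Suc)
  also have "\<dots> = (\<Sum>k<Suc n. L (g k))" using cg by (intro L_sum) auto
  also have "\<dots> \<le> (\<Sum>k<Suc n. d * measure radon (U k))" by (intro sum_mono Lg)
  also have "\<dots> = (\<integral>x. (\<Sum>k<Suc n. d * indicator (U k) x) \<partial>radon)"
    using openin_sets_radon[OF U] radon.emeasure_finite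
    by (subst Bochner_Integration.integral_sum) (auto simp: less_top[symmetric])
  also have "\<dots> \<le> (\<integral>x. f x + d \<partial>radon)"
  proof (rule integral_mono)
    show "integrable radon (\<lambda>x. \<Sum>k<Suc n. d * indicator (U k) x)"
      using openin_sets_radon[OF U] radon.emeasure_finite
      by (intro Bochner_Integration.integrable_sum) (auto simp: less_top[symmetric])
    show "integrable radon (\<lambda>x. f x + d)" using integrable_radon[OF f] by simp
    fix x assume "x \<in> space radon"
    then have x: "x \<in> X" by (simp add: space_radon)
    \<comment> \<open>At most \<open>\<lceil>f x / d\<rceil>\<close> indices \<open>k\<close>
      satisfy \<open>k * d < f x\<close>, so the step function exceeds \<open>f\<close> by at most
      \<open>d\<close>.\<close>
    have "(\<Sum>k<Suc n. d * indicator (U k) x) = d * card {k\<in>{..<Suc n}. x \<in> U k}"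
      by (simp add: sum_distrib_left[symmetric] indicator_def sum.If_cases Int_def del: sum.lessThan_Suc)
    also have "{k\<in>{..<Suc n}. x \<in> U k} \<subseteq> {..<nat \<lceil>f x / d\<rceil>}"
      using x d(1) by (auto simp: U_def field_simps less_ceiling_iff zless_nat_eq_int_zless)
    then have "card {k\<in>{..<Suc n}. x \<in> U k} \<le> nat \<lceil>f x / d\<rceil>"
      using card_mono[of "{..<nat \<lceil>f x / d\<rceil>}"] by fastforce
    then have c1: "real (card {k\<in>{..<Suc n}. x \<in> U k}) \<le> real (nat \<lceil>f x / d\<rceil>)" by (rule of_nat_mono)
    have c2: "real (nat \<lceil>f x / d\<rceil>) \<le> f x / d + 1"
    proof -
      have "0 \<le> f x / d" using f01[OF x] d(1) by simp
      then show ?thesis by linarith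
    qed
    have "real (card {k\<in>{..<Suc n}. x \<in> U k}) \<le> f x / d + 1" using c1 c2 by (rule order_trans)
    then have "d * card {k\<in>{..<Suc n}. x \<in> U k} \<le> d * (f x / d + 1)"
      using d(1) by (intro mult_left_mono) auto
    also have "\<dots> = f x + d" using d(1) by (simp add: field_simps)
    finally show "(\<Sum>k<Suc n. d * indicator (U k) x) \<le> f x + d" .
  qed
  also have "\<dots> = (\<integral>x. f x \<partial>radon) + d" using integrable_radon[OF f] radon.prob_space by simp
  finally show "L f \<le> (\<integral>x. f x \<partial>radon) + e" using n by (simp add: d_def)
qed

text \<open>An affine rescaling into the unit interval extends the one-sided estimate to every
  continuous function; applying it to \<open>- f\<close> gives the reverse inequality.\<close>

lemma integral_radon:
  assumes f: "continuous_on X f"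
  shows "(\<integral>x. f x \<partial>radon) = L f"
proof -
  have le: "L g \<le> (\<integral>x. g x \<partial>radon)" if g: "continuous_on X g" for g
  proof -
    have "bounded (g ` X)"
      using compact_continuous_image[OF g compact] by (rule compact_imp_bounded)
    then obtain B where B: "\<And>x. x \<in> X \<Longrightarrow> \<bar>g x\<bar> \<le> B" by (auto simp: bounded_iff)
    define C where "C = max B 1"
    have C: "C > 0" "\<And>x. x \<in> X \<Longrightarrow> \<bar>g x\<bar> \<le> C" using B by (force simp: C_def)+
    have c: "continuous_on X (\<lambda>x. (1/(2*C)) * g x)" "continuous_on X (\<lambda>x. (1/(2*C)) * g x + 1/2)"
      using g C(1) by (auto intro!: continuous_intros)
    have "L (\<lambda>x. (1/(2*C)) * g x + 1/2) \<le> (\<integral>x. (1/(2*C)) * g x + 1/2 \<partial>radon)"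
    proof (rule L_le_integral_unit[OF c(2)])
      fix x assume "x \<in> X"
      then have "- C \<le> g x" "g x \<le> C" using C(2)[of x] by auto
      then show "0 \<le> (1/(2*C)) * g x + 1/2 \<and> (1/(2*C)) * g x + 1/2 \<le> 1"
        using C(1) by (auto simp: field_simps)
    qed
    then have "(1/(2*C)) * L g + 1/2 \<le> (1/(2*C)) * (\<integral>x. g x \<partial>radon) + 1/2"
      using integrable_radon[OF g] radon.prob_space
      by (simp only: L_add[OF c(1) continuous_on_const] L_scale[OF g] L_const) simp
    then show ?thesis using C(1) by (simp add: divide_le_cancel)
  qed
  have "L (\<lambda>x. - 1 * f x) \<le> (\<integral>x. - 1 * f x \<partial>radon)"
    using f by (intro le continuous_intros)
  then have "(\<integral>x. f x \<partial>radon) \<le> L f" by (simp only: L_scale[OF f]) simp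
  then show ?thesis using le[OF f] by simp
qed

theorem Riesz_representation:
  obtains \<mu> where "\<mu> \<in> M1 X" "\<And>f. continuous_on X f \<Longrightarrow> (\<integral>x. f x \<partial>\<mu>) = L f"
proof (rule that[of "completion radon"])
  show "completion radon \<in> M1 X"
    unfolding M1_def using radon.prob_space_axioms sets_radon inner_regular_radon by blast
  show "(\<integral>x. f x \<partial>completion radon) = L f" if "continuous_on X f" for f
    using integral_radon[OF that] continuous_borel_measurable_radon[OF that]
    by (simp add: integral_completion)
qed

end

section \<open>Radon probability measures\<close>

lemma M1E:
  assumes "\<mu> \<in> M1 X"
  obtains N where "\<mu> = completion N" "prob_space N" "sets N = sets (restrict_space borel X)"
    "space N = X" "\<And>B. B \<in> sets N \<Longrightarrow> emeasure N B = (SUP K\<in>{K. compact K \<and> K \<subseteq> B}. emeasure N K)"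
proof -
  obtain N where N: "\<mu> = completion N" "prob_space N" "sets N = sets (restrict_space borel X)"
    "\<And>B. B \<in> sets N \<Longrightarrow> emeasure N B = (SUP K\<in>{K. compact K \<and> K \<subseteq> B}. emeasure N K)"
    using assms unfolding M1_def by blast
  have "space N = X" using sets_eq_imp_space_eq[OF N(3)] by (simp add: space_restrict_space)
  then show thesis using that N by blast
qed

lemma
  assumes "\<mu> \<in> M1 X"
  shows prob_space_M1: "prob_space \<mu>" and space_M1: "space \<mu> = X"
    and borel_subset_sets_M1: "sets (restrict_space borel X) \<subseteq> sets \<mu>"
proof -
  obtain N where N: "\<mu> = completion N" "prob_space N" "sets N = sets (restrict_space borel X)" "space N = X"
    using M1E[OF assms] by metis
  interpret prob_space N by (rule N)
  show "prob_space \<mu>" unfolding N(1)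
    by (rule prob_spaceI) (simp add: emeasure_space_1)
  show "space \<mu> = X" using N by simp
  show "sets (restrict_space borel X) \<subseteq> sets \<mu>" using N by auto
qed

lemma borel_measurable_continuous_M1:
  fixes f :: "'a::t2_space \<Rightarrow> real"
  assumes "\<mu> \<in> M1 X" "continuous_on X f"
  shows "f \<in> borel_measurable \<mu>"
proof -
  have "f \<in> borel_measurable (restrict_space borel X)"
    using assms(2) by (rule borel_measurable_continuous_on_restrict)
  moreover have "space (restrict_space borel X) = space \<mu>"
    using space_M1[OF assms(1)] by (simp add: space_restrict_space)
  ultimately show ?thesis
    using borel_subset_sets_M1[OF assms(1)] unfolding measurable_def by auto
qed

lemma integrable_continuous_M1:
  fixes f :: "'a::t2_space \<Rightarrow> real"
  assumes \<mu>: "\<mu> \<in> M1 X" and X: "compact X" and f: "continuous_on X f"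
  shows "integrable \<mu> f"
proof -
  interpret prob_space \<mu> by (rule prob_space_M1[OF \<mu>])
  have "bounded (f ` X)"
    using compact_continuous_image[OF f X] by (rule compact_imp_bounded)
  then obtain B where "\<And>x. x \<in> X \<Longrightarrow> norm (f x) \<le> B" by (auto simp: bounded_iff)
  then show ?thesis
    using borel_measurable_continuous_M1[OF \<mu> f]
    by (intro integrable_const_bound[of _ B]) (auto simp: space_M1[OF \<mu>])
qed

text \<open>It suffices to compare the underlying Borel measures on compact \<open>K\<close>, by
  inner regularity. Choose a compact \<open>K'\<close> filling almost all of \<open>X - K\<close>
  and integrate a Urysohn function that is 1 on \<open>K\<close> and 0 on \<open>K'\<close>.\<close>

lemma M1_eqI:
  fixes X :: "'a::t2_space set"
  assumes \<mu>: "\<mu> \<in> M1 X" and \<nu>: "\<nu> \<in> M1 X" and X: "compact X"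
    and eq: "\<And>f :: 'a \<Rightarrow> real. continuous_on X f \<Longrightarrow> (\<integral>x. f x \<partial>\<mu>) = (\<integral>x. f x \<partial>\<nu>)"
  shows "\<mu> = \<nu>"
proof -
  obtain M where M: "\<mu> = completion M" "prob_space M" "sets M = sets (restrict_space borel X)" "space M = X"
    "\<And>B. B \<in> sets M \<Longrightarrow> emeasure M B = (SUP K\<in>{K. compact K \<and> K \<subseteq> B}. emeasure M K)"
    using M1E[OF \<mu>] by metis
  obtain N where N: "\<nu> = completion N" "prob_space N" "sets N = sets (restrict_space borel X)" "space N = X"
    "\<And>B. B \<in> sets N \<Longrightarrow> emeasure N B = (SUP K\<in>{K. compact K \<and> K \<subseteq> B}. emeasure N K)"
    using M1E[OF \<nu>] by metis
  interpret \<mu>: prob_space \<mu> by (rule prob_space_M1[OF \<mu>])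
  interpret \<nu>: prob_space \<nu> by (rule prob_space_M1[OF \<nu>])
  interpret N: prob_space N by (rule N(2))
  have comp: "K \<in> sets M" "closedin (top_of_set X) K" if "compact K" "K \<subseteq> X" for K
    using that compact_imp_closed[OF that(1)] M(3)
    by (auto simp: sets_restrict_space closed_subset image_iff intro!: bexI[of _ K])
  \<comment> \<open>Stated for an arbitrary ordered pair of measures, since it is used in both
    directions.\<close>
  have le: "emeasure M' K \<le> emeasure N' K"
    if M': "\<mu>' = completion M'" "prob_space M'" "sets M' = sets (restrict_space borel X)" "space M' = X" "\<mu>' \<in> M1 X"
      and N': "\<nu>' = completion N'" "prob_space N'" "sets N' = sets (restrict_space borel X)" "space N' = X" "\<nu>' \<in> M1 X"
      "\<And>B. B \<in> sets N' \<Longrightarrow> emeasure N' B = (SUP K\<in>{K. compact K \<and> K \<subseteq> B}. emeasure N' K)"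
      and eq': "\<And>f :: 'a \<Rightarrow> real. continuous_on X f \<Longrightarrow> (\<integral>x. f x \<partial>\<mu>') = (\<integral>x. f x \<partial>\<nu>')"
      and K: "compact K" "K \<subseteq> X" for \<mu>' \<nu>' M' N' K
  proof (rule ennreal_le_epsilon)
    fix e :: real assume e: "e > 0"
    interpret M': prob_space M' by (rule M'(2))
    interpret N': prob_space N' by (rule N'(2))
    have sK: "K \<in> sets M'" "K \<in> sets N'" using comp[OF K] M(3) M'(3) N'(3) by auto
    have "\<exists>K'. compact K' \<and> K' \<subseteq> X - K \<and> measure N' (X - K) - e < measure N' K'"
    proof (rule ccontr)
      assume neg: "\<not> ?thesis"
      have "emeasure N' (X - K) \<le> ennreal (measure N' (X - K) - e)"
        using N'(6)[of "X - K"] sK(2) N'(4) sets.compl_sets[of K N'] neg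
        by (auto simp: N'.emeasure_eq_measure not_less intro!: SUP_least ennreal_leI)
      moreover have "measure N' {} \<le> measure N' (X - K) - e" using neg by (force simp: not_less)
      ultimately show False using e by (simp add: N'.emeasure_eq_measure)
    qed
    then obtain K' where K': "compact K'" "K' \<subseteq> X - K" "measure N' (X - K) - e < measure N' K'" by blast
    have sK': "K' \<in> sets N'" using comp[of K'] K' M(3) N'(3) by auto
    obtain f :: "'a \<Rightarrow> real" where f: "continuous_on X f" "\<And>x. x \<in> X \<Longrightarrow> 0 \<le> f x \<and> f x \<le> 1"
      "\<And>x. x \<in> K' \<Longrightarrow> f x = 0" "\<And>x. x \<in> K \<Longrightarrow> f x = 1"
      using Urysohn_compact[OF X comp(2)[of K'] comp(2)[OF K]] K' by blast
    have iM: "integrable \<mu>' f" "integrable \<nu>' f"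
      using integrable_continuous_M1[OF _ X f(1)] M' N' by auto
    have "f \<in> borel_measurable (restrict_space borel X)"
      using f(1) by (rule borel_measurable_continuous_on_restrict)
    then have mf: "f \<in> borel_measurable M'" "f \<in> borel_measurable N'"
      using measurable_cong_sets[OF M'(3) refl] measurable_cong_sets[OF N'(3) refl] by auto
    have iMN: "integrable M' f" "integrable N' f"
      using iM M'(1) N'(1) mf by (simp_all add: integrable_completion)
    have "measure M' K = (\<integral>x. indicator K x \<partial>M')" using sK by simp
    also have "\<dots> \<le> (\<integral>x. f x \<partial>M')"
      using sK f(2,4) iMN M'(4) M'.emeasure_finite
      by (intro integral_mono) (auto simp: less_top[symmetric] split: split_indicator)
    also have "\<dots> = (\<integral>x. f x \<partial>N')"
      using eq'[OF f(1)] M'(1) N'(1) mf by (simp add: integral_completion)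
    also have "\<dots> \<le> (\<integral>x. indicator (X - K') x \<partial>N')"
      using sK' f(2,3) iMN N'(4) N'.emeasure_finite sets.compl_sets[OF sK']
      by (intro integral_mono) (auto simp: less_top[symmetric] split: split_indicator)
    also have "\<dots> = measure N' (X - K')" using sets.compl_sets[OF sK'] N'(4) Int_absorb2[OF Diff_subset[of X K']] by simp
    also have "\<dots> \<le> measure N' K + e"
      using N'.prob_compl[OF sK'] N'.prob_compl[OF sK(2)] K'(3) N'(4) by simp
    finally have "ennreal (measure M' K) \<le> ennreal (measure N' K + e)" by (rule ennreal_leI)
    then show "emeasure M' K \<le> emeasure N' K + ennreal e"
      using e by (simp add: M'.emeasure_eq_measure N'.emeasure_eq_measure)
  qed
  have "M = N"
  proof (rule measure_eqI)
    show "sets M = sets N" using M N by simp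
    fix A assume A: "A \<in> sets M"
    then have "A \<subseteq> X" using sets.sets_into_space M(4) by blast
    then have "emeasure M K = emeasure N K" if "compact K" "K \<subseteq> A" for K
      using le[OF M(1-4) \<mu> N(1-4) \<nu> N(5) eq that(1)] le[OF N(1-4) \<nu> M(1-4) \<mu> M(5) eq[symmetric] that(1)] that
      by (intro order_antisym) auto
    then show "emeasure M A = emeasure N A"
      using M(5)[OF A] N(5)[of A] A M(3) N(3) by auto
  qed
  then show ?thesis using M N by simp
qed

section \<open>Baire sets\<close>

lemma space_baire [simp]: "space (baire X) = X"
  unfolding baire_def by (rule space_measure_of) auto

lemma sets_baire: "sets (baire X) = sigma_sets X {{x \<in> X. f x = 0} | f :: 'a::topological_space \<Rightarrow> real. continuous_on X f}"
  unfolding baire_def by (rule sets_measure_of) auto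

lemma zero_set_in_baire [intro]:
  fixes f :: "'a::topological_space \<Rightarrow> real"
  shows "continuous_on X f \<Longrightarrow> {x \<in> X. f x = 0} \<in> sets (baire X)"
  unfolding sets_baire by blast

lemma borel_measurable_baire_continuous:
  fixes f :: "'a::topological_space \<Rightarrow> real"
  assumes f: "continuous_on X f"
  shows "f \<in> borel_measurable (baire X)"
proof (rule borel_measurableI_le)
  fix c
  have "{x \<in> X. max 0 (f x - c) = 0} \<in> sets (baire X)"
    by (intro zero_set_in_baire continuous_intros f)
  also have "{x \<in> X. max 0 (f x - c) = 0} = {x \<in> space (baire X). f x \<le> c}" by auto
  finally show "{x \<in> space (baire X). f x \<le> c} \<in> sets (baire X)" .
qed

lemma baire_subset_borel: "sets (baire X) \<subseteq> sets (restrict_space borel X)"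
proof -
  have "{x \<in> X. f x = 0} \<in> sets (restrict_space borel X)" if "continuous_on X f" for f :: "'a \<Rightarrow> real"
    using borel_measurable_continuous_on_restrict[OF that] measurable_sets[of f "restrict_space borel X" borel "{0}"]
    by (auto simp: vimage_def Int_def space_restrict_space conj_commute)
  then have "sigma_sets (space (restrict_space borel X)) {{x \<in> X. f x = 0} | f :: 'a \<Rightarrow> real. continuous_on X f}
      \<subseteq> sets (restrict_space borel X)"
    by (intro sets.sigma_sets_subset) auto
  then show ?thesis by (simp add: sets_baire space_restrict_space)
qed

lemma baire_subset_sets_M1: "\<mu> \<in> M1 X \<Longrightarrow> sets (baire X) \<subseteq> sets \<mu>"
  using baire_subset_borel borel_subset_sets_M1 by blast

lemma measurable_ident_baire: "\<mu> \<in> M1 X \<Longrightarrow> (\<lambda>x. x) \<in> measurable \<mu> (baire X)"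
  using baire_subset_sets_M1[of \<mu> X] space_M1[of \<mu> X] sets.sets_into_space[of _ "baire X"]
  by (intro measurableI) (auto simp: Int_absorb2)

lemma borel_measurable_M1_baire:
  assumes "\<mu> \<in> M1 X" "f \<in> measurable (baire X) N"
  shows "f \<in> measurable \<mu> N"
  using measurable_compose[OF measurable_ident_baire[OF assms(1)] assms(2)] .

text \<open>The series with terms \<open>(1/2)^n * min 1 \<bar>g n x\<bar>\<close> converges
  uniformly and vanishes exactly where all \<open>g n\<close> do.\<close>

lemma zero_set_INT:
  fixes g :: "nat \<Rightarrow> 'a::topological_space \<Rightarrow> real"
  assumes g: "\<And>n. continuous_on X (g n)"
  obtains h :: "'a \<Rightarrow> real" where "continuous_on X h" "{x \<in> X. h x = 0} = {x \<in> X. \<forall>n. g n x = 0}"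
proof -
  define t where "t = (\<lambda>n x. (1/2)^n * min 1 \<bar>g n x\<bar>)"
  have t: "norm (t n x) \<le> (1/2)^n" "0 \<le> t n x" for n x by (auto simp: t_def mult_left_le)
  have sm: "summable (\<lambda>n. (1/2::real)^n)" by (simp add: summable_geometric)
  have "uniform_limit X (\<lambda>n x. \<Sum>i<n. t i x) (\<lambda>x. suminf (\<lambda>i. t i x)) sequentially"
    by (rule Weierstrass_m_test[OF _ sm]) (use t in auto)
  moreover have "continuous_on X (\<lambda>x. \<Sum>i<n. t i x)" for n
    unfolding t_def by (intro continuous_intros g)
  ultimately have c: "continuous_on X (\<lambda>x. suminf (\<lambda>i. t i x))"
    by (intro uniform_limit_theorem) auto
  have "suminf (\<lambda>i. t i x) = 0 \<longleftrightarrow> (\<forall>n. g n x = 0)" for x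
  proof -
    have "summable (\<lambda>i. t i x)" by (rule summable_comparison_test'[OF sm]) (use t in auto)
    then have "suminf (\<lambda>i. t i x) = 0 \<longleftrightarrow> (\<forall>n. t n x = 0)" using t by (intro suminf_eq_zero_iff) auto
    also have "\<dots> \<longleftrightarrow> (\<forall>n. g n x = 0)" by (auto simp: t_def min_def)
    finally show ?thesis .
  qed
  then show thesis using that[OF c] by auto
qed

text \<open>The induction runs over the symmetric statement that both a set and its complement
  contain zero sets whose union has almost full measure; complements then cost nothing.\<close>

lemma inner_regular_zero_sets:
  fixes X :: "'a::topological_space set"
  assumes M: "finite_measure M" and sp: "space M = X" and sub: "sets (baire X) \<subseteq> sets M"
    and B: "B \<in> sets (baire X)" and e: "e > 0"
  obtains f :: "'a \<Rightarrow> real" where "continuous_on X f" "{x \<in> X. f x = 0} \<subseteq> B"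
    "measure M (B - {x \<in> X. f x = 0}) < e"
proof -
  interpret finite_measure M by (rule M)
  let ?Z = "\<lambda>f :: 'a \<Rightarrow> real. {x \<in> X. f x = 0}"
  have Z: "?Z f \<in> sets M" if "continuous_on X f" for f using that sub by auto
  define P where "P = (\<lambda>A e. \<exists>f g. continuous_on X f \<and> continuous_on X g \<and>
    ?Z f \<subseteq> A \<and> ?Z g \<subseteq> X - A \<and> measure M (X - ?Z f - ?Z g) < e)"
  have "\<forall>e>0. P B e"
    using B unfolding sets_baire
  proof induction
    case (Basic A)
    then obtain f :: "'a \<Rightarrow> real" where f: "continuous_on X f" "A = ?Z f" by auto
    show ?case
    proof (intro allI impI)
      fix e :: real assume e: "e > 0"
      \<comment> \<open>The zero sets of the \<open>g n\<close> are
        \<open>{\<bar>f\<bar> \<ge> 1/(n+1)}\<close> and increase to the complement of the zero set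
        of \<open>f\<close>.\<close>
      define g where "g = (\<lambda>n x. max 0 (inverse (real (Suc n)) - \<bar>f x\<bar>))"
      have g: "continuous_on X (g n)" for n unfolding g_def by (intro continuous_intros f(1))
      have Zg: "?Z (g n) = {x \<in> X. inverse (real (Suc n)) \<le> \<bar>f x\<bar>}" for n
      proof -
        have "max 0 (a - b) = 0 \<longleftrightarrow> a \<le> b" for a b :: real by linarith
        then show ?thesis unfolding g_def by blast
      qed
      have "decseq (\<lambda>n. X - ?Z f - ?Z (g n))"
      proof (rule decseq_SucI)
        fix n
        have "inverse (real (Suc (Suc n))) \<le> inverse (real (Suc n))" by (intro le_imp_inverse_le) auto
        then have "inverse (real (Suc (Suc n))) \<le> \<bar>f x\<bar>" if "inverse (real (Suc n)) \<le> \<bar>f x\<bar>" for x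
          using that by (rule order_trans)
        then show "X - ?Z f - ?Z (g (Suc n)) \<subseteq> X - ?Z f - ?Z (g n)" unfolding Zg by blast
      qed
      moreover have "(\<Inter>n. X - ?Z f - ?Z (g n)) = {}"
      proof -
        have False if x: "x \<in> X" "f x \<noteq> 0" "\<And>n. g n x \<noteq> 0" for x
        proof -
          obtain n where "inverse (real (Suc n)) < \<bar>f x\<bar>" using reals_Archimedean[of "\<bar>f x\<bar>"] x(2) by auto
          then show False using x(3)[of n] by (simp add: g_def)
        qed
        then show ?thesis by blast
      qed
      moreover have "range (\<lambda>n. X - ?Z f - ?Z (g n)) \<subseteq> sets M"
        using Z[OF f(1)] Z[OF g] sp sets.top[of M] by auto
      ultimately have "(\<lambda>n. measure M (X - ?Z f - ?Z (g n))) \<longlonglongrightarrow> measure M {}"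
        using finite_Lim_measure_decseq[of "\<lambda>n. X - ?Z f - ?Z (g n)"] by metis
      then have "\<forall>\<^sub>F n in sequentially. measure M (X - ?Z f - ?Z (g n)) < e"
        using e by (intro order_tendstoD(2)) auto
      then obtain n where n: "measure M (X - ?Z f - ?Z (g n)) < e" by (auto simp: eventually_sequentially)
      have "?Z (g n) \<subseteq> X - A" using f(2) by (auto simp: g_def)
      then show "P A e" unfolding P_def using f g[of n] n by blast
    qed
  next
    case Empty
    show ?case
      unfolding P_def by (intro allI impI exI[of _ "\<lambda>_. 1"] exI[of _ "\<lambda>_. 0"]) auto
  next
    case (Compl A)
    show ?case
    proof (intro allI impI)
      fix e :: real assume "e > 0"
      then obtain f g where fg: "continuous_on X f" "continuous_on X g" "?Z f \<subseteq> A" "?Z g \<subseteq> X - A"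
        "measure M (X - ?Z f - ?Z g) < e"
        using Compl(2) unfolding P_def by blast
      have "?Z f \<subseteq> X - (X - A)" using fg(3) by auto
      moreover have "X - ?Z f - ?Z g = X - ?Z g - ?Z f" by auto
      ultimately show "P (X - A) e"
        unfolding P_def using fg by (intro exI[of _ g] exI[of _ f]) auto
    qed
  next
    case (Union A)
    show ?case
    proof (intro allI impI)
      fix e :: real assume e: "e > 0"
      \<comment> \<open>The errors sum to \<open>e/2\<close>. The other half pays for passing from a
        countable union of zero sets, which need not be a zero set, to a finite one.\<close>
      define Q where "Q = (\<lambda>n f g. continuous_on X f \<and> continuous_on X g \<and> ?Z f \<subseteq> A n \<and> ?Z g \<subseteq> X - A n \<and>
        measure M (X - ?Z f - ?Z g) < e/2 * (1/2)^Suc n)"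
      have "P (A n) (e/2 * (1/2)^Suc n)" for n using Union(2) e by simp
      then have "\<forall>n. \<exists>f g. Q n f g" unfolding P_def Q_def by blast
      then obtain f g where "\<And>n. Q n (f n) (g n)" by metis
      then have fg: "\<And>n. continuous_on X (f n)" "\<And>n. continuous_on X (g n)"
        "\<And>n. ?Z (f n) \<subseteq> A n" "\<And>n. ?Z (g n) \<subseteq> X - A n"
        "\<And>n. measure M (X - ?Z (f n) - ?Z (g n)) < e/2 * (1/2)^Suc n"
        unfolding Q_def by blast+
      obtain h where h: "continuous_on X h" "?Z h = {x \<in> X. \<forall>n. g n x = 0}"
        by (rule zero_set_INT[OF fg(2)])
      \<comment> \<open>A finite product has the finite union as its zero set, while
        \<open>h\<close> treats the countable intersection on the complementary side.\<close>
      define F where "F = (\<lambda>N x. \<Prod>n<N. f n x)"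
      have F: "continuous_on X (F N)" for N unfolding F_def by (intro continuous_intros fg)
      have ZF: "?Z (F N) = (\<Union>n<N. ?Z (f n))" for N unfolding F_def by auto
      define D where "D = (\<lambda>N. (\<Union>n. ?Z (f n)) - ?Z (F N))"
      have D: "D N \<in> sets M" for N unfolding D_def using Z[OF F] Z[OF fg(1)] by auto
      have "decseq D" unfolding D_def ZF by (auto simp: decseq_def)
      moreover have "(\<Inter>N. D N) = {}" unfolding D_def ZF by auto
      ultimately have "(\<lambda>N. measure M (D N)) \<longlonglongrightarrow> measure M {}"
        using finite_Lim_measure_decseq[of D] D by auto
      then have "\<forall>\<^sub>F N in sequentially. measure M (D N) < e/2"
        using e by (intro order_tendstoD(2)) auto
      then obtain N where N: "measure M (D N) < e/2" by (auto simp: eventually_sequentially)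
      define R where "R = (\<lambda>n. X - ?Z (f n) - ?Z (g n))"
      have R: "R n \<in> sets M" for n unfolding R_def using Z[OF fg(1)] Z[OF fg(2)] sp sets.top[of M] by auto
      have half: "(\<lambda>n. e/2 * (1/2)^Suc n) sums (e/2)"
        using sums_mult[OF power_half_series, of "e/2"] by simp
      have le: "measure M (R n) \<le> e/2 * (1/2)^Suc n" for n using fg(5)[of n] unfolding R_def by linarith
      have sR: "summable (\<lambda>n. measure M (R n))"
        by (rule summable_comparison_test'[OF sums_summable[OF half], of 0]) (use le in simp)
      have "X - ?Z (F N) - ?Z h \<subseteq> D N \<union> (\<Union>n. R n)"
        unfolding D_def R_def h(2) by auto
      then have "measure M (X - ?Z (F N) - ?Z h) \<le> measure M (D N \<union> (\<Union>n. R n))"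
        using D R by (intro finite_measure_mono) auto
      also have "\<dots> \<le> measure M (D N) + measure M (\<Union>n. R n)"
        using D R by (intro measure_Un_le) auto
      also have "measure M (\<Union>n. R n) \<le> (\<Sum>n. measure M (R n))"
      proof (rule finite_measure_subadditive_countably)
        show "summable (\<lambda>n. measure M (R n))" by (rule sR)
      qed (use R in auto)
      also have "\<dots> \<le> (\<Sum>n. e/2 * (1/2)^Suc n)"
        by (rule suminf_le[OF le sR sums_summable[OF half]])
      also have "\<dots> = e/2" using sums_unique[OF half] by simp
      finally have "measure M (X - ?Z (F N) - ?Z h) < e" using N by simp
      moreover have "?Z (F N) \<subseteq> (\<Union>n. A n)" unfolding ZF using fg(3) by blast
      moreover have "?Z h \<subseteq> X - (\<Union>n. A n)" unfolding h(2) using fg(4) by blast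
      ultimately show "P (\<Union>n. A n) e" unfolding P_def using F h(1) by blast
    qed
  qed
  then obtain f g where fg: "continuous_on X f" "continuous_on X g" "?Z f \<subseteq> B" "?Z g \<subseteq> X - B"
    "measure M (X - ?Z f - ?Z g) < e"
    using e unfolding P_def by blast
  have "B \<subseteq> X" using sets.sets_into_space[OF B] by simp
  then have "B - ?Z f \<subseteq> X - ?Z f - ?Z g" using fg(4) by auto
  then have "measure M (B - ?Z f) \<le> measure M (X - ?Z f - ?Z g)"
    using Z[OF fg(1)] Z[OF fg(2)] sp sets.top[of M] by (intro finite_measure_mono) auto
  then show thesis using that fg by force
qed

section \<open>Baire measures and integrals of continuous functions\<close>

lemma Int_stable_zero_sets:
  "Int_stable {{x \<in> X. f x = 0} | f :: 'a::topological_space \<Rightarrow> real. continuous_on X f}"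
proof (rule Int_stableI)
  fix A B
  assume "A \<in> {{x \<in> X. f x = 0} | f :: 'a \<Rightarrow> real. continuous_on X f}"
    and "B \<in> {{x \<in> X. f x = 0} | f :: 'a \<Rightarrow> real. continuous_on X f}"
  then obtain f g :: "'a \<Rightarrow> real" where fg: "continuous_on X f" "continuous_on X g"
    "A = {x \<in> X. f x = 0}" "B = {x \<in> X. g x = 0}" by auto
  have "continuous_on X (\<lambda>x. \<bar>f x\<bar> + \<bar>g x\<bar>)" by (intro continuous_intros fg)
  moreover have "A \<inter> B = {x \<in> X. \<bar>f x\<bar> + \<bar>g x\<bar> = 0}" using fg by auto
  ultimately show "A \<inter> B \<in> {{x \<in> X. f x = 0} | f :: 'a \<Rightarrow> real. continuous_on X f}"
    by (intro CollectI exI[of _ "\<lambda>x. \<bar>f x\<bar> + \<bar>g x\<bar>"] conjI)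
qed

lemma zero_set_measure_limit:
  fixes f :: "'a::topological_space \<Rightarrow> real"
  assumes M: "finite_measure M" and sp: "space M = X" and sub: "sets (baire X) \<subseteq> sets M"
    and f: "continuous_on X f"
  shows "(\<lambda>n. \<integral>x. max 0 (1 - real n * \<bar>f x\<bar>) \<partial>M) \<longlonglongrightarrow> measure M {x \<in> X. f x = 0}"
proof -
  interpret finite_measure M by (rule M)
  have id: "(\<lambda>x. x) \<in> measurable M (baire X)"
    using sub sp sets.sets_into_space[of _ "baire X"] by (intro measurableI) (auto simp: Int_absorb2)
  have meas: "g \<in> borel_measurable M" if "continuous_on X g" for g :: "'a \<Rightarrow> real"
    using measurable_compose[OF id borel_measurable_baire_continuous[OF that]] .
  have Z: "{x \<in> X. f x = 0} \<in> sets M" using f sub by auto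
  have "(\<lambda>n. \<integral>x. max 0 (1 - real n * \<bar>f x\<bar>) \<partial>M) \<longlonglongrightarrow> (\<integral>x. indicator {x \<in> X. f x = 0} x \<partial>M)"
  proof (rule integral_dominated_convergence[where w = "\<lambda>_. 1"])
    show "AE x in M. (\<lambda>n. max 0 (1 - real n * \<bar>f x\<bar>)) \<longlonglongrightarrow> indicator {x \<in> X. f x = 0} x"
    proof (rule AE_I2)
      fix x assume x: "x \<in> space M"
      show "(\<lambda>n. max 0 (1 - real n * \<bar>f x\<bar>)) \<longlonglongrightarrow> indicator {x \<in> X. f x = 0} x"
      proof (cases "f x = 0")
        case True
        then show ?thesis using x sp by simp
      next
        case False
        then obtain N :: nat where N: "1 < real N * \<bar>f x\<bar>" using reals_Archimedean3[of "\<bar>f x\<bar>"] by auto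
        have "max 0 (1 - real n * \<bar>f x\<bar>) = 0" if "n \<ge> N" for n
        proof -
          have "real N * \<bar>f x\<bar> \<le> real n * \<bar>f x\<bar>" using that by (intro mult_right_mono) auto
          then show ?thesis using N by simp
        qed
        then have "\<forall>\<^sub>F n in sequentially. max 0 (1 - real n * \<bar>f x\<bar>) = indicator {x \<in> X. f x = 0} x"
          using False by (auto simp: eventually_sequentially)
        then show ?thesis by (rule tendsto_eventually)
      qed
    qed
    show "(\<lambda>x. max 0 (1 - real n * \<bar>f x\<bar>)) \<in> borel_measurable M" for n
      by (intro meas continuous_intros f)
    show "AE x in M. norm (max 0 (1 - real n * \<bar>f x\<bar>)) \<le> 1" for n by simp
    show "indicator {x \<in> X. f x = 0} \<in> borel_measurable M" using Z by simp
  qed simp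
  moreover have "{x \<in> X. f x = 0} \<inter> X = {x \<in> X. f x = 0}" by auto
  ultimately show ?thesis using Z sp by simp
qed

text \<open>Zero sets are an intersection-stable generator and their measures are limits of
  integrals of \<open>max 0 (1 - n * \<bar>f x\<bar>)\<close>, so Dynkin's argument applies. With
  \<open>c = 1\<close> this is uniqueness: equal integrals of continuous functions give equal
  measures of Baire sets.\<close>

lemma measure_baire_mixture:
  fixes X :: "'a::topological_space set"
  assumes M: "prob_space M" "space M = X" "sets (baire X) \<subseteq> sets M"
    and M1: "prob_space M\<^sub>1" "space M\<^sub>1 = X" "sets (baire X) \<subseteq> sets M\<^sub>1"
    and M2: "prob_space M\<^sub>2" "space M\<^sub>2 = X" "sets (baire X) \<subseteq> sets M\<^sub>2"
    and eq: "\<And>f :: 'a \<Rightarrow> real. continuous_on X f \<Longrightarrow>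
      (\<integral>x. f x \<partial>M) = c * (\<integral>x. f x \<partial>M\<^sub>1) + (1 - c) * (\<integral>x. f x \<partial>M\<^sub>2)"
    and A: "A \<in> sets (baire X)"
  shows "measure M A = c * measure M\<^sub>1 A + (1 - c) * measure M\<^sub>2 A"
proof -
  interpret M: prob_space M by (rule M)
  interpret M1: prob_space M\<^sub>1 by (rule M1)
  interpret M2: prob_space M\<^sub>2 by (rule M2)
  let ?\<Z> = "{{x \<in> X. f x = 0} | f :: 'a \<Rightarrow> real. continuous_on X f}"
  have "?\<Z> \<subseteq> Pow X" by auto
  moreover have "A \<in> sigma_sets X ?\<Z>" using A unfolding sets_baire .
  ultimately show ?thesis
  proof (induction rule: sigma_sets_induct_disjoint[OF Int_stable_zero_sets, consumes 2, case_names basic empty compl union])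
    case (basic A)
    then obtain f :: "'a \<Rightarrow> real" where f: "continuous_on X f" "A = {x \<in> X. f x = 0}" by auto
    let ?h = "\<lambda>n x. max 0 (1 - real n * \<bar>f x\<bar>)"
    have h: "continuous_on X (?h n)" for n by (intro continuous_intros f)
    have "(\<lambda>n. c * (\<integral>x. ?h n x \<partial>M\<^sub>1) + (1 - c) * (\<integral>x. ?h n x \<partial>M\<^sub>2))
        \<longlonglongrightarrow> c * measure M\<^sub>1 A + (1 - c) * measure M\<^sub>2 A"
      unfolding f(2)
      by (intro tendsto_intros zero_set_measure_limit f M1 M2 M1.finite_measure_axioms M2.finite_measure_axioms)
    moreover have "(\<lambda>n. \<integral>x. ?h n x \<partial>M) \<longlonglongrightarrow> measure M A"
      unfolding f(2) by (intro zero_set_measure_limit f M M.finite_measure_axioms)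
    ultimately show ?case unfolding eq[OF h] by (rule LIMSEQ_unique[rotated])
  next
    case empty
    then show ?case by simp
  next
    case (compl A)
    then have "A \<in> sets M" "A \<in> sets M\<^sub>1" "A \<in> sets M\<^sub>2" using M M1 M2 by (auto simp: sets_baire)
    then have "measure M (X - A) = 1 - measure M A" "measure M\<^sub>1 (X - A) = 1 - measure M\<^sub>1 A"
      "measure M\<^sub>2 (X - A) = 1 - measure M\<^sub>2 A"
      using M.prob_compl M1.prob_compl M2.prob_compl M(2) M1(2) M2(2) by auto
    then show ?case unfolding compl(2)
      by (simp only: compl(2)) (simp add: algebra_simps)
  next
    case (union A)
    have s: "range A \<subseteq> sets M" "range A \<subseteq> sets M\<^sub>1" "range A \<subseteq> sets M\<^sub>2"
      using union(2) M M1 M2 by (auto simp: sets_baire)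
    have "(\<lambda>i. c * measure M\<^sub>1 (A i) + (1 - c) * measure M\<^sub>2 (A i))
        sums (c * measure M\<^sub>1 (\<Union>i. A i) + (1 - c) * measure M\<^sub>2 (\<Union>i. A i))"
      using s union(1) by (intro sums_add sums_mult M1.finite_measure_UNION M2.finite_measure_UNION) auto
    moreover have "(\<lambda>i. measure M (A i)) sums measure M (\<Union>i. A i)"
      using s union(1) by (intro M.finite_measure_UNION) auto
    ultimately show ?case using union(3) by (simp add: sums_unique2)
  qed
qed

text \<open>Integration against \<open>\<rho>\<close> is a positive functional on the continuous
  functions, and its representing Radon measure agrees with \<open>\<rho>\<close> on Baire sets.
  Every later construction of a Radon measure by images or densities goes through this
  extension.\<close>

theorem baire_measure_extension:
  fixes X :: "'a::t2_space set"
  assumes X: "compact X" and \<rho>: "prob_space \<rho>" and sets_\<rho>: "sets \<rho> = sets (baire X)"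
  obtains \<mu> where "\<mu> \<in> M1 X" "distr \<mu> (baire X) (\<lambda>x. x) = \<rho>"
proof -
  interpret \<rho>: prob_space \<rho> by (rule \<rho>)
  have sp: "space \<rho> = X" using sets_eq_imp_space_eq[OF sets_\<rho>] by simp
  have meas: "f \<in> borel_measurable \<rho>" if "continuous_on X f" for f :: "'a \<Rightarrow> real"
    using borel_measurable_baire_continuous[OF that] measurable_cong_sets[OF sets_\<rho> refl] by auto
  have int: "integrable \<rho> f" if f: "continuous_on X f" for f :: "'a \<Rightarrow> real"
  proof -
    have "bounded (f ` X)"
      using compact_continuous_image[OF f X] by (rule compact_imp_bounded)
    then obtain B where "\<And>x. x \<in> X \<Longrightarrow> norm (f x) \<le> B" by (auto simp: bounded_iff)
    then show ?thesis
      using meas[OF f] by (intro \<rho>.integrable_const_bound[of _ B]) (auto simp: sp)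
  qed
  have pf: "positive_functional X (\<lambda>f. \<integral>x. f x \<partial>\<rho>)"
  proof
    show "0 \<le> (\<integral>x. f x \<partial>\<rho>)" if "\<And>x. x \<in> X \<Longrightarrow> 0 \<le> f x" for f :: "'a \<Rightarrow> real"
      using that sp by (intro Bochner_Integration.integral_nonneg) auto
  qed (use X int \<rho>.prob_space in auto)
  obtain \<mu> where \<mu>: "\<mu> \<in> M1 X"
    "\<And>f :: 'a \<Rightarrow> real. continuous_on X f \<Longrightarrow> (\<integral>x. f x \<partial>\<mu>) = (\<integral>x. f x \<partial>\<rho>)"
    using positive_functional.Riesz_representation[OF pf] by blast
  interpret \<mu>: prob_space \<mu> by (rule prob_space_M1[OF \<mu>(1)])
  note id = measurable_ident_baire[OF \<mu>(1)]
  have "distr \<mu> (baire X) (\<lambda>x. x) = \<rho>"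
  proof (rule measure_eqI)
    show "sets (distr \<mu> (baire X) (\<lambda>x. x)) = sets \<rho>" by (simp add: sets_\<rho>)
    fix A assume "A \<in> sets (distr \<mu> (baire X) (\<lambda>x. x))"
    then have A: "A \<in> sets (baire X)" by simp
    have "measure \<mu> A = 1 * measure \<rho> A + (1 - 1) * measure \<rho> A"
      using \<mu> A sp sets_\<rho> \<rho> \<mu>.prob_space_axioms
      by (intro measure_baire_mixture[where X = X]) (auto simp: space_M1 dest: baire_subset_sets_M1)
    moreover have "A \<subseteq> X" using sets.sets_into_space[OF A] by simp
    ultimately show "emeasure (distr \<mu> (baire X) (\<lambda>x. x)) A = emeasure \<rho> A"
      using A id by (simp add: emeasure_distr \<mu>.emeasure_eq_measure \<rho>.emeasure_eq_measure
          space_M1[OF \<mu>(1)] Int_absorb2)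
  qed
  then show thesis using that \<mu>(1) by blast
qed

lemma
  fixes f :: "'a::t2_space \<Rightarrow> real"
  assumes \<mu>: "\<mu> \<in> M1 X" "distr \<mu> (baire X) (\<lambda>x. x) = \<rho>"
  shows integral_baire_ext: "f \<in> borel_measurable (baire X) \<Longrightarrow> (\<integral>x. f x \<partial>\<mu>) = (\<integral>x. f x \<partial>\<rho>)"
    and integrable_baire_ext: "f \<in> borel_measurable (baire X) \<Longrightarrow> integrable \<mu> f \<longleftrightarrow> integrable \<rho> f"
proof -
  note id = measurable_ident_baire[OF \<mu>(1)]
  show "(\<integral>x. f x \<partial>\<mu>) = (\<integral>x. f x \<partial>\<rho>)" "integrable \<mu> f \<longleftrightarrow> integrable \<rho> f"
    if "f \<in> borel_measurable (baire X)"
    unfolding \<mu>(2)[symmetric] using that id by (simp_all add: integral_distr integrable_distr_eq)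
qed

section \<open>Bauer's maximum principle\<close>

locale compact_convex =
  fixes X :: "'a::locally_convex_space set"
  assumes compact_X: "compact X" and convex_X: "convex X"
begin

lemma affine_funD:
  "affine_fun_on X f \<Longrightarrow> x \<in> X \<Longrightarrow> y \<in> X \<Longrightarrow> 0 \<le> t \<Longrightarrow> t \<le> 1 \<Longrightarrow>
    f ((1 - t) *\<^sub>R x + t *\<^sub>R y) = (1 - t) * f x + t * f y"
  unfolding affine_fun_on_def by auto

lemma affine_imp_convex_on: "affine_fun_on X f \<Longrightarrow> convex_on X f"
  using convex_X by (intro convex_onI) (auto simp: affine_funD)

lemma affine_imp_convex_on_minus: "affine_fun_on X f \<Longrightarrow> convex_on X (\<lambda>x. - f x)"
  using convex_X by (intro convex_onI) (auto simp: affine_funD)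

lemma affine_fun_sum:
  assumes "affine_fun_on X f" "finite S" "sum c S = 1" "\<And>i. i \<in> S \<Longrightarrow> 0 \<le> c i" "\<And>i. i \<in> S \<Longrightarrow> y i \<in> X"
  shows "f (\<Sum>i\<in>S. c i *\<^sub>R y i) = (\<Sum>i\<in>S. c i * f (y i))"
proof -
  have "S \<noteq> {}" using assms(3) by auto
  then have "f (\<Sum>i\<in>S. c i *\<^sub>R y i) \<le> (\<Sum>i\<in>S. c i * f (y i))"
    "- f (\<Sum>i\<in>S. c i *\<^sub>R y i) \<le> (\<Sum>i\<in>S. c i * - f (y i))"
    using assms affine_imp_convex_on affine_imp_convex_on_minus
    by (intro convex_on_sum[of S X]; auto)+
  then show ?thesis by (simp add: sum_negf)
qed

lemma A_cD: "a \<in> A_c X \<Longrightarrow> affine_fun_on X a" "a \<in> A_c X \<Longrightarrow> continuous_on X a"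
  "a \<in> A_c X \<Longrightarrow> a \<in> extensional X"
  by (auto simp: A_c_def)

text \<open>Closed extreme sets as in the Krein-Milman argument: no convexity is asked, and all
  interior points of a segment are tested, whereas \<open>extremal\<close> tests only
  midpoints.\<close>

definition extremal_set :: "'a set \<Rightarrow> bool" where
  "extremal_set E \<longleftrightarrow> E \<noteq> {} \<and> closed E \<and> E \<subseteq> X \<and>
    (\<forall>y\<in>X. \<forall>z\<in>X. \<forall>t. 0 < t \<and> t < 1 \<and> (1 - t) *\<^sub>R y + t *\<^sub>R z \<in> E \<longrightarrow> y \<in> E \<and> z \<in> E)"

lemma extremal_setD:
  "extremal_set E \<Longrightarrow> y \<in> X \<Longrightarrow> z \<in> X \<Longrightarrow> 0 < t \<Longrightarrow> t < 1 \<Longrightarrow> (1 - t) *\<^sub>R y + t *\<^sub>R z \<in> E \<Longrightarrow>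
    y \<in> E \<and> z \<in> E"
  unfolding extremal_set_def by blast

lemma extremal_set_basic: "extremal_set E \<Longrightarrow> E \<noteq> {}" "extremal_set E \<Longrightarrow> closed E" "extremal_set E \<Longrightarrow> E \<subseteq> X"
  by (simp_all add: extremal_set_def)

lemma closed_level_set:
  assumes "continuous_on X (f :: 'a \<Rightarrow> real)" "closed E" "E \<subseteq> X"
  shows "closed {x \<in> E. f x = c}"
proof -
  have "closedin (top_of_set E) {x \<in> E. f x \<in> {c}}"
    using continuous_closedin_preimage[OF continuous_on_subset[OF assms(1,3)], of "{c}"]
    by (simp add: vimage_def Int_def conj_commute)
  then show ?thesis using assms(2) closedin_closed_trans by auto
qed

text \<open>If a weighted mean with positive weights of numbers at most \<open>f w\<close> is at
  least \<open>f w\<close>, then all these numbers equal \<open>f w\<close>.\<close>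

lemma extremal_set_max:
  assumes E: "extremal_set E" and f: "continuous_on X f" "convex_on X f"
  obtains m where "extremal_set {x \<in> E. f x = m}" "\<And>x. x \<in> E \<Longrightarrow> f x \<le> m"
proof -
  have E': "closed E" "E \<subseteq> X" "E \<noteq> {}" using E by (auto simp: extremal_set_def)
  have "compact E" using compact_Int_closed[OF compact_X E'(1)] E'(2) by (simp add: Int_absorb1)
  then obtain w where w: "w \<in> E" "\<And>x. x \<in> E \<Longrightarrow> f x \<le> f w"
    using continuous_attains_sup[OF _ E'(3) continuous_on_subset[OF f(1) E'(2)]] by blast
  have "extremal_set {x \<in> E. f x = f w}"
    unfolding extremal_set_def
  proof (intro conjI ballI allI impI; (elim conjE)?)
    show "{x \<in> E. f x = f w} \<noteq> {}" "{x \<in> E. f x = f w} \<subseteq> X" using w(1) E'(2) by auto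
    show "closed {x \<in> E. f x = f w}" by (rule closed_level_set[OF f(1) E'(1,2)])
    fix y z and t :: real
    assume *: "y \<in> X" "z \<in> X" "0 < t" "t < 1" "(1 - t) *\<^sub>R y + t *\<^sub>R z \<in> {x \<in> E. f x = f w}"
    have yz: "y \<in> E" "z \<in> E" using extremal_setD[OF E *(1-4)] *(5) by auto
    have "f w \<le> (1 - t) * f y + t * f z"
      using convex_onD[OF f(2), of t y z] * by auto
    moreover have "(1 - t) * f y \<le> (1 - t) * f w" "t * f z \<le> t * f w"
      using w(2)[OF yz(1)] w(2)[OF yz(2)] *(3,4) by (auto intro: mult_left_mono)
    ultimately have "t * (f w - f z) \<le> 0" "(1 - t) * (f w - f y) \<le> 0" by (auto simp: algebra_simps)
    then have "f z = f w" "f y = f w"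
      using w(2)[OF yz(1)] w(2)[OF yz(2)] *(3,4) by (auto simp: mult_le_0_iff)
    then show "y \<in> {x \<in> E. f x = f w}" "z \<in> {x \<in> E. f x = f w}" using yz by auto
  qed
  then show thesis using that w(2) by blast
qed

text \<open>Compactness lets Zorn's lemma produce a minimal extremal set. It is a singleton, since
  the maximizers of a separating function in \<open>A_c X\<close> would form a smaller extremal
  set.\<close>

lemma extremal_set_contains_extreme_point:
  assumes E: "extremal_set E"
  obtains x where "x \<in> E" "x extreme_point_of X"
proof -
  define A where "A = {F. extremal_set F \<and> F \<subseteq> E}"
  have "\<exists>m\<in>A. \<forall>a\<in>A. a \<subseteq> m \<longrightarrow> a = m"
  proof (rule predicate_Zorn)
    show "partial_order_on A (relation_of (\<lambda>F G. G \<subseteq> F) A)"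
      by (rule partial_order_on_relation_ofI) auto
    fix C assume C: "C \<in> Chains (relation_of (\<lambda>F G. G \<subseteq> F) A)"
    then have CA: "C \<subseteq> A" by (auto simp: Chains_def relation_of_def)
    have Cx: "extremal_set F" if "F \<in> C" for F using CA that by (auto simp: A_def)
    show "\<exists>u\<in>A. \<forall>a\<in>C. u \<subseteq> a"
    proof (cases "C = {}")
      case True
      then show ?thesis using E by (auto simp: A_def)
    next
      case False
      have "X \<inter> \<Inter>C \<noteq> {}"
      proof (rule compact_imp_fip[OF compact_X])
        fix F' assume F': "finite F'" "F' \<subseteq> C"
        show "X \<inter> \<Inter>F' \<noteq> {}"
        proof (cases "F' = {}")
          case True
          then show ?thesis using E by (auto simp: extremal_set_def)
        next
          case False
          have "subset.chain A F'"
            using C F'(2) by (auto simp: subset_chain_def Chains_def relation_of_def)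
          then have "\<Inter>F' \<in> C" using Inter_in_chain[OF F'(1) False] F'(2) by blast
          note this' = extremal_set_basic[OF Cx[OF this]]
          show ?thesis unfolding Int_absorb1[OF this'(3)] by (rule this'(1))
        qed
      qed (rule extremal_set_basic(2)[OF Cx])
      then have ne: "\<Inter>C \<noteq> {}" by blast
      have "extremal_set (\<Inter>C)"
        unfolding extremal_set_def
      proof (intro conjI ballI allI impI ne; (elim conjE)?)
        show "closed (\<Inter>C)" using extremal_set_basic(2)[OF Cx] by (intro closed_Inter ballI)
        show "\<Inter>C \<subseteq> X" using extremal_set_basic(3)[OF Cx] False by blast
        fix y z and t :: real
        assume *: "y \<in> X" "z \<in> X" "0 < t" "t < 1" "(1 - t) *\<^sub>R y + t *\<^sub>R z \<in> \<Inter>C"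
        have "y \<in> F \<and> z \<in> F" if "F \<in> C" for F
          using extremal_setD[OF Cx[OF that] *(1-4)] *(5) that by blast
        then show "y \<in> \<Inter>C" "z \<in> \<Inter>C" by auto
      qed
      then have "\<Inter>C \<in> A" using CA False by (auto simp: A_def)
      then show ?thesis by blast
    qed
  qed
  then obtain F where FA: "F \<in> A" "\<forall>a\<in>A. a \<subseteq> F \<longrightarrow> a = F" by (rule bexE)
  then have F: "extremal_set F" "F \<subseteq> E" by (simp_all add: A_def)
  have Fmin: "G = F" if "extremal_set G" "G \<subseteq> F" for G
  proof -
    have "G \<in> A" using that F(2) by (simp add: A_def)
    then show ?thesis using FA(2) that(2) by simp
  qed
  have FX: "F \<subseteq> X" using F by (auto simp: extremal_set_def)
  obtain x where x: "x \<in> F" using F(1) by (auto simp: extremal_set_def)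
  have single: "y = x" if y: "y \<in> F" for y
  proof (rule ccontr)
    assume "y \<noteq> x"
    then obtain a where a: "a \<in> A_c X" "a y < a x"
      using A_c_separating[OF convex_X] y x FX by blast
    obtain m where m: "extremal_set {x \<in> F. a x = m}" "\<And>x. x \<in> F \<Longrightarrow> a x \<le> m"
      using extremal_set_max[OF F(1) A_cD(2)[OF a(1)] affine_imp_convex_on[OF A_cD(1)[OF a(1)]]] by blast
    have "{x \<in> F. a x = m} = F" using Fmin[OF m(1)] by auto
    then have "\<forall>w\<in>F. a w = m" by blast
    then show False using x y a(2) by auto
  qed
  have "x extreme_point_of X"
    unfolding extreme_point_of_def in_segment
  proof (intro conjI ballI notI; (elim conjE exE)?)
    show "x \<in> X" using x FX by auto
    fix y z and t :: real
    assume "y \<in> X" "z \<in> X" "y \<noteq> z" "0 < t" "t < 1" "x = (1 - t) *\<^sub>R y + t *\<^sub>R z"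
    then have "y \<in> F \<and> z \<in> F" using extremal_setD[OF F(1), of y z t] x by auto
    then show False using single \<open>y \<noteq> z\<close> by auto
  qed
  then show thesis using that x F(2) by blast
qed

theorem Bauer_maximum_principle:
  assumes "X \<noteq> {}" "continuous_on X f" "convex_on X f"
  obtains x where "x extreme_point_of X" "\<And>y. y \<in> X \<Longrightarrow> f y \<le> f x"
proof -
  have "extremal_set X"
    using assms(1) compact_imp_closed[OF compact_X] by (auto simp: extremal_set_def)
  then obtain m where m: "extremal_set {x \<in> X. f x = m}" "\<And>x. x \<in> X \<Longrightarrow> f x \<le> m"
    using extremal_set_max assms(2,3) by blast
  obtain x where "x \<in> {x \<in> X. f x = m}" "x extreme_point_of X"
    using extremal_set_contains_extreme_point[OF m(1)] by blast
  then show thesis using that m(2) by auto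
qed

end

section \<open>Barycenters\<close>

context compact_convex
begin

text \<open>Cut \<open>X\<close> into finitely many Baire cells on which every function of
  \<open>A\<close> varies by at most \<open>e\<close>, pick a point in each cell, and average these
  points with the masses of the cells.\<close>

lemma ex_approximate_barycenter:
  assumes M: "prob_space M" and sp: "space M = X" and sub: "sets (baire X) \<subseteq> sets M"
    and A: "finite A" "A \<subseteq> A_c X" and e: "e > 0"
  obtains x where "x \<in> X" "\<And>a. a \<in> A \<Longrightarrow> \<bar>a x - (\<integral>y. a y \<partial>M)\<bar> \<le> e"
proof -
  interpret prob_space M by (rule M)
  have id: "(\<lambda>x. x) \<in> measurable M (baire X)"
    using sub sp sets.sets_into_space[of _ "baire X"] by (intro measurableI) (auto simp: Int_absorb2)
  have meas: "g \<in> borel_measurable M" if "continuous_on X g" for g :: "'a \<Rightarrow> real"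
    using measurable_compose[OF id borel_measurable_baire_continuous[OF that]] .
  have bnd: "\<exists>B. \<forall>x\<in>X. \<bar>a x\<bar> \<le> B" if "a \<in> A" for a
    using compact_imp_bounded[OF compact_continuous_image[OF A_cD(2) compact_X], of a] A(2) that
    by (auto simp: bounded_iff)
  \<comment> \<open>Rounding to multiples of \<open>e\<close> labels the cells; finitely many labels
    occur because each function of \<open>A\<close> is bounded on \<open>X\<close>.\<close>
  define \<phi> where "\<phi> = (\<lambda>x. \<lambda>a\<in>A. \<lfloor>a x / e\<rfloor>)"
  have fin: "finite (\<phi> ` X)"
  proof -
    obtain B where B: "\<And>a x. a \<in> A \<Longrightarrow> x \<in> X \<Longrightarrow> \<bar>a x\<bar> \<le> B a" using bnd by metis
    have "\<phi> x \<in> PiE A (\<lambda>a. {\<lfloor>- B a / e\<rfloor>..\<lfloor>B a / e\<rfloor>})" if "x \<in> X" for x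
    proof (rule PiE_I)
      fix a assume a: "a \<in> A"
      have "- B a \<le> a x" "a x \<le> B a" using B[OF a that] by auto
      then show "\<phi> x a \<in> {\<lfloor>- B a / e\<rfloor>..\<lfloor>B a / e\<rfloor>}"
        using e a divide_right_mono[of "- B a" "a x" e] by (auto simp: \<phi>_def intro!: floor_mono divide_right_mono)
    qed (auto simp: \<phi>_def)
    then have "\<phi> ` X \<subseteq> PiE A (\<lambda>a. {\<lfloor>- B a / e\<rfloor>..\<lfloor>B a / e\<rfloor>})" by auto
    then show ?thesis by (rule finite_subset) (use A(1) in \<open>auto intro: finite_PiE\<close>)
  qed
  define P where "P = (\<lambda>v. {x \<in> X. \<phi> x = v})"
  have close: "\<bar>a x - a y\<bar> \<le> e" if "\<phi> x = \<phi> y" "a \<in> A" for x y a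
  proof -
    have eq: "\<lfloor>a x / e\<rfloor> = \<lfloor>a y / e\<rfloor>" using fun_cong[OF that(1), of a] that(2) by (simp add: \<phi>_def)
    have "\<bar>a x / e - a y / e\<bar> \<le> 1" using eq by linarith
    then have "\<bar>(a x - a y) / e\<bar> \<le> 1" by (simp add: diff_divide_distrib)
    then show ?thesis using e by (simp add: abs_divide)
  qed
  have P: "P v \<in> sets M" if "v \<in> \<phi> ` X" for v
  proof -
    have v: "v \<in> extensional A" using that by (auto simp: \<phi>_def)
    have "P v = {x \<in> space M. \<forall>a\<in>A. \<lfloor>a x / e\<rfloor> = v a}"
      using v unfolding P_def sp by (auto simp: \<phi>_def extensional_def fun_eq_iff restrict_def)
    also have "\<dots> \<in> sets M"
    proof (rule sets.sets_Collect_finite_All[OF _ A(1)])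
      fix a assume "a \<in> A"
      then have a: "a \<in> borel_measurable M" using A(2) A_cD(2) meas by auto
      have "{x \<in> space M. \<lfloor>a x / e\<rfloor> = v a} = {x \<in> space M. real_of_int (v a) \<le> a x / e \<and> a x / e < real_of_int (v a) + 1}"
        by (auto simp: floor_eq_iff)
      also have "\<dots> \<in> sets M" using a by measurable
      finally show "{x \<in> space M. \<lfloor>a x / e\<rfloor> = v a} \<in> sets M" .
    qed
    finally show ?thesis .
  qed
  have "\<exists>x. x \<in> X \<and> \<phi> x = v" if "v \<in> \<phi> ` X" for v using that by auto
  then obtain p where p: "\<And>v. v \<in> \<phi> ` X \<Longrightarrow> p v \<in> X \<and> \<phi> (p v) = v" by metis
  have pX: "p v \<in> X" if "v \<in> \<phi> ` X" for v using p[OF that] by simp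
  have total: "(\<Sum>v\<in>\<phi> ` X. measure M (P v)) = 1"
  proof -
    have "(\<Sum>v\<in>\<phi> ` X. measure M (P v)) = measure M (\<Union>v\<in>\<phi> ` X. P v)"
      using P by (intro finite_measure_finite_Union[symmetric, OF fin]) (auto simp: disjoint_family_on_def P_def)
    also have "(\<Union>v\<in>\<phi> ` X. P v) = space M" by (auto simp: P_def sp)
    finally show ?thesis by (simp add: prob_space)
  qed
  define x where "x = (\<Sum>v\<in>\<phi> ` X. measure M (P v) *\<^sub>R p v)"
  have "x \<in> X" unfolding x_def
    using pX total by (intro convex_sum[OF fin convex_X]) auto
  moreover have "\<bar>a x - (\<integral>y. a y \<partial>M)\<bar> \<le> e" if a: "a \<in> A" for a
  proof -
    have aA: "a \<in> A_c X" using a A(2) by auto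
    obtain B where B: "\<And>x. x \<in> X \<Longrightarrow> \<bar>a x\<bar> \<le> B" using bnd[OF a] by auto
    have ia: "integrable M a"
      using meas[OF A_cD(2)[OF aA]] B by (intro integrable_const_bound[of _ B]) (auto simp: sp)
    let ?s = "\<lambda>y. \<Sum>v\<in>\<phi> ` X. a (p v) * indicator (P v) y"
    have ints': "integrable M (\<lambda>y. a (p v) * indicator (P v) y)" if "v \<in> \<phi> ` X" for v
      using P[OF that] emeasure_finite by (auto simp: less_top[symmetric])
    have ints: "integrable M ?s" using ints' by (intro Bochner_Integration.integrable_sum) auto
    have "a x = (\<Sum>v\<in>\<phi> ` X. measure M (P v) * a (p v))" unfolding x_def
      using pX total by (intro affine_fun_sum[OF A_cD(1)[OF aA] fin]) auto
    also have "\<dots> = (\<integral>y. ?s y \<partial>M)"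
      using ints' P by (subst Bochner_Integration.integral_sum) (auto simp: mult.commute intro!: sum.cong)
    finally have "a x - (\<integral>y. a y \<partial>M) = (\<integral>y. ?s y - a y \<partial>M)" using ints ia by simp
    also have "\<bar>\<dots>\<bar> \<le> (\<integral>y. \<bar>?s y - a y\<bar> \<partial>M)"
      using ints ia by (intro integral_abs_bound)
    also have "\<dots> \<le> (\<integral>y. e \<partial>M)"
    proof (rule integral_mono)
      fix y assume "y \<in> space M"
      then have y: "y \<in> X" using sp by simp
      have "?s y = (\<Sum>v\<in>\<phi> ` X. if v = \<phi> y then a (p v) else 0)"
        using y by (intro sum.cong) (auto simp: P_def)
      also have "\<dots> = a (p (\<phi> y))" using y fin by (simp add: sum.delta)
      finally show "\<bar>?s y - a y\<bar> \<le> e" using close[of "p (\<phi> y)" y] p[of "\<phi> y"] y a by auto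
    qed (use ints ia in auto)
    finally show ?thesis by (simp add: prob_space)
  qed
  ultimately show thesis using that by blast
qed

text \<open>Each requirement "\<open>a x\<close> is within \<open>e\<close> of the integral of
  \<open>a\<close>" defines a closed set; finitely many of them are met simultaneously by an
  approximate barycenter, and compactness of \<open>X\<close> does the rest.\<close>

theorem ex_barycenter:
  assumes M: "prob_space M" and sp: "space M = X" and sub: "sets (baire X) \<subseteq> sets M"
  obtains x where "barycenter X M x"
proof -
  let ?I = "{(a, e). a \<in> A_c X \<and> e > (0::real)}"
  let ?C = "\<lambda>(a, e). {x \<in> X. \<bar>a x - (\<integral>y. a y \<partial>M)\<bar> \<le> e}"
  have "X \<inter> (\<Inter>i\<in>?I. ?C i) \<noteq> {}"
  proof (rule compact_imp_fip_image[OF compact_X])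
    fix i assume "i \<in> ?I"
    then obtain a e where i: "i = (a, e)" "a \<in> A_c X" by auto
    \<comment> \<open>Rewrites the inequality as a zero set so that closedness of level sets
      applies.\<close>
    have "continuous_on X (\<lambda>x. max 0 (\<bar>a x - (\<integral>y. a y \<partial>M)\<bar> - e))"
      by (intro continuous_intros A_cD(2) i)
    from closed_level_set[OF this compact_imp_closed[OF compact_X] order_refl, of 0]
    show "closed (?C i)" unfolding i(1) by (simp add: max_def) (smt (verit) Collect_cong)
  next
    fix I' assume I': "finite I'" "I' \<subseteq> ?I"
    define e where "e = Min (insert 1 (snd ` I'))"
    have e: "e > 0" unfolding e_def using I' by (subst Min_gr_iff) auto
    have "fst ` I' \<subseteq> A_c X" "finite (fst ` I')" using I' by auto
    then obtain x where x: "x \<in> X" "\<And>a. a \<in> fst ` I' \<Longrightarrow> \<bar>a x - (\<integral>y. a y \<partial>M)\<bar> \<le> e"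
      using ex_approximate_barycenter[OF M sp sub _ _ e] by metis
    have "x \<in> ?C i" if i: "i \<in> I'" for i
    proof -
      have "e \<le> snd i" unfolding e_def using I' i by (intro Min_le) auto
      then show ?thesis using x(1) x(2)[of "fst i"] i by (auto simp: split_beta)
    qed
    then show "X \<inter> (\<Inter>i\<in>I'. ?C i) \<noteq> {}" using x(1) by blast
  qed
  then obtain x where x: "x \<in> X" "\<And>a e. a \<in> A_c X \<Longrightarrow> e > 0 \<Longrightarrow> \<bar>a x - (\<integral>y. a y \<partial>M)\<bar> \<le> e"
    by auto
  have "a x = (\<integral>y. a y \<partial>M)" if "a \<in> A_c X" for a
  proof -
    have "\<bar>a x - (\<integral>y. a y \<partial>M)\<bar> \<le> 0"
      by (rule field_le_epsilon) (use x(2)[OF that] in auto)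
    then show ?thesis by simp
  qed
  then show thesis using that x(1) by (auto simp: barycenter_def)
qed

lemma barycenter_unique: "barycenter X M x \<Longrightarrow> barycenter X M y \<Longrightarrow> x = y"
  using A_c_separating[OF convex_X, of x y] unfolding barycenter_def by (metis order_less_irrefl)

end

section \<open>Simons' inequality\<close>

context compact_convex
begin

text \<open>With \<open>S\<close> the supremum over \<open>X\<close> and \<open>h\<^sub>n\<close> the partial sums of \<open>\<Sum>n. l^n g\<^sub>n\<close>, the near-optimality of each
  \<open>g\<^sub>n\<close> makes the increments of \<open>S h\<^sub>n\<close> decay no faster than \<open>l^n\<close>. At a point where the full sum attains its maximum,
  every \<open>g\<^sub>n\<close> must then be large.\<close>

theorem Simons:
  fixes F :: "nat \<Rightarrow> 'a \<Rightarrow> real"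
  assumes cont: "\<And>n. continuous_on X (F n)" and conv: "\<And>n. convex_on X (F n)"
    and bound: "\<And>n x. x \<in> X \<Longrightarrow> \<bar>F n x\<bar> \<le> C"
    and x0: "x0 \<in> X" "\<And>n. s \<le> F n x0" and \<delta>: "\<delta> > 0"
  obtains b where "b extreme_point_of X" "\<And>n. \<exists>k\<ge>n. s - \<delta> \<le> F k b"
proof -
  have C: "C \<ge> 0" using bound[OF x0(1), of 0] by linarith
  \<comment> \<open>The ratio is so small that all errors proportional to \<open>l\<close> in the
    final estimate total at most \<open>\<delta> / 2\<close>, see \<open>gb\<close>.\<close>
  define l where "l = \<delta> / (2 * (C + \<bar>s\<bar> + \<delta>))"
  have den: "C + \<bar>s\<bar> + \<delta> > 0" using C \<delta> by linarith
  have l: "0 < l" "l < 1" "l * (C + \<bar>s\<bar> + \<delta>) = \<delta> / 2"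
    unfolding l_def using C \<delta> den by (auto simp: field_simps)
  \<comment> \<open>Chosen so that \<open>2 * \<epsilon> n\<close> equals \<open>l ^ Suc n\<close>
    times the increment of \<open>\<delta> / 2 * (1 - (1/2)^n)\<close>; the losses in
    \<open>d_ge\<close> telescope and stay below \<open>\<delta> / 2\<close>.\<close>
  define \<epsilon> where "\<epsilon> = (\<lambda>n. \<delta> / 8 * l ^ Suc n * (1/2)^n)"
  have \<epsilon>: "\<epsilon> n > 0" for n unfolding \<epsilon>_def using \<delta> l by simp
  define G where "G = {g. continuous_on X g \<and> convex_on X g \<and> (\<forall>x\<in>X. \<bar>g x\<bar> \<le> C) \<and> s \<le> g x0}"
  have "convex G"
    unfolding convex_def
  proof (intro ballI allI impI)
    fix f g and u v :: real
    assume *: "f \<in> G" "g \<in> G" "0 \<le> u" "0 \<le> v" "u + v = 1"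
    have eq: "u *\<^sub>R f + v *\<^sub>R g = (\<lambda>x. u * f x + v * g x)" by (simp add: fun_eq_iff)
    have "\<bar>u * f x + v * g x\<bar> \<le> C" if "x \<in> X" for x
    proof -
      have "\<bar>u * f x + v * g x\<bar> \<le> u * \<bar>f x\<bar> + v * \<bar>g x\<bar>"
        using *(3,4) abs_triangle_ineq[of "u * f x" "v * g x"] by (simp add: abs_mult)
      also have "\<dots> \<le> u * C + v * C"
        using * that by (intro add_mono mult_left_mono) (auto simp: G_def)
      also have "\<dots> = C" using *(5) by (simp add: distrib_right[symmetric])
      finally show ?thesis .
    qed
    moreover have "s \<le> u * f x0 + v * g x0"
    proof -
      have "u * s + v * s \<le> u * f x0 + v * g x0"
        using * by (intro add_mono mult_left_mono) (auto simp: G_def)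
      then show ?thesis using *(5) by (simp add: distrib_right[symmetric])
    qed
    moreover have "continuous_on X (\<lambda>x. u * f x + v * g x)" using * by (auto simp: G_def intro!: continuous_intros)
    moreover have "convex_on X (\<lambda>x. u * f x + v * g x)"
      using * by (auto simp: G_def intro!: convex_on_add convex_on_cmul)
    ultimately show "u *\<^sub>R f + v *\<^sub>R g \<in> G" unfolding eq by (simp add: G_def)
  qed
  \<comment> \<open>Hulls of tails: a statement about one element of \<open>K n\<close> at a point
    yields one about some \<open>F k\<close> with \<open>k \<ge> n\<close>.\<close>
  define K where "K = (\<lambda>n. convex hull (F ` {n..}))"
  have KG: "K n \<subseteq> G" for n
    unfolding K_def using cont conv bound x0(2) by (intro hull_minimal \<open>convex G\<close>) (auto simp: G_def)
  have Kmono: "K (Suc n) \<subseteq> K n" for n unfolding K_def by (intro hull_mono image_mono) auto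
  have Kne: "F n \<in> K n" for n unfolding K_def by (intro hull_inc) auto
  have Gb: "\<bar>g x\<bar> \<le> C" if "g \<in> G" "x \<in> X" for g x using that by (auto simp: G_def)
  define S where "S = (\<lambda>f :: 'a \<Rightarrow> real. SUP x\<in>X. f x)"
  define bd where "bd = (\<lambda>f :: 'a \<Rightarrow> real. \<exists>B. \<forall>x\<in>X. \<bar>f x\<bar> \<le> B)"
  have Sle: "S f \<le> c" if "\<And>x. x \<in> X \<Longrightarrow> f x \<le> c" for f c
    unfolding S_def using x0(1) that by (intro cSUP_least) auto
  have leS: "f x \<le> S f" if f: "bd f" and x: "x \<in> X" for f x
  proof -
    obtain B where "\<And>x. x \<in> X \<Longrightarrow> \<bar>f x\<bar> \<le> B" using f by (auto simp: bd_def)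
    then have "bdd_above (f ` X)" by (intro bdd_aboveI[of _ B]) (auto simp: abs_le_iff)
    then show ?thesis unfolding S_def using x by (intro cSUP_upper)
  qed
  have bd_add: "bd (\<lambda>x. f x + c * g x)" if f: "bd f" and g: "g \<in> G" for f g c
  proof -
    obtain B where B: "\<And>x. x \<in> X \<Longrightarrow> \<bar>f x\<bar> \<le> B" using f by (auto simp: bd_def)
    have "\<bar>f x + c * g x\<bar> \<le> B + \<bar>c\<bar> * C" if x: "x \<in> X" for x
      using B[OF x] Gb[OF g x] abs_triangle_ineq[of "f x" "c * g x"] mult_left_mono[of "\<bar>g x\<bar>" C "\<bar>c\<bar>"]
      by (simp add: abs_mult)
    then show ?thesis unfolding bd_def by blast
  qed
  \<comment> \<open>One step adds \<open>l ^ n * g\<close> with \<open>g\<close> in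
    \<open>K n\<close> such that the supremum over \<open>X\<close> of the new function is minimal
    up to \<open>\<epsilon> n\<close>.\<close>
  define Q where "Q = (\<lambda>n h h'. \<exists>g\<in>K n. h' = (\<lambda>x. h x + l ^ n * g x) \<and>
    (\<forall>g'\<in>K n. S h' \<le> S (\<lambda>x. h x + l ^ n * g' x) + \<epsilon> n))"
  have "\<exists>h. \<forall>n. (bd (h n) \<and> (n = 0 \<longrightarrow> h n = (\<lambda>_. 0))) \<and> Q n (h n) (h (Suc n))"
  proof (rule dependent_nat_choice)
    show "\<exists>h. bd h \<and> ((0::nat) = 0 \<longrightarrow> h = (\<lambda>_. 0))" by (auto simp: bd_def)
    fix h and n :: nat assume "bd h \<and> (n = 0 \<longrightarrow> h = (\<lambda>_. 0))"
    then have h: "bd h" by simp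
    let ?T = "\<lambda>g. S (\<lambda>x. h x + l ^ n * g x)"
    define I where "I = (INF g\<in>K n. ?T g)"
    have "h x0 + l ^ n * s \<le> ?T g" if "g \<in> K n" for g
    proof -
      have "g \<in> G" using that KG by auto
      then have "h x0 + l ^ n * s \<le> h x0 + l ^ n * g x0" using l by (auto simp: G_def)
      also have "\<dots> \<le> ?T g" using bd_add[OF h \<open>g \<in> G\<close>] x0(1) by (intro leS)
      finally show ?thesis .
    qed
    then have bb: "bdd_below (?T ` K n)" by (intro bdd_belowI[of _ "h x0 + l ^ n * s"]) auto
    have "\<exists>g\<in>K n. ?T g < I + \<epsilon> n"
      using cINF_less_iff[OF _ bb, of "I + \<epsilon> n"] Kne[of n] \<epsilon>[of n] unfolding I_def by auto
    then obtain g where g: "g \<in> K n" "?T g < I + \<epsilon> n" by (rule bexE)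
    have "I \<le> ?T g'" if "g' \<in> K n" for g' unfolding I_def using bb that by (rule cINF_lower)
    then have "?T g \<le> ?T g' + \<epsilon> n" if "g' \<in> K n" for g' using g(2) that by fastforce
    then have "Q n h (\<lambda>x. h x + l ^ n * g x)" unfolding Q_def using g(1) by blast
    moreover have "bd (\<lambda>x. h x + l ^ n * g x)" using bd_add[OF h] g(1) KG by blast
    ultimately show "\<exists>h'. (bd h' \<and> (Suc n = 0 \<longrightarrow> h' = (\<lambda>_. 0))) \<and> Q n h h'" by auto
  qed
  then obtain h where h: "\<And>n. bd (h n)" "h 0 = (\<lambda>_. 0)" "\<And>n. Q n (h n) (h (Suc n))" by auto
  then have "\<forall>n. \<exists>g. g \<in> K n \<and> h (Suc n) = (\<lambda>x. h n x + l ^ n * g x) \<and>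
      (\<forall>g'\<in>K n. S (h (Suc n)) \<le> S (\<lambda>x. h n x + l ^ n * g' x) + \<epsilon> n)"
    unfolding Q_def by blast
  from choice[OF this] obtain g where gg: "\<forall>n. g n \<in> K n \<and> h (Suc n) = (\<lambda>x. h n x + l ^ n * g n x) \<and>
      (\<forall>g'\<in>K n. S (h (Suc n)) \<le> S (\<lambda>x. h n x + l ^ n * g' x) + \<epsilon> n)" by (rule exE)
  have gK: "g n \<in> K n" for n using gg by blast
  have hSuc: "h (Suc n) x = h n x + l ^ n * g n x" for n x
    using gg by (metis (no_types))
  have opt: "S (h (Suc n)) \<le> S (\<lambda>x. h n x + l ^ n * g' x) + \<epsilon> n" if "g' \<in> K n" for n g'
    using gg that by blast
  have gG: "g n \<in> G" for n using gK KG by blast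
  define d where "d = (\<lambda>n. S (h (Suc n)) - S (h n))"
  \<comment> \<open>Compare \<open>g n\<close> with its competitor
    \<open>(g n + l * g (Suc n)) / (1 + l)\<close> in \<open>K n\<close>. With this choice the
    perturbed \<open>h n\<close> is the mean of \<open>h n\<close> and \<open>h (n + 2)\<close> with
    weights \<open>l / (1 + l)\<close> and \<open>1 / (1 + l)\<close>.\<close>
  have rec: "l * d n - 2 * \<epsilon> n \<le> d (Suc n)" for n
  proof -
    let ?u = "1 / (1 + l)" and ?v = "l / (1 + l)"
    have uv: "0 \<le> ?u" "0 \<le> ?v" "?u + ?v = 1" using l by (auto simp: add_divide_distrib[symmetric])
    have "g (Suc n) \<in> K n" using gK[of "Suc n"] Kmono[of n] by blast
    moreover have "convex (K n)" unfolding K_def by (rule convex_convex_hull)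
    ultimately have "?u *\<^sub>R g n + ?v *\<^sub>R g (Suc n) \<in> K n" using gK[of n] uv by (intro convexD)
    from opt[OF this] have 1: "S (h (Suc n)) \<le> S (\<lambda>x. h n x + l ^ n * (?u * g n x + ?v * g (Suc n) x)) + \<epsilon> n"
      by simp
    have "S (\<lambda>x. h n x + l ^ n * (?u * g n x + ?v * g (Suc n) x)) \<le> (l * S (h n) + S (h (Suc (Suc n)))) / (1 + l)"
    proof (rule Sle)
      fix x assume x: "x \<in> X"
      have "l * h n x \<le> l * S (h n)" using leS[OF h(1) x] l by (intro mult_left_mono) auto
      then have "(l * h n x + h (Suc (Suc n)) x) / (1 + l) \<le> (l * S (h n) + S (h (Suc (Suc n)))) / (1 + l)"
        using leS[OF h(1) x, of "Suc (Suc n)"] l by (intro divide_right_mono add_mono) auto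
      moreover have "h n x + l ^ n * (?u * g n x + ?v * g (Suc n) x) = (l * h n x + h (Suc (Suc n)) x) / (1 + l)"
      proof -
        define u where "u = ?u"
        define v where "v = ?v"
        have uv': "u * (1 + l) = 1" "v * (1 + l) = l" using l by (simp_all add: u_def v_def)
        have "(h n x + l ^ n * (u * g n x + v * g (Suc n) x)) * (1 + l) =
            h n x * (1 + l) + l ^ n * (g n x * (u * (1 + l)) + g (Suc n) x * (v * (1 + l)))"
          by (simp only: distrib_left distrib_right ac_simps)
        also have "\<dots> = l * h n x + h (Suc (Suc n)) x"
          unfolding uv' by (simp add: hSuc algebra_simps)
        finally show ?thesis using l unfolding u_def v_def by (simp add: eq_divide_eq)
      qed
      ultimately show "h n x + l ^ n * (?u * g n x + ?v * g (Suc n) x) \<le> (l * S (h n) + S (h (Suc (Suc n)))) / (1 + l)"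
        by simp
    qed
    with 1 have "S (h (Suc n)) - \<epsilon> n \<le> (l * S (h n) + S (h (Suc (Suc n)))) / (1 + l)" by simp
    then have "(1 + l) * (S (h (Suc n)) - \<epsilon> n) \<le> l * S (h n) + S (h (Suc (Suc n)))"
      using l by (simp add: field_simps)
    moreover have "(1 + l) * \<epsilon> n \<le> 2 * \<epsilon> n" using l \<epsilon>[of n] by (intro mult_right_mono) auto
    ultimately show ?thesis unfolding d_def by (simp add: algebra_simps)
  qed
  have d_ge: "l ^ n * (s - \<delta> / 2 * (1 - (1/2)^n)) \<le> d n" for n
  proof (induction n)
    case 0
    have "s \<le> g 0 x0" using gG by (auto simp: G_def)
    also have "\<dots> \<le> S (h (Suc 0))" using leS[OF h(1) x0(1), of "Suc 0"] by (simp add: hSuc h(2))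
    finally show ?case using Sle[of "h 0" 0] by (simp add: d_def h(2))
  next
    case (Suc n)
    have "l * (l ^ n * (s - \<delta> / 2 * (1 - (1/2)^n))) \<le> l * d n" using Suc l by (intro mult_left_mono) auto
    moreover have "l ^ Suc n * (s - \<delta> / 2 * (1 - (1/2)^Suc n)) =
        l * (l ^ n * (s - \<delta> / 2 * (1 - (1/2)^n))) - 2 * \<epsilon> n"
      by (simp add: \<epsilon>_def algebra_simps)
    ultimately show ?case using rec[of n] by linarith
  qed
  define s' where "s' = s - \<delta> / 2"
  have d_ge': "l ^ n * s' \<le> d n" for n
  proof -
    have "l ^ n * s' \<le> l ^ n * (s - \<delta> / 2 * (1 - (1/2)^n))"
      unfolding s'_def using l \<delta> by (intro mult_left_mono) (auto simp: algebra_simps)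
    then show ?thesis using d_ge[of n] by simp
  qed
  \<comment> \<open>Geometric summation of the lower bounds on \<open>d\<close>; multiplying by
    \<open>1 - l\<close> avoids quotients.\<close>
  have grow: "(1 - l) * S (h n) + s' * l ^ n * (1 - l ^ j) \<le> (1 - l) * S (h (n + j))" for n j
  proof (induction j)
    case (Suc j)
    have "(1 - l) * (l ^ (n + j) * s') \<le> (1 - l) * d (n + j)"
      using d_ge'[of "n + j"] l by (intro mult_left_mono) auto
    then show ?case using Suc by (simp add: d_def algebra_simps power_add)
  qed simp
  have hG: "continuous_on X (h n) \<and> convex_on X (h n)" for n
  proof (induction n)
    case 0
    then show ?case using convex_X by (simp add: h(2) convex_on_const)
  next
    case (Suc n)
    have e: "h (Suc n) = (\<lambda>x. h n x + l ^ n * g n x)" by (rule ext) (rule hSuc)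
    show ?case unfolding e using Suc gG[of n] l
      by (auto simp: G_def intro!: continuous_intros convex_on_add convex_on_cmul)
  qed
  have hsum: "h n x = (\<Sum>i<n. l ^ i * g i x)" for n x
    by (induction n) (auto simp: hSuc h(2))
  define H where "H = (\<lambda>x. suminf (\<lambda>i. l ^ i * g i x))"
  have sml: "summable (\<lambda>i. l ^ i * C)" using l by (intro summable_mult2) (simp add: summable_geometric)
  have tb: "norm (l ^ i * g i x) \<le> l ^ i * C" if "x \<in> X" for i x
    using Gb[OF gG that] l by (simp add: abs_mult mult_left_mono)
  have sm: "summable (\<lambda>i. l ^ i * g i x)" if "x \<in> X" for x
    by (rule summable_comparison_test'[OF sml, of 0]) (use tb[OF that] in auto)
  have hlim: "(\<lambda>n. h n x) \<longlonglongrightarrow> H x" if "x \<in> X" for x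
    using summable_LIMSEQ[OF sm[OF that]] by (simp add: hsum H_def)
  have "uniform_limit X (\<lambda>n x. \<Sum>i<n. l ^ i * g i x) H sequentially"
    unfolding H_def by (rule Weierstrass_m_test[OF tb sml])
  then have cH: "continuous_on X H"
    using hG by (intro uniform_limit_theorem[of _ h]) (auto simp: hsum[abs_def])
  have vH: "convex_on X H"
  proof (rule convex_onI[OF _ convex_X])
    fix t x y assume *: "(0::real) < t" "t < 1" "x \<in> X" "y \<in> X"
    then have z: "(1 - t) *\<^sub>R x + t *\<^sub>R y \<in> X" using convexD_alt[OF convex_X] by auto
    show "H ((1 - t) *\<^sub>R x + t *\<^sub>R y) \<le> (1 - t) * H x + t * H y"
    proof (rule LIMSEQ_le[OF hlim[OF z]])
      show "(\<lambda>n. (1 - t) * h n x + t * h n y) \<longlonglongrightarrow> (1 - t) * H x + t * H y"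
        using * by (intro tendsto_intros hlim)
      show "\<exists>N. \<forall>n\<ge>N. h n ((1 - t) *\<^sub>R x + t *\<^sub>R y) \<le> (1 - t) * h n x + t * h n y"
        using convex_onD[of X "h n" for n] hG * by (intro exI[of _ 0]) simp
    qed
  qed
  have tail: "(1 - l) * \<bar>H x - h n x\<bar> \<le> C * l ^ n" if x: "x \<in> X" for n x
  proof -
    have "H x - h n x = (\<Sum>i. l ^ (i + n) * g (i + n) x)"
      using suminf_minus_initial_segment[OF sm[OF x], of n] by (simp add: H_def hsum)
    moreover have "norm (\<Sum>i. l ^ (i + n) * g (i + n) x) \<le> (\<Sum>i. l ^ i * (l ^ n * C))"
    proof (rule norm_suminf_le)
      show "norm (l ^ (i + n) * g (i + n) x) \<le> l ^ i * (l ^ n * C)" for i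
        using tb[OF x, of "i + n"] by (simp add: power_add mult.assoc)
      show "summable (\<lambda>i. l ^ i * (l ^ n * C))" using l by (intro summable_mult2) (simp add: summable_geometric)
    qed
    moreover have "(\<Sum>i. l ^ i * (l ^ n * C)) = 1 / (1 - l) * (l ^ n * C)"
      using l by (subst suminf_mult2[symmetric]) (auto simp: suminf_geometric summable_geometric)
    ultimately have "\<bar>H x - h n x\<bar> \<le> 1 / (1 - l) * (l ^ n * C)" by simp
    then show ?thesis using l by (simp add: field_simps)
  qed
  have "X \<noteq> {}" using x0(1) by auto
  then obtain b where b: "b extreme_point_of X" "\<And>y. y \<in> X \<Longrightarrow> H y \<le> H b"
    using Bauer_maximum_principle cH vH by blast
  have bX: "b \<in> X" using b(1) by (simp add: extreme_point_of_def)
  have upper: "(1 - l) * S (h N) \<le> (1 - l) * H b + C * l ^ N" for N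
  proof -
    have "S (h N) \<le> H b + C * l ^ N / (1 - l)"
    proof (rule Sle)
      fix x assume x: "x \<in> X"
      have "(1 - l) * (h N x - H x) \<le> (1 - l) * \<bar>H x - h N x\<bar>" using l by (intro mult_left_mono) auto
      then have "h N x - H x \<le> C * l ^ N / (1 - l)" using tail[OF x, of N] l by (simp add: field_simps)
      then show "h N x \<le> H b + C * l ^ N / (1 - l)" using b(2)[OF x] by simp
    qed
    then show ?thesis using l by (simp add: field_simps)
  qed
  \<comment> \<open>Combine \<open>grow\<close> with \<open>upper\<close> at index
    \<open>n + j\<close> and let \<open>j\<close> tend to infinity; only here is it used that
    \<open>b\<close> maximizes the full sum \<open>H\<close>.\<close>
  have low: "(1 - l) * S (h n) + s' * l ^ n \<le> (1 - l) * H b" for n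
  proof (rule LIMSEQ_le)
    have lp: "(\<lambda>j. l ^ j) \<longlonglongrightarrow> 0" using l by (intro LIMSEQ_power_zero) auto
    have "(\<lambda>j. (1 - l) * S (h n) + s' * l ^ n * (1 - l ^ j)) \<longlonglongrightarrow> (1 - l) * S (h n) + s' * l ^ n * (1 - 0)"
      by (intro tendsto_intros lp)
    then show "(\<lambda>j. (1 - l) * S (h n) + s' * l ^ n * (1 - l ^ j)) \<longlonglongrightarrow> (1 - l) * S (h n) + s' * l ^ n"
      by simp
    have "(\<lambda>j. (1 - l) * H b + C * (l ^ n * l ^ j)) \<longlonglongrightarrow> (1 - l) * H b + C * (l ^ n * 0)"
      by (intro tendsto_intros lp)
    then show "(\<lambda>j. (1 - l) * H b + C * (l ^ n * l ^ j)) \<longlonglongrightarrow> (1 - l) * H b" by simp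
    show "\<exists>N. \<forall>j\<ge>N. (1 - l) * S (h n) + s' * l ^ n * (1 - l ^ j) \<le> (1 - l) * H b + C * (l ^ n * l ^ j)"
    proof (intro exI[of _ 0] allI impI)
      fix j
      show "(1 - l) * S (h n) + s' * l ^ n * (1 - l ^ j) \<le> (1 - l) * H b + C * (l ^ n * l ^ j)"
        using grow[of n j] upper[of "n + j"] by (simp add: power_add)
    qed
  qed
  \<comment> \<open>At \<open>b\<close>, \<open>low\<close> and the tail bound reduce to
    \<open>s' \<le> (1 - l) * g n b + C * l\<close>. If \<open>g n b\<close> were below
    \<open>s - \<delta>\<close>, the right side would be less than
    \<open>s - \<delta> + l * (C + \<bar>s\<bar> + \<delta>)\<close>, which is
    \<open>s'\<close>.\<close>
  have gb: "s - \<delta> \<le> g n b" for n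
  proof (rule ccontr)
    assume neg: "\<not> s - \<delta> \<le> g n b"
    have "(1 - l) * (H b - h (Suc n) b) \<le> (1 - l) * \<bar>H b - h (Suc n) b\<bar>" using l by (intro mult_left_mono) auto
    then have "(1 - l) * (H b - h (Suc n) b) \<le> C * l ^ Suc n" using tail[OF bX, of "Suc n"] by simp
    then have "(1 - l) * H b \<le> (1 - l) * h n b + (1 - l) * (l ^ n * g n b) + C * l ^ Suc n"
      by (simp add: hSuc algebra_simps)
    moreover have "(1 - l) * h n b \<le> (1 - l) * S (h n)" using leS[OF h(1) bX] l by (intro mult_left_mono) auto
    ultimately have "s' * l ^ n \<le> (1 - l) * (l ^ n * g n b) + C * l ^ Suc n" using low[of n] by linarith
    then have "l ^ n * s' \<le> l ^ n * ((1 - l) * g n b + C * l)" by (simp add: algebra_simps)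
    then have "s' \<le> (1 - l) * g n b + C * l" using l by simp
    moreover have "(1 - l) * g n b < (1 - l) * (s - \<delta>)" using neg l by (intro mult_strict_left_mono) auto
    moreover have "l * (- s) \<le> l * \<bar>s\<bar>" using l by (intro mult_left_mono) auto
    ultimately show False using l(3) by (simp add: s'_def algebra_simps)
  qed
  have "\<exists>k\<ge>n. s - \<delta> \<le> F k b" for n
  proof (rule ccontr)
    assume neg: "\<not> (\<exists>k\<ge>n. s - \<delta> \<le> F k b)"
    \<comment> \<open>Functions below \<open>s - \<delta>\<close> at \<open>b\<close> form a convex
      set, so it would contain the whole tail hull and in particular \<open>g n\<close>.\<close>
    have "convex {f. f b < s - \<delta>}"
      unfolding convex_def
    proof (intro ballI allI impI)
      fix f f' and u v :: real
      assume *: "f \<in> {f. f b < s - \<delta>}" "f' \<in> {f. f b < s - \<delta>}" "0 \<le> u" "0 \<le> v" "u + v = 1"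
      then have "u * f b + v * f' b < s - \<delta>" by (intro convex_bound_lt) auto
      then show "u *\<^sub>R f + v *\<^sub>R f' \<in> {f. f b < s - \<delta>}" by simp
    qed
    then have "K n \<subseteq> {f. f b < s - \<delta>}"
      unfolding K_def using neg by (intro hull_minimal) auto
    then show False using gK[of n] gb[of n] by auto
  qed
  then show thesis using that b(1) by blast
qed

text \<open>If \<open>h n x \<le> - e\<close> infinitely often, Simons' inequality for that
  subsequence of \<open>- h n\<close> produces an extreme point at which
  \<open>- h n \<ge> e/2\<close> infinitely often.\<close>

corollary concave_sequence_liminf:
  fixes h :: "nat \<Rightarrow> 'a \<Rightarrow> real"
  assumes cont: "\<And>n. continuous_on X (h n)" and conc: "\<And>n. convex_on X (\<lambda>x. - h n x)"
    and bound: "\<And>n x. x \<in> X \<Longrightarrow> \<bar>h n x\<bar> \<le> C"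
    and ext: "\<And>b e. b extreme_point_of X \<Longrightarrow> e > 0 \<Longrightarrow> \<forall>\<^sub>F n in sequentially. - e < h n b"
    and x: "x \<in> X" and e: "e > 0"
  shows "\<forall>\<^sub>F n in sequentially. - e < h n x"
proof (rule ccontr)
  assume "\<not> ?thesis"
  then have "\<exists>\<^sub>F n in sequentially. h n x \<le> - e" by (simp add: not_eventually not_less)
  then have "infinite {n. h n x \<le> - e}" by (simp add: frequently_cofinite cofinite_eq_sequentially[symmetric])
  then obtain r :: "nat \<Rightarrow> nat" where r: "strict_mono r" "\<And>n. r n \<in> {n. h n x \<le> - e}"
    using infinite_enumerate by blast
  have r': "e \<le> - h (r n) x" for n using r(2)[of n] by auto
  obtain b where b: "b extreme_point_of X" "\<And>n. \<exists>k\<ge>n. e - e/2 \<le> - h (r k) b"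
    by (rule Simons[of "\<lambda>n x. - h (r n) x" C x e "e/2"])
       (use cont conc bound x e r' in \<open>auto intro!: continuous_intros\<close>)
  have "\<forall>\<^sub>F n in sequentially. - (e/2) < h n b" using ext[OF b(1)] e by simp
  then obtain N where N: "\<And>n. n \<ge> N \<Longrightarrow> - (e/2) < h n b" by (auto simp: eventually_sequentially)
  obtain k where k: "k \<ge> N" "e - e/2 \<le> - h (r k) b" using b(2) by blast
  have "r k \<ge> N" using k(1) seq_suble[OF r(1), of k] by simp
  then show False using N[of "r k"] k(2) by simp
qed

end

section \<open>Maximal measures\<close>

context compact_convex
begin

section \<open>Convex continuous functions and the ring of their differences\<close>

definition conv_cont :: "('a \<Rightarrow> real) set" where
  "conv_cont = {f. continuous_on X f \<and> convex_on X f}"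

lemma conv_cont_add: "f \<in> conv_cont \<Longrightarrow> g \<in> conv_cont \<Longrightarrow> (\<lambda>x. f x + g x) \<in> conv_cont"
  by (auto simp: conv_cont_def intro!: continuous_intros convex_on_add)

lemma conv_cont_cmul: "c \<ge> 0 \<Longrightarrow> f \<in> conv_cont \<Longrightarrow> (\<lambda>x. c * f x) \<in> conv_cont"
  by (auto simp: conv_cont_def intro!: continuous_intros convex_on_cmul)

lemma conv_cont_const: "(\<lambda>_. c) \<in> conv_cont"
  using convex_X by (simp add: conv_cont_def convex_on_const)

lemma conv_cont_max: "f \<in> conv_cont \<Longrightarrow> g \<in> conv_cont \<Longrightarrow> (\<lambda>x. max (f x) (g x)) \<in> conv_cont"
  unfolding conv_cont_def
proof (intro CollectI conjI)
  assume f: "f \<in> {f. continuous_on X f \<and> convex_on X f}" and g: "g \<in> {f. continuous_on X f \<and> convex_on X f}"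
  then show "continuous_on X (\<lambda>x. max (f x) (g x))" by (auto intro!: continuous_intros)
  show "convex_on X (\<lambda>x. max (f x) (g x))"
  proof (rule convex_onI[OF _ convex_X])
    fix t x y assume *: "(0::real) < t" "t < 1" "x \<in> X" "y \<in> X"
    have "f ((1 - t) *\<^sub>R x + t *\<^sub>R y) \<le> (1 - t) * f x + t * f y"
      "g ((1 - t) *\<^sub>R x + t *\<^sub>R y) \<le> (1 - t) * g x + t * g y"
      using f g * by (auto intro!: convex_onD)
    moreover have "(1 - t) * f x + t * f y \<le> (1 - t) * max (f x) (g x) + t * max (f y) (g y)"
      "(1 - t) * g x + t * g y \<le> (1 - t) * max (f x) (g x) + t * max (f y) (g y)"
      using * by (auto intro!: add_mono mult_left_mono)
    ultimately show "max (f ((1 - t) *\<^sub>R x + t *\<^sub>R y)) (g ((1 - t) *\<^sub>R x + t *\<^sub>R y))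
        \<le> (1 - t) * max (f x) (g x) + t * max (f y) (g y)" by linarith
  qed
qed

lemma conv_cont_square:
  assumes f: "f \<in> conv_cont" and nonneg: "\<And>x. x \<in> X \<Longrightarrow> 0 \<le> f x"
  shows "(\<lambda>x. (f x)\<^sup>2) \<in> conv_cont"
  unfolding conv_cont_def
proof (intro CollectI conjI)
  show "continuous_on X (\<lambda>x. (f x)\<^sup>2)" using f by (auto simp: conv_cont_def intro!: continuous_intros)
  show "convex_on X (\<lambda>x. (f x)\<^sup>2)"
  proof (rule convex_onI[OF _ convex_X])
    fix t x y assume *: "(0::real) < t" "t < 1" "x \<in> X" "y \<in> X"
    then have z: "(1 - t) *\<^sub>R x + t *\<^sub>R y \<in> X" using convexD_alt[OF convex_X] by auto
    have "f ((1 - t) *\<^sub>R x + t *\<^sub>R y) \<le> (1 - t) * f x + t * f y"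
      using f * by (auto simp: conv_cont_def intro!: convex_onD)
    then have "(f ((1 - t) *\<^sub>R x + t *\<^sub>R y))\<^sup>2 \<le> ((1 - t) * f x + t * f y)\<^sup>2"
      using nonneg[OF z] by (intro power_mono)
    also have "\<dots> = (1 - t) * (f x)\<^sup>2 + t * (f y)\<^sup>2 - t * (1 - t) * (f x - f y)\<^sup>2"
      by (simp add: power2_eq_square algebra_simps)
    also have "\<dots> \<le> (1 - t) * (f x)\<^sup>2 + t * (f y)\<^sup>2" using * by simp
    finally show "(f ((1 - t) *\<^sub>R x + t *\<^sub>R y))\<^sup>2 \<le> (1 - t) * (f x)\<^sup>2 + t * (f y)\<^sup>2" .
  qed
qed

lemma A_c_conv_cont: "a \<in> A_c X \<Longrightarrow> a \<in> conv_cont" "a \<in> A_c X \<Longrightarrow> (\<lambda>x. - a x) \<in> conv_cont"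
  using A_cD affine_imp_convex_on affine_imp_convex_on_minus
  by (auto simp: conv_cont_def intro!: continuous_intros)

lemma bounded_continuous:
  fixes f :: "'a \<Rightarrow> real"
  assumes "continuous_on X f"
  obtains B where "\<And>x. x \<in> X \<Longrightarrow> \<bar>f x\<bar> \<le> B" "B \<ge> 0"
proof -
  obtain B where B: "\<And>x. x \<in> X \<Longrightarrow> \<bar>f x\<bar> \<le> B"
    using compact_imp_bounded[OF compact_continuous_image[OF assms compact_X]] by (auto simp: bounded_iff)
  show thesis by (rule that[of "max B 0"]) (use B in force)+
qed

definition diff_conv :: "('a \<Rightarrow> real) set" where
  "diff_conv = {\<lambda>x. f x - g x | f g. f \<in> conv_cont \<and> g \<in> conv_cont}"

lemma diff_convI: "f \<in> conv_cont \<Longrightarrow> g \<in> conv_cont \<Longrightarrow> (\<And>x. h x = f x - g x) \<Longrightarrow> h \<in> diff_conv"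
  unfolding diff_conv_def by (intro CollectI exI[of _ f] exI[of _ g]) auto

lemma diff_convE:
  assumes "h \<in> diff_conv"
  obtains f g where "f \<in> conv_cont" "g \<in> conv_cont" "h = (\<lambda>x. f x - g x)"
  using assms unfolding diff_conv_def by blast

lemma diff_conv_nonnegE:
  assumes "h \<in> diff_conv"
  obtains f g where "f \<in> conv_cont" "g \<in> conv_cont" "h = (\<lambda>x. f x - g x)"
    "\<And>x. x \<in> X \<Longrightarrow> 0 \<le> f x" "\<And>x. x \<in> X \<Longrightarrow> 0 \<le> g x"
proof -
  obtain f g where fg: "f \<in> conv_cont" "g \<in> conv_cont" "h = (\<lambda>x. f x - g x)"
    using diff_convE[OF assms] .
  obtain B where B: "\<And>x. x \<in> X \<Longrightarrow> \<bar>f x\<bar> \<le> B" "B \<ge> 0" using fg(1) bounded_continuous by (auto simp: conv_cont_def)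
  obtain C where C: "\<And>x. x \<in> X \<Longrightarrow> \<bar>g x\<bar> \<le> C" "C \<ge> 0" using fg(2) bounded_continuous by (auto simp: conv_cont_def)
  show thesis
  proof (rule that[of "\<lambda>x. f x + (B + C)" "\<lambda>x. g x + (B + C)"])
    show "(\<lambda>x. f x + (B + C)) \<in> conv_cont" "(\<lambda>x. g x + (B + C)) \<in> conv_cont"
      by (intro conv_cont_add fg conv_cont_const)+
    show "0 \<le> f x + (B + C)" "0 \<le> g x + (B + C)" if "x \<in> X" for x
      using B(1)[OF that] C(1)[OF that] B(2) C(2) by linarith+
  qed (simp add: fg(3))
qed

text \<open>By polarization \<open>2 (f1 - g1) (f2 - g2)\<close> is
  \<open>(f1 + f2)^2 + (g1 + g2)^2\<close> minus \<open>(f1 + g2)^2 + (g1 + f2)^2\<close>. Squares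
  of nonnegative convex functions are convex, hence the nonnegative representations.\<close>

lemma diff_conv_mult:
  assumes "h \<in> diff_conv" "k \<in> diff_conv"
  shows "(\<lambda>x. h x * k x) \<in> diff_conv"
proof -
  obtain f1 g1 where 1: "f1 \<in> conv_cont" "g1 \<in> conv_cont" "h = (\<lambda>x. f1 x - g1 x)"
    "\<And>x. x \<in> X \<Longrightarrow> 0 \<le> f1 x" "\<And>x. x \<in> X \<Longrightarrow> 0 \<le> g1 x" using diff_conv_nonnegE[OF assms(1)] by blast
  obtain f2 g2 where 2: "f2 \<in> conv_cont" "g2 \<in> conv_cont" "k = (\<lambda>x. f2 x - g2 x)"
    "\<And>x. x \<in> X \<Longrightarrow> 0 \<le> f2 x" "\<And>x. x \<in> X \<Longrightarrow> 0 \<le> g2 x" using diff_conv_nonnegE[OF assms(2)] by blast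
  let ?P = "\<lambda>x. 1/2 * ((f1 x + f2 x)\<^sup>2 + (g1 x + g2 x)\<^sup>2)"
  let ?Q = "\<lambda>x. 1/2 * ((f1 x + g2 x)\<^sup>2 + (g1 x + f2 x)\<^sup>2)"
  show ?thesis
  proof (rule diff_convI)
    show "?P \<in> conv_cont" "?Q \<in> conv_cont"
      using 1 2 by (intro conv_cont_cmul conv_cont_add conv_cont_square; simp)+
    show "h x * k x = ?P x - ?Q x" for x
      by (simp add: 1(3) 2(3) power2_eq_square field_simps)
  qed
qed

lemma function_ring_on_diff_conv: "function_ring_on diff_conv X"
proof
  show "compact X" by (rule compact_X)
  show "continuous_on X h" if h: "h \<in> diff_conv" for h
    using h by (rule diff_convE) (auto simp: conv_cont_def intro!: continuous_intros)
  show "(\<lambda>x. h x + k x) \<in> diff_conv" if h: "h \<in> diff_conv" and k: "k \<in> diff_conv" for h k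
  proof -
    obtain f1 g1 where 1: "f1 \<in> conv_cont" "g1 \<in> conv_cont" "h = (\<lambda>x. f1 x - g1 x)" using diff_convE[OF h] .
    obtain f2 g2 where 2: "f2 \<in> conv_cont" "g2 \<in> conv_cont" "k = (\<lambda>x. f2 x - g2 x)" using diff_convE[OF k] .
    show ?thesis
      by (rule diff_convI[of "\<lambda>x. f1 x + f2 x" "\<lambda>x. g1 x + g2 x"]) (use 1 2 conv_cont_add in auto)
  qed
  show "(\<lambda>x. h x * k x) \<in> diff_conv" if "h \<in> diff_conv" "k \<in> diff_conv" for h k
    using that by (rule diff_conv_mult)
  show "(\<lambda>_. c) \<in> diff_conv" for c
    by (rule diff_convI[of "\<lambda>_. c" "\<lambda>_. 0"]) (auto intro: conv_cont_const)
  show "\<exists>f\<in>diff_conv. f x \<noteq> f y" if "x \<in> X" "y \<in> X" "x \<noteq> y" for x y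
  proof -
    obtain a where a: "a \<in> A_c X" "a x < a y" using A_c_separating[OF convex_X] \<open>x \<in> X\<close> \<open>y \<in> X\<close> \<open>x \<noteq> y\<close> by blast
    have "a \<in> diff_conv" by (rule diff_convI[of a "\<lambda>_. 0"]) (auto intro: conv_cont_const A_c_conv_cont a)
    then show ?thesis using a(2) by (intro bexI[of _ a]) auto
  qed
qed

lemma diff_conv_dense:
  assumes "continuous_on X (f :: 'a \<Rightarrow> real)" "e > 0"
  obtains g where "g \<in> diff_conv" "\<And>x. x \<in> X \<Longrightarrow> \<bar>f x - g x\<bar> < e"
  using function_ring_on.Stone_Weierstrass_basic[OF function_ring_on_diff_conv assms] by blast

text \<open>Mokobodzki's form of maximality: every continuous function agrees \<open>\<mu>\<close>-almost everywhere with its upper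
  envelope. Stated through continuous concave majorants, it needs no integral of the (merely upper
  semicontinuous) envelope.\<close>

definition mokobodzki :: "'a measure \<Rightarrow> bool" where
  "mokobodzki \<mu> \<longleftrightarrow> (\<forall>f. \<forall>e>0. continuous_on X f \<longrightarrow>
     (\<exists>h. (\<lambda>x. - h x) \<in> conv_cont \<and> (\<forall>x\<in>X. f x \<le> h x) \<and> (\<integral>x. h x \<partial>\<mu>) \<le> (\<integral>x. f x \<partial>\<mu>) + e))"

lemma mokobodzkiE:
  assumes "mokobodzki \<mu>" "continuous_on X f" "e > 0"
  obtains h where "(\<lambda>x. - h x) \<in> conv_cont" "\<And>x. x \<in> X \<Longrightarrow> f x \<le> h x" "(\<integral>x. h x \<partial>\<mu>) \<le> (\<integral>x. f x \<partial>\<mu>) + e"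
  using assms unfolding mokobodzki_def by blast

lemma conv_cont_minusD: "(\<lambda>x. - h x) \<in> conv_cont \<Longrightarrow> continuous_on X h"
  using continuous_on_minus[of X "\<lambda>x. - h x"] by (simp add: conv_cont_def)

section \<open>Existence and characterization of maximal measures\<close>

lemma positive_functional_M1:
  assumes \<mu>: "\<mu> \<in> M1 X"
  shows "positive_functional X (\<lambda>f. \<integral>x. f x \<partial>\<mu>)"
proof -
  interpret prob_space \<mu> by (rule prob_space_M1[OF \<mu>])
  show ?thesis
  proof
    show "0 \<le> (\<integral>x. f x \<partial>\<mu>)" if "\<And>x. x \<in> X \<Longrightarrow> 0 \<le> f x" for f :: "'a \<Rightarrow> real"
      using that space_M1[OF \<mu>] by (intro Bochner_Integration.integral_nonneg) auto
  qed (use compact_X integrable_continuous_M1[OF \<mu> compact_X] prob_space in auto)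
qed

lemma positive_functional_eval:
  assumes "x \<in> X"
  shows "positive_functional X (\<lambda>f. f x)"
  by standard (use compact_X assms in auto)

text \<open>Start from \<open>p0 f\<close>, the infimum of \<open>L\<close> over concave continuous
  majorants of \<open>f\<close>. A minimal approximable \<open>p\<close> below \<open>p0\<close> is
  odd on convex functions, hence on their differences and by density on all continuous functions, so
  a measure represents it. Approximability then reads as \<open>mokobodzki\<close>. Taking
  \<open>L\<close> an integral gives a maximal measure above a given one; taking \<open>L\<close>
  evaluation at \<open>x\<close>, one representing \<open>x\<close>.\<close>

theorem ex_mokobodzki:
  assumes L: "positive_functional X L"
  obtains \<nu> where "\<nu> \<in> M1 X" "mokobodzki \<nu>" "\<And>f. f \<in> conv_cont \<Longrightarrow> L f \<le> (\<integral>x. f x \<partial>\<nu>)"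
proof -
  interpret positive_functional X L by (rule L)
  define V where "V = {f :: 'a \<Rightarrow> real. continuous_on X f}"
  define Q where "Q = {f :: 'a \<Rightarrow> real. \<forall>x\<in>X. 0 \<le> f x}"
  define maj where "maj = (\<lambda>f. {h :: 'a \<Rightarrow> real. - h \<in> conv_cont \<and> h - f \<in> Q})"
  define p0 where "p0 = (\<lambda>f. INF h\<in>maj f. L h)"
  have sV: "subspace V"
    unfolding subspace_def V_def by (auto intro!: continuous_intros simp: plus_fun_def zero_fun_def scaleR_fun_def)
  have KV: "conv_cont \<subseteq> V" by (auto simp: V_def conv_cont_def)
  have K2: "f + g \<in> conv_cont" if "f \<in> conv_cont" "g \<in> conv_cont" for f g
    using conv_cont_add[OF that] by (simp add: plus_fun_def)
  have K3: "c *\<^sub>R f \<in> conv_cont" if "c \<ge> 0" "f \<in> conv_cont" for f c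
    using conv_cont_cmul[OF that] by (simp add: scaleR_fun_def)
  have majD: "continuous_on X h" "x \<in> X \<Longrightarrow> f x \<le> h x" if "h \<in> maj f" for h f x
    using that conv_cont_minusD[of h] by (auto simp: maj_def Q_def fun_Compl_def fun_diff_def)
  have lower: "L f \<le> L h" if "f \<in> V" "h \<in> maj f" for f h
    using that majD[OF that(2)] by (intro L_mono) (auto simp: V_def)
  have ne: "maj f \<noteq> {}" if f: "f \<in> V" for f
  proof -
    obtain B where B: "\<And>x. x \<in> X \<Longrightarrow> \<bar>f x\<bar> \<le> B" using bounded_continuous f unfolding V_def by blast
    have "(\<lambda>_. B) \<in> maj f"
      using B conv_cont_const[of "- B"] by (fastforce simp: maj_def Q_def fun_Compl_def fun_diff_def)
    then show ?thesis by auto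
  qed
  have p0le: "p0 f \<le> L h" if "f \<in> V" "h \<in> maj f" for f h
    unfolding p0_def using lower that by (intro cINF_lower bdd_belowI[of _ "L f"]) auto
  have p0ge: "c \<le> p0 f" if "f \<in> V" "\<And>h. h \<in> maj f \<Longrightarrow> c \<le> L h" for c f
    unfolding p0_def using ne that by (intro cINF_greatest) auto
  have p0app: "\<exists>h\<in>maj f. L h < p0 f + e" if f: "f \<in> V" and e: "e > 0" for f e
    using p0ge[OF f, of "p0 f + e"] e by (meson less_add_same_cancel1 not_le)
  have p0sub: "p0 (f + g) \<le> p0 f + p0 g" if f: "f \<in> V" and g: "g \<in> V" for f g
  proof (rule field_le_epsilon)
    fix e :: real assume "e > 0"
    then have e: "e/2 > 0" by simp
    obtain h where h: "h \<in> maj f" "L h < p0 f + e/2" using p0app[OF f e] by blast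
    obtain k where k: "k \<in> maj g" "L k < p0 g + e/2" using p0app[OF g e] by blast
    have "- h + - k \<in> conv_cont" using h k by (intro K2) (auto simp: maj_def)
    moreover have "- h + - k = - (h + k)" by simp
    ultimately have "h + k \<in> maj (f + g)"
      using h(1) k(1) by (auto simp: maj_def Q_def intro: add_mono)
    then have "p0 (f + g) \<le> L (h + k)" using p0le subspace_add[OF sV f g] by blast
    also have "L (h + k) = L h + L k"
      using L_add[OF majD(1)[OF h(1)] majD(1)[OF k(1)]] by (simp add: plus_fun_def)
    finally show "p0 (f + g) \<le> p0 f + p0 g + e" using h k by simp
  qed
  have p0hom_le: "p0 (c *\<^sub>R f) \<le> c * p0 f" if c: "c > 0" and f: "f \<in> V" for c f
  proof -
    have "p0 (c *\<^sub>R f) / c \<le> p0 f"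
    proof (rule p0ge[OF f])
      fix h assume h: "h \<in> maj f"
      have "c *\<^sub>R - h \<in> conv_cont" using h c by (intro K3) (auto simp: maj_def)
      then have "c *\<^sub>R h \<in> maj (c *\<^sub>R f)" using h c by (auto simp: maj_def Q_def mult_left_mono)
      then have "p0 (c *\<^sub>R f) \<le> L (c *\<^sub>R h)" using p0le subspace_scale[OF sV f] by blast
      also have "L (c *\<^sub>R h) = c * L h"
        using L_scale[OF majD(1)[OF h]] by (simp add: scaleR_fun_def)
      finally show "p0 (c *\<^sub>R f) / c \<le> L h" using c by (simp add: field_simps)
    qed
    then show ?thesis using c by (simp add: field_simps)
  qed
  have p0hom: "p0 (c *\<^sub>R f) = c * p0 f" if c: "c \<ge> 0" and f: "f \<in> V" for c f
  proof (cases "c = 0")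
    case True
    have "(\<lambda>_. 0) \<in> maj 0" using conv_cont_const[of 0] by (auto simp: maj_def Q_def fun_Compl_def)
    then have "p0 0 \<le> 0" using p0le[OF subspace_0[OF sV]] L_const[of 0] by force
    moreover have "0 \<le> p0 0"
      using lower[OF subspace_0[OF sV]] L_const[of 0] by (intro p0ge subspace_0[OF sV]) (auto simp: zero_fun_def)
    ultimately show ?thesis using True by simp
  next
    case False
    then have c: "c > 0" using that by simp
    have "p0 ((1/c) *\<^sub>R (c *\<^sub>R f)) \<le> (1/c) * p0 (c *\<^sub>R f)"
      using c subspace_scale[OF sV f] by (intro p0hom_le) auto
    then have "c * p0 f \<le> p0 (c *\<^sub>R f)" using c by (simp add: field_simps)
    then show ?thesis using p0hom_le[OF c f] by simp
  qed
  have "sublinear_on V p0" using p0sub p0hom by (auto simp: sublinear_on_def)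
  moreover have "approx_from V conv_cont Q p0"
    unfolding approx_from_def
  proof (intro ballI allI impI)
    fix f and e :: real assume f: "f \<in> V" and e: "e > 0"
    obtain h where h: "h \<in> maj f" "L h < p0 f + e" using p0app[OF f e] by blast
    \<comment> \<open>A concave function is its own majorant, so \<open>p0 h \<le> L h\<close>; a
      nearly optimal majorant for \<open>L\<close> is therefore nearly optimal for
      \<open>p0\<close>.\<close>
    have "h \<in> maj h" using h(1) by (auto simp: maj_def Q_def)
    then have "p0 h \<le> L h" using p0le[of h h] majD(1)[OF h(1)] by (simp add: V_def)
    then show "\<exists>h. - h \<in> conv_cont \<and> h - f \<in> Q \<and> p0 h \<le> p0 f + e"
      using h by (intro exI[of _ h]) (auto simp: maj_def)
  qed
  ultimately obtain p where p: "sublinear_on V p" "approx_from V conv_cont Q p" "\<And>f. f \<in> V \<Longrightarrow> p f \<le> p0 f"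
    "\<And>g. g \<in> conv_cont \<Longrightarrow> p (- g) = - p g"
    using minimal_sublinear_linear[OF sV _ _ KV K2 K3] by blast
  note sub = sublinear_onD(1)[OF p(1)] and hom = sublinear_onD(2)[OF p(1)]
  have ple: "p f \<le> c" if "f \<in> V" "\<And>x. x \<in> X \<Longrightarrow> f x \<le> c" for f c
  proof -
    have "(\<lambda>_. c) \<in> maj f"
      using that(2) conv_cont_const[of "- c"] by (auto simp: maj_def Q_def fun_Compl_def)
    then show ?thesis using p(3)[OF that(1)] p0le[OF that(1), of "\<lambda>_. c"] L_const[of c] by simp
  qed
  have pdc: "p (- g) = - p g" if g: "g \<in> diff_conv" for g
  proof -
    obtain f1 f2 where f: "f1 \<in> conv_cont" "f2 \<in> conv_cont" "g = (\<lambda>x. f1 x - f2 x)" using diff_convE[OF g] .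
    have "g = f1 + - f2" by (simp add: f(3) fun_eq_iff)
    then show ?thesis
      using sublinear_on_additive(2)[OF p(1) sV, of f1 "- f2"] f KV p(4) subspace_neg[OF sV] by auto
  qed
  have dcV: "g \<in> V" if "g \<in> diff_conv" for g
    using function_ring_on.continuous[OF function_ring_on_diff_conv that] by (simp add: V_def)
  \<comment> \<open>\<open>p\<close> is at most the supremum over \<open>X\<close> of its argument,
    so uniform approximation by differences of convex functions carries oddness over.\<close>
  have pneg: "p (- f) = - p f" if f: "f \<in> V" for f
  proof -
    have "p f + p (- f) \<le> 0"
    proof (rule field_le_epsilon)
      fix e :: real assume "e > 0"
      then have e: "e/2 > 0" by simp
      obtain g where g: "g \<in> diff_conv" "\<And>x. x \<in> X \<Longrightarrow> \<bar>f x - g x\<bar> < e/2"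
        using diff_conv_dense[OF _ e] f unfolding V_def by blast
      have V: "f - g \<in> V" "g - f \<in> V" "g \<in> V" "- g \<in> V"
        using f dcV[OF g(1)] subspace_diff[OF sV] subspace_neg[OF sV] by auto
      have "p f \<le> p (f - g) + p g" "p (- f) \<le> p (g - f) + p (- g)"
        using sub[OF V(1,3)] sub[OF V(2,4)] by simp_all
      moreover have "p (f - g) \<le> e/2"
      proof (rule ple[OF V(1)])
        fix x assume "x \<in> X"
        then have "f x - g x \<le> e/2" using g(2)[of x] by linarith
        then show "(f - g) x \<le> e/2" by simp
      qed
      moreover have "p (g - f) \<le> e/2"
      proof (rule ple[OF V(2)])
        fix x assume "x \<in> X"
        then have "g x - f x \<le> e/2" using g(2)[of x] by linarith
        then show "(g - f) x \<le> e/2" by simp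
      qed
      ultimately show "p f + p (- f) \<le> 0 + e" using pdc[OF g(1)] by simp
    qed
    then show ?thesis using sublinear_on_minus[OF p(1) sV f] by simp
  qed
  have padd: "p (f + g) = p f + p g" if "f \<in> V" "g \<in> V" for f g
    using sublinear_on_additive(1)[OF p(1) sV that] pneg that by auto
  have "positive_functional X p"
  proof
    show "compact X" by (rule compact_X)
    show "p (\<lambda>x. f x + g x) = p f + p g" if "continuous_on X f" "continuous_on X g" for f g
      using padd[of f g] that by (simp add: V_def plus_fun_def)
    show "p (\<lambda>x. c * f x) = c * p f" if f: "continuous_on X f" for f c
    proof -
      have fV: "f \<in> V" using f by (simp add: V_def)
      have "p (c *\<^sub>R f) = c * p f"
      proof (cases "c \<ge> 0")
        case False
        then have "p ((- c) *\<^sub>R f) = - c * p f" using hom[OF fV, of "- c"] by simp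
        then show ?thesis using pneg[OF subspace_scale[OF sV fV, of c]] by simp
      qed (use hom[OF fV] in auto)
      then show ?thesis by (simp add: scaleR_fun_def)
    qed
    show "0 \<le> p f" if f: "continuous_on X f" "\<And>x. x \<in> X \<Longrightarrow> 0 \<le> f x" for f
    proof -
      have fV: "f \<in> V" using f by (simp add: V_def)
      have "p (- f) \<le> 0" using subspace_neg[OF sV fV] f(2) by (intro ple) auto
      then show ?thesis using pneg[OF fV] by simp
    qed
    have V1: "(\<lambda>_. 1) \<in> V" by (simp add: V_def)
    have "p (\<lambda>_. 1) \<le> 1" using V1 by (intro ple) auto
    moreover have "p (- (\<lambda>_. 1)) \<le> - 1" using subspace_neg[OF sV V1] by (intro ple) auto
    ultimately show "p (\<lambda>_. 1) = 1" using pneg[OF V1] by simp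
  qed
  then obtain \<nu> where \<nu>: "\<nu> \<in> M1 X" "\<And>f :: 'a \<Rightarrow> real. continuous_on X f \<Longrightarrow> (\<integral>x. f x \<partial>\<nu>) = p f"
    using positive_functional.Riesz_representation[of X p] by blast
  have "mokobodzki \<nu>"
    unfolding mokobodzki_def
  proof (intro allI impI)
    fix f :: "'a \<Rightarrow> real" and e :: real assume e: "e > 0" and f: "continuous_on X f"
    obtain h where h: "- h \<in> conv_cont" "h - f \<in> Q" "p h \<le> p f + e"
      by (rule approx_fromD[OF p(2) _ e, of f]) (use f in \<open>auto simp: V_def\<close>)
    have "(\<lambda>x. - h x) \<in> conv_cont" using h(1) by (simp add: fun_Compl_def)
    then show "\<exists>h. (\<lambda>x. - h x) \<in> conv_cont \<and> (\<forall>x\<in>X. f x \<le> h x) \<and> (\<integral>x. h x \<partial>\<nu>) \<le> (\<integral>x. f x \<partial>\<nu>) + e"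
      using h(2,3) \<nu>(2)[OF f] \<nu>(2)[OF conv_cont_minusD] by (intro exI[of _ h]) (auto simp: Q_def)
  qed
  moreover have "L f \<le> (\<integral>x. f x \<partial>\<nu>)" if f: "f \<in> conv_cont" for f
  proof -
    have fV: "f \<in> V" using f KV by auto
    have cf: "continuous_on X f" using fV by (simp add: V_def)
    \<comment> \<open>For convex \<open>f\<close> the function \<open>- f\<close> majorizes itself,
      so \<open>p (- f) \<le> p0 (- f) \<le> L (- f)\<close>.\<close>
    have "- f \<in> maj (- f)" using f by (auto simp: maj_def Q_def)
    then have "p0 (- f) \<le> L (- f)" using p0le[OF subspace_neg[OF sV fV]] by blast
    then have "p (- f) \<le> L (- f)" using p(3)[OF subspace_neg[OF sV fV]] by linarith
    moreover have "L (- f) = - L f" using L_scale[OF cf, of "-1"] by (simp add: fun_Compl_def)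
    ultimately show ?thesis using pneg[OF fV] \<nu>(2)[OF cf] by simp
  qed
  ultimately show thesis using that \<nu>(1) by blast
qed

text \<open>A concave majorant \<open>h\<close> of \<open>f\<close> cannot gain integral when
  passing to a larger \<open>\<nu>\<close>, so \<open>\<nu>\<close> integrates every continuous
  \<open>f\<close> to at most what \<open>\<mu>\<close> does; applied to \<open>f\<close> and
  \<open>- f\<close>.\<close>

lemma mokobodzki_imp_maximal:
  assumes \<mu>: "\<mu> \<in> M1 X" "mokobodzki \<mu>"
  shows "\<mu> \<in> maximal_measures X"
  unfolding maximal_measures_def
proof (intro CollectI conjI ballI impI \<mu>(1))
  fix \<nu> assume \<nu>: "\<nu> \<in> M1 X" "choquet_le X \<mu> \<nu>"
  have le: "(\<integral>x. f x \<partial>\<nu>) \<le> (\<integral>x. f x \<partial>\<mu>)" if f: "continuous_on X f" for f :: "'a \<Rightarrow> real"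
  proof (rule field_le_epsilon)
    fix e :: real assume e: "e > 0"
    obtain h where h: "(\<lambda>x. - h x) \<in> conv_cont" "\<And>x. x \<in> X \<Longrightarrow> f x \<le> h x"
      "(\<integral>x. h x \<partial>\<mu>) \<le> (\<integral>x. f x \<partial>\<mu>) + e" using mokobodzkiE[OF \<mu>(2) f e] by blast
    have "(\<integral>x. f x \<partial>\<nu>) \<le> (\<integral>x. h x \<partial>\<nu>)"
      using h(2) conv_cont_minusD[OF h(1)] f space_M1[OF \<nu>(1)]
      by (intro integral_mono integrable_continuous_M1[OF \<nu>(1) compact_X]) auto
    also have "(\<integral>x. - h x \<partial>\<mu>) \<le> (\<integral>x. - h x \<partial>\<nu>)"
      using \<nu>(2) h(1) unfolding choquet_le_def conv_cont_def by blast
    then have "(\<integral>x. h x \<partial>\<nu>) \<le> (\<integral>x. h x \<partial>\<mu>)" by simp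
    finally show "(\<integral>x. f x \<partial>\<nu>) \<le> (\<integral>x. f x \<partial>\<mu>) + e" using h(3) by simp
  qed
  show "\<nu> = \<mu>"
  proof (rule M1_eqI[OF \<nu>(1) \<mu>(1) compact_X])
    fix f :: "'a \<Rightarrow> real" assume f: "continuous_on X f"
    show "(\<integral>x. f x \<partial>\<nu>) = (\<integral>x. f x \<partial>\<mu>)"
      using le[OF f] le[OF continuous_on_minus[OF f]] by simp
  qed
qed

text \<open>The existence theorem puts a measure with the property above \<open>\<mu>\<close>, and
  maximality identifies the two.\<close>

lemma maximal_imp_mokobodzki:
  assumes "\<mu> \<in> maximal_measures X"
  shows "\<mu> \<in> M1 X" "mokobodzki \<mu>"
proof -
  show \<mu>: "\<mu> \<in> M1 X" using assms by (simp add: maximal_measures_def)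
  obtain \<nu> where \<nu>: "\<nu> \<in> M1 X" "mokobodzki \<nu>" "\<And>f. f \<in> conv_cont \<Longrightarrow> (\<integral>x. f x \<partial>\<mu>) \<le> (\<integral>x. f x \<partial>\<nu>)"
    using ex_mokobodzki[OF positive_functional_M1[OF \<mu>]] by blast
  have "choquet_le X \<mu> \<nu>" using \<nu>(3) by (auto simp: choquet_le_def conv_cont_def)
  then have "\<nu> = \<mu>" using assms \<nu>(1) by (auto simp: maximal_measures_def)
  then show "mokobodzki \<mu>" using \<nu>(2) by simp
qed

theorem ex_maximal_measure:
  assumes x: "x \<in> X"
  obtains \<mu> where "\<mu> \<in> maximal_measures X" "barycenter X \<mu> x"
proof -
  obtain \<nu> where \<nu>: "\<nu> \<in> M1 X" "mokobodzki \<nu>" "\<And>f. f \<in> conv_cont \<Longrightarrow> f x \<le> (\<integral>x. f x \<partial>\<nu>)"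
    using ex_mokobodzki[OF positive_functional_eval[OF x]] by blast
  have "a x = (\<integral>x. a x \<partial>\<nu>)" if "a \<in> A_c X" for a
    using \<nu>(3)[OF A_c_conv_cont(1)[OF that]] \<nu>(3)[OF A_c_conv_cont(2)[OF that]] by simp
  then have "barycenter X \<nu> x" using x by (simp add: barycenter_def)
  then show thesis using that mokobodzki_imp_maximal[OF \<nu>(1,2)] by blast
qed

text \<open>If the zero set had positive measure, the functions
  \<open>- max 0 (1 - n * \<bar>f x\<bar>)\<close> would have concave majorants \<open>h n\<close>
  with integrals bounded away from 0 from below zero. At each extreme point they are eventually 0,
  so \<open>concave_sequence_liminf\<close> forces \<open>h n\<close> to 0 everywhere, against
  dominated convergence.\<close>

lemma maximal_null_zero_set:
  fixes f :: "'a \<Rightarrow> real"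
  assumes \<mu>: "\<mu> \<in> maximal_measures X" and f: "continuous_on X f"
    and ext: "\<And>b. b extreme_point_of X \<Longrightarrow> f b \<noteq> 0"
  shows "measure \<mu> {x \<in> X. f x = 0} = 0"
proof (rule ccontr)
  let ?Z = "{x \<in> X. f x = 0}"
  note \<mu>' = maximal_imp_mokobodzki[OF \<mu>]
  interpret prob_space \<mu> by (rule prob_space_M1[OF \<mu>'(1)])
  note int = integrable_continuous_M1[OF \<mu>'(1) compact_X]
  have Z: "?Z \<in> sets \<mu>" using baire_subset_sets_M1[OF \<mu>'(1)] zero_set_in_baire[OF f] by blast
  assume "measure \<mu> ?Z \<noteq> 0"
  then have c: "measure \<mu> ?Z / 2 > 0" by (simp add: zero_less_measure_iff)
  define g where "g = (\<lambda>n x. - max 0 (1 - real n * \<bar>f x\<bar>))"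
  have cg: "continuous_on X (g n)" for n unfolding g_def by (intro continuous_intros f)
  have g1: "- 1 \<le> g n x" "g n x \<le> 0" for n x by (auto simp: g_def)
  have "\<exists>h. (\<lambda>x. - h x) \<in> conv_cont \<and> (\<forall>x\<in>X. g n x \<le> h x) \<and> (\<integral>x. h x \<partial>\<mu>) \<le> (\<integral>x. g n x \<partial>\<mu>) + measure \<mu> ?Z / 2" for n
    using \<mu>'(2)[unfolded mokobodzki_def, rule_format, OF c cg[of n]] .
  then obtain k where k: "\<And>n. (\<lambda>x. - k n x) \<in> conv_cont" "\<And>n x. x \<in> X \<Longrightarrow> g n x \<le> k n x"
    "\<And>n. (\<integral>x. k n x \<partial>\<mu>) \<le> (\<integral>x. g n x \<partial>\<mu>) + measure \<mu> ?Z / 2" by metis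
  \<comment> \<open>Cutting at 0 keeps concavity and the majorant property and gives the uniform
    bounds -1 and 0.\<close>
  define h where "h = (\<lambda>n x. min (k n x) 0)"
  have "(\<lambda>x. - h n x) = (\<lambda>x. max (- k n x) 0)" for n by (auto simp: h_def fun_eq_iff)
  then have hc: "(\<lambda>x. - h n x) \<in> conv_cont" for n
    using conv_cont_max[OF k(1) conv_cont_const[of 0], of n] by simp
  have ch: "continuous_on X (h n)" for n using conv_cont_minusD[OF hc] .
  have hg: "g n x \<le> h n x" if "x \<in> X" for n x using k(2)[OF that] g1(2) by (auto simp: h_def)
  have h1: "- 1 \<le> h n x" "h n x \<le> 0" if "x \<in> X" for n x
    using hg[OF that, of n] g1(1)[of n x] by (auto simp: h_def)
  have hint: "(\<integral>x. h n x \<partial>\<mu>) \<le> - (measure \<mu> ?Z / 2)" for n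
  proof -
    have "(\<integral>x. h n x \<partial>\<mu>) \<le> (\<integral>x. k n x \<partial>\<mu>)"
      using ch conv_cont_minusD[OF k(1)] by (intro integral_mono int) (auto simp: h_def)
    also have "\<dots> \<le> (\<integral>x. g n x \<partial>\<mu>) + measure \<mu> ?Z / 2" by (rule k(3))
    also have "(\<integral>x. g n x \<partial>\<mu>) \<le> (\<integral>x. - indicator ?Z x \<partial>\<mu>)"
    proof (rule integral_mono[OF int[OF cg]])
      show "integrable \<mu> (\<lambda>x. - indicator ?Z x :: real)"
        using Z emeasure_finite by (auto simp: less_top[symmetric])
      show "g n x \<le> - indicator ?Z x" for x using g1(2)[of n x] by (auto simp: g_def split: split_indicator)
    qed
    also have "\<dots> = - measure \<mu> ?Z" using Z space_M1[OF \<mu>'(1)] Int_absorb2[of ?Z X] by simp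
    finally show ?thesis by simp
  qed
  have lim: "(\<lambda>n. h n x) \<longlonglongrightarrow> 0" if x: "x \<in> X" for x
  proof (rule order_tendstoI)
    fix e :: real assume "e < 0"
    then have e: "- e > 0" by simp
    have "\<forall>\<^sub>F n in sequentially. - (- e) < h n x"
    proof (rule concave_sequence_liminf[OF ch _ _ _ x e, where C = 1])
      show "convex_on X (\<lambda>x. - h n x)" for n using hc by (simp add: conv_cont_def)
      show "\<bar>h n x\<bar> \<le> 1" if "x \<in> X" for n x using h1[OF that, of n] by auto
      fix b and d :: real assume b: "b extreme_point_of X" and d: "d > 0"
      obtain N :: nat where N: "1 < real N * \<bar>f b\<bar>"
        using reals_Archimedean3[of "\<bar>f b\<bar>"] ext[OF b] by auto
      have "g n b = 0" if "n \<ge> N" for n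
      proof -
        have "real N * \<bar>f b\<bar> \<le> real n * \<bar>f b\<bar>" using that by (intro mult_right_mono) auto
        then show ?thesis using N by (simp add: g_def)
      qed
      then have "- d < h n b" if "n \<ge> N" for n
        using hg[of b n] b d that by (fastforce simp: extreme_point_of_def)
      then show "\<forall>\<^sub>F n in sequentially. - d < h n b" by (auto simp: eventually_sequentially)
    qed
    then show "\<forall>\<^sub>F n in sequentially. e < h n x" by simp
  next
    fix e :: real assume e: "0 < e"
    show "\<forall>\<^sub>F n in sequentially. h n x < e"
      by (rule always_eventually) (use h1(2)[OF x] e in \<open>auto intro: le_less_trans\<close>)
  qed
  have "(\<lambda>n. \<integral>x. h n x \<partial>\<mu>) \<longlonglongrightarrow> (\<integral>x. 0 \<partial>\<mu>)"
  proof (rule integral_dominated_convergence[where w = "\<lambda>_. 1"])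
    show "h n \<in> borel_measurable \<mu>" for n by (rule borel_measurable_continuous_M1[OF \<mu>'(1) ch])
    show "AE x in \<mu>. (\<lambda>n. h n x) \<longlonglongrightarrow> 0" using lim space_M1[OF \<mu>'(1)] by (intro AE_I2) auto
    show "AE x in \<mu>. norm (h n x) \<le> 1" for n
    proof (rule AE_I2)
      fix x assume "x \<in> space \<mu>"
      then show "norm (h n x) \<le> 1" using h1[of x n] space_M1[OF \<mu>'(1)] by auto
    qed
  qed auto
  then have "(\<lambda>n. \<integral>x. h n x \<partial>\<mu>) \<longlonglongrightarrow> 0" by simp
  then have "0 \<le> - (measure \<mu> ?Z / 2)"
    by (rule LIMSEQ_le_const2) (use hint in auto)
  then show False using c by simp
qed

text \<open>A Baire set of positive measure contains a zero set of positive measure, which also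
  misses the extreme points.\<close>

theorem maximal_null_baire:
  assumes \<mu>: "\<mu> \<in> maximal_measures X" and B: "B \<in> sets (baire X)" and ext: "B \<inter> ext_points X = {}"
  shows "measure \<mu> B = 0"
proof (rule ccontr)
  note \<mu>' = maximal_imp_mokobodzki[OF \<mu>]
  interpret prob_space \<mu> by (rule prob_space_M1[OF \<mu>'(1)])
  assume "measure \<mu> B \<noteq> 0"
  then have pos: "measure \<mu> B > 0" by (simp add: zero_less_measure_iff)
  obtain f :: "'a \<Rightarrow> real" where f: "continuous_on X f" "{x \<in> X. f x = 0} \<subseteq> B" "measure \<mu> (B - {x \<in> X. f x = 0}) < measure \<mu> B"
    using inner_regular_zero_sets[OF finite_measure_axioms space_M1[OF \<mu>'(1)] baire_subset_sets_M1[OF \<mu>'(1)] B pos] .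
  have "f b \<noteq> 0" if "b extreme_point_of X" for b
    using that f(2) ext by (auto simp: extreme_point_of_def)
  then have "measure \<mu> {x \<in> X. f x = 0} = 0" by (rule maximal_null_zero_set[OF \<mu> f(1)])
  moreover have "measure \<mu> (B - {x \<in> X. f x = 0}) = measure \<mu> B - measure \<mu> {x \<in> X. f x = 0}"
    using B f(2) zero_set_in_baire[OF f(1)] baire_subset_sets_M1[OF \<mu>'(1)] by (intro finite_measure_Diff) auto
  ultimately show False using f(3) by simp
qed

text \<open>The minimum of concave majorants that are good for \<open>\<mu>\<close> and for
  \<open>\<nu>\<close> is concave and good for both, so \<open>mokobodzki\<close> passes to
  mixtures.\<close>

lemma maximal_mixture:
  assumes \<mu>: "\<mu> \<in> maximal_measures X" and \<nu>: "\<nu> \<in> maximal_measures X" and c: "0 \<le> c" "c \<le> 1"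
  obtains \<tau> where "\<tau> \<in> maximal_measures X"
    "\<And>f :: 'a \<Rightarrow> real. continuous_on X f \<Longrightarrow> (\<integral>x. f x \<partial>\<tau>) = c * (\<integral>x. f x \<partial>\<mu>) + (1 - c) * (\<integral>x. f x \<partial>\<nu>)"
proof -
  note \<mu>' = maximal_imp_mokobodzki[OF \<mu>] and \<nu>' = maximal_imp_mokobodzki[OF \<nu>]
  note int\<mu> = integrable_continuous_M1[OF \<mu>'(1) compact_X] and int\<nu> = integrable_continuous_M1[OF \<nu>'(1) compact_X]
  interpret \<mu>: prob_space \<mu> by (rule prob_space_M1[OF \<mu>'(1)])
  interpret \<nu>: prob_space \<nu> by (rule prob_space_M1[OF \<nu>'(1)])
  have "positive_functional X (\<lambda>f. c * (\<integral>x. f x \<partial>\<mu>) + (1 - c) * (\<integral>x. f x \<partial>\<nu>))"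
  proof
    show "0 \<le> c * (\<integral>x. f x \<partial>\<mu>) + (1 - c) * (\<integral>x. f x \<partial>\<nu>)" if "\<And>x. x \<in> X \<Longrightarrow> 0 \<le> f x" for f :: "'a \<Rightarrow> real"
      using that c space_M1[OF \<mu>'(1)] space_M1[OF \<nu>'(1)]
      by (intro add_nonneg_nonneg mult_nonneg_nonneg Bochner_Integration.integral_nonneg) auto
  qed (use compact_X int\<mu> int\<nu> \<mu>.prob_space \<nu>.prob_space in \<open>auto simp: algebra_simps\<close>)
  then obtain \<tau> where \<tau>: "\<tau> \<in> M1 X"
    "\<And>f :: 'a \<Rightarrow> real. continuous_on X f \<Longrightarrow> (\<integral>x. f x \<partial>\<tau>) = c * (\<integral>x. f x \<partial>\<mu>) + (1 - c) * (\<integral>x. f x \<partial>\<nu>)"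
    using positive_functional.Riesz_representation by blast
  have "mokobodzki \<tau>"
    unfolding mokobodzki_def
  proof (intro allI impI)
    fix f :: "'a \<Rightarrow> real" and e :: real assume e: "e > 0" and f: "continuous_on X f"
    obtain h where h: "(\<lambda>x. - h x) \<in> conv_cont" "\<And>x. x \<in> X \<Longrightarrow> f x \<le> h x"
      "(\<integral>x. h x \<partial>\<mu>) \<le> (\<integral>x. f x \<partial>\<mu>) + e" using mokobodzkiE[OF \<mu>'(2) f e] by blast
    obtain k where k: "(\<lambda>x. - k x) \<in> conv_cont" "\<And>x. x \<in> X \<Longrightarrow> f x \<le> k x"
      "(\<integral>x. k x \<partial>\<nu>) \<le> (\<integral>x. f x \<partial>\<nu>) + e" using mokobodzkiE[OF \<nu>'(2) f e] by blast
    let ?m = "\<lambda>x. min (h x) (k x)"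
    have "(\<lambda>x. - ?m x) = (\<lambda>x. max (- h x) (- k x))" by (auto simp: fun_eq_iff)
    then have m: "(\<lambda>x. - ?m x) \<in> conv_cont" using conv_cont_max[OF h(1) k(1)] by simp
    note cm = conv_cont_minusD[OF m]
    have "(\<integral>x. ?m x \<partial>\<mu>) \<le> (\<integral>x. h x \<partial>\<mu>)" "(\<integral>x. ?m x \<partial>\<nu>) \<le> (\<integral>x. k x \<partial>\<nu>)"
      using cm conv_cont_minusD[OF h(1)] conv_cont_minusD[OF k(1)]
      by (intro integral_mono int\<mu> int\<nu>; simp)+
    then have "(\<integral>x. ?m x \<partial>\<mu>) \<le> (\<integral>x. f x \<partial>\<mu>) + e" "(\<integral>x. ?m x \<partial>\<nu>) \<le> (\<integral>x. f x \<partial>\<nu>) + e"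
      using h(3) k(3) by linarith+
    then have "c * (\<integral>x. ?m x \<partial>\<mu>) \<le> c * ((\<integral>x. f x \<partial>\<mu>) + e)"
      "(1 - c) * (\<integral>x. ?m x \<partial>\<nu>) \<le> (1 - c) * ((\<integral>x. f x \<partial>\<nu>) + e)"
      using c by (auto intro!: mult_left_mono)
    then have "(\<integral>x. ?m x \<partial>\<tau>) \<le> (\<integral>x. f x \<partial>\<tau>) + e"
      unfolding \<tau>(2)[OF cm] \<tau>(2)[OF f] by (simp add: algebra_simps)
    then show "\<exists>h. (\<lambda>x. - h x) \<in> conv_cont \<and> (\<forall>x\<in>X. f x \<le> h x) \<and> (\<integral>x. h x \<partial>\<tau>) \<le> (\<integral>x. f x \<partial>\<tau>) + e"
      using m h(2) k(2) by (intro exI[of _ ?m]) auto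
  qed
  then show thesis using that mokobodzki_imp_maximal[OF \<tau>(1)] \<tau>(2) by blast
qed

end

section \<open>Analytic sets\<close>

text \<open>Projections along \<^typ>\<open>nat \<Rightarrow> nat\<close> of closed sets. Inside a compact set these are the K-analytic sets, and
  Lusin's separation argument applies without metrizability.\<close>

definition analytic :: "'x::topological_space set \<Rightarrow> bool" where
  "analytic A \<longleftrightarrow> (\<exists>D :: ('x \<times> (nat \<Rightarrow> nat)) set. closed D \<and> A = fst ` D)"

lemma analytic_closed: "closed A \<Longrightarrow> analytic A"
  unfolding analytic_def by (intro exI[of _ "A \<times> UNIV"]) (auto intro!: closed_Times)

text \<open>The first entry of a witness encodes the index of the set, the shifted remainder is a
  witness for that set.\<close>

lemma analytic_UN:
  fixes A :: "nat \<Rightarrow> 'x::topological_space set"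
  assumes "\<And>n. analytic (A n)"
  shows "analytic (\<Union>n. A n)"
proof -
  obtain D :: "nat \<Rightarrow> ('x \<times> (nat \<Rightarrow> nat)) set" where D: "\<And>n. closed (D n)" "\<And>n. A n = fst ` D n"
    using assms unfolding analytic_def by metis
  let ?f = "\<lambda>p :: 'x \<times> (nat \<Rightarrow> nat). (fst p, \<lambda>k. snd p (Suc k))"
  define E where "E = {p. ?f p \<in> D (snd p 0)}"
  have c0: "continuous_on UNIV (\<lambda>p :: 'x \<times> (nat \<Rightarrow> nat). snd p k)" for k
    by (rule continuous_on_product_then_coordinatewise) (rule continuous_on_snd[OF continuous_on_id])
  have cf: "continuous_on UNIV ?f"
    by (intro continuous_on_Pair continuous_on_fst continuous_on_id continuous_on_coordinatewise_then_product c0)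
  have "- E = (\<Union>n. {p. snd p 0 = n} \<inter> ?f -` (- D n))" by (auto simp: E_def)
  also have "open \<dots>"
  proof (intro open_UN ballI open_Int)
    have "open ((\<lambda>p :: 'x \<times> (nat \<Rightarrow> nat). snd p 0) -` {n})" for n
      by (intro open_vimage discrete_topology_class.open_discrete c0)
    then show "open {p :: 'x \<times> (nat \<Rightarrow> nat). snd p 0 = n}" for n
      by (simp add: vimage_def)
    show "open (?f -` (- D n))" for n using D(1) by (intro open_vimage cf) auto
  qed
  finally have "closed E" by (simp add: closed_def)
  moreover have "(\<Union>n. A n) = fst ` E"
  proof
    show "fst ` E \<subseteq> (\<Union>n. A n)"
    proof
      fix x assume "x \<in> fst ` E"
      then obtain \<sigma> where "(x, \<lambda>k. \<sigma> (Suc k)) \<in> D (\<sigma> 0)" by (auto simp: E_def)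
      then show "x \<in> (\<Union>n. A n)" unfolding D(2) by force
    qed
    show "(\<Union>n. A n) \<subseteq> fst ` E"
    proof
      fix x assume "x \<in> (\<Union>n. A n)"
      then obtain n \<sigma> where "(x, \<sigma>) \<in> D n" unfolding D(2) by auto
      then have "(x, case_nat n \<sigma>) \<in> E" by (simp add: E_def)
      then show "x \<in> fst ` E" by force
    qed
  qed
  ultimately show ?thesis unfolding analytic_def by blast
qed

text \<open>A pairing function stores countably many witnesses in a single sequence.\<close>

lemma analytic_INT:
  fixes A :: "nat \<Rightarrow> 'x::topological_space set"
  assumes "\<And>n. analytic (A n)"
  shows "analytic (\<Inter>n. A n)"
proof -
  obtain D :: "nat \<Rightarrow> ('x \<times> (nat \<Rightarrow> nat)) set" where D: "\<And>n. closed (D n)" "\<And>n. A n = fst ` D n"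
    using assms unfolding analytic_def by metis
  let ?f = "\<lambda>n p :: 'x \<times> (nat \<Rightarrow> nat). (fst p, \<lambda>k. snd p (prod_encode (n, k)))"
  define E where "E = (\<Inter>n. ?f n -` D n)"
  have c0: "continuous_on UNIV (\<lambda>p :: 'x \<times> (nat \<Rightarrow> nat). snd p k)" for k
    by (rule continuous_on_product_then_coordinatewise) (rule continuous_on_snd[OF continuous_on_id])
  have cf: "continuous_on UNIV (?f n)" for n
    by (intro continuous_on_Pair continuous_on_fst continuous_on_id continuous_on_coordinatewise_then_product c0)
  have "closed E" unfolding E_def using D(1) cf by (intro closed_INT ballI closed_vimage) auto
  moreover have "(\<Inter>n. A n) = fst ` E"
  proof
    show "fst ` E \<subseteq> (\<Inter>n. A n)"
    proof
      fix x assume "x \<in> fst ` E"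
      then obtain \<sigma> where "\<And>n. (x, \<lambda>k. \<sigma> (prod_encode (n, k))) \<in> D n" by (auto simp: E_def)
      then show "x \<in> (\<Inter>n. A n)" unfolding D(2) by (auto intro!: image_eqI[rotated])
    qed
    show "(\<Inter>n. A n) \<subseteq> fst ` E"
    proof
      fix x assume "x \<in> (\<Inter>n. A n)"
      then have "\<forall>n. \<exists>\<sigma>. (x, \<sigma>) \<in> D n" unfolding D(2) by force
      then obtain \<sigma> where \<sigma>: "\<And>n. (x, \<sigma> n) \<in> D n" by metis
      have "(x, \<lambda>m. case prod_decode m of (n, k) \<Rightarrow> \<sigma> n k) \<in> E" using \<sigma> by (simp add: E_def)
      then show "x \<in> fst ` E" by force
    qed
  qed
  ultimately show ?thesis unfolding analytic_def by blast
qed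

text \<open>Compactness of \<open>Y\<close> makes \<open>f\<close> times the identity map the closed
  set \<open>D\<close> to a closed set, and the witness coordinate is left alone.\<close>

lemma analytic_image:
  fixes A :: "'x::t2_space set" and f :: "'x \<Rightarrow> 'y::t2_space"
  assumes A: "analytic A" "A \<subseteq> Y" and Y: "compact Y" and f: "continuous_on Y f"
  shows "analytic (f ` A)"
proof -
  obtain D :: "('x \<times> (nat \<Rightarrow> nat)) set" where D: "closed D" "A = fst ` D" using A(1) unfolding analytic_def by blast
  define E where "E = (\<lambda>p. (f (fst p), snd p)) ` D"
  have "open (- E)"
  proof (rule Topological_Spaces.openI)
    fix q assume q: "q \<in> - E"
    \<comment> \<open>Pairs of an open \<open>U\<close> and a neighbourhood \<open>V\<close> of
      \<open>q\<close> that misses the image of the part of \<open>D\<close> over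
      \<open>U \<inter> Y\<close>. Finitely many such \<open>U\<close> cover \<open>Y\<close>, and
      the intersection of their \<open>V\<close> misses the whole image.\<close>
    define P where "P = (\<lambda>(U, V). open U \<and> open V \<and> q \<in> V \<and> (\<forall>x\<in>U \<inter> Y. \<forall>\<sigma>. (x, \<sigma>) \<in> D \<longrightarrow> (f x, \<sigma>) \<notin> V))"
    have ex: "\<exists>U V. x \<in> U \<and> P (U, V)" if x: "x \<in> Y" for x
    proof (cases "f x = fst q")
      case False
      then obtain W1 W2 where W: "open W1" "open W2" "f x \<in> W1" "fst q \<in> W2" "W1 \<inter> W2 = {}"
        using hausdorff by metis
      obtain U where U: "open U" "x \<in> U" "\<And>y. y \<in> U \<inter> Y \<Longrightarrow> f y \<in> W1"
        using f W(1,3) x unfolding continuous_on_topological by (metis IntE)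
      have "P (U, W2 \<times> UNIV)" unfolding P_def using U W by (auto intro!: open_Times simp: mem_Times_iff)
      then show ?thesis using U(2) by blast
    next
      case True
      then have mem: "(x, snd q) \<in> - D" using q by (force simp: E_def)
      obtain U V where "open U" "open V" "(x, snd q) \<in> U \<times> V" "U \<times> V \<subseteq> - D"
        by (rule open_prod_elim[OF open_Compl[OF D(1)] mem])
      then have UV: "open U" "open V" "x \<in> U" "snd q \<in> V" "U \<times> V \<subseteq> - D" by auto
      have "P (U, UNIV \<times> V)" unfolding P_def using UV by (auto intro!: open_Times simp: mem_Times_iff)
      then show ?thesis using UV(3) by blast
    qed
    have cov: "Y \<subseteq> \<Union> {U. \<exists>V. P (U, V)}" using ex by blast
    have op: "open U" if "U \<in> {U. \<exists>V. P (U, V)}" for U using that by (auto simp: P_def)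
    obtain \<C> where \<C>: "\<C> \<subseteq> {U. \<exists>V. P (U, V)}" "finite \<C>" "Y \<subseteq> \<Union>\<C>"
      by (rule compactE[OF Y cov op])
    then have "\<forall>U\<in>\<C>. \<exists>V. P (U, V)" by blast
    then obtain V where V: "\<And>U. U \<in> \<C> \<Longrightarrow> P (U, V U)" by metis
    have "open (\<Inter>U\<in>\<C>. V U)" using \<C>(2) V by (intro open_INT) (auto simp: P_def)
    moreover have "q \<in> (\<Inter>U\<in>\<C>. V U)" using V by (auto simp: P_def)
    moreover have "(\<Inter>U\<in>\<C>. V U) \<subseteq> - E"
    proof
      fix r assume r: "r \<in> (\<Inter>U\<in>\<C>. V U)"
      show "r \<in> - E"
      proof
        assume "r \<in> E"
        then obtain x \<sigma> where x: "(x, \<sigma>) \<in> D" "r = (f x, \<sigma>)" by (auto simp: E_def)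
        have "x \<in> Y" using x(1) A(2) D(2) by force
        then obtain U where "U \<in> \<C>" "x \<in> U" using \<C>(3) by blast
        then show False using V[of U] x \<open>x \<in> Y\<close> r by (auto simp: P_def)
      qed
    qed
    ultimately show "\<exists>T. open T \<and> q \<in> T \<and> T \<subseteq> - E" by blast
  qed
  then have "closed E" by (simp add: closed_def)
  moreover have "f ` A = fst ` E" by (force simp: E_def D(2))
  ultimately show ?thesis unfolding analytic_def by blast
qed

section \<open>Lusin separation\<close>

lemma open_fun_nat_prefix:
  fixes W :: "(nat \<Rightarrow> nat) set"
  assumes "open W" "s \<in> W"
  obtains n where "\<And>t. (\<And>i. i < n \<Longrightarrow> t i = s i) \<Longrightarrow> t \<in> W"
proof -
  obtain U where U: "s \<in> PiE UNIV U" "finite {i. U i \<noteq> UNIV}" "PiE UNIV U \<subseteq> W"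
    using product_topology_open_contains_basis[OF assms(1)[unfolded open_fun_def] assms(2)] by auto
  obtain n where n: "{i. U i \<noteq> UNIV} \<subseteq> {..<n}" using finite_nat_iff_bounded[of "{i. U i \<noteq> UNIV}"] U(2) by auto
  show thesis
  proof (rule that[of n])
    fix t assume t: "\<And>i. i < n \<Longrightarrow> t i = s i"
    have "t i \<in> U i" for i
      using n t[of i] U(1) by (cases "U i = UNIV") (auto simp: PiE_iff)
    then show "t \<in> W" using U(3) by (auto simp: PiE_iff)
  qed
qed

definition prefix_part :: "('x \<times> (nat \<Rightarrow> nat)) set \<Rightarrow> (nat \<Rightarrow> nat) \<Rightarrow> nat \<Rightarrow> 'x set" where
  "prefix_part D s n = fst ` {p \<in> D. \<forall>i<n. snd p i = s i}"

lemma prefix_part_0: "prefix_part D s 0 = fst ` D"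
  by (simp add: prefix_part_def)

lemma prefix_part_cong: "(\<And>i. i < n \<Longrightarrow> s i = t i) \<Longrightarrow> prefix_part D s n = prefix_part D t n"
  by (auto simp: prefix_part_def)

lemma prefix_part_Suc: "prefix_part D s n = (\<Union>k. prefix_part D (s(n := k)) (Suc n))"
proof
  show "prefix_part D s n \<subseteq> (\<Union>k. prefix_part D (s(n := k)) (Suc n))"
  proof
    fix x assume "x \<in> prefix_part D s n"
    then obtain \<sigma> where \<sigma>: "(x, \<sigma>) \<in> D" "\<forall>i<n. \<sigma> i = s i" by (auto simp: prefix_part_def)
    have "x \<in> prefix_part D (s(n := \<sigma> n)) (Suc n)"
      unfolding prefix_part_def using \<sigma> by (intro image_eqI[of _ _ "(x, \<sigma>)"]) (auto simp: less_Suc_eq)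
    then show "x \<in> (\<Union>k. prefix_part D (s(n := k)) (Suc n))" by blast
  qed
  show "(\<Union>k. prefix_part D (s(n := k)) (Suc n)) \<subseteq> prefix_part D s n"
    by (fastforce simp: prefix_part_def)
qed

text \<open>Closedness of \<open>D\<close> gives each point of \<open>C\<close> a neighbourhood and
  a length \<open>n\<close> whose prefix part misses it; compactness makes the length
  uniform.\<close>

lemma prefix_part_eventually:
  fixes D :: "('x::t2_space \<times> (nat \<Rightarrow> nat)) set"
  assumes D: "closed D" and C: "compact C" "\<And>x. x \<in> C \<Longrightarrow> (x, s) \<notin> D"
  obtains N where "\<And>n. n \<ge> N \<Longrightarrow> prefix_part D s n \<inter> C = {}"
proof -
  define \<U> where "\<U> = (\<lambda>n. {U. open U \<and> U \<inter> prefix_part D s n = {}})"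
  have mono: "prefix_part D s n \<subseteq> prefix_part D s m" if "m \<le> n" for m n
    using that by (auto simp: prefix_part_def)
  have ex: "\<exists>n U. U \<in> \<U> n \<and> x \<in> U" if x: "x \<in> C" for x
  proof -
    have mem: "(x, s) \<in> - D" using C(2)[OF x] by simp
    obtain U V where "open U" "open V" "(x, s) \<in> U \<times> V" "U \<times> V \<subseteq> - D"
      by (rule open_prod_elim[OF open_Compl[OF D] mem])
    then have UV: "open U" "open V" "x \<in> U" "s \<in> V" "U \<times> V \<subseteq> - D" by auto
    obtain n where n: "\<And>t. (\<And>i. i < n \<Longrightarrow> t i = s i) \<Longrightarrow> t \<in> V"
      using open_fun_nat_prefix[OF UV(2,4)] by blast
    have "U \<inter> prefix_part D s n = {}"
    proof -
      have False if "y \<in> U" "(y, \<sigma>) \<in> D" "\<forall>i<n. \<sigma> i = s i" for y \<sigma>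
        using n[of \<sigma>] UV(5) that by blast
      then show ?thesis by (force simp: prefix_part_def)
    qed
    then show ?thesis using UV unfolding \<U>_def by blast
  qed
  have cov: "C \<subseteq> \<Union>(\<Union>n. \<U> n)" using ex by blast
  have op: "open U" if "U \<in> (\<Union>n. \<U> n)" for U using that by (auto simp: \<U>_def)
  obtain \<C> where \<C>: "\<C> \<subseteq> (\<Union>n. \<U> n)" "finite \<C>" "C \<subseteq> \<Union>\<C>"
    by (rule compactE[OF C(1) cov op])
  then have "\<forall>U\<in>\<C>. \<exists>n. U \<in> \<U> n" by blast
  then obtain n where n: "\<And>U. U \<in> \<C> \<Longrightarrow> U \<in> \<U> (n U)" by metis
  obtain N where N: "\<And>U. U \<in> \<C> \<Longrightarrow> n U \<le> N"
    using \<C>(2) by (meson finite_imageI finite_nat_set_iff_bounded_le imageI)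
  show thesis
  proof (rule that[of N])
    fix k assume k: "N \<le> k"
    have "U \<inter> prefix_part D s k = {}" if U: "U \<in> \<C>" for U
      using n[OF U] mono[of "n U" k] N[OF U] k by (auto simp: \<U>_def)
    then show "prefix_part D s k \<inter> C = {}" using \<C>(3) by blast
  qed
qed

text \<open>If \<open>A\<close> and \<open>B\<close> were inseparable, one could refine both along
  branches \<open>s\<close> and \<open>t\<close> with inseparable pieces at every length. The points
  over the full branches form disjoint closed sets, and a Urysohn function between them separates
  the pieces at some finite length.\<close>

theorem analytic_separation:
  fixes X A B :: "'x::t2_space set"
  assumes X: "compact X" and A: "analytic A" "A \<subseteq> X" and B: "analytic B" "B \<subseteq> X" and disj: "A \<inter> B = {}"
  obtains C where "C \<in> sets (baire X)" "A \<subseteq> C" "C \<inter> B = {}"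
proof -
  obtain D :: "('x \<times> (nat \<Rightarrow> nat)) set" where D: "closed D" "A = fst ` D" using A(1) unfolding analytic_def by blast
  obtain E :: "('x \<times> (nat \<Rightarrow> nat)) set" where E: "closed E" "B = fst ` E" using B(1) unfolding analytic_def by blast
  define sep where "sep = (\<lambda>P Q. \<exists>C\<in>sets (baire X). P \<subseteq> C \<and> C \<inter> Q = {})"
  \<comment> \<open>The countable combination behind the argument: an inseparable pair of countable
    unions has an inseparable pair of members.\<close>
  have sep_UN: "sep (\<Union>k. P k) (\<Union>j. Q j)" if PQ: "\<And>k j. sep (P k) (Q j)" for P Q :: "nat \<Rightarrow> 'x set"
  proof -
    obtain C where C: "\<And>k j. C k j \<in> sets (baire X)" "\<And>k j. P k \<subseteq> C k j" "\<And>k j. C k j \<inter> Q j = {}"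
      using PQ unfolding sep_def by metis
    have "(\<Union>k. \<Inter>j. C k j) \<in> sets (baire X)" using C(1) by (intro sets.countable_UN' sets.countable_INT') auto
    moreover have "(\<Union>k. P k) \<subseteq> (\<Union>k. \<Inter>j. C k j)" using C(2) by blast
    moreover have "(\<Union>k. \<Inter>j. C k j) \<inter> (\<Union>j. Q j) = {}" using C(3) by blast
    ultimately show ?thesis unfolding sep_def by blast
  qed
  have "sep A B"
  proof (rule ccontr)
    assume neg: "\<not> sep A B"
    define R where "R = (\<lambda>n p. \<not> sep (prefix_part D (fst p) n) (prefix_part E (snd p) n))"
    have "\<exists>f. \<forall>n. R n (f n) \<and> (\<forall>i<n. fst (f (Suc n)) i = fst (f n) i \<and> snd (f (Suc n)) i = snd (f n) i)"
    proof (rule dependent_nat_choice)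
      show "\<exists>p. R 0 p" using neg by (simp add: R_def prefix_part_0 D(2) E(2))
      fix p n assume p: "R n p"
      have "\<exists>k j. \<not> sep (prefix_part D ((fst p)(n := k)) (Suc n)) (prefix_part E ((snd p)(n := j)) (Suc n))"
      proof (rule ccontr)
        assume "\<not> ?thesis"
        then have "sep (\<Union>k. prefix_part D ((fst p)(n := k)) (Suc n)) (\<Union>j. prefix_part E ((snd p)(n := j)) (Suc n))"
          by (intro sep_UN) blast
        then show False using p unfolding R_def prefix_part_Suc[symmetric] by simp
      qed
      then obtain k j where "R (Suc n) ((fst p)(n := k), (snd p)(n := j))" by (auto simp: R_def)
      then show "\<exists>q. R (Suc n) q \<and> (\<forall>i<n. fst q i = fst p i \<and> snd q i = snd p i)"
        by (intro exI[of _ "((fst p)(n := k), (snd p)(n := j))"]) auto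
    qed
    then obtain f where f: "\<And>n. R n (f n)" "\<And>n i. i < n \<Longrightarrow> fst (f (Suc n)) i = fst (f n) i"
      "\<And>n i. i < n \<Longrightarrow> snd (f (Suc n)) i = snd (f n) i" by blast
    \<comment> \<open>Coordinate \<open>i\<close> no longer changes from stage \<open>i + 1\<close>
      on, so the diagonal is the limit branch.\<close>
    define s where "s = (\<lambda>i. fst (f (Suc i)) i)"
    define t where "t = (\<lambda>i. snd (f (Suc i)) i)"
    have st: "fst (f n) i = s i \<and> snd (f n) i = t i" if "i < n" for n i
      using that
    proof (induction n)
      case (Suc n)
      then show ?case using f(2,3)[of i n] by (cases "i = n") (auto simp: s_def t_def)
    qed simp
    have nsep: "\<not> sep (prefix_part D s n) (prefix_part E t n)" for n
      using f(1)[of n] prefix_part_cong[of n "fst (f n)" s D] prefix_part_cong[of n "snd (f n)" t E] st[of _ n]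
      by (simp add: R_def)
    define K where "K = {x. (x, s) \<in> D}"
    define M where "M = {x. (x, t) \<in> E}"
    have "continuous_on UNIV (\<lambda>x :: 'x. (x, u))" for u :: "nat \<Rightarrow> nat"
      by (intro continuous_on_Pair continuous_on_id continuous_on_const)
    then have "closed K" "closed M" unfolding K_def M_def
      using closed_vimage[OF D(1), of "\<lambda>x. (x, s)"] closed_vimage[OF E(1), of "\<lambda>x. (x, t)"]
      by (simp_all add: vimage_def)
    moreover have KM: "K \<subseteq> A" "M \<subseteq> B" unfolding K_def M_def D(2) E(2) by force+
    ultimately have "closedin (top_of_set X) K" "closedin (top_of_set X) M"
      using A(2) B(2) by (auto intro!: closed_subset)
    moreover have "K \<inter> M = {}" using KM disj by auto
    ultimately obtain h :: "'x \<Rightarrow> real" where h: "continuous_on X h" "\<And>x. x \<in> K \<Longrightarrow> h x = 0" "\<And>x. x \<in> M \<Longrightarrow> h x = 1"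
      using Urysohn_compact[OF X] by metis
    \<comment> \<open>Both closed sets include the level 1/2: eventually one piece lies strictly
      below it and the other strictly above.\<close>
    have "closedin (top_of_set X) {x \<in> X. 1/2 \<le> h x}" "closedin (top_of_set X) {x \<in> X. h x \<le> 1/2}"
      using continuous_closedin_preimage[OF h(1), of "{1/2..}"] continuous_closedin_preimage[OF h(1), of "{..1/2}"]
      by (simp_all add: vimage_def Int_def conj_commute)
    then have comp: "compact {x \<in> X. 1/2 \<le> h x}" "compact {x \<in> X. h x \<le> 1/2}"
      using X closedin_compact by blast+
    obtain N1 where N1: "\<And>n. n \<ge> N1 \<Longrightarrow> prefix_part D s n \<inter> {x \<in> X. 1/2 \<le> h x} = {}"
      by (rule prefix_part_eventually[OF D(1) comp(1), of s]) (use h(2) in \<open>auto simp: K_def\<close>)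
    obtain N2 where N2: "\<And>n. n \<ge> N2 \<Longrightarrow> prefix_part E t n \<inter> {x \<in> X. h x \<le> 1/2} = {}"
      by (rule prefix_part_eventually[OF E(1) comp(2), of t]) (use h(3) in \<open>auto simp: M_def\<close>)
    let ?N = "max N1 N2"
    have sub: "prefix_part D s ?N \<subseteq> X" "prefix_part E t ?N \<subseteq> X"
      using A(2) B(2) unfolding D(2) E(2) prefix_part_def by auto
    have "{x \<in> X. h x \<le> 1/2} \<in> sets (baire X)"
      using measurable_sets[OF borel_measurable_baire_continuous[OF h(1)], of "{..1/2}"]
      by (simp add: vimage_def Int_def conj_commute)
    moreover have "prefix_part D s ?N \<subseteq> {x \<in> X. h x \<le> 1/2}" using N1[of ?N] sub(1) by force
    moreover have "{x \<in> X. h x \<le> 1/2} \<inter> prefix_part E t ?N = {}" using N2[of ?N] by auto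
    ultimately have "sep (prefix_part D s ?N) (prefix_part E t ?N)" unfolding sep_def by blast
    then show False using nsep by blast
  qed
  then show thesis using that unfolding sep_def by blast
qed

corollary analytic_coanalytic_baire:
  fixes X A :: "'x::t2_space set"
  assumes "compact X" "A \<subseteq> X" "analytic A" "analytic (X - A)"
  shows "A \<in> sets (baire X)"
proof -
  obtain C where C: "C \<in> sets (baire X)" "A \<subseteq> C" "C \<inter> (X - A) = {}"
    using analytic_separation[OF assms(1,3,2,4)] by blast
  moreover have "C \<subseteq> X" using sets.sets_into_space[OF C(1)] by simp
  ultimately have "C = A" by blast
  then show ?thesis using C(1) by simp
qed

text \<open>Analyticity need not pass to complements, so the induction carries a set and its
  complement together.\<close>

lemma baire_analytic:
  fixes X A :: "'x::t2_space set"
  assumes X: "compact X" and A: "A \<in> sets (baire X)"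
  shows "analytic A"
proof -
  have cl: "closed {x \<in> X. (c::real) \<le> f x}" if "continuous_on X f" for f c
  proof -
    have "closedin (top_of_set X) {x \<in> X. c \<le> f x}"
      using continuous_closedin_preimage[OF that, of "{c..}"] by (simp add: vimage_def Int_def conj_commute)
    then show ?thesis using closedin_closed_trans compact_imp_closed[OF X] by blast
  qed
  have "A \<subseteq> X \<and> analytic A \<and> analytic (X - A)"
    using A unfolding sets_baire
  proof induction
    case (Basic A)
    then obtain f :: "'x \<Rightarrow> real" where f: "continuous_on X f" "A = {x \<in> X. f x = 0}" by auto
    have cf: "continuous_on X (\<lambda>x. - \<bar>f x\<bar>)" by (intro continuous_intros f(1))
    have "A = {x \<in> X. 0 \<le> - \<bar>f x\<bar>}" using f(2) by auto
    then have "analytic A" using analytic_closed[OF cl[OF cf, of 0]] by metis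
    moreover have "X - A = (\<Union>n. {x \<in> X. inverse (real (Suc n)) \<le> \<bar>f x\<bar>})"
    proof
      show "X - A \<subseteq> (\<Union>n. {x \<in> X. inverse (real (Suc n)) \<le> \<bar>f x\<bar>})"
      proof
        fix x assume "x \<in> X - A"
        then have x: "x \<in> X" "\<bar>f x\<bar> > 0" using f(2) by auto
        then obtain n where "inverse (real (Suc n)) < \<bar>f x\<bar>" using reals_Archimedean by blast
        then show "x \<in> (\<Union>n. {x \<in> X. inverse (real (Suc n)) \<le> \<bar>f x\<bar>})" using x(1) by (auto intro: less_imp_le)
      qed
      have "x \<in> X - A" if "x \<in> X" "inverse (real (Suc n)) \<le> \<bar>f x\<bar>" for x n
      proof -
        have "0 < inverse (real (Suc n))" by simp
        then have "f x \<noteq> 0" using that(2) by linarith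
        then show ?thesis using that(1) f(2) by simp
      qed
      then show "(\<Union>n. {x \<in> X. inverse (real (Suc n)) \<le> \<bar>f x\<bar>}) \<subseteq> X - A" by blast
    qed
    moreover have "analytic (\<Union>n. {x \<in> X. inverse (real (Suc n)) \<le> \<bar>f x\<bar>})"
      using f(1) by (intro analytic_UN analytic_closed cl continuous_intros)
    ultimately show ?case using f(2) by auto
  next
    case Empty
    then show ?case using compact_imp_closed[OF X] by (auto intro: analytic_closed)
  next
    case (Compl A)
    then show ?case by (simp add: double_diff)
  next
    case (Union A)
    have eq: "X - (\<Union>n. A n) = (\<Inter>n. X - A n)" by auto
    have "analytic (X - (\<Union>n. A n))" unfolding eq using Union by (intro analytic_INT) blast
    moreover have "analytic (\<Union>n. A n)" using Union by (intro analytic_UN) blast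
    ultimately show ?case using Union by blast
  qed
  then show ?thesis by blast
qed

lemma measurable_baire_continuous:
  fixes \<pi> :: "'x::topological_space \<Rightarrow> 'y::topological_space"
  assumes \<pi>: "continuous_on Y \<pi>" "\<pi> ` Y \<subseteq> X"
  shows "\<pi> \<in> measurable (baire Y) (baire X)"
proof (rule measurable_sigma_sets[OF sets_baire])
  show "\<pi> \<in> space (baire Y) \<rightarrow> X" using \<pi>(2) by auto
  fix Z assume "Z \<in> {{x \<in> X. f x = 0} | f :: 'y \<Rightarrow> real. continuous_on X f}"
  then obtain f :: "'y \<Rightarrow> real" where f: "continuous_on X f" "Z = {x \<in> X. f x = 0}" by auto
  have eq: "\<pi> -` Z \<inter> space (baire Y) = {y \<in> Y. (f \<circ> \<pi>) y = 0}" using f(2) \<pi>(2) by auto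
  have "continuous_on Y (f \<circ> \<pi>)"
    by (rule continuous_on_compose[OF \<pi>(1) continuous_on_subset[OF f(1) \<pi>(2)]])
  then show "\<pi> -` Z \<inter> space (baire Y) \<in> sets (baire Y)"
    unfolding eq by (rule zero_set_in_baire)
qed auto

section \<open>Strongly affine Baire functions\<close>

context compact_convex
begin

definition sa_baire :: "('a \<Rightarrow> real) set" where
  "sa_baire = A_sa X \<inter> Ba X"

lemma sa_baireD:
  assumes "f \<in> sa_baire"
  shows "f \<in> extensional X" "f \<in> borel_measurable (baire X)"
    and "\<mu> \<in> M1 X \<Longrightarrow> barycenter X \<mu> x \<Longrightarrow> integrable \<mu> f"
    and "\<mu> \<in> M1 X \<Longrightarrow> barycenter X \<mu> x \<Longrightarrow> (\<integral>y. f y \<partial>\<mu>) = f x"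
  using assms by (auto simp: sa_baire_def A_sa_def Ba_def has_bochner_integral_iff)

lemma sa_baireI:
  assumes "f \<in> extensional X" "f \<in> borel_measurable (baire X)"
    "\<And>\<mu> x. \<mu> \<in> M1 X \<Longrightarrow> barycenter X \<mu> x \<Longrightarrow> integrable \<mu> f \<and> (\<integral>y. f y \<partial>\<mu>) = f x"
  shows "f \<in> sa_baire"
  using assms borel_measurable_M1_baire[of _ X f borel]
  by (simp add: sa_baire_def A_sa_def Ba_def has_bochner_integral_iff)

lemma barycenter_in: "barycenter X \<mu> x \<Longrightarrow> x \<in> X"
  by (simp add: barycenter_def)

lemma ext_in: "x \<in> ext_points X \<Longrightarrow> x \<in> X"
  by (simp add: extreme_point_of_def)

lemma integrable_bounded_baire:
  fixes f :: "'a \<Rightarrow> real"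
  assumes \<mu>: "\<mu> \<in> M1 X" and f: "f \<in> borel_measurable (baire X)" "\<And>x. x \<in> X \<Longrightarrow> \<bar>f x\<bar> \<le> B"
  shows "integrable \<mu> f"
proof -
  interpret prob_space \<mu> by (rule prob_space_M1[OF \<mu>])
  show ?thesis
    using borel_measurable_M1_baire[OF \<mu> f(1)] f(2)
    by (intro integrable_const_bound[of _ B]) (auto simp: space_M1[OF \<mu>])
qed

lemma borel_measurable_baire_restrict:
  fixes f :: "'a \<Rightarrow> real"
  shows "restrict f X \<in> borel_measurable (baire X) \<longleftrightarrow> f \<in> borel_measurable (baire X)"
  by (rule measurable_cong) simp

lemma integral_restrict_M1: "\<mu> \<in> M1 X \<Longrightarrow> (\<integral>y. restrict f X y \<partial>\<mu>) = (\<integral>y. f y \<partial>\<mu> :: real)"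
  by (intro Bochner_Integration.integral_cong) (auto simp: space_M1)

lemma integrable_restrict_M1: "\<mu> \<in> M1 X \<Longrightarrow> integrable \<mu> (restrict f X) \<longleftrightarrow> integrable \<mu> (f :: 'a \<Rightarrow> real)"
  by (intro Bochner_Integration.integrable_cong) (auto simp: space_M1)

lemma sa_baire_restrictI:
  assumes "f \<in> borel_measurable (baire X)"
    "\<And>\<mu> x. \<mu> \<in> M1 X \<Longrightarrow> barycenter X \<mu> x \<Longrightarrow> integrable \<mu> f \<and> (\<integral>y. f y \<partial>\<mu>) = f x"
  shows "restrict f X \<in> sa_baire"
proof (rule sa_baireI)
  show "restrict f X \<in> borel_measurable (baire X)" unfolding borel_measurable_baire_restrict by (rule assms(1))
  fix \<mu> x assume \<mu>: "\<mu> \<in> M1 X" "barycenter X \<mu> x"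
  show "integrable \<mu> (restrict f X) \<and> (\<integral>y. restrict f X y \<partial>\<mu>) = restrict f X x"
    unfolding integral_restrict_M1[OF \<mu>(1)] integrable_restrict_M1[OF \<mu>(1)]
    using assms(2)[OF \<mu>] barycenter_in[OF \<mu>(2)] by simp
qed (rule restrict_extensional)

lemma A_c_subset_sa_baire: "A_c X \<subseteq> sa_baire"
proof
  fix a assume a: "a \<in> A_c X"
  then show "a \<in> sa_baire"
    using integrable_continuous_M1[OF _ compact_X A_cD(2)[OF a]]
    by (intro sa_baireI A_cD borel_measurable_baire_continuous) (auto simp: barycenter_def)
qed

lemma const_in_A_c: "(\<lambda>x\<in>X. c) \<in> A_c X"
proof -
  have "continuous_on X (\<lambda>x\<in>X. c)" by (subst continuous_on_cong[OF refl, of _ _ "\<lambda>_. c"]) auto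
  moreover have "affine_fun_on X (\<lambda>x\<in>X. c)"
    using convexD_alt[OF convex_X] by (auto simp: affine_fun_on_def algebra_simps)
  ultimately show ?thesis by (simp add: A_c_def)
qed

lemma sa_baire_lincomb:
  assumes f: "f \<in> sa_baire" and g: "g \<in> sa_baire"
  shows "(\<lambda>x\<in>X. c * f x + d * g x) \<in> sa_baire"
proof (rule sa_baire_restrictI)
  show "(\<lambda>x. c * f x + d * g x) \<in> borel_measurable (baire X)"
    using sa_baireD(2)[OF f] sa_baireD(2)[OF g] by measurable
  fix \<mu> x assume *: "\<mu> \<in> M1 X" "barycenter X \<mu> x"
  show "integrable \<mu> (\<lambda>x. c * f x + d * g x) \<and> (\<integral>y. c * f y + d * g y \<partial>\<mu>) = c * f x + d * g x"
    using sa_baireD(3,4)[OF f *] sa_baireD(3,4)[OF g *] by simp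
qed

lemma sa_baire_add: "f \<in> sa_baire \<Longrightarrow> g \<in> sa_baire \<Longrightarrow> (\<lambda>x\<in>X. f x + g x) \<in> sa_baire"
  using sa_baire_lincomb[of f g 1 1] by simp

lemma sa_baire_scale: "f \<in> sa_baire \<Longrightarrow> (\<lambda>x\<in>X. c * f x) \<in> sa_baire"
  using sa_baire_lincomb[of f f c 0] by simp

text \<open>An unbounded \<open>f\<close> would have \<open>\<bar>f (p n)\<bar> \<ge> 2 ^ Suc n\<close> along some sequence, and then would not be integrable with
  respect to the measure \<open>\<Sum>n. 2 ^ - Suc n \<cdot> \<delta>\<^bsub>p n\<^esub>\<close>.\<close>

lemma sa_baire_bounded:
  assumes f: "f \<in> sa_baire"
  obtains B where "B \<ge> 0" "\<And>x. x \<in> X \<Longrightarrow> \<bar>f x\<bar> \<le> B"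
proof -
  have "\<exists>B. \<forall>x\<in>X. \<bar>f x\<bar> \<le> B"
  proof (rule ccontr)
    assume "\<not> ?thesis"
    then have "\<forall>n::nat. \<exists>x. x \<in> X \<and> 2 ^ Suc n < \<bar>f x\<bar>" by (meson not_le)
    then obtain p where p: "\<And>n. p n \<in> X" "\<And>n. 2 ^ Suc n < \<bar>f (p n)\<bar>" by metis
    define P where "P = density (count_space (UNIV :: nat set)) (\<lambda>n. ennreal ((1/2) ^ Suc n))"
    have "emeasure P (space P) = (\<Sum>n. ennreal ((1/2) ^ Suc n))"
      by (simp add: P_def emeasure_density nn_integral_count_space_nat)
    also have "\<dots> = 1" by (subst suminf_ennreal_eq[OF zero_le_power power_half_series]) auto
    finally interpret P: prob_space P by (rule prob_spaceI)
    have pm: "p \<in> measurable P (baire X)" using p(1) by (simp add: P_def)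
    define \<rho> where "\<rho> = distr P (baire X) p"
    have \<rho>: "prob_space \<rho>" unfolding \<rho>_def by (rule P.prob_space_distr[OF pm])
    obtain \<mu> where \<mu>: "\<mu> \<in> M1 X" "distr \<mu> (baire X) (\<lambda>x. x) = \<rho>"
      using baire_measure_extension[OF compact_X \<rho>] by (auto simp: \<rho>_def)
    obtain x where x: "barycenter X \<mu> x"
      using ex_barycenter[OF prob_space_M1[OF \<mu>(1)] space_M1[OF \<mu>(1)] baire_subset_sets_M1[OF \<mu>(1)]] by blast
    note fm = sa_baireD(2)[OF f]
    have "integrable \<mu> f" by (rule sa_baireD(3)[OF f \<mu>(1) x])
    then have "integrable \<rho> f" using integrable_baire_ext[OF \<mu> fm] by simp
    then have "integrable P (\<lambda>n. f (p n))" unfolding \<rho>_def by (rule integrable_distr[OF pm])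
    then have "integrable (count_space UNIV) (\<lambda>n. (1/2) ^ Suc n * f (p n))"
      unfolding P_def by (subst (asm) integrable_density) auto
    then have "summable (\<lambda>n. norm ((1/2) ^ Suc n * f (p n)))" by (simp only: integrable_count_space_nat_iff)
    then have "(\<lambda>n. norm ((1/2) ^ Suc n * f (p n))) \<longlonglongrightarrow> 0" by (rule summable_LIMSEQ_zero)
    then have "\<forall>\<^sub>F n in sequentially. norm ((1/2) ^ Suc n * f (p n)) < 1" by (rule order_tendstoD) simp
    then obtain n where "norm ((1/2) ^ Suc n * f (p n)) < 1" by (auto simp: eventually_sequentially)
    then have "(1/2) ^ Suc n * \<bar>f (p n)\<bar> < 1" by (simp add: abs_mult)
    moreover have "(1/2 :: real) ^ Suc n * 2 ^ Suc n = 1" by (simp add: power_mult_distrib[symmetric])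
    moreover have "(1/2) ^ Suc n * 2 ^ Suc n < (1/2) ^ Suc n * \<bar>f (p n)\<bar>"
      using p(2)[of n] by (intro mult_strict_left_mono) auto
    ultimately show False by linarith
  qed
  then obtain B where B: "\<forall>x\<in>X. \<bar>f x\<bar> \<le> B" ..
  show thesis by (rule that[of "max B 0"]) (use B in force)+
qed

lemma AE_maximal:
  assumes \<mu>: "\<mu> \<in> maximal_measures X" and B: "B \<in> sets (baire X)" and ext: "ext_points X \<subseteq> B"
  shows "AE y in \<mu>. y \<in> B"
proof -
  note \<mu>' = maximal_imp_mokobodzki(1)[OF \<mu>]
  interpret prob_space \<mu> by (rule prob_space_M1[OF \<mu>'])
  have X': "X - B \<in> sets (baire X)" using sets.compl_sets[OF B] by simp
  have "measure \<mu> (X - B) = 0" using ext by (intro maximal_null_baire[OF \<mu> X']) auto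
  then have "X - B \<in> null_sets \<mu>"
    using X' baire_subset_sets_M1[OF \<mu>'] by (auto simp: null_sets_def emeasure_eq_measure)
  then show ?thesis
    by (rule AE_I'[of _ \<mu>]) (auto simp: space_M1[OF \<mu>'])
qed

text \<open>A maximal measure representing \<open>x\<close> is carried by the Baire set
  \<open>{f \<ge> c}\<close>, as this contains the extreme points; integrate.\<close>

lemma sa_baire_ge:
  assumes f: "f \<in> sa_baire" and ext: "\<And>e. e \<in> ext_points X \<Longrightarrow> c \<le> f e" and x: "x \<in> X"
  shows "c \<le> f x"
proof -
  obtain \<mu> where \<mu>: "\<mu> \<in> maximal_measures X" "barycenter X \<mu> x" using ex_maximal_measure[OF x] .
  note \<mu>' = maximal_imp_mokobodzki(1)[OF \<mu>(1)]
  interpret prob_space \<mu> by (rule prob_space_M1[OF \<mu>'])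
  have "{y \<in> space (baire X). c \<le> f y} \<in> sets (baire X)" using sa_baireD(2)[OF f] by measurable
  then have "AE y in \<mu>. y \<in> {y \<in> space (baire X). c \<le> f y}"
    using ext by (intro AE_maximal[OF \<mu>(1)]) (auto simp: extreme_point_of_def)
  then have ae: "AE y in \<mu>. c \<le> f y" by (rule AE_mp) (intro AE_I2, simp)
  have "(\<integral>y. c \<partial>\<mu>) \<le> (\<integral>y. f y \<partial>\<mu>)"
    using sa_baireD(3)[OF f \<mu>' \<mu>(2)] ae by (intro integral_mono_AE) auto
  then show ?thesis using sa_baireD(4)[OF f \<mu>' \<mu>(2)] by (simp add: prob_space)
qed

lemma sa_baire_le:
  assumes f: "f \<in> sa_baire" and ext: "\<And>e. e \<in> ext_points X \<Longrightarrow> f e \<le> c" and x: "x \<in> X"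
  shows "f x \<le> c"
proof -
  have "- c \<le> (\<lambda>x\<in>X. (-1) * f x) x"
    using ext by (intro sa_baire_ge[OF sa_baire_scale[OF f] _ x]) (auto simp: extreme_point_of_def)
  then show ?thesis using x by simp
qed

lemma sa_baire_limit:
  assumes f: "\<And>n. f n \<in> sa_baire" and bound: "\<And>n x. x \<in> X \<Longrightarrow> \<bar>f n x\<bar> \<le> C"
    and lim: "\<And>x. x \<in> X \<Longrightarrow> (\<lambda>n. f n x) \<longlonglongrightarrow> g x" and g: "g \<in> extensional X"
  shows "g \<in> sa_baire"
proof (rule sa_baireI[OF g])
  show gm: "g \<in> borel_measurable (baire X)"
    by (rule borel_measurable_LIMSEQ_real[of _ f]) (use lim sa_baireD(2)[OF f] in auto)
  fix \<mu> x assume \<mu>: "\<mu> \<in> M1 X" "barycenter X \<mu> x"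
  interpret prob_space \<mu> by (rule prob_space_M1[OF \<mu>(1)])
  note sp = space_M1[OF \<mu>(1)]
  have fm: "f n \<in> borel_measurable \<mu>" for n by (rule borel_measurable_M1_baire[OF \<mu>(1) sa_baireD(2)[OF f]])
  have gm': "g \<in> borel_measurable \<mu>" by (rule borel_measurable_M1_baire[OF \<mu>(1) gm])
  have *: "AE y in \<mu>. (\<lambda>n. f n y) \<longlonglongrightarrow> g y" "\<And>n. AE y in \<mu>. norm (f n y) \<le> C"
    using lim bound sp by auto
  have "(\<lambda>n. \<integral>y. f n y \<partial>\<mu>) \<longlonglongrightarrow> (\<integral>y. g y \<partial>\<mu>)"
    by (rule integral_dominated_convergence[where w = "\<lambda>_. C", OF gm' fm _ *]) simp
  moreover have "(\<lambda>n. \<integral>y. f n y \<partial>\<mu>) \<longlonglongrightarrow> g x"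
    unfolding sa_baireD(4)[OF f \<mu>] by (rule lim[OF barycenter_in[OF \<mu>(2)]])
  ultimately have "(\<integral>y. g y \<partial>\<mu>) = g x" by (rule LIMSEQ_unique)
  moreover have "integrable \<mu> g"
    by (rule integrable_dominated_convergence[where w = "\<lambda>_. C", OF gm' fm _ *]) simp
  ultimately show "integrable \<mu> g \<and> (\<integral>y. g y \<partial>\<mu>) = g x" by simp
qed

text \<open>The bound spreads from the extreme points to \<open>X\<close> by
  \<open>sa_baire_ge\<close> and \<open>sa_baire_le\<close>. For a maximal \<open>\<mu>\<close>
  representing \<open>x\<close> the Baire set where the sequence is Cauchy has full measure, so
  \<open>f n x\<close>, being the integral of \<open>f n\<close>, converges by dominated
  convergence.\<close>

lemma sa_baire_limit_ext:
  assumes f: "\<And>n. f n \<in> sa_baire" and bound: "\<And>n e. e \<in> ext_points X \<Longrightarrow> \<bar>f n e\<bar> \<le> C"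
    and lim: "\<And>e. e \<in> ext_points X \<Longrightarrow> (\<lambda>n. f n e) \<longlonglongrightarrow> g e"
  obtains b where "b \<in> sa_baire" "\<And>e. e \<in> ext_points X \<Longrightarrow> b e = g e"
proof -
  have bX: "\<bar>f n x\<bar> \<le> C" if x: "x \<in> X" for n x
  proof -
    have "- C \<le> f n e" "f n e \<le> C" if "e \<in> ext_points X" for e using bound[OF that, of n] by linarith+
    then have "- C \<le> f n x" "f n x \<le> C" using sa_baire_ge[OF f _ x] sa_baire_le[OF f _ x] by blast+
    then show ?thesis by linarith
  qed
  have conv: "convergent (\<lambda>n. f n x)" if x: "x \<in> X" for x
  proof -
    obtain \<mu> where \<mu>: "\<mu> \<in> maximal_measures X" "barycenter X \<mu> x" using ex_maximal_measure[OF x] .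
    note \<mu>' = maximal_imp_mokobodzki(1)[OF \<mu>(1)]
    interpret prob_space \<mu> by (rule prob_space_M1[OF \<mu>'])
    note sp = space_M1[OF \<mu>']
    have fm: "f n \<in> borel_measurable \<mu>" for n by (rule borel_measurable_M1_baire[OF \<mu>' sa_baireD(2)[OF f]])
    have "{y \<in> space (baire X). Cauchy (\<lambda>n. f n y)} \<in> sets (baire X)"
      by (rule sets_Collect_Cauchy[OF sa_baireD(2)[OF f]])
    then have "AE y in \<mu>. y \<in> {y \<in> space (baire X). Cauchy (\<lambda>n. f n y)}"
      by (rule AE_maximal[OF \<mu>(1)]) (use lim ext_in in \<open>auto intro: LIMSEQ_imp_Cauchy\<close>)
    then have ae: "AE y in \<mu>. (\<lambda>n. f n y) \<longlonglongrightarrow> lim (\<lambda>n. f n y)"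
      by (rule AE_mp) (intro AE_I2, simp add: Cauchy_convergent_iff convergent_LIMSEQ_iff)
    have "(\<lambda>n. \<integral>y. f n y \<partial>\<mu>) \<longlonglongrightarrow> (\<integral>y. lim (\<lambda>n. f n y) \<partial>\<mu>)"
    proof (rule integral_dominated_convergence[where w = "\<lambda>_. C", OF _ fm _ ae])
      show "(\<lambda>y. lim (\<lambda>n. f n y)) \<in> borel_measurable \<mu>" using fm by (rule borel_measurable_lim_metric)
      show "AE y in \<mu>. norm (f n y) \<le> C" for n using bX sp by auto
    qed simp
    then show ?thesis unfolding sa_baireD(4)[OF f \<mu>' \<mu>(2)] by (auto simp: convergent_def)
  qed
  define b where "b = (\<lambda>x\<in>X. lim (\<lambda>n. f n x))"
  have bl: "(\<lambda>n. f n x) \<longlonglongrightarrow> b x" if "x \<in> X" for x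
    using conv[OF that] that by (simp add: b_def convergent_LIMSEQ_iff)
  have be: "b \<in> extensional X" unfolding b_def by (rule restrict_extensional)
  have "b \<in> sa_baire" by (rule sa_baire_limit[OF f bX bl be])
  moreover have "b e = g e" if e: "e \<in> ext_points X" for e
    using LIMSEQ_unique[OF bl[OF ext_in[OF e]] lim[OF e]] .
  ultimately show thesis using that by blast
qed

lemma monotone_limits_sa_baire: "monotone_limits X sa_baire = sa_baire"
proof
  show "monotone_limits X sa_baire \<subseteq> sa_baire"
  proof
    fix f assume "f \<in> monotone_limits X sa_baire"
    then obtain s C where s: "f \<in> extensional X" "\<forall>n. s n \<in> sa_baire" "\<forall>n. \<forall>x\<in>X. \<bar>s n x\<bar> \<le> C"
      "\<forall>x\<in>X. incseq (\<lambda>n. s n x) \<and> (\<lambda>n. s n x) \<longlonglongrightarrow> f x"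
      unfolding monotone_limits_def by blast
    show "f \<in> sa_baire" by (rule sa_baire_limit[of s C f]) (use s in auto)
  qed
  show "sa_baire \<subseteq> monotone_limits X sa_baire"
  proof
    fix f assume f: "f \<in> sa_baire"
    obtain B where "\<And>x. x \<in> X \<Longrightarrow> \<bar>f x\<bar> \<le> B" using sa_baire_bounded[OF f] by blast
    then show "f \<in> monotone_limits X sa_baire"
      using f sa_baireD(1)[OF f] unfolding monotone_limits_def
      by (intro CollectI conjI exI[of _ "\<lambda>_. f"] exI[of _ B]) auto
  qed
qed

text \<open>The map \<open>y\<close> is only Baire measurable, so the image of the weighted measure
  is formed on Baire sets and then extended.\<close>

lemma weighted_image:
  assumes \<mu>: "\<mu> \<in> M1 X" and w: "w \<in> borel_measurable (baire X)" "\<And>x. x \<in> X \<Longrightarrow> 0 \<le> w x"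
    and int: "integrable \<mu> w" "(\<integral>x. w x \<partial>\<mu>) = 1" and y: "y \<in> measurable (baire X) (baire X)"
  obtains \<nu> where "\<nu> \<in> M1 X"
    "\<And>g :: 'a \<Rightarrow> real. g \<in> borel_measurable (baire X) \<Longrightarrow> (\<integral>x. g x \<partial>\<nu>) = (\<integral>x. w x * g (y x) \<partial>\<mu>)"
proof -
  let ?D = "density \<mu> w"
  have wm: "w \<in> borel_measurable \<mu>" by (rule borel_measurable_M1_baire[OF \<mu> w(1)])
  have ym: "y \<in> measurable \<mu> (baire X)" by (rule borel_measurable_M1_baire[OF \<mu> y])
  have wae: "AE x in \<mu>. 0 \<le> w x" using w(2) space_M1[OF \<mu>] by (intro AE_I2) auto
  have "emeasure ?D (space ?D) = (\<integral>\<^sup>+x. ennreal (w x) \<partial>\<mu>)"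
    using wm by (simp add: emeasure_density cong: nn_integral_cong)
  also have "\<dots> = 1" using nn_integral_eq_integral[OF int(1) wae] int(2) by simp
  finally interpret D: prob_space ?D by (rule prob_spaceI)
  have yD: "y \<in> measurable ?D (baire X)" using ym by simp
  define \<rho> where "\<rho> = distr ?D (baire X) y"
  have \<rho>: "prob_space \<rho>" unfolding \<rho>_def by (rule D.prob_space_distr[OF yD])
  obtain \<nu> where \<nu>: "\<nu> \<in> M1 X" "distr \<nu> (baire X) (\<lambda>x. x) = \<rho>"
    using baire_measure_extension[OF compact_X \<rho>] by (auto simp: \<rho>_def)
  have "(\<integral>x. g x \<partial>\<nu>) = (\<integral>x. w x * g (y x) \<partial>\<mu>)" if g: "g \<in> borel_measurable (baire X)" for g :: "'a \<Rightarrow> real"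
  proof -
    have "(\<integral>x. g x \<partial>\<nu>) = (\<integral>x. g x \<partial>\<rho>)" by (rule integral_baire_ext[OF \<nu> g])
    also have "\<dots> = (\<integral>x. g (y x) \<partial>?D)" unfolding \<rho>_def by (rule integral_distr[OF yD g])
    also have "\<dots> = (\<integral>x. w x * g (y x) \<partial>\<mu>)"
      using integral_density[OF measurable_compose[OF ym g] wm wae] by simp
    finally show ?thesis .
  qed
  then show thesis using that \<nu>(1) by blast
qed

section \<open>Measures representing extreme points\<close>

lemma ex_barycenter_M1:
  assumes "\<mu> \<in> M1 X"
  obtains x where "barycenter X \<mu> x"
  using ex_barycenter[OF prob_space_M1[OF assms] space_M1[OF assms] baire_subset_sets_M1[OF assms]] by blast

lemma conditional_barycenter:
  assumes \<mu>: "\<mu> \<in> M1 X" and C: "C \<in> sets (baire X)" and pos: "measure \<mu> C > 0"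
  obtains \<nu> z where "\<nu> \<in> M1 X" "barycenter X \<nu> z"
    "\<And>g :: 'a \<Rightarrow> real. g \<in> borel_measurable (baire X) \<Longrightarrow> (\<integral>x. g x \<partial>\<nu>) = (\<integral>x. indicator C x * g x \<partial>\<mu>) / measure \<mu> C"
proof -
  interpret prob_space \<mu> by (rule prob_space_M1[OF \<mu>])
  have C\<mu>: "C \<in> sets \<mu>" using C baire_subset_sets_M1[OF \<mu>] by blast
  define w where "w = (\<lambda>x. indicator C x / measure \<mu> C)"
  have wm: "w \<in> borel_measurable (baire X)" unfolding w_def using C by measurable
  have iC: "integrable \<mu> (indicator C :: 'a \<Rightarrow> real)" using C\<mu> emeasure_finite by (auto simp: less_top[symmetric])
  have w0: "0 \<le> w x" for x unfolding w_def by simp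
  have wi: "integrable \<mu> w" unfolding w_def using iC by simp
  have w1: "(\<integral>x. w x \<partial>\<mu>) = 1"
    unfolding w_def using pos C\<mu> sets.sets_into_space[OF C\<mu>] by (simp add: Int_absorb2)
  obtain \<nu> where \<nu>: "\<nu> \<in> M1 X"
    "\<And>g :: 'a \<Rightarrow> real. g \<in> borel_measurable (baire X) \<Longrightarrow> (\<integral>x. g x \<partial>\<nu>) = (\<integral>x. w x * g x \<partial>\<mu>)"
    using weighted_image[OF \<mu> wm w0 wi w1, of "\<lambda>x. x"] by auto
  obtain z where z: "barycenter X \<nu> z" using ex_barycenter_M1[OF \<nu>(1)] .
  show thesis
    by (rule that[OF \<nu>(1) z]) (simp add: \<nu>(2) w_def)
qed

lemma convex_comb_eqI:
  assumes xyz: "x \<in> X" "y \<in> X" "z \<in> X" "0 \<le> t" "t \<le> 1"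
    and eq: "\<And>a. a \<in> A_c X \<Longrightarrow> a x = t * a y + (1 - t) * a z"
  shows "x = t *\<^sub>R y + (1 - t) *\<^sub>R z"
proof (rule ccontr)
  assume ne: "x \<noteq> t *\<^sub>R y + (1 - t) *\<^sub>R z"
  have inX: "t *\<^sub>R y + (1 - t) *\<^sub>R z \<in> X" using xyz by (intro convexD[OF convex_X]) auto
  obtain a where a: "a \<in> A_c X" "a x < a (t *\<^sub>R y + (1 - t) *\<^sub>R z)"
    using A_c_separating[OF convex_X xyz(1) inX ne] .
  have "a (t *\<^sub>R y + (1 - t) *\<^sub>R z) = t * a y + (1 - t) * a z"
    using affine_funD[OF A_cD(1)[OF a(1)] xyz(3,2,4,5)] by (simp add: add.commute)
  then show False using a eq by simp
qed

lemma extreme_point_combD: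
  assumes x: "x extreme_point_of X" and yz: "y \<in> X" "z \<in> X" "0 < t" "t < 1" and eq: "x = t *\<^sub>R y + (1 - t) *\<^sub>R z"
  shows "y = x" "z = x"
proof -
  have "x \<notin> open_segment z y" using x yz unfolding extreme_point_of_def by blast
  then have "z = y" using yz eq unfolding in_segment by (auto simp: add.commute)
  then show "y = x" "z = x" using eq by (simp_all add: scaleR_left_distrib[symmetric])
qed

text \<open>A substitute for "only the point mass represents an extreme point". If
  \<open>g > g x\<close> on a set \<open>C\<close> of positive measure, the barycenter
  \<open>z\<close> of the normalized restriction to \<open>C\<close> has \<open>g z > g x\<close>,
  while splitting \<open>\<mu>\<close> along \<open>C\<close> and extremality force
  \<open>z = x\<close>.\<close>

lemma AE_extreme_le:
  assumes x: "x extreme_point_of X" and \<mu>: "\<mu> \<in> M1 X" "barycenter X \<mu> x" and g: "g \<in> sa_baire"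
  shows "AE y in \<mu>. g y \<le> g x"
proof -
  interpret prob_space \<mu> by (rule prob_space_M1[OF \<mu>(1)])
  define C where "C = {y \<in> X. g x < g y}"
  have C: "C \<in> sets (baire X)"
    using measurable_sets[OF sa_baireD(2)[OF g], of "{g x<..}"] by (simp add: C_def vimage_def Int_def conj_commute)
  have C\<mu>: "C \<in> sets \<mu>" using C baire_subset_sets_M1[OF \<mu>(1)] by blast
  have CX: "C \<subseteq> X" by (auto simp: C_def)
  have Cc: "X - C \<in> sets (baire X)" using sets.compl_sets[OF C] by simp
  have gi: "integrable \<mu> g" by (rule sa_baireD(3)[OF g \<mu>])
  have "measure \<mu> C = 0"
  proof (rule ccontr)
    assume "measure \<mu> C \<noteq> 0"
    then have pos: "measure \<mu> C > 0" by (simp add: zero_less_measure_iff)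
    have iC: "integrable \<mu> (\<lambda>y. indicator C y * (g y - g x))"
      using gi C\<mu> integrable_real_mult_indicator[OF C\<mu>, of "\<lambda>y. g y - g x"] by (simp add: mult.commute)
    have ge0: "AE y in \<mu>. 0 \<le> indicator C y * (g y - g x)" by (intro AE_I2) (auto simp: C_def indicator_def)
    have "(\<integral>y. indicator C y * (g y - g x) \<partial>\<mu>) \<noteq> 0"
    proof
      assume "(\<integral>y. indicator C y * (g y - g x) \<partial>\<mu>) = 0"
      then have "AE y in \<mu>. indicator C y * (g y - g x) = 0" using integral_nonneg_eq_0_iff_AE[OF iC ge0] by simp
      then have "AE y in \<mu>. y \<notin> C" by (rule AE_mp) (intro AE_I2, auto simp: C_def indicator_def)
      then have "measure \<mu> C = 0" using C\<mu> AE_iff_null_sets[OF C\<mu>] by (auto simp: null_sets_def measure_def)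
      then show False using pos by simp
    qed
    moreover have "0 \<le> (\<integral>y. indicator C y * (g y - g x) \<partial>\<mu>)" by (rule integral_nonneg_AE[OF ge0])
    ultimately have gt: "0 < (\<integral>y. indicator C y * (g y - g x) \<partial>\<mu>)" by linarith
    obtain \<nu> z where z: "\<nu> \<in> M1 X" "barycenter X \<nu> z"
      "\<And>h :: 'a \<Rightarrow> real. h \<in> borel_measurable (baire X) \<Longrightarrow> (\<integral>y. h y \<partial>\<nu>) = (\<integral>y. indicator C y * h y \<partial>\<mu>) / measure \<mu> C"
      using conditional_barycenter[OF \<mu>(1) C pos] by blast
    have iCg: "integrable \<mu> (\<lambda>y. indicator C y * g y)"
      using integrable_real_mult_indicator[OF C\<mu> gi] by (simp add: mult.commute)
    have iC1: "integrable \<mu> (\<lambda>y. indicator C y * g x)"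
      using C\<mu> emeasure_finite by (auto simp: less_top[symmetric])
    have "(\<integral>y. indicator C y * (g y - g x) \<partial>\<mu>) = (\<integral>y. indicator C y * g y \<partial>\<mu>) - measure \<mu> C * g x"
      using iCg iC1 C\<mu> CX space_M1[OF \<mu>(1)] by (simp add: right_diff_distrib Int_absorb2)
    then have "measure \<mu> C * g x < (\<integral>y. indicator C y * g y \<partial>\<mu>)" using gt by simp
    then have "g x < (\<integral>y. indicator C y * g y \<partial>\<mu>) / measure \<mu> C" using pos by (simp add: field_simps)
    also have "\<dots> = g z" using z(3)[OF sa_baireD(2)[OF g]] sa_baireD(4)[OF g z(1,2)] by simp
    finally have gz: "g x < g z" .
    have "z = x"
    \<comment> \<open>With a null complement there is no second conditional measure; then
      \<open>z\<close> and \<open>x\<close> are barycenters of measures with the same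
      integrals.\<close>
    proof (cases "measure \<mu> (X - C) = 0")
      case True
      have "measure \<mu> C = 1" using True prob_compl[OF C\<mu>] space_M1[OF \<mu>(1)] by simp
      have "X - C \<in> null_sets \<mu>"
        using True Cc baire_subset_sets_M1[OF \<mu>(1)] by (auto simp: null_sets_def emeasure_eq_measure)
      then have ae: "AE y in \<mu>. y \<in> C" by (rule AE_I') (auto simp: space_M1[OF \<mu>(1)])
      have "a x = a z" if a: "a \<in> A_c X" for a
      proof -
        note aH = subsetD[OF A_c_subset_sa_baire a]
        have "(\<integral>y. indicator C y * a y \<partial>\<mu>) = (\<integral>y. a y \<partial>\<mu>)"
          using ae borel_measurable_M1_baire[OF \<mu>(1) sa_baireD(2)[OF aH]] C\<mu>
          by (intro integral_cong_AE) auto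
        then show ?thesis
          using z(3)[OF sa_baireD(2)[OF aH]] sa_baireD(4)[OF aH z(1,2)] sa_baireD(4)[OF aH \<mu>] \<open>measure \<mu> C = 1\<close> by simp
      qed
      then show ?thesis
        using convex_comb_eqI[of x z z 1] barycenter_in[OF z(2)] barycenter_in[OF \<mu>(2)] by simp
    next
      case False
      then have pos': "measure \<mu> (X - C) > 0" by (simp add: zero_less_measure_iff)
      obtain \<nu>' z' where z': "\<nu>' \<in> M1 X" "barycenter X \<nu>' z'"
        "\<And>h :: 'a \<Rightarrow> real. h \<in> borel_measurable (baire X) \<Longrightarrow>
          (\<integral>y. h y \<partial>\<nu>') = (\<integral>y. indicator (X - C) y * h y \<partial>\<mu>) / measure \<mu> (X - C)"
        using conditional_barycenter[OF \<mu>(1) Cc pos'] by blast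
      define t where "t = measure \<mu> C"
      have t': "measure \<mu> (X - C) = 1 - t" using prob_compl[OF C\<mu>] space_M1[OF \<mu>(1)] by (simp add: t_def)
      have t: "0 < t" "t < 1" using pos pos' t' by (auto simp: t_def)
      have "x = t *\<^sub>R z + (1 - t) *\<^sub>R z'"
      proof (rule convex_comb_eqI)
        fix a assume a: "a \<in> A_c X"
        note aH = subsetD[OF A_c_subset_sa_baire a]
        have ai: "integrable \<mu> a" by (rule sa_baireD(3)[OF aH \<mu>])
        have Cc\<mu>: "X - C \<in> sets \<mu>" using Cc baire_subset_sets_M1[OF \<mu>(1)] by blast
        have i1: "integrable \<mu> (\<lambda>y. indicator C y * a y)"
          using integrable_real_mult_indicator[OF C\<mu> ai] by (simp add: mult.commute)
        have i2: "integrable \<mu> (\<lambda>y. indicator (X - C) y * a y)"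
          using integrable_real_mult_indicator[OF Cc\<mu> ai] by (simp add: mult.commute)
        have "a x = (\<integral>y. a y \<partial>\<mu>)" using sa_baireD(4)[OF aH \<mu>] by simp
        also have "\<dots> = (\<integral>y. indicator C y * a y + indicator (X - C) y * a y \<partial>\<mu>)"
          using space_M1[OF \<mu>(1)] by (intro Bochner_Integration.integral_cong) (auto simp: indicator_def)
        also have "\<dots> = t * a z + (1 - t) * a z'"
          using i1 i2 z(3)[OF sa_baireD(2)[OF aH]] z'(3)[OF sa_baireD(2)[OF aH]]
            sa_baireD(4)[OF aH z(1,2)] sa_baireD(4)[OF aH z'(1,2)] t t' pos pos'
          by (simp add: t_def)
        finally show "a x = t * a z + (1 - t) * a z'" .
      qed (use t barycenter_in[OF z(2)] barycenter_in[OF z'(2)] barycenter_in[OF \<mu>(2)] in auto)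
      then show ?thesis
        using extreme_point_combD(1)[OF x _ _ t] barycenter_in[OF z(2)] barycenter_in[OF z'(2)] by blast
    qed
    then show False using gz by simp
  qed
  then have "C \<in> null_sets \<mu>" using C\<mu> by (auto simp: null_sets_def emeasure_eq_measure)
  then show ?thesis by (rule AE_I') (auto simp: C_def space_M1[OF \<mu>(1)])
qed

lemma AE_extreme_eq:
  assumes x: "x extreme_point_of X" and \<mu>: "\<mu> \<in> M1 X" "barycenter X \<mu> x" and g: "g \<in> sa_baire"
  shows "AE y in \<mu>. g y = g x"
proof -
  have xX: "x \<in> X" by (rule barycenter_in[OF \<mu>(2)])
  have "AE y in \<mu>. (\<lambda>y\<in>X. (-1) * g y) y \<le> (\<lambda>y\<in>X. (-1) * g y) x"
    by (rule AE_extreme_le[OF x \<mu> sa_baire_scale[OF g]])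
  moreover have "AE y in \<mu>. y \<in> X" using space_M1[OF \<mu>(1)] by (intro AE_I2) simp
  ultimately show ?thesis
    using AE_extreme_le[OF x \<mu> g] by eventually_elim (use xX in auto)
qed

text \<open>The same \<open>b\<close> serves both notions. An identity on the extreme points holds
  on a Baire set containing them. Conversely, a maximal measure representing an extreme point sees
  \<open>b\<close>, \<open>u\<close> and \<open>a\<close> as constants.\<close>

lemma multipliers_eq_strong: "multipliers X sa_baire = strong_multipliers X sa_baire"
proof -
  have "(\<exists>b\<in>sa_baire. \<forall>x\<in>ext_points X. b x = u x * a x) \<longleftrightarrow>
      (\<exists>b\<in>sa_baire. \<forall>\<mu>\<in>maximal_measures X. AE x in \<mu>. b x = u x * a x)"
    if u: "u \<in> sa_baire" and a: "a \<in> sa_baire" for u a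
  proof (intro bex_cong refl iffI ballI)
    fix b \<mu> assume b: "b \<in> sa_baire" and eq: "\<forall>x\<in>ext_points X. b x = u x * a x"
      and \<mu>: "\<mu> \<in> maximal_measures X"
    have "{x \<in> space (baire X). b x = u x * a x} \<in> sets (baire X)"
      using sa_baireD(2)[OF b] sa_baireD(2)[OF u] sa_baireD(2)[OF a] by measurable
    then have "AE x in \<mu>. x \<in> {x \<in> space (baire X). b x = u x * a x}"
      using eq ext_in by (intro AE_maximal[OF \<mu>]) auto
    then show "AE x in \<mu>. b x = u x * a x" by (rule AE_mp) (intro AE_I2, simp)
  next
    fix b x assume b: "b \<in> sa_baire" and ae: "\<forall>\<mu>\<in>maximal_measures X. AE x in \<mu>. b x = u x * a x"
      and x: "x \<in> ext_points X"
    obtain \<mu> where \<mu>: "\<mu> \<in> maximal_measures X" "barycenter X \<mu> x" using ex_maximal_measure[OF ext_in[OF x]] .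
    note \<mu>' = maximal_imp_mokobodzki(1)[OF \<mu>(1)]
    interpret prob_space \<mu> by (rule prob_space_M1[OF \<mu>'])
    have x': "x extreme_point_of X" using x by simp
    have "AE y in \<mu>. b x = u x * a x"
      using AE_extreme_eq[OF x' \<mu>' \<mu>(2) b] AE_extreme_eq[OF x' \<mu>' \<mu>(2) u] AE_extreme_eq[OF x' \<mu>' \<mu>(2) a]
        ae[rule_format, OF \<mu>(1)]
      by eventually_elim simp
    then show "b x = u x * a x" by simp
  qed
  then show ?thesis unfolding multipliers_def strong_multipliers_def by blast
qed

end

section \<open>Split faces\<close>

context compact_convex
begin

text \<open>\<open>extremal\<close> speaks only of midpoints. For weight \<open>s \<ge> 1/2\<close>
  the point is the midpoint of \<open>y\<close> and another point of the segment; for smaller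
  \<open>s\<close> it is the midpoint of \<open>z\<close> and the point with weight
  \<open>2 * s\<close>, and doubling ends after finitely many steps.\<close>

lemma extremal_combD:
  assumes A: "extremal X A" and y: "y \<in> X" and z: "z \<in> X" and t: "0 < t" "t < 1"
    and mem: "t *\<^sub>R y + (1 - t) *\<^sub>R z \<in> A"
  shows "y \<in> A" "z \<in> A"
proof -
  have mid: "v \<in> A \<and> w \<in> A" if "v \<in> X" "w \<in> X" "(1/2) *\<^sub>R (v + w) \<in> A" for v w
    using A that unfolding extremal_def by blast
  have cx: "s *\<^sub>R y + (1 - s) *\<^sub>R z \<in> X" if "y \<in> X" "z \<in> X" "0 \<le> s" "s \<le> 1" for s y z
    using that by (intro convexD[OF convex_X]) auto
  have big: "y \<in> A" if "1/2 \<le> s" "s \<le> 1" "s *\<^sub>R y + (1 - s) *\<^sub>R z \<in> A" "y \<in> X" "z \<in> X" for s y z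
  proof -
    have "(1/2) *\<^sub>R (y + ((2 * s - 1) *\<^sub>R y + (1 - (2 * s - 1)) *\<^sub>R z)) = s *\<^sub>R y + (1 - s) *\<^sub>R z"
      by (simp add: algebra_simps)
    then show ?thesis using mid[OF that(4) cx[OF that(4,5), of "2 * s - 1"]] that by auto
  qed
  have gen: "y \<in> A" if "1/2 ^ n \<le> s" "s < 1" "s *\<^sub>R y + (1 - s) *\<^sub>R z \<in> A" "y \<in> X" "z \<in> X" for n :: nat and s y z
    using that
  proof (induction n arbitrary: s)
    case (Suc n)
    show ?case
    proof (cases "1/2 \<le> s")
      case True
      then show ?thesis using big Suc.prems by auto
    next
      case False
      have s: "0 < s" using Suc.prems(1) less_le_trans[of 0 "1 / 2 ^ Suc n" s] by simp
      have half: "(1/2) *\<^sub>R z + (1/2) *\<^sub>R z = z" by (simp add: scaleR_left_distrib[symmetric])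
      have "(1/2) *\<^sub>R (z + ((2 * s) *\<^sub>R y + (1 - 2 * s) *\<^sub>R z)) = s *\<^sub>R y + (1 - s) *\<^sub>R z"
        by (simp add: algebra_simps half)
      then have "(2 * s) *\<^sub>R y + (1 - 2 * s) *\<^sub>R z \<in> A"
        using mid[OF Suc.prems(5) cx[OF Suc.prems(4,5), of "2 * s"]] Suc.prems(3) False s by auto
      then show ?thesis using Suc.prems False by (intro Suc.IH[of "2 * s"]) auto
    qed
  qed simp
  have ex: "\<exists>n::nat. 1/2 ^ n \<le> s" if "0 < s" for s :: real
    using real_arch_pow_inv[OF that, of "1/2"] by (auto simp: power_one_over intro: less_imp_le)
  show "y \<in> A" using ex[OF t(1)] gen[OF _ t(2) mem y z] by blast
  have "(1 - t) *\<^sub>R z + (1 - (1 - t)) *\<^sub>R y \<in> A" using mem by (simp add: add.commute)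
  then show "z \<in> A" using ex[of "1 - t"] gen[of _ "1 - t" z y] t y z by auto
qed

lemma compl_face_subset: "compl_face X A \<subseteq> X"
  by (auto simp: compl_face_def face_def extremal_def)

lemma compl_face_disjoint: "A \<inter> compl_face X A = {}"
  by (auto simp: compl_face_def)

lemma compl_face_combD:
  assumes "y \<in> X" "z \<in> X" "0 < t" "t < 1" "t *\<^sub>R y + (1 - t) *\<^sub>R z \<in> compl_face X A"
  shows "y \<in> compl_face X A" "z \<in> compl_face X A"
proof -
  obtain B where B: "face X B" "B \<inter> A = {}" "t *\<^sub>R y + (1 - t) *\<^sub>R z \<in> B"
    using assms(5) by (auto simp: compl_face_def)
  then have "y \<in> B" "z \<in> B" using extremal_combD[of B y z t] assms by (auto simp: face_def)
  then show "y \<in> compl_face X A" "z \<in> compl_face X A" using B by (auto simp: compl_face_def)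
qed

text \<open>Strong affinity is tested on a two-point measure, obtained as the image of a weighted
  measure on \<open>bool\<close> extended to a Radon measure.\<close>

lemma sa_baire_affine:
  assumes f: "f \<in> sa_baire"
  shows "affine_fun_on X f"
  unfolding affine_fun_on_def
proof (intro ballI)
  fix x y and t :: real assume x: "x \<in> X" and y: "y \<in> X" and t: "t \<in> {0..1}"
  define P where "P = density (count_space (UNIV :: bool set)) (\<lambda>b. ennreal (if b then t else 1 - t))"
  have "emeasure P (space P) = ennreal t + ennreal (1 - t)"
    by (simp add: P_def emeasure_density nn_integral_count_space_finite UNIV_bool add.commute)
  also have "\<dots> = 1" using t by (simp flip: ennreal_plus)
  finally interpret P: prob_space P by (rule prob_spaceI)
  define p where "p = (\<lambda>b. if b then y else x)"
  have pm: "p \<in> measurable P (baire X)" using x y by (simp add: P_def p_def)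
  define \<rho> where "\<rho> = distr P (baire X) p"
  have \<rho>: "prob_space \<rho>" unfolding \<rho>_def by (rule P.prob_space_distr[OF pm])
  obtain \<mu> where \<mu>: "\<mu> \<in> M1 X" "distr \<mu> (baire X) (\<lambda>x. x) = \<rho>"
    using baire_measure_extension[OF compact_X \<rho>] by (auto simp: \<rho>_def)
  have int: "(\<integral>z. g z \<partial>\<mu>) = (1 - t) * g x + t * g y" if g: "g \<in> borel_measurable (baire X)" for g :: "'a \<Rightarrow> real"
  proof -
    have "(\<integral>z. g z \<partial>\<mu>) = (\<integral>z. g z \<partial>\<rho>)" by (rule integral_baire_ext[OF \<mu> g])
    also have "\<dots> = (\<integral>b. g (p b) \<partial>P)" unfolding \<rho>_def by (rule integral_distr[OF pm g])
    also have "\<dots> = (\<integral>b. (if b then t else 1 - t) * g (p b) \<partial>count_space UNIV)"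
      unfolding P_def using t by (subst integral_density) auto
    also have "\<dots> = (1 - t) * g x + t * g y"
      by (simp add: lebesgue_integral_count_space_finite UNIV_bool p_def)
    finally show ?thesis .
  qed
  have "(1 - t) *\<^sub>R x + t *\<^sub>R y \<in> X" using x y t convexD_alt[OF convex_X] by auto
  then have "barycenter X \<mu> ((1 - t) *\<^sub>R x + t *\<^sub>R y)"
    using int borel_measurable_baire_continuous[OF A_cD(2)] affine_funD[OF A_cD(1)] x y t
    by (auto simp: barycenter_def)
  then show "f ((1 - t) *\<^sub>R x + t *\<^sub>R y) = (1 - t) * f x + t * f y"
    using sa_baireD(4)[OF f \<mu>(1)] int[OF sa_baireD(2)[OF f]] by auto
qed

lemma sa_baire_comb:
  assumes "f \<in> sa_baire" "y \<in> X" "z \<in> X" "0 \<le> t" "t \<le> 1"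
  shows "f (t *\<^sub>R y + (1 - t) *\<^sub>R z) = t * f y + (1 - t) * f z"
  using affine_funD[OF sa_baire_affine[OF assms(1)] assms(3,2,4,5)] by (simp add: add.commute)

lemma level_set_baire:
  assumes "f \<in> sa_baire"
  shows "{x \<in> X. f x = c} \<in> sets (baire X)"
  using measurable_sets[OF sa_baireD(2)[OF assms], of "{c}"]
  by (simp add: vimage_def Int_def conj_commute)

lemma level_set_measure_convex:
  assumes f: "f \<in> sa_baire"
  shows "measure_convex X {x \<in> X. f x = c}"
  unfolding measure_convex_def
proof (intro conjI ballI allI impI; (elim conjE)?)
  let ?F = "{x \<in> X. f x = c}"
  show "?F \<subseteq> X" by auto
  fix \<mu> assume \<mu>: "\<mu> \<in> M1 X"
  interpret prob_space \<mu> by (rule prob_space_M1[OF \<mu>])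
  show F: "?F \<in> sets \<mu>" using level_set_baire[OF f] baire_subset_sets_M1[OF \<mu>] by blast
  fix x assume F1: "measure \<mu> ?F = 1" and x: "barycenter X \<mu> x"
  have "AE y in \<mu>. y \<in> ?F" using prob_eq_1[OF F] F1 by simp
  then have "AE y in \<mu>. f y = c" by (rule AE_mp) (intro AE_I2, simp)
  then have "(\<integral>y. f y \<partial>\<mu>) = (\<integral>y. c \<partial>\<mu>)"
    using borel_measurable_M1_baire[OF \<mu> sa_baireD(2)[OF f]] by (intro integral_cong_AE) auto
  then show "x \<in> ?F" using sa_baireD(4)[OF f \<mu> x] barycenter_in[OF x] by (simp add: prob_space)
qed

lemma AE_at_maximum:
  assumes f: "f \<in> sa_baire" and \<mu>: "\<mu> \<in> M1 X" "barycenter X \<mu> x" and le: "\<And>y. y \<in> X \<Longrightarrow> f y \<le> f x"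
  shows "AE y in \<mu>. f y = f x"
proof -
  interpret prob_space \<mu> by (rule prob_space_M1[OF \<mu>(1)])
  have i: "integrable \<mu> (\<lambda>y. f x - f y)" using sa_baireD(3)[OF f \<mu>] by simp
  have "AE y in \<mu>. 0 \<le> f x - f y" using le space_M1[OF \<mu>(1)] by (intro AE_I2) auto
  moreover have "(\<integral>y. f x - f y \<partial>\<mu>) = 0" using sa_baireD(3,4)[OF f \<mu>] by (simp add: prob_space)
  ultimately have "AE y in \<mu>. f x - f y = 0" using integral_nonneg_eq_0_iff_AE[OF i] by simp
  then show ?thesis by (rule AE_mp) (intro AE_I2, simp)
qed

lemma AE_at_minimum:
  assumes f: "f \<in> sa_baire" and \<mu>: "\<mu> \<in> M1 X" "barycenter X \<mu> x" and le: "\<And>y. y \<in> X \<Longrightarrow> f x \<le> f y"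
  shows "AE y in \<mu>. f y = f x"
proof -
  have xX: "x \<in> X" by (rule barycenter_in[OF \<mu>(2)])
  have "AE y in \<mu>. (\<lambda>y\<in>X. (-1) * f y) y = (\<lambda>y\<in>X. (-1) * f y) x"
    by (rule AE_at_maximum[OF sa_baire_scale[OF f] \<mu>]) (use le xX in auto)
  moreover have "AE y in \<mu>. y \<in> X" using space_M1[OF \<mu>(1)] by (intro AE_I2) simp
  ultimately show ?thesis by eventually_elim (use xX in auto)
qed

end

section \<open>Faces cut out by a function with values 0 and 1 on the extreme points\<close>

locale ext_indicator = compact_convex +
  fixes f
  assumes f: "f \<in> sa_baire" and f01: "\<And>e. e \<in> ext_points X \<Longrightarrow> f e = 0 \<or> f e = 1"
begin

definition F where "F = {x \<in> X. f x = 1}"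
definition G where "G = {x \<in> X. f x = 0}"

lemma f_bounds: "x \<in> X \<Longrightarrow> 0 \<le> f x" "x \<in> X \<Longrightarrow> f x \<le> 1"
  using sa_baire_ge[OF f, of 0 x] sa_baire_le[OF f, of 1 x] f01 by fastforce+

lemma FG_baire: "F \<in> sets (baire X)" "G \<in> sets (baire X)"
  unfolding F_def G_def by (rule level_set_baire[OF f])+

lemma FG_measure_convex: "measure_convex X F" "measure_convex X G"
  unfolding F_def G_def by (rule level_set_measure_convex[OF f])+

lemma face_F: "face X F" and face_G: "face X G"
proof -
  have c: "convex {x \<in> X. f x = c}" for c
    unfolding convex_alt
  proof (intro ballI allI impI)
    fix x y and u :: real
    assume xy: "x \<in> {x \<in> X. f x = c}" "y \<in> {x \<in> X. f x = c}" and u: "0 \<le> u \<and> u \<le> 1"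
    have "f ((1 - u) *\<^sub>R x + u *\<^sub>R y) = (1 - u) * f x + u * f y"
      using affine_funD[OF sa_baire_affine[OF f]] xy u by auto
    then show "(1 - u) *\<^sub>R x + u *\<^sub>R y \<in> {x \<in> X. f x = c}"
      using xy u convexD_alt[OF convex_X] by (auto simp: algebra_simps)
  qed
  have mid: "f ((1/2) *\<^sub>R (y + z)) = (f y + f z) / 2" if "y \<in> X" "z \<in> X" for y z
    using sa_baire_comb[OF f that, of "1/2"] by (simp add: scaleR_right_distrib)
  have "extremal X F"
    unfolding extremal_def
  proof (intro conjI ballI impI)
    fix y z assume *: "y \<in> X" "z \<in> X" "(1/2) *\<^sub>R (y + z) \<in> F"
    then have "(f y + f z) / 2 = 1" using mid by (simp add: F_def)
    then show "y \<in> F" "z \<in> F" using f_bounds[OF *(1)] f_bounds[OF *(2)] * unfolding F_def by auto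
  qed (auto simp: F_def)
  then show "face X F" using c unfolding face_def F_def by blast
  have "extremal X G"
    unfolding extremal_def
  proof (intro conjI ballI impI)
    fix y z assume *: "y \<in> X" "z \<in> X" "(1/2) *\<^sub>R (y + z) \<in> G"
    then have "(f y + f z) / 2 = 0" using mid by (simp add: G_def)
    then show "y \<in> G" "z \<in> G" using f_bounds[OF *(1)] f_bounds[OF *(2)] * unfolding G_def by auto
  qed (auto simp: G_def)
  then show "face X G" using c unfolding face_def G_def by blast
qed

text \<open>A maximal measure representing \<open>x\<close> is carried by \<open>F \<union> G\<close>; its normalized restrictions to \<open>F\<close> and \<open>G\<close>
  have barycenters in \<open>F\<close> and \<open>G\<close>.\<close>

lemma ex_decomposition:
  assumes x: "x \<in> X" and fx: "0 < f x" "f x < 1"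
  obtains y z where "y \<in> F" "z \<in> G" "x = f x *\<^sub>R y + (1 - f x) *\<^sub>R z"
proof -
  obtain \<mu> where \<mu>: "\<mu> \<in> maximal_measures X" "barycenter X \<mu> x" using ex_maximal_measure[OF x] .
  note \<mu>' = maximal_imp_mokobodzki(1)[OF \<mu>(1)]
  interpret prob_space \<mu> by (rule prob_space_M1[OF \<mu>'])
  have FG: "F \<in> sets \<mu>" "G \<in> sets \<mu>" using FG_baire baire_subset_sets_M1[OF \<mu>'] by auto
  have "AE y in \<mu>. y \<in> F \<union> G"
    by (rule AE_maximal[OF \<mu>(1)]) (use FG_baire f01 ext_in in \<open>auto simp: F_def G_def\<close>)
  then have ae: "AE y in \<mu>. f y = indicator F y" by (rule AE_mp) (intro AE_I2, auto simp: F_def G_def)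
  have "(\<integral>y. f y \<partial>\<mu>) = (\<integral>y. indicator F y \<partial>\<mu>)"
    using ae borel_measurable_M1_baire[OF \<mu>' sa_baireD(2)[OF f]] FG by (intro integral_cong_AE) auto
  also have "\<dots> = measure \<mu> F" using FG(1) sets.sets_into_space[OF FG(1)] by (simp add: Int_absorb2)
  finally have mF: "measure \<mu> F = f x" using sa_baireD(4)[OF f \<mu>' \<mu>(2)] by simp
  have "measure \<mu> (F \<union> G) = 1" using \<open>AE y in \<mu>. y \<in> F \<union> G\<close> FG by (intro prob_eq_1[THEN iffD2]) auto
  moreover have "measure \<mu> (F \<union> G) = measure \<mu> F + measure \<mu> G"
    using FG by (intro finite_measure_Union) (auto simp: F_def G_def)
  ultimately have mG: "measure \<mu> G = 1 - f x" using mF by simp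
  obtain \<nu> y where y: "\<nu> \<in> M1 X" "barycenter X \<nu> y"
    "\<And>h :: 'a \<Rightarrow> real. h \<in> borel_measurable (baire X) \<Longrightarrow> (\<integral>v. h v \<partial>\<nu>) = (\<integral>v. indicator F v * h v \<partial>\<mu>) / measure \<mu> F"
    using conditional_barycenter[OF \<mu>' FG_baire(1)] mF fx by auto
  obtain \<nu>' z where z: "\<nu>' \<in> M1 X" "barycenter X \<nu>' z"
    "\<And>h :: 'a \<Rightarrow> real. h \<in> borel_measurable (baire X) \<Longrightarrow> (\<integral>v. h v \<partial>\<nu>') = (\<integral>v. indicator G v * h v \<partial>\<mu>) / measure \<mu> G"
    using conditional_barycenter[OF \<mu>' FG_baire(2)] mG fx by auto
  have "(\<integral>v. indicator F v * f v \<partial>\<mu>) = (\<integral>v. indicator F v \<partial>\<mu>)"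
    by (intro Bochner_Integration.integral_cong) (auto simp: F_def indicator_def)
  also have "\<dots> = measure \<mu> F" using FG(1) sets.sets_into_space[OF FG(1)] by (simp add: Int_absorb2)
  finally have "f y = 1"
    using y(3)[OF sa_baireD(2)[OF f]] sa_baireD(4)[OF f y(1,2)] mF fx by simp
  then have yF: "y \<in> F" using barycenter_in[OF y(2)] by (simp add: F_def)
  have "(\<integral>v. indicator G v * f v \<partial>\<mu>) = (\<integral>v. 0 \<partial>\<mu>)"
    by (intro Bochner_Integration.integral_cong) (auto simp: G_def indicator_def)
  then have "f z = 0"
    using z(3)[OF sa_baireD(2)[OF f]] sa_baireD(4)[OF f z(1,2)] by simp
  then have zG: "z \<in> G" using barycenter_in[OF z(2)] by (simp add: G_def)
  have "x = f x *\<^sub>R y + (1 - f x) *\<^sub>R z"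
  proof (rule convex_comb_eqI)
    fix a assume a: "a \<in> A_c X"
    note aH = subsetD[OF A_c_subset_sa_baire a]
    have ai: "integrable \<mu> a" by (rule sa_baireD(3)[OF aH \<mu>' \<mu>(2)])
    have i1: "integrable \<mu> (\<lambda>v. indicator F v * a v)"
      using integrable_real_mult_indicator[OF FG(1) ai] by (simp add: mult.commute)
    have i2: "integrable \<mu> (\<lambda>v. indicator G v * a v)"
      using integrable_real_mult_indicator[OF FG(2) ai] by (simp add: mult.commute)
    have "AE v in \<mu>. a v = indicator F v * a v + indicator G v * a v"
      using \<open>AE y in \<mu>. y \<in> F \<union> G\<close> by (rule AE_mp) (intro AE_I2, auto simp: F_def G_def indicator_def)
    then have "(\<integral>v. a v \<partial>\<mu>) = (\<integral>v. indicator F v * a v + indicator G v * a v \<partial>\<mu>)"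
      using ai i1 i2 by (intro integral_cong_AE borel_measurable_integrable) auto
    also have "\<dots> = f x * a y + (1 - f x) * a z"
      using i1 i2 y(3)[OF sa_baireD(2)[OF aH]] z(3)[OF sa_baireD(2)[OF aH]]
        sa_baireD(4)[OF aH y(1,2)] sa_baireD(4)[OF aH z(1,2)] fx mF mG by simp
    finally show "a x = f x * a y + (1 - f x) * a z" using sa_baireD(4)[OF aH \<mu>' \<mu>(2)] by simp
  qed (use x fx barycenter_in[OF y(2)] barycenter_in[OF z(2)] in auto)
  then show thesis using that yF zG by blast
qed

text \<open>A point with \<open>0 < f x < 1\<close> has a component in \<open>F\<close>, which any
  face containing the point must contain too.\<close>

lemma compl_face_F: "compl_face X F = G"
proof
  show "G \<subseteq> compl_face X F" using face_G by (auto simp: compl_face_def F_def G_def)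
  show "compl_face X F \<subseteq> G"
  proof
    fix x assume "x \<in> compl_face X F"
    then obtain B where B: "face X B" "B \<inter> F = {}" "x \<in> B" by (auto simp: compl_face_def)
    have x: "x \<in> X" using B by (auto simp: face_def extremal_def)
    show "x \<in> G"
    proof (rule ccontr)
      assume "x \<notin> G"
      then have fx: "0 < f x" "f x < 1" using x f_bounds[OF x] B(2,3) by (auto simp: F_def G_def less_le)
      obtain y z where yz: "y \<in> F" "z \<in> G" "x = f x *\<^sub>R y + (1 - f x) *\<^sub>R z"
        using ex_decomposition[OF x fx] .
      have "y \<in> B"
        using B(1,3) yz fx by (intro extremal_combD(1)[of B y z "f x"]) (auto simp: face_def F_def G_def)
      then show False using B(2) yz(1) by auto
    qed
  qed
qed

text \<open>Uniqueness of the \<open>F\<close> component is isolated as a hypothesis because it has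
  two sources, the multiplier property and the simplex property. The weight is forced:
  \<open>f\<close> is affine, 1 on \<open>F\<close> and 0 on \<open>G\<close>, so it equals
  \<open>f x\<close>.\<close>

lemma
  assumes unique: "\<And>t y z y' z'. \<lbrakk>0 < t; t < 1; y \<in> F; z \<in> G; y' \<in> F; z' \<in> G;
      t *\<^sub>R y + (1 - t) *\<^sub>R z = t *\<^sub>R y' + (1 - t) *\<^sub>R z'\<rbrakk> \<Longrightarrow> y = y'"
  shows split_face_F: "split_face X F" and split_lambda_F: "split_lambda X F = f"
proof -
  have fcomb: "f x = t" if "0 < t" "t < 1" "y \<in> F" "z \<in> G" "x = t *\<^sub>R y + (1 - t) *\<^sub>R z" for x t y z
    using sa_baire_comb[OF f, of y z t] that by (simp add: F_def G_def)
  have nFG: "0 < f x \<and> f x < 1" if "x \<in> X - (F \<union> G)" for x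
    using that f_bounds[of x] by (auto simp: F_def G_def less_le)
  show "split_face X F"
    unfolding split_face_def compl_face_F
  proof (intro conjI ballI face_F)
    show "convex G" using face_G by (simp add: face_def)
    fix x assume x: "x \<in> X - (F \<union> G)"
    obtain y z where yz: "y \<in> F" "z \<in> G" "x = f x *\<^sub>R y + (1 - f x) *\<^sub>R z"
      using ex_decomposition nFG[OF x] x by blast
    show "\<exists>!(t, y, z). t \<in> {0<..<1} \<and> y \<in> F \<and> z \<in> G \<and> x = t *\<^sub>R y + (1 - t) *\<^sub>R z"
    proof (rule ex1I[of _ "(f x, y, z)"])
      show "case (f x, y, z) of (t, y, z) \<Rightarrow> t \<in> {0<..<1} \<and> y \<in> F \<and> z \<in> G \<and> x = t *\<^sub>R y + (1 - t) *\<^sub>R z"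
        using yz nFG[OF x] by auto
      fix p assume p: "case p of (t, y, z) \<Rightarrow> t \<in> {0<..<1} \<and> y \<in> F \<and> z \<in> G \<and> x = t *\<^sub>R y + (1 - t) *\<^sub>R z"
      obtain t y' z' where p': "p = (t, y', z')" by (cases p)
      have q: "0 < t" "t < 1" "y' \<in> F" "z' \<in> G" "x = t *\<^sub>R y' + (1 - t) *\<^sub>R z'" using p p' by auto
      have t: "f x = t" by (rule fcomb[OF q])
      have eq: "t *\<^sub>R y + (1 - t) *\<^sub>R z = t *\<^sub>R y' + (1 - t) *\<^sub>R z'" using yz(3) q(5) unfolding t by simp
      have "y = y'" by (rule unique[OF q(1,2) yz(1,2) q(3,4) eq])
      moreover from this have "z = z'" using eq q(2) by simp
      ultimately show "p = (f x, y, z)" using t p' by simp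
    qed
  qed
  show "split_lambda X F = f"
  proof
    fix x
    show "split_lambda X F x = f x"
    proof (cases "x \<in> X - (F \<union> G)")
      case True
      obtain y z where yz: "y \<in> F" "z \<in> G" "x = f x *\<^sub>R y + (1 - f x) *\<^sub>R z"
        using ex_decomposition nFG[OF True] True by blast
      have "(THE t. t \<in> {0<..<1} \<and> (\<exists>y\<in>F. \<exists>z\<in>G. x = t *\<^sub>R y + (1 - t) *\<^sub>R z)) = f x"
      proof (rule the_equality)
        show "f x \<in> {0<..<1} \<and> (\<exists>y\<in>F. \<exists>z\<in>G. x = f x *\<^sub>R y + (1 - f x) *\<^sub>R z)"
          using yz nFG[OF True] by auto
        show "t = f x" if "t \<in> {0<..<1} \<and> (\<exists>y\<in>F. \<exists>z\<in>G. x = t *\<^sub>R y + (1 - t) *\<^sub>R z)" for t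
          using that fcomb by force
      qed
      then show ?thesis using True by (simp add: split_lambda_def compl_face_F)
    next
      case False
      then consider "x \<notin> X" | "x \<in> X" "x \<in> F" | "x \<in> X" "x \<notin> F" "x \<in> G" by blast
      then show ?thesis
      proof cases
        case 1
        then show ?thesis using sa_baireD(1)[OF f] by (simp add: split_lambda_def extensional_def)
      next
        case 2
        then have "split_lambda X F x = 1" by (simp add: split_lambda_def)
        then show ?thesis using 2 by (simp add: F_def)
      next
        case 3
        then have "split_lambda X F x = 0" by (simp add: split_lambda_def compl_face_F)
        then show ?thesis using 3 by (simp add: G_def)
      qed
    qed
  qed
qed

text \<open>The extension \<open>b\<close> of \<open>f * a\<close> equals \<open>a\<close> on
  \<open>F\<close> and 0 on \<open>G\<close>, since measures representing points there live where
  \<open>f\<close> has its extreme value. Affinity of \<open>b\<close> then recovers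
  \<open>t * a y\<close> from the point alone, and \<open>A_c X\<close> separates points.\<close>

lemma unique_of_multiplier:
  assumes mult: "\<And>a. a \<in> A_c X \<Longrightarrow> \<exists>b\<in>sa_baire. \<forall>e\<in>ext_points X. b e = f e * a e"
    and t: "0 < t" "t < 1" and yz: "y \<in> F" "z \<in> G" "y' \<in> F" "z' \<in> G"
    and eq: "t *\<^sub>R y + (1 - t) *\<^sub>R z = t *\<^sub>R y' + (1 - t) *\<^sub>R z'"
  shows "y = y'"
proof (rule ccontr)
  assume "y \<noteq> y'"
  have X: "y \<in> X" "z \<in> X" "y' \<in> X" "z' \<in> X" using yz by (auto simp: F_def G_def)
  obtain a where a: "a \<in> A_c X" "a y < a y'" using A_c_separating[OF convex_X X(1,3) \<open>y \<noteq> y'\<close>] .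
  obtain b where b: "b \<in> sa_baire" "\<forall>e\<in>ext_points X. b e = f e * a e" using mult[OF a(1)] by blast
  note aH = subsetD[OF A_c_subset_sa_baire a(1)]
  have bae: "AE v in \<mu>. b v = f v * a v" if \<mu>: "\<mu> \<in> maximal_measures X" for \<mu>
  proof -
    have "{v \<in> space (baire X). b v = f v * a v} \<in> sets (baire X)"
      using sa_baireD(2)[OF b(1)] sa_baireD(2)[OF f] sa_baireD(2)[OF aH] by measurable
    then have "AE v in \<mu>. v \<in> {v \<in> space (baire X). b v = f v * a v}"
      using b(2) ext_in by (intro AE_maximal[OF \<mu>]) auto
    then show ?thesis by (rule AE_mp) (intro AE_I2, simp)
  qed
  have bF: "b v = a v" if v: "v \<in> F" for v
  proof -
    have vX: "v \<in> X" and fv: "f v = 1" using v by (auto simp: F_def)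
    obtain \<mu> where \<mu>: "\<mu> \<in> maximal_measures X" "barycenter X \<mu> v" using ex_maximal_measure[OF vX] .
    note \<mu>' = maximal_imp_mokobodzki(1)[OF \<mu>(1)]
    have "AE u in \<mu>. f u = f v" by (rule AE_at_maximum[OF f \<mu>' \<mu>(2)]) (use f_bounds fv in auto)
    then have "AE u in \<mu>. b u = a u" using bae[OF \<mu>(1)] by eventually_elim (simp add: fv)
    then have "(\<integral>u. b u \<partial>\<mu>) = (\<integral>u. a u \<partial>\<mu>)"
      using borel_measurable_M1_baire[OF \<mu>' sa_baireD(2)[OF b(1)]] borel_measurable_M1_baire[OF \<mu>' sa_baireD(2)[OF aH]]
      by (intro integral_cong_AE) auto
    then show ?thesis using sa_baireD(4)[OF b(1) \<mu>' \<mu>(2)] sa_baireD(4)[OF aH \<mu>' \<mu>(2)] by simp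
  qed
  have bG: "b v = 0" if v: "v \<in> G" for v
  proof -
    have vX: "v \<in> X" and fv: "f v = 0" using v by (auto simp: G_def)
    obtain \<mu> where \<mu>: "\<mu> \<in> maximal_measures X" "barycenter X \<mu> v" using ex_maximal_measure[OF vX] .
    note \<mu>' = maximal_imp_mokobodzki(1)[OF \<mu>(1)]
    have "AE u in \<mu>. f u = f v" by (rule AE_at_minimum[OF f \<mu>' \<mu>(2)]) (use f_bounds fv in auto)
    then have "AE u in \<mu>. b u = 0" using bae[OF \<mu>(1)] by eventually_elim (simp add: fv)
    then have "(\<integral>u. b u \<partial>\<mu>) = (\<integral>u. 0 \<partial>\<mu>)"
      using borel_measurable_M1_baire[OF \<mu>' sa_baireD(2)[OF b(1)]] by (intro integral_cong_AE) auto
    then show ?thesis using sa_baireD(4)[OF b(1) \<mu>' \<mu>(2)] by simp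
  qed
  have "t * b y + (1 - t) * b z = t * b y' + (1 - t) * b z'"
    using sa_baire_comb[OF b(1) X(1,2), of t] sa_baire_comb[OF b(1) X(3,4), of t] eq t by simp
  then have "t * a y = t * a y'" using bF[OF yz(1)] bF[OF yz(3)] bG[OF yz(2)] bG[OF yz(4)] by simp
  then show False using a(2) t by simp
qed

text \<open>In a simplex, mixing maximal measures of \<open>y\<close> and \<open>z\<close> gives the maximal measure of \<open>t y + (1 - t) z\<close>,
  whose restriction to \<open>F\<close> recovers the measure of \<open>y\<close>.\<close>

lemma unique_of_simplex:
  assumes simplex: "choquet_simplex X"
    and t: "0 < t" "t < 1" and yz: "y \<in> F" "z \<in> G" "y' \<in> F" "z' \<in> G"
    and eq: "t *\<^sub>R y + (1 - t) *\<^sub>R z = t *\<^sub>R y' + (1 - t) *\<^sub>R z'"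
  shows "y = y'"
proof -
  define x where "x = t *\<^sub>R y + (1 - t) *\<^sub>R z"
  have ex: "\<exists>\<mu> \<tau>. \<mu> \<in> M1 X \<and> barycenter X \<mu> v \<and> \<tau> \<in> maximal_measures X \<and> barycenter X \<tau> x \<and>
      (\<forall>A\<in>sets (baire X). measure \<tau> (A \<inter> F) = t * measure \<mu> A)"
    if v: "v \<in> F" and w: "w \<in> G" and x': "x = t *\<^sub>R v + (1 - t) *\<^sub>R w" for v w
  proof -
    have vw: "v \<in> X" "w \<in> X" "f v = 1" "f w = 0" using v w by (auto simp: F_def G_def)
    obtain \<mu> where \<mu>: "\<mu> \<in> maximal_measures X" "barycenter X \<mu> v" using ex_maximal_measure[OF vw(1)] .
    obtain \<nu> where \<nu>: "\<nu> \<in> maximal_measures X" "barycenter X \<nu> w" using ex_maximal_measure[OF vw(2)] .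
    note \<mu>' = maximal_imp_mokobodzki(1)[OF \<mu>(1)] and \<nu>' = maximal_imp_mokobodzki(1)[OF \<nu>(1)]
    interpret \<mu>: prob_space \<mu> by (rule prob_space_M1[OF \<mu>'])
    interpret \<nu>: prob_space \<nu> by (rule prob_space_M1[OF \<nu>'])
    obtain \<tau> where \<tau>: "\<tau> \<in> maximal_measures X"
      "\<And>g :: 'a \<Rightarrow> real. continuous_on X g \<Longrightarrow> (\<integral>u. g u \<partial>\<tau>) = t * (\<integral>u. g u \<partial>\<mu>) + (1 - t) * (\<integral>u. g u \<partial>\<nu>)"
      using maximal_mixture[OF \<mu>(1) \<nu>(1), of t] t by auto
    note \<tau>' = maximal_imp_mokobodzki(1)[OF \<tau>(1)]
    have xX: "x \<in> X" unfolding x' using vw t by (intro convexD[OF convex_X]) auto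
    have "barycenter X \<tau> x"
      unfolding barycenter_def
    proof (intro conjI ballI xX)
      fix a assume a: "a \<in> A_c X"
      have "a x = t * a v + (1 - t) * a w"
        unfolding x' by (rule sa_baire_comb) (use subsetD[OF A_c_subset_sa_baire a] vw t in auto)
      then show "a x = (\<integral>u. a u \<partial>\<tau>)"
        using \<tau>(2)[OF A_cD(2)[OF a]] \<mu>(2) \<nu>(2) a by (simp add: barycenter_def)
    qed
    moreover have "measure \<tau> (A \<inter> F) = t * measure \<mu> A" if A: "A \<in> sets (baire X)" for A
    proof -
      have AF: "A \<inter> F \<in> sets (baire X)" using A FG_baire by blast
      have s: "A \<in> sets \<mu>" "F \<in> sets \<mu>" "F \<in> sets \<nu>" "A \<inter> F \<in> sets \<nu>"
        using A AF FG_baire baire_subset_sets_M1[OF \<mu>'] baire_subset_sets_M1[OF \<nu>'] by auto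
      have "measure \<tau> (A \<inter> F) = t * measure \<mu> (A \<inter> F) + (1 - t) * measure \<nu> (A \<inter> F)"
        by (rule measure_baire_mixture[OF prob_space_M1[OF \<tau>'] space_M1[OF \<tau>'] baire_subset_sets_M1[OF \<tau>']
              prob_space_M1[OF \<mu>'] space_M1[OF \<mu>'] baire_subset_sets_M1[OF \<mu>']
              prob_space_M1[OF \<nu>'] space_M1[OF \<nu>'] baire_subset_sets_M1[OF \<nu>'] \<tau>(2) AF])
      moreover have "measure \<mu> (A \<inter> F) = measure \<mu> A"
      proof -
        have "AE u in \<mu>. f u = f v" by (rule AE_at_maximum[OF f \<mu>' \<mu>(2)]) (use f_bounds vw in auto)
        then have "AE u in \<mu>. u \<in> A \<inter> F \<longleftrightarrow> u \<in> A"
          by (rule AE_mp) (intro AE_I2, auto simp: F_def vw(3) space_M1[OF \<mu>'])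
        then show ?thesis using s by (intro measure_eq_AE) auto
      qed
      moreover have "measure \<nu> (A \<inter> F) = measure \<nu> {}"
      proof (rule measure_eq_AE)
        have "AE u in \<nu>. f u = f w" by (rule AE_at_minimum[OF f \<nu>' \<nu>(2)]) (use f_bounds vw in auto)
        then show "AE u in \<nu>. u \<in> A \<inter> F \<longleftrightarrow> u \<in> {}"
          by (rule AE_mp) (intro AE_I2, auto simp: F_def vw(4))
      qed (use s in auto)
      ultimately show ?thesis by simp
    qed
    ultimately show ?thesis using \<mu>' \<mu>(2) \<tau>(1) by blast
  qed
  obtain \<mu> \<tau> where 1: "\<mu> \<in> M1 X" "barycenter X \<mu> y" "\<tau> \<in> maximal_measures X" "barycenter X \<tau> x"
    "\<And>A. A \<in> sets (baire X) \<Longrightarrow> measure \<tau> (A \<inter> F) = t * measure \<mu> A"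
    using ex[OF yz(1,2) x_def] by blast
  obtain \<mu>' \<tau>' where 2: "\<mu>' \<in> M1 X" "barycenter X \<mu>' y'" "\<tau>' \<in> maximal_measures X" "barycenter X \<tau>' x"
    "\<And>A. A \<in> sets (baire X) \<Longrightarrow> measure \<tau>' (A \<inter> F) = t * measure \<mu>' A"
    using ex[OF yz(3,4)] eq unfolding x_def by blast
  have "\<tau> = \<tau>'" using simplex 1(3,4) 2(3,4) barycenter_in[OF 1(4)] unfolding choquet_simplex_def by blast
  have meq: "measure \<mu> A = measure \<mu>' A" if "A \<in> sets (baire X)" for A
    using 1(5)[OF that] 2(5)[OF that] \<open>\<tau> = \<tau>'\<close> t by simp
  interpret \<mu>: prob_space \<mu> by (rule prob_space_M1[OF 1(1)])
  interpret \<mu>': prob_space \<mu>' by (rule prob_space_M1[OF 2(1)])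
  \<comment> \<open>Agreement on Baire sets transfers the integrals of functions in
    \<open>A_c X\<close>, so \<open>y'\<close> is also a barycenter of \<open>\<mu>\<close>.\<close>
  have "distr \<mu> (baire X) (\<lambda>x. x) = distr \<mu>' (baire X) (\<lambda>x. x)"
  proof (rule measure_eqI)
    fix A assume "A \<in> sets (distr \<mu> (baire X) (\<lambda>x. x))"
    then have A: "A \<in> sets (baire X)" by simp
    then have "A \<subseteq> X" using sets.sets_into_space[OF A] by simp
    then show "emeasure (distr \<mu> (baire X) (\<lambda>x. x)) A = emeasure (distr \<mu>' (baire X) (\<lambda>x. x)) A"
      using A meq[OF A] measurable_ident_baire[OF 1(1)] measurable_ident_baire[OF 2(1)]
      by (simp add: emeasure_distr \<mu>.emeasure_eq_measure \<mu>'.emeasure_eq_measure space_M1[OF 1(1)] space_M1[OF 2(1)] Int_absorb2)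
  qed simp
  then have "(\<integral>u. a u \<partial>\<mu>) = (\<integral>u. a u \<partial>\<mu>')" if "a \<in> A_c X" for a
    using integral_baire_ext[OF 1(1) refl, of a] integral_baire_ext[OF 2(1) refl, of a]
      borel_measurable_baire_continuous[OF A_cD(2)[OF that]] by simp
  then have "barycenter X \<mu> y'" using 2(2) by (simp add: barycenter_def)
  then show ?thesis using barycenter_unique 1(2) by blast
qed

end

section \<open>Split faces define multipliers\<close>

locale split_baire_face = compact_convex +
  fixes F
  assumes split: "split_face X F"
    and F_baire: "F \<in> sets (baire X)" and F_mc: "measure_convex X F"
    and G_baire: "compl_face X F \<in> sets (baire X)" and G_mc: "measure_convex X (compl_face X F)"
begin

abbreviation G where "G \<equiv> compl_face X F"

lemma FG: "F \<subseteq> X" "G \<subseteq> X" "F \<inter> G = {}"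
  using F_mc compl_face_subset compl_face_disjoint by (auto simp: measure_convex_def)

text \<open>A component with coefficient \<open>0\<close> is an arbitrary point of \<open>X\<close>, so decompositions exist also on \<open>F \<union> G\<close> but
  are unique there only up to that component.\<close>

definition dec :: "'a \<Rightarrow> real \<times> 'a \<times> 'a \<Rightarrow> bool" where
  "dec x p \<longleftrightarrow> (case p of (t, y, z) \<Rightarrow> 0 \<le> t \<and> t \<le> 1 \<and> y \<in> X \<and> z \<in> X \<and> (t \<noteq> 0 \<longrightarrow> y \<in> F) \<and>
     (t \<noteq> 1 \<longrightarrow> z \<in> G) \<and> x = t *\<^sub>R y + (1 - t) *\<^sub>R z)"

lemma ex_dec:
  assumes x: "x \<in> X"
  shows "\<exists>p. dec x p"
proof -
  consider "x \<in> F" | "x \<in> G" | "x \<in> X - (F \<union> G)" using x by blast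
  then show ?thesis
  proof cases
    case 1
    then have "dec x (1, x, x)" using x by (simp add: dec_def)
    then show ?thesis ..
  next
    case 2
    then have "dec x (0, x, x)" using x by (simp add: dec_def)
    then show ?thesis ..
  next
    case 3
    have "\<exists>!(t, y, z). t \<in> {0<..<1} \<and> y \<in> F \<and> z \<in> G \<and> x = t *\<^sub>R y + (1 - t) *\<^sub>R z"
      using split 3 unfolding split_face_def by blast
    then obtain t y z where "t \<in> {0<..<1}" "y \<in> F" "z \<in> G" "x = t *\<^sub>R y + (1 - t) *\<^sub>R z" by auto
    then have "dec x (t, y, z)" using FG by (auto simp: dec_def)
    then show ?thesis ..
  qed
qed

lemma extremal_F: "extremal X F"
  using split by (simp add: split_face_def face_def)

lemma dec_F: "x \<in> F \<Longrightarrow> dec x (t, y, z) \<Longrightarrow> t = 1 \<and> y = x"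
proof -
  assume x: "x \<in> F" and d: "dec x (t, y, z)"
  have "t = 1"
  proof (rule ccontr)
    assume t1: "t \<noteq> 1"
    then have z: "z \<in> G" using d by (simp add: dec_def)
    show False
    proof (cases "t = 0")
      case True
      then show False using d x z FG(3) by (auto simp: dec_def)
    next
      case False
      then have "z \<in> F" using extremal_combD(2)[OF extremal_F, of y z t] d x t1 by (auto simp: dec_def)
      then show False using z FG(3) by auto
    qed
  qed
  then show ?thesis using d by (simp add: dec_def)
qed

lemma dec_G: "x \<in> G \<Longrightarrow> dec x (t, y, z) \<Longrightarrow> t = 0 \<and> z = x"
proof -
  assume x: "x \<in> G" and d: "dec x (t, y, z)"
  have "t = 0"
  proof (rule ccontr)
    assume t0: "t \<noteq> 0"
    then have y: "y \<in> F" using d by (simp add: dec_def)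
    show False
    proof (cases "t = 1")
      case True
      then show False using d x y FG(3) by (auto simp: dec_def)
    next
      case False
      then have "y \<in> G" using compl_face_combD(1)[of y z t F] d x t0 by (auto simp: dec_def)
      then show False using y FG(3) by auto
    qed
  qed
  then show ?thesis using d by (simp add: dec_def)
qed

lemma dec_unique:
  assumes "x \<in> X" "dec x (t, y, z)" "dec x (t', y', z')"
  shows "t = t'" "t \<noteq> 0 \<Longrightarrow> y = y'" "t \<noteq> 1 \<Longrightarrow> z = z'"
proof -
  have "t = t' \<and> (t \<noteq> 0 \<longrightarrow> y = y') \<and> (t \<noteq> 1 \<longrightarrow> z = z')"
  proof (cases "x \<in> F \<union> G")
    case True
    then show ?thesis using dec_F[OF _ assms(2)] dec_F[OF _ assms(3)] dec_G[OF _ assms(2)] dec_G[OF _ assms(3)] by auto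
  next
    case False
    then have x: "x \<in> X - (F \<union> G)" using assms(1) by simp
    have in01: "s \<in> {0<..<1} \<and> v \<in> F \<and> w \<in> G \<and> x = s *\<^sub>R v + (1 - s) *\<^sub>R w" if d: "dec x (s, v, w)" for s v w
    proof -
      have "s \<noteq> 0" "s \<noteq> 1" using d False by (auto simp: dec_def)
      then show ?thesis using d by (auto simp: dec_def)
    qed
    have "\<exists>!(t, y, z). t \<in> {0<..<1} \<and> y \<in> F \<and> z \<in> G \<and> x = t *\<^sub>R y + (1 - t) *\<^sub>R z"
      using split x unfolding split_face_def by blast
    then have "(t, y, z) = (t', y', z')"
      by (rule ex1E) (use in01[OF assms(2)] in01[OF assms(3)] in auto)
    then show ?thesis by simp
  qed
  then show "t = t'" "t \<noteq> 0 \<Longrightarrow> y = y'" "t \<noteq> 1 \<Longrightarrow> z = z'" by auto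
qed

lemma dec_unique_pair:
  assumes "x \<in> X" "dec x p" "dec x q"
  shows "fst p = fst q" "fst p \<noteq> 0 \<Longrightarrow> fst (snd p) = fst (snd q)" "fst p \<noteq> 1 \<Longrightarrow> snd (snd p) = snd (snd q)"
proof -
  obtain t y z t' y' z' where "p = (t, y, z)" "q = (t', y', z')" by (cases p, cases q) auto
  then show "fst p = fst q" "fst p \<noteq> 0 \<Longrightarrow> fst (snd p) = fst (snd q)" "fst p \<noteq> 1 \<Longrightarrow> snd (snd p) = snd (snd q)"
    using dec_unique[of x t y z t' y' z'] assms by simp_all
qed

text \<open>An arbitrary choice; it is used through quantities that do not depend on the choice, or
  after fixing the ambiguous component as in \<open>pr1\<close> and \<open>pr2\<close>.\<close>

definition D :: "'a \<Rightarrow> real \<times> 'a \<times> 'a" where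
  "D x = (SOME p. dec x p)"

lemma dec_D: "x \<in> X \<Longrightarrow> dec x (D x)"
  unfolding D_def by (rule someI_ex[OF ex_dec])

definition lam where "lam x = fst (D x)"

lemma dec_D': "x \<in> X \<Longrightarrow> dec x (lam x, fst (snd (D x)), snd (snd (D x)))"
  using dec_D by (simp add: lam_def)

lemma lambda_01: "x \<in> X \<Longrightarrow> 0 \<le> lam x" "x \<in> X \<Longrightarrow> lam x \<le> 1"
  using dec_D' by (auto simp: dec_def)

lemma lambda_eq_1: "x \<in> X \<Longrightarrow> lam x = 1 \<longleftrightarrow> x \<in> F"
  using dec_F[OF _ dec_D'] dec_D'[of x] by (auto simp: dec_def)

lemma lambda_eq_0: "x \<in> X \<Longrightarrow> lam x = 0 \<longleftrightarrow> x \<in> G"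
  using dec_G[OF _ dec_D'] dec_D'[of x] by (auto simp: dec_def)

definition Y :: "(real \<times> 'a \<times> 'a) set" where "Y = {0..1} \<times> X \<times> X"

lemma compact_Y: "compact Y"
  unfolding Y_def by (intro compact_Times compact_X compact_Icc)

lemma continuous_on_comb: "continuous_on Y (\<lambda>p. fst p *\<^sub>R fst (snd p) + (1 - fst p) *\<^sub>R snd (snd p))"
  by (intro continuous_on_add continuous_on_scaleR_tvs continuous_on_fst continuous_on_snd continuous_on_diff
      continuous_on_const continuous_on_id)

lemma measurable_fst_Y: "fst \<in> borel_measurable (baire Y)"
  by (intro borel_measurable_baire_continuous continuous_on_fst continuous_on_id)

lemma measurable_y_Y: "(\<lambda>p. fst (snd p)) \<in> measurable (baire Y) (baire X)"
  by (intro measurable_baire_continuous continuous_on_fst continuous_on_snd continuous_on_id) (auto simp: Y_def)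

lemma measurable_z_Y: "(\<lambda>p. snd (snd p)) \<in> measurable (baire Y) (baire X)"
  by (intro measurable_baire_continuous continuous_on_snd continuous_on_id) (auto simp: Y_def)

text \<open>The triples in the compact space \<open>Y\<close> that decompose their own combination;
  \<open>dec\<close> is the inverse of the combination map restricted to \<open>R\<close>.\<close>

definition R where "R = {p \<in> Y. (fst p \<noteq> 0 \<longrightarrow> fst (snd p) \<in> F) \<and> (fst p \<noteq> 1 \<longrightarrow> snd (snd p) \<in> G)}"

lemma R_baire: "R \<in> sets (baire Y)"
proof -
  have s: "{p \<in> space (baire Y). fst p = c} \<in> sets (baire Y)" for c
    using measurable_fst_Y by measurable
  have y: "{p \<in> space (baire Y). fst (snd p) \<in> F} \<in> sets (baire Y)"
    using measurable_sets[OF measurable_y_Y F_baire] by (simp add: vimage_def Int_def conj_commute)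
  have z: "{p \<in> space (baire Y). snd (snd p) \<in> G} \<in> sets (baire Y)"
    using measurable_sets[OF measurable_z_Y G_baire] by (simp add: vimage_def Int_def conj_commute)
  have "R = ({p \<in> space (baire Y). fst p = 0} \<union> {p \<in> space (baire Y). fst (snd p) \<in> F}) \<inter>
      ({p \<in> space (baire Y). fst p = 1} \<union> {p \<in> space (baire Y). snd (snd p) \<in> G})"
    by (auto simp: R_def)
  also have "\<dots> \<in> sets (baire Y)" by (intro sets.Int sets.Un s y z)
  finally show ?thesis .
qed

lemma dec_iff: "dec x p \<longleftrightarrow> p \<in> R \<and> x = fst p *\<^sub>R fst (snd p) + (1 - fst p) *\<^sub>R snd (snd p)"
  by (auto simp: dec_def R_def Y_def)

text \<open>The sets where the composite exceeds, resp. does not exceed, a given value are complementary images of Baire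
  sets, hence analytic, and by Lusin separation both are Baire.\<close>

lemma measurable_decomposition:
  assumes W: "W \<in> borel_measurable (baire Y)"
    and inv: "\<And>x p q. x \<in> X \<Longrightarrow> dec x p \<Longrightarrow> dec x q \<Longrightarrow> W p = (W q :: real)"
  shows "(\<lambda>x. W (D x)) \<in> borel_measurable (baire X)"
proof (rule borel_measurableI_le)
  fix c
  let ?\<pi> = "\<lambda>p :: real \<times> 'a \<times> 'a. fst p *\<^sub>R fst (snd p) + (1 - fst p) *\<^sub>R snd (snd p)"
  have \<pi>X: "?\<pi> p \<in> X" if "p \<in> Y" for p
    using that by (intro convexD[OF convex_X]) (auto simp: Y_def)
  have RY: "R \<subseteq> Y" by (auto simp: R_def)
  let ?A = "{p \<in> R. W p \<le> c}" and ?B = "{p \<in> R. c < W p}"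
  have "{p \<in> space (baire Y). W p \<le> c} \<in> sets (baire Y)" "{p \<in> space (baire Y). c < W p} \<in> sets (baire Y)"
    using W by measurable
  then have "R \<inter> {p \<in> space (baire Y). W p \<le> c} \<in> sets (baire Y)" "R \<inter> {p \<in> space (baire Y). c < W p} \<in> sets (baire Y)"
    using R_baire by blast+
  moreover have "R \<inter> {p \<in> space (baire Y). W p \<le> c} = ?A" "R \<inter> {p \<in> space (baire Y). c < W p} = ?B"
    using RY by auto
  ultimately have AB: "analytic ?A" "analytic ?B" using baire_analytic[OF compact_Y] by auto
  have im: "?\<pi> ` ?A = {x \<in> X. W (D x) \<le> c}" "?\<pi> ` ?B = {x \<in> X. c < W (D x)}"
  proof -
    \<comment> \<open>By invariance, \<open>W\<close> at any triple of \<open>R\<close> is its value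
      at the chosen decomposition of the represented point; this makes the two images
      disjoint.\<close>
    have Wp: "W p = W (D (?\<pi> p)) \<and> ?\<pi> p \<in> X" if p: "p \<in> R" for p
    proof -
      have x: "?\<pi> p \<in> X" using \<pi>X p RY by auto
      have "dec (?\<pi> p) p" using p by (simp add: dec_iff)
      then show ?thesis using inv[OF x _ dec_D[OF x]] x by blast
    qed
    have DR: "D x \<in> R \<and> x = ?\<pi> (D x)" if "x \<in> X" for x using dec_D[OF that] by (simp add: dec_iff)
    show "?\<pi> ` ?A = {x \<in> X. W (D x) \<le> c}"
    proof (intro equalityI subsetI)
      fix x assume "x \<in> ?\<pi> ` ?A"
      then obtain p where p: "p \<in> R" "W p \<le> c" "x = ?\<pi> p" by blast
      show "x \<in> {x \<in> X. W (D x) \<le> c}" using Wp[OF p(1)] p(2) unfolding p(3) by simp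
    next
      fix x assume x: "x \<in> {x \<in> X. W (D x) \<le> c}"
      then show "x \<in> ?\<pi> ` ?A" using DR[of x] by (intro image_eqI[of _ _ "D x"]) auto
    qed
    show "?\<pi> ` ?B = {x \<in> X. c < W (D x)}"
    proof (intro equalityI subsetI)
      fix x assume "x \<in> ?\<pi> ` ?B"
      then obtain p where p: "p \<in> R" "c < W p" "x = ?\<pi> p" by blast
      show "x \<in> {x \<in> X. c < W (D x)}" using Wp[OF p(1)] p(2) unfolding p(3) by simp
    next
      fix x assume x: "x \<in> {x \<in> X. c < W (D x)}"
      then show "x \<in> ?\<pi> ` ?B" using DR[of x] by (intro image_eqI[of _ _ "D x"]) auto
    qed
  qed
  have "analytic (?\<pi> ` ?A)" "analytic (?\<pi> ` ?B)"
    by (rule analytic_image[OF AB(1) _ compact_Y continuous_on_comb], use RY in blast)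
       (rule analytic_image[OF AB(2) _ compact_Y continuous_on_comb], use RY in blast)
  then have "analytic {x \<in> X. W (D x) \<le> c}" "analytic {x \<in> X. c < W (D x)}" unfolding im by auto
  moreover have "X - {x \<in> X. W (D x) \<le> c} = {x \<in> X. c < W (D x)}" by auto
  ultimately have "{x \<in> X. W (D x) \<le> c} \<in> sets (baire X)"
    by (intro analytic_coanalytic_baire compact_X) auto
  then show "{x \<in> space (baire X). W (D x) \<le> c} \<in> sets (baire X)" by simp
qed

lemma measurable_lambda: "lam \<in> borel_measurable (baire X)"
proof -
  have "(\<lambda>x. fst (D x)) \<in> borel_measurable (baire X)"
  proof (rule measurable_decomposition[OF measurable_fst_Y])
    show "fst p = fst q" if "x \<in> X" "dec x p" "dec x q" for x p q
      using that by (rule dec_unique_pair(1))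
  qed
  then show ?thesis by (simp add: lam_def[abs_def])
qed

text \<open>When the weight vanishes the component in \<open>D\<close> is arbitrary; the default
  \<open>x\<close> makes \<open>pr1\<close> a Baire map from \<open>X\<close> to itself.\<close>

definition pr1 where "pr1 x = (if lam x = 0 then x else fst (snd (D x)))"
definition pr2 where "pr2 x = (if lam x = 1 then x else snd (snd (D x)))"

lemma pr_X: "x \<in> X \<Longrightarrow> pr1 x \<in> X" "x \<in> X \<Longrightarrow> pr2 x \<in> X"
  using dec_D'[of x] by (auto simp: pr1_def pr2_def dec_def split_beta)

lemma pr_FG: "x \<in> X \<Longrightarrow> lam x \<noteq> 0 \<Longrightarrow> pr1 x \<in> F" "x \<in> X \<Longrightarrow> lam x \<noteq> 1 \<Longrightarrow> pr2 x \<in> G"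
  using dec_D'[of x] by (auto simp: pr1_def pr2_def dec_def split_beta)

lemma pr_comb: "x \<in> X \<Longrightarrow> x = lam x *\<^sub>R pr1 x + (1 - lam x) *\<^sub>R pr2 x"
  using dec_D'[of x] by (auto simp: pr1_def pr2_def dec_def)

lemma pr1_eq: "x \<in> X \<Longrightarrow> dec x (t, y, z) \<Longrightarrow> lam x = t \<and> (t \<noteq> 0 \<longrightarrow> pr1 x = y)"
  using dec_unique[OF _ dec_D', of x t y z] by (auto simp: pr1_def)

text \<open>The product of the weight with the indicator of \<open>B\<close> at the component does
  not depend on the decomposition, since the weight kills the ambiguous case.\<close>

lemma measurable_pr1: "pr1 \<in> measurable (baire X) (baire X)"
proof (rule measurableI)
  fix B assume B: "B \<in> sets (baire X)"
  let ?W = "\<lambda>p. fst p * indicator B (fst (snd p)) :: real"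
  have "?W \<in> borel_measurable (baire Y)"
    by (intro borel_measurable_times measurable_fst_Y measurable_compose[OF measurable_y_Y borel_measurable_indicator[OF B]])
  then have "(\<lambda>x. ?W (D x)) \<in> borel_measurable (baire X)"
  proof (rule measurable_decomposition)
    show "?W p = ?W q" if "x \<in> X" "dec x p" "dec x q" for x p q
      using dec_unique_pair(1,2)[OF that] by (cases "fst p = 0") auto
  qed
  then have "{x \<in> space (baire X). ?W (D x) \<noteq> 0} \<in> sets (baire X)" by measurable
  moreover have "{x \<in> space (baire X). lam x = 0} \<in> sets (baire X)" using measurable_lambda by measurable
  ultimately have "{x \<in> space (baire X). ?W (D x) \<noteq> 0} \<union> ({x \<in> space (baire X). lam x = 0} \<inter> B) \<in> sets (baire X)"
    using B by (intro sets.Un sets.Int)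
  moreover have "pr1 -` B \<inter> space (baire X) =
      {x \<in> space (baire X). ?W (D x) \<noteq> 0} \<union> ({x \<in> space (baire X). lam x = 0} \<inter> B)"
    by (auto simp: pr1_def lam_def indicator_def split: if_splits)
  ultimately show "pr1 -` B \<inter> space (baire X) \<in> sets (baire X)" by simp
qed (simp add: pr_X)

lemma measurable_pr2: "pr2 \<in> measurable (baire X) (baire X)"
proof (rule measurableI)
  fix B assume B: "B \<in> sets (baire X)"
  let ?W = "\<lambda>p. (1 - fst p) * indicator B (snd (snd p)) :: real"
  have "?W \<in> borel_measurable (baire Y)"
    by (intro borel_measurable_times borel_measurable_diff borel_measurable_const measurable_fst_Y
        measurable_compose[OF measurable_z_Y borel_measurable_indicator[OF B]])
  then have "(\<lambda>x. ?W (D x)) \<in> borel_measurable (baire X)"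
  proof (rule measurable_decomposition)
    show "?W p = ?W q" if "x \<in> X" "dec x p" "dec x q" for x p q
      using dec_unique_pair(1,3)[OF that] by (cases "fst p = 1") auto
  qed
  then have "{x \<in> space (baire X). ?W (D x) \<noteq> 0} \<in> sets (baire X)" by measurable
  moreover have "{x \<in> space (baire X). lam x = 1} \<in> sets (baire X)" using measurable_lambda by measurable
  ultimately have "{x \<in> space (baire X). ?W (D x) \<noteq> 0} \<union> ({x \<in> space (baire X). lam x = 1} \<inter> B) \<in> sets (baire X)"
    using B by (intro sets.Un sets.Int)
  moreover have "pr2 -` B \<inter> space (baire X) =
      {x \<in> space (baire X). ?W (D x) \<noteq> 0} \<union> ({x \<in> space (baire X). lam x = 1} \<inter> B)"
    by (auto simp: pr2_def lam_def indicator_def split: if_splits)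
  ultimately show "pr2 -` B \<inter> space (baire X) \<in> sets (baire X)" by simp
qed (simp add: pr_X)

lemma measure_convexD:
  "measure_convex X A \<Longrightarrow> \<mu> \<in> M1 X \<Longrightarrow> barycenter X \<mu> x \<Longrightarrow> measure \<mu> A = 1 \<Longrightarrow> x \<in> A"
  unfolding measure_convex_def by blast

text \<open>If \<open>x\<close> is the barycenter of \<open>\<mu>\<close>, then the images of \<open>lam \<cdot> \<mu>\<close> under \<open>pr1\<close> and of \<open>(1 - lam) \<cdot> \<mu>\<close> under \<open>pr2\<close> are carried by
  \<open>F\<close> and \<open>G\<close>; by measure convexity their barycenters form the decomposition of \<open>x\<close>.\<close>

theorem lambda_mult_sa_baire:
  assumes a: "a \<in> sa_baire"
  shows "(\<lambda>x\<in>X. lam x * a (pr1 x)) \<in> sa_baire"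
proof (rule sa_baire_restrictI)
  let ?b = "\<lambda>x. lam x * a (pr1 x)"
  note apm = measurable_compose[OF measurable_pr1 sa_baireD(2)[OF a]]
  show bm: "?b \<in> borel_measurable (baire X)"
    by (intro borel_measurable_times measurable_lambda apm)
  obtain B where B: "B \<ge> 0" "\<And>x. x \<in> X \<Longrightarrow> \<bar>a x\<bar> \<le> B" using sa_baire_bounded[OF a] by blast
  fix \<mu> x assume \<mu>: "\<mu> \<in> M1 X" and bx: "barycenter X \<mu> x"
  interpret prob_space \<mu> by (rule prob_space_M1[OF \<mu>])
  note sp = space_M1[OF \<mu>]
  have xX: "x \<in> X" by (rule barycenter_in[OF bx])
  have bi: "integrable \<mu> ?b"
  proof (rule integrable_bounded_baire[OF \<mu> bm])
    fix v assume v: "v \<in> X"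
    have "\<bar>lam v * a (pr1 v)\<bar> \<le> 1 * B"
      unfolding abs_mult using lambda_01[OF v] B pr_X[OF v] by (intro mult_mono) auto
    then show "\<bar>lam v * a (pr1 v)\<bar> \<le> B" by simp
  qed
  have li: "integrable \<mu> lam"
    by (rule integrable_bounded_baire[OF \<mu> measurable_lambda, of 1]) (use lambda_01 in auto)
  define c where "c = (\<integral>v. lam v \<partial>\<mu>)"
  have l0: "AE v in \<mu>. 0 \<le> lam v" and l1: "AE v in \<mu>. 0 \<le> 1 - lam v"
    using lambda_01 sp by (auto intro!: AE_I2)
  have c01: "0 \<le> c" "c \<le> 1"
  proof -
    show "0 \<le> c" unfolding c_def by (rule integral_nonneg_AE[OF l0])
    have "0 \<le> (\<integral>v. 1 - lam v \<partial>\<mu>)" by (rule integral_nonneg_AE[OF l1])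
    then show "c \<le> 1" using li by (simp add: c_def prob_space)
  qed
  have sF: "F \<in> sets \<mu>" "G \<in> sets \<mu>" using F_baire G_baire baire_subset_sets_M1[OF \<mu>] by auto
  have bm\<mu>: "?b \<in> borel_measurable \<mu>" "a \<in> borel_measurable \<mu>"
    using borel_measurable_M1_baire[OF \<mu> bm] borel_measurable_M1_baire[OF \<mu> sa_baireD(2)[OF a]] by auto
  have aeX: "AE v in \<mu>. v \<in> X" using sp by (intro AE_I2) simp
  \<comment> \<open>In the first two cases one weight has mass 0 and cannot be normalized; then
    \<open>\<mu>\<close> is carried by \<open>G\<close> or by \<open>F\<close>, and measure
    convexity places \<open>x\<close> there.\<close>
  consider "c = 0" | "c = 1" | "0 < c" "c < 1" using c01 by linarith
  then have "(\<integral>v. ?b v \<partial>\<mu>) = ?b x"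
  proof cases
    case 1
    then have ae: "AE v in \<mu>. lam v = 0" using integral_nonneg_eq_0_iff_AE[OF li l0] by (simp add: c_def)
    then have "AE v in \<mu>. v \<in> G" using aeX by eventually_elim (use lambda_eq_0 in blast)
    then have "x \<in> G" using measure_convexD[OF G_mc \<mu> bx] prob_eq_1[OF sF(2)] by simp
    then have "?b x = 0" using lambda_eq_0[OF xX] by simp
    moreover have "(\<integral>v. ?b v \<partial>\<mu>) = (\<integral>v. 0 \<partial>\<mu>)"
      using ae bm\<mu> by (intro integral_cong_AE) auto
    ultimately show ?thesis by simp
  next
    case 2
    have i: "integrable \<mu> (\<lambda>v. 1 - lam v)" using li by simp
    have "(\<integral>v. 1 - lam v \<partial>\<mu>) = 0" using 2 li by (simp add: c_def prob_space)
    then have ae: "AE v in \<mu>. 1 - lam v = 0" using integral_nonneg_eq_0_iff_AE[OF i l1] by simp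
    then have aeF: "AE v in \<mu>. v \<in> F" using aeX by eventually_elim (use lambda_eq_1 in auto)
    then have xF: "x \<in> F" using measure_convexD[OF F_mc \<mu> bx] prob_eq_1[OF sF(1)] by simp
    have bF: "?b v = a v" if v: "v \<in> F" for v
    proof -
      have "v \<in> X" using v FG by auto
      then show ?thesis using dec_F[OF v dec_D'] by (auto simp: pr1_def)
    qed
    have "(\<integral>v. ?b v \<partial>\<mu>) = (\<integral>v. a v \<partial>\<mu>)"
      using aeF bm\<mu> by (intro integral_cong_AE) (auto simp: bF elim!: AE_mp)
    then show ?thesis using sa_baireD(4)[OF a \<mu> bx] bF[OF xF] by simp
  next
    case 3
    define w1 where "w1 = (\<lambda>v. lam v / c)"
    define w2 where "w2 = (\<lambda>v. (1 - lam v) / (1 - c))"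
    have w1: "w1 \<in> borel_measurable (baire X)" "\<And>v. v \<in> X \<Longrightarrow> 0 \<le> w1 v" "integrable \<mu> w1" "(\<integral>v. w1 v \<partial>\<mu>) = 1"
      using measurable_lambda lambda_01 li 3 by (auto simp: w1_def c_def[symmetric])
    have w2: "w2 \<in> borel_measurable (baire X)" "\<And>v. v \<in> X \<Longrightarrow> 0 \<le> w2 v" "integrable \<mu> w2" "(\<integral>v. w2 v \<partial>\<mu>) = 1"
      using measurable_lambda lambda_01 li 3 by (auto simp: w2_def c_def[symmetric] prob_space)
    obtain \<nu>1 where \<nu>1: "\<nu>1 \<in> M1 X"
      "\<And>g :: 'a \<Rightarrow> real. g \<in> borel_measurable (baire X) \<Longrightarrow> (\<integral>v. g v \<partial>\<nu>1) = (\<integral>v. w1 v * g (pr1 v) \<partial>\<mu>)"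
      using weighted_image[OF \<mu> w1 measurable_pr1] by blast
    obtain \<nu>2 where \<nu>2: "\<nu>2 \<in> M1 X"
      "\<And>g :: 'a \<Rightarrow> real. g \<in> borel_measurable (baire X) \<Longrightarrow> (\<integral>v. g v \<partial>\<nu>2) = (\<integral>v. w2 v * g (pr2 v) \<partial>\<mu>)"
      using weighted_image[OF \<mu> w2 measurable_pr2] by blast
    obtain y where y: "barycenter X \<nu>1 y" using ex_barycenter_M1[OF \<nu>1(1)] .
    obtain z where z: "barycenter X \<nu>2 z" using ex_barycenter_M1[OF \<nu>2(1)] .
    \<comment> \<open>\<open>pr1\<close> may leave \<open>F\<close> only where \<open>lam\<close>
      vanishes, and \<open>w1\<close> vanishes there as well.\<close>
    have "measure \<nu>1 F = (\<integral>v. indicator F v \<partial>\<nu>1)"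
      using F_baire baire_subset_sets_M1[OF \<nu>1(1)] FG space_M1[OF \<nu>1(1)] by (auto simp: Int_absorb2)
    also have "\<dots> = (\<integral>v. w1 v * indicator F (pr1 v) \<partial>\<mu>)" using F_baire by (intro \<nu>1(2)) auto
    also have "\<dots> = (\<integral>v. w1 v \<partial>\<mu>)"
      by (intro Bochner_Integration.integral_cong) (use pr_FG sp in \<open>auto simp: w1_def indicator_def\<close>)
    finally have "y \<in> F" using measure_convexD[OF F_mc \<nu>1(1) y] w1(4) by simp
    have "measure \<nu>2 G = (\<integral>v. indicator G v \<partial>\<nu>2)"
      using G_baire baire_subset_sets_M1[OF \<nu>2(1)] FG space_M1[OF \<nu>2(1)] by (auto simp: Int_absorb2)
    also have "\<dots> = (\<integral>v. w2 v * indicator G (pr2 v) \<partial>\<mu>)" using G_baire by (intro \<nu>2(2)) auto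
    also have "\<dots> = (\<integral>v. w2 v \<partial>\<mu>)"
      by (intro Bochner_Integration.integral_cong) (use pr_FG sp in \<open>auto simp: w2_def indicator_def\<close>)
    finally have "z \<in> G" using measure_convexD[OF G_mc \<nu>2(1) z] w2(4) by simp
    have yz: "y \<in> X" "z \<in> X" using \<open>y \<in> F\<close> \<open>z \<in> G\<close> FG by auto
    have c1: "c * (w1 v * r) = lam v * r" "(1 - c) * (w2 v * r) = (1 - lam v) * r" for v r
      using 3 by (simp_all add: w1_def w2_def)
    have "x = c *\<^sub>R y + (1 - c) *\<^sub>R z"
    proof (rule convex_comb_eqI[OF xX yz c01])
      fix h assume h: "h \<in> A_c X"
      note hH = subsetD[OF A_c_subset_sa_baire h]
      obtain C where C: "C \<ge> 0" "\<And>x. x \<in> X \<Longrightarrow> \<bar>h x\<bar> \<le> C" using sa_baire_bounded[OF hH] by blast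
      have m1: "(\<lambda>v. lam v * h (pr1 v)) \<in> borel_measurable (baire X)"
        by (intro borel_measurable_times measurable_lambda measurable_compose[OF measurable_pr1 sa_baireD(2)[OF hH]])
      have m2: "(\<lambda>v. (1 - lam v) * h (pr2 v)) \<in> borel_measurable (baire X)"
        by (intro borel_measurable_times borel_measurable_diff borel_measurable_const measurable_lambda
            measurable_compose[OF measurable_pr2 sa_baireD(2)[OF hH]])
      have i1: "integrable \<mu> (\<lambda>v. lam v * h (pr1 v))"
      proof (rule integrable_bounded_baire[OF \<mu> m1])
        fix v assume v: "v \<in> X"
        show "\<bar>lam v * h (pr1 v)\<bar> \<le> 1 * C"
          unfolding abs_mult using lambda_01[OF v] C pr_X[OF v] by (intro mult_mono) auto
      qed
      have i2: "integrable \<mu> (\<lambda>v. (1 - lam v) * h (pr2 v))"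
      proof (rule integrable_bounded_baire[OF \<mu> m2])
        fix v assume v: "v \<in> X"
        show "\<bar>(1 - lam v) * h (pr2 v)\<bar> \<le> 1 * C"
          unfolding abs_mult using lambda_01[OF v] C pr_X[OF v] by (intro mult_mono) auto
      qed
      have "h x = (\<integral>v. h v \<partial>\<mu>)" using sa_baireD(4)[OF hH \<mu> bx] by simp
      also have "\<dots> = (\<integral>v. lam v * h (pr1 v) + (1 - lam v) * h (pr2 v) \<partial>\<mu>)"
      proof (rule Bochner_Integration.integral_cong[OF refl])
        fix v assume "v \<in> space \<mu>"
        then have v: "v \<in> X" using sp by simp
        have "h (lam v *\<^sub>R pr1 v + (1 - lam v) *\<^sub>R pr2 v) = lam v * h (pr1 v) + (1 - lam v) * h (pr2 v)"
          by (rule sa_baire_comb[OF hH pr_X[OF v] lambda_01[OF v]])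
        then show "h v = lam v * h (pr1 v) + (1 - lam v) * h (pr2 v)" using pr_comb[OF v] by simp
      qed
      also have "\<dots> = (\<integral>v. lam v * h (pr1 v) \<partial>\<mu>) + (\<integral>v. (1 - lam v) * h (pr2 v) \<partial>\<mu>)"
        by (rule Bochner_Integration.integral_add[OF i1 i2])
      also have "(\<integral>v. lam v * h (pr1 v) \<partial>\<mu>) = c * h y"
        using sa_baireD(4)[OF hH \<nu>1(1) y] \<nu>1(2)[OF sa_baireD(2)[OF hH]]
          integral_mult_right_zero[of \<mu> c "\<lambda>v. w1 v * h (pr1 v)"] by (simp only: c1)
      also have "(\<integral>v. (1 - lam v) * h (pr2 v) \<partial>\<mu>) = (1 - c) * h z"
        using sa_baireD(4)[OF hH \<nu>2(1) z] \<nu>2(2)[OF sa_baireD(2)[OF hH]]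
          integral_mult_right_zero[of \<mu> "1 - c" "\<lambda>v. w2 v * h (pr2 v)"] by (simp only: c1)
      finally show "h x = c * h y + (1 - c) * h z" .
    qed
    \<comment> \<open>Uniqueness of decompositions now identifies \<open>c\<close> with
      \<open>lam x\<close> and \<open>y\<close> with \<open>pr1 x\<close>, which turns the integral
      formula into strong affinity at \<open>x\<close>.\<close>
    then have "dec x (c, y, z)" using \<open>y \<in> F\<close> \<open>z \<in> G\<close> yz c01 by (simp add: dec_def)
    then have "lam x = c" "pr1 x = y" using pr1_eq[OF xX] 3 by auto
    moreover have "(\<integral>v. ?b v \<partial>\<mu>) = c * a y"
      using sa_baireD(4)[OF a \<nu>1(1) y] \<nu>1(2)[OF sa_baireD(2)[OF a]]
        integral_mult_right_zero[of \<mu> c "\<lambda>v. w1 v * a (pr1 v)"] by (simp only: c1)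
    ultimately show ?thesis by simp
  qed
  then show "integrable \<mu> ?b \<and> (\<integral>v. ?b v \<partial>\<mu>) = ?b x" using bi by simp
qed

lemma ext_subset: "ext_points X \<subseteq> F \<union> G"
proof
  fix e assume e: "e \<in> ext_points X"
  have eX: "e \<in> X" by (rule ext_in[OF e])
  show "e \<in> F \<union> G"
  proof (rule ccontr)
    assume "e \<notin> F \<union> G"
    then have l: "lam e \<noteq> 0" "lam e \<noteq> 1" using lambda_eq_0[OF eX] lambda_eq_1[OF eX] by auto
    then have "0 < lam e" "lam e < 1" using lambda_01[OF eX] by auto
    then have "pr1 e = e" using extreme_point_combD(1)[OF _ pr_X[OF eX] _ _ pr_comb[OF eX]] e by blast
    then show False using pr_FG(1)[OF eX l(1)] \<open>e \<notin> F \<union> G\<close> by simp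
  qed
qed

lemma split_lambda_eq: "split_lambda X F = restrict lam X"
proof
  fix x
  show "split_lambda X F x = restrict lam X x"
  proof (cases "x \<in> X - (F \<union> G)")
    case True
    then have xX: "x \<in> X" by simp
    have l: "lam x \<noteq> 0" "lam x \<noteq> 1" using lambda_eq_0[OF xX] lambda_eq_1[OF xX] True by auto
    have "(THE t. t \<in> {0<..<1} \<and> (\<exists>y\<in>F. \<exists>z\<in>G. x = t *\<^sub>R y + (1 - t) *\<^sub>R z)) = lam x"
    proof (rule the_equality)
      show "lam x \<in> {0<..<1} \<and> (\<exists>y\<in>F. \<exists>z\<in>G. x = lam x *\<^sub>R y + (1 - lam x) *\<^sub>R z)"
        using pr_FG[OF xX] pr_comb[OF xX] l lambda_01[OF xX] by (auto simp: less_le)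
      fix t assume t: "t \<in> {0<..<1} \<and> (\<exists>y\<in>F. \<exists>z\<in>G. x = t *\<^sub>R y + (1 - t) *\<^sub>R z)"
      then obtain y z where yz: "y \<in> F" "z \<in> G" "x = t *\<^sub>R y + (1 - t) *\<^sub>R z" by blast
      then have "dec x (t, y, z)" using t FG by (auto simp: dec_def)
      then show "t = lam x" using pr1_eq[OF xX] by simp
    qed
    then show ?thesis using True by (simp add: split_lambda_def)
  next
    case False
    then show ?thesis
      using lambda_eq_0[of x] lambda_eq_1[of x] by (auto simp: split_lambda_def)
  qed
qed

lemma split_lambda_sa_baire: "split_lambda X F \<in> sa_baire"
proof -
  have "(\<lambda>x\<in>X. lam x * (\<lambda>x\<in>X. 1) (pr1 x)) \<in> sa_baire"
    by (rule lambda_mult_sa_baire[OF subsetD[OF A_c_subset_sa_baire const_in_A_c]])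
  also have "(\<lambda>x\<in>X. lam x * (\<lambda>x\<in>X. 1) (pr1 x)) = split_lambda X F"
    unfolding split_lambda_eq by (rule restrict_ext) (simp add: pr_X)
  finally show ?thesis .
qed

lemma split_lambda_ext: "e \<in> ext_points X \<Longrightarrow> split_lambda X F e = indicator F e"
  using ext_subset FG(3) lambda_eq_0[of e] lambda_eq_1[of e] ext_in[of e]
  by (auto simp: split_lambda_eq indicator_def)

lemma split_mult_sa_baire:
  assumes a: "a \<in> sa_baire"
  shows "\<exists>b\<in>sa_baire. \<forall>e\<in>ext_points X. b e = indicator F e * a e"
proof (intro bexI ballI)
  show "(\<lambda>x\<in>X. lam x * a (pr1 x)) \<in> sa_baire" by (rule lambda_mult_sa_baire[OF a])
  fix e assume e: "e \<in> ext_points X"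
  have eX: "e \<in> X" by (rule ext_in[OF e])
  show "(\<lambda>x\<in>X. lam x * a (pr1 x)) e = indicator F e * a e"
  proof (cases "e \<in> F")
    case True
    then show ?thesis using dec_F[OF True dec_D'[OF eX]] eX by (simp add: pr1_def)
  next
    case False
    then have "lam e = 0" using ext_subset e lambda_eq_0[OF eX] by auto
    then show ?thesis using False eX by simp
  qed
qed

lemma split_lambda_multiplier: "split_lambda X F \<in> multipliers X sa_baire"
  using split_lambda_sa_baire split_mult_sa_baire split_lambda_ext unfolding multipliers_def by simp

end

section \<open>From multipliers to split faces\<close>

context compact_convex
begin

text \<open>By Stone--Weierstrass the functions \<open>\<phi>\<close> with \<open>\<phi> (u) \<cdot> a\<close> extending to an element of \<open>sa_baire\<close> include all continuous
  ones, and bounded pointwise limits then give the indicators of the sets \<open>{u > c}\<close>.\<close>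

lemma multiplier_indicator:
  assumes H: "A_c X \<subseteq> H" "H \<subseteq> sa_baire"
    and add: "\<And>f g. f \<in> H \<Longrightarrow> g \<in> H \<Longrightarrow> (\<lambda>x\<in>X. f x + g x) \<in> H"
    and scale: "\<And>c f. f \<in> H \<Longrightarrow> (\<lambda>x\<in>X. c * f x) \<in> H"
    and u: "u \<in> multipliers X H" and a: "a \<in> H"
  shows "\<exists>b\<in>sa_baire. \<forall>e\<in>ext_points X. b e = (if c < u e then 1 else 0) * a e"
proof -
  have uH: "u \<in> H" and um: "\<And>a. a \<in> H \<Longrightarrow> \<exists>b\<in>H. \<forall>x\<in>ext_points X. b x = u x * a x"
    using u by (auto simp: multipliers_def)
  obtain B where B: "B \<ge> 0" "\<And>x. x \<in> X \<Longrightarrow> \<bar>u x\<bar> \<le> B" using sa_baire_bounded H(2) uH by blast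
  have uB: "u e \<in> {-B..B}" if "e \<in> ext_points X" for e using B(2)[OF ext_in[OF that]] by auto
  obtain A where A: "A \<ge> 0" "\<And>x. x \<in> X \<Longrightarrow> \<bar>a x\<bar> \<le> A" using sa_baire_bounded H(2) a by blast
  \<comment> \<open>Quantifying over all \<open>a\<close> in \<open>H\<close> is what closes
    \<open>R\<close> under products: the multiplications are performed one after the other.\<close>
  define R where "R = {\<phi> :: real \<Rightarrow> real. continuous_on {-B..B} \<phi> \<and>
    (\<forall>a\<in>H. \<exists>b\<in>H. \<forall>e\<in>ext_points X. b e = \<phi> (u e) * a e)}"
  interpret R: function_ring_on R "{-B..B}"
  proof
    show "compact {-B..B}" by simp
    show "continuous_on {-B..B} \<phi>" if "\<phi> \<in> R" for \<phi> using that by (simp add: R_def)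
    show "(\<lambda>x. \<phi> x + \<psi> x) \<in> R" if "\<phi> \<in> R" "\<psi> \<in> R" for \<phi> \<psi>
      unfolding R_def
    proof (intro CollectI conjI ballI)
      show "continuous_on {-B..B} (\<lambda>x. \<phi> x + \<psi> x)" using that by (auto simp: R_def intro!: continuous_intros)
      fix a assume a: "a \<in> H"
      obtain b where b: "b \<in> H" "\<forall>e\<in>ext_points X. b e = \<phi> (u e) * a e" using \<open>\<phi> \<in> R\<close> a unfolding R_def by blast
      obtain d where d: "d \<in> H" "\<forall>e\<in>ext_points X. d e = \<psi> (u e) * a e" using \<open>\<psi> \<in> R\<close> a unfolding R_def by blast
      show "\<exists>b\<in>H. \<forall>e\<in>ext_points X. b e = (\<phi> (u e) + \<psi> (u e)) * a e"
        by (rule bexI[OF _ add[OF b(1) d(1)]]) (use b(2) d(2) ext_in in \<open>auto simp: distrib_right\<close>)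
    qed
    show "(\<lambda>x. \<phi> x * \<psi> x) \<in> R" if "\<phi> \<in> R" "\<psi> \<in> R" for \<phi> \<psi>
      unfolding R_def
    proof (intro CollectI conjI ballI)
      show "continuous_on {-B..B} (\<lambda>x. \<phi> x * \<psi> x)" using that by (auto simp: R_def intro!: continuous_intros)
      fix a assume a: "a \<in> H"
      obtain b where b: "b \<in> H" "\<forall>e\<in>ext_points X. b e = \<psi> (u e) * a e" using \<open>\<psi> \<in> R\<close> a unfolding R_def by blast
      obtain d where d: "d \<in> H" "\<forall>e\<in>ext_points X. d e = \<phi> (u e) * b e" using \<open>\<phi> \<in> R\<close> b(1) unfolding R_def by blast
      show "\<exists>b\<in>H. \<forall>e\<in>ext_points X. b e = \<phi> (u e) * \<psi> (u e) * a e"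
        using b(2) d by (intro bexI[of _ d]) auto
    qed
    show "(\<lambda>_. r) \<in> R" for r
      unfolding R_def
    proof (intro CollectI conjI ballI continuous_on_const)
      fix a assume a: "a \<in> H"
      show "\<exists>b\<in>H. \<forall>e\<in>ext_points X. b e = r * a e"
        by (rule bexI[OF _ scale[OF a, of r]]) (use ext_in in auto)
    qed
    have "(\<lambda>x. x) \<in> R" using um by (auto simp: R_def intro!: continuous_intros)
    then show "\<exists>f\<in>R. f x \<noteq> f y" if "x \<noteq> y" for x y using that by (intro bexI[of _ "\<lambda>x. x"])
  qed
  \<comment> \<open>\<open>H\<close> is not assumed closed under limits, so from here on the
    products are found in \<open>sa_baire\<close>.\<close>
  have cont: "\<exists>b\<in>sa_baire. \<forall>e\<in>ext_points X. b e = \<phi> (u e) * a e" if \<phi>: "continuous_on {-B..B} \<phi>" for \<phi>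
  proof -
    have "\<exists>\<psi>\<in>R. \<forall>s\<in>{-B..B}. \<bar>\<phi> s - \<psi> s\<bar> < inverse (real (Suc n))" for n
      by (rule R.Stone_Weierstrass_basic[OF \<phi>]) simp
    then obtain \<psi> where \<psi>: "\<And>n. \<psi> n \<in> R" "\<And>n s. s \<in> {-B..B} \<Longrightarrow> \<bar>\<phi> s - \<psi> n s\<bar> < inverse (real (Suc n))" by metis
    have "\<exists>b\<in>H. \<forall>e\<in>ext_points X. b e = \<psi> n (u e) * a e" for n using \<psi>(1)[of n] a unfolding R_def by blast
    then obtain b where b: "\<And>n. b n \<in> H" "\<And>n e. e \<in> ext_points X \<Longrightarrow> b n e = \<psi> n (u e) * a e" by metis
    have "bounded (\<phi> ` {-B..B})" using compact_continuous_image[OF \<phi>] by (intro compact_imp_bounded) simp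
    then obtain C where C': "\<forall>s\<in>{-B..B}. \<bar>\<phi> s\<bar> \<le> C" by (auto simp: bounded_iff)
    have C: "\<bar>\<phi> s\<bar> \<le> C" if "s \<in> {-B..B}" for s by (rule bspec[OF C' that])
    have lim: "(\<lambda>n. b n e) \<longlonglongrightarrow> \<phi> (u e) * a e" if e: "e \<in> ext_points X" for e
    proof -
      have "(\<lambda>n. \<phi> (u e) - \<psi> n (u e)) \<longlonglongrightarrow> 0"
        by (rule tendsto_rabs_zero_cancel, rule real_tendsto_sandwich[OF _ _ tendsto_const LIMSEQ_inverse_real_of_nat])
          (use \<psi>(2)[OF uB[OF e]] in \<open>auto intro!: always_eventually less_imp_le\<close>)
      then have "(\<lambda>n. \<phi> (u e) - (\<phi> (u e) - \<psi> n (u e))) \<longlonglongrightarrow> \<phi> (u e) - 0" by (intro tendsto_intros)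
      then show ?thesis unfolding b(2)[OF e] by (intro tendsto_intros) simp
    qed
    have bound: "\<bar>b n e\<bar> \<le> (C + 1) * A" if e: "e \<in> ext_points X" for n e
    proof -
      have "inverse (real (Suc n)) \<le> 1" by (simp add: inverse_le_1_iff)
      then have "\<bar>\<psi> n (u e)\<bar> \<le> C + 1" using \<psi>(2)[OF uB[OF e], of n] C[OF uB[OF e]] by linarith
      then show ?thesis unfolding b(2)[OF e] abs_mult using A(1) A(2)[OF ext_in[OF e]] by (intro mult_mono) auto
    qed
    show ?thesis
    proof (rule sa_baire_limit_ext[OF subsetD[OF H(2) b(1)] bound lim])
      fix b' assume b': "b' \<in> sa_baire" "\<And>e. e \<in> ext_points X \<Longrightarrow> b' e = \<phi> (u e) * a e"
      show ?thesis by (rule bexI[OF _ b'(1)], rule ballI, rule b'(2))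
    qed
  qed
  \<comment> \<open>Continuous ramps with values in the unit interval, tending pointwise to the
    indicator of the half-line above \<open>c\<close>.\<close>
  define \<theta> where "\<theta> = (\<lambda>n s. min 1 (max 0 (real n * (s - c))))"
  have "\<exists>b\<in>sa_baire. \<forall>e\<in>ext_points X. b e = \<theta> n (u e) * a e" for n
    by (rule cont) (auto simp: \<theta>_def intro!: continuous_intros)
  then obtain b where b: "\<And>n. b n \<in> sa_baire" "\<And>n e. e \<in> ext_points X \<Longrightarrow> b n e = \<theta> n (u e) * a e" by metis
  have lim: "(\<lambda>n. b n e) \<longlonglongrightarrow> (if c < u e then 1 else 0) * a e" if e: "e \<in> ext_points X" for e
  proof -
    have "(\<lambda>n. \<theta> n (u e)) \<longlonglongrightarrow> (if c < u e then 1 else 0)"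
    proof (cases "c < u e")
      case True
      then obtain N :: nat where N: "1 < real N * (u e - c)" using reals_Archimedean3[of "u e - c"] by auto
      have "\<theta> n (u e) = 1" if "n \<ge> N" for n
      proof -
        have "real N * (u e - c) \<le> real n * (u e - c)" using that True by (intro mult_right_mono) auto
        then show ?thesis using N by (simp add: \<theta>_def)
      qed
      then have "\<forall>\<^sub>F n in sequentially. \<theta> n (u e) = 1" by (auto simp: eventually_sequentially)
      then show ?thesis using True by (simp add: tendsto_eventually)
    next
      case False
      then have "\<theta> n (u e) = 0" for n by (simp add: \<theta>_def mult_nonneg_nonpos)
      then show ?thesis using False by simp
    qed
    then show ?thesis unfolding b(2)[OF e] by (intro tendsto_intros)
  qed
  have bound: "\<bar>b n e\<bar> \<le> 1 * A" if e: "e \<in> ext_points X" for n e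
    unfolding b(2)[OF e] abs_mult using A(1) A(2)[OF ext_in[OF e]] by (intro mult_mono) (auto simp: \<theta>_def)
  show ?thesis
  proof (rule sa_baire_limit_ext[OF b(1) bound lim])
    fix b' assume b': "b' \<in> sa_baire" "\<And>e. e \<in> ext_points X \<Longrightarrow> b' e = (if c < u e then 1 else 0) * a e"
    show ?thesis by (rule bexI[OF _ b'(1)], rule ballI, rule b'(2))
  qed
qed

text \<open>The description of faces in part (a). It mentions no function space, which is what
  allows a multiplier of a subspace to be replaced by multipliers of
  \<open>sa_baire\<close>.\<close>

definition good_split_face :: "'a set \<Rightarrow> bool" where
  "good_split_face F \<longleftrightarrow> split_face X F \<and> F \<in> sets (baire X) \<and> measure_convex X F \<and>
     compl_face X F \<in> sets (baire X) \<and> measure_convex X (compl_face X F)"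

lemma good_split_faceD:
  "good_split_face F \<Longrightarrow> split_baire_face X F"
  using compact_convex_axioms
  by (simp add: good_split_face_def split_baire_face_def split_baire_face_axioms_def)

lemma good_split_face_indicator:
  assumes f: "f \<in> sa_baire" "\<And>e. e \<in> ext_points X \<Longrightarrow> f e = 0 \<or> f e = 1"
    and alt: "choquet_simplex X \<or> (\<forall>a\<in>A_c X. \<exists>b\<in>sa_baire. \<forall>e\<in>ext_points X. b e = f e * a e)"
  shows "good_split_face {x \<in> X. f x = 1}" "split_lambda X {x \<in> X. f x = 1} = f"
proof -
  interpret ext_indicator X f by standard (use f in auto)
  have unique: "y = y'" if "0 < t" "t < 1" "y \<in> F" "z \<in> G" "y' \<in> F" "z' \<in> G"
      "t *\<^sub>R y + (1 - t) *\<^sub>R z = t *\<^sub>R y' + (1 - t) *\<^sub>R z'" for t y z y' z'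
    using alt unique_of_simplex[OF _ that] unique_of_multiplier[OF _ that] by blast
  show "split_lambda X {x \<in> X. f x = 1} = f"
    unfolding F_def[symmetric] by (rule split_lambda_F) (rule unique)
  have "good_split_face F"
    unfolding good_split_face_def compl_face_F
  proof (intro conjI FG_baire FG_measure_convex)
    show "split_face X F" by (rule split_face_F) (rule unique)
  qed
  then show "good_split_face {x \<in> X. f x = 1}" by (simp add: F_def)
qed

lemma level_set_ext:
  assumes "\<And>e. e \<in> ext_points X \<Longrightarrow> f e = (if 0 < (m e :: real) then 1 else (0 :: real))"
  shows "{x \<in> X. 0 < m x} \<inter> ext_points X = {x \<in> X. f x = 1} \<inter> ext_points X"
  using assms by (auto split: if_splits)

text \<open>Stated for a general \<open>H\<close> and threshold \<open>c\<close> for the sake of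
  part (b). Multiplying functions of \<open>A_c X\<close> by the indicator is enough to make
  decompositions unique.\<close>

lemma multiplier_good_split_face:
  assumes H: "A_c X \<subseteq> H" "H \<subseteq> sa_baire"
    and add: "\<And>f g. f \<in> H \<Longrightarrow> g \<in> H \<Longrightarrow> (\<lambda>x\<in>X. f x + g x) \<in> H"
    and scale: "\<And>c f. f \<in> H \<Longrightarrow> (\<lambda>x\<in>X. c * f x) \<in> H"
    and u: "u \<in> multipliers X H"
  obtains f where "f \<in> sa_baire" "\<And>e. e \<in> ext_points X \<Longrightarrow> f e = (if c < u e then 1 else 0)"
    "good_split_face {x \<in> X. f x = 1}" "split_lambda X {x \<in> X. f x = 1} = f"
proof -
  have one: "(\<lambda>x\<in>X. 1) \<in> H" using const_in_A_c H(1) by blast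
  obtain f where f: "f \<in> sa_baire" "\<forall>e\<in>ext_points X. f e = (if c < u e then 1 else 0) * (\<lambda>x\<in>X. 1) e"
    by (rule bexE[OF multiplier_indicator[OF H add scale u one, of c]])
  have fe: "f e = (if c < u e then 1 else 0)" if "e \<in> ext_points X" for e
    using f(2) that ext_in[OF that] by simp
  have "\<exists>b\<in>sa_baire. \<forall>e\<in>ext_points X. b e = f e * a e" if a: "a \<in> A_c X" for a
  proof -
    obtain b where b: "b \<in> sa_baire" "\<forall>e\<in>ext_points X. b e = (if c < u e then 1 else 0) * a e"
      by (rule bexE[OF multiplier_indicator[OF H add scale u subsetD[OF H(1) a], of c]])
    show ?thesis
    proof (rule bexI[OF _ b(1)], rule ballI)
      fix e assume e: "e \<in> ext_points X"
      show "b e = f e * a e" using bspec[OF b(2) e] unfolding fe[OF e] .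
    qed
  qed
  then have alt: "choquet_simplex X \<or> (\<forall>a\<in>A_c X. \<exists>b\<in>sa_baire. \<forall>e\<in>ext_points X. b e = f e * a e)" by blast
  have f01: "f e = 0 \<or> f e = 1" if "e \<in> ext_points X" for e using fe[OF that] by simp
  show thesis
    by (rule that[OF f(1) fe good_split_face_indicator[OF f(1) f01 alt]])
qed

lemma fam_A_eq_good: "fam_A X sa_baire = {F \<inter> ext_points X | F. good_split_face F}"
proof (intro equalityI subsetI)
  fix E assume "E \<in> fam_A X sa_baire"
  then obtain m where m: "m \<in> multipliers X sa_baire" "E = {x \<in> X. m x > 0} \<inter> ext_points X" by (auto simp: fam_A_def)
  obtain f where f: "f \<in> sa_baire" "\<And>e. e \<in> ext_points X \<Longrightarrow> f e = (if 0 < m e then 1 else 0)"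
    "good_split_face {x \<in> X. f x = 1}"
    using multiplier_good_split_face[OF A_c_subset_sa_baire order_refl sa_baire_add sa_baire_scale m(1)] by blast
  have "E = {x \<in> X. f x = 1} \<inter> ext_points X" unfolding m(2) by (rule level_set_ext[OF f(2)])
  then show "E \<in> {F \<inter> ext_points X | F. good_split_face F}" using f(3) by blast
next
  fix E assume "E \<in> {F \<inter> ext_points X | F. good_split_face F}"
  then obtain F where F: "good_split_face F" "E = F \<inter> ext_points X" by blast
  interpret split_baire_face X F by (rule good_split_faceD[OF F(1)])
  have "E = {x \<in> X. split_lambda X F x > 0} \<inter> ext_points X"
    unfolding F(2) using split_lambda_ext ext_in by (auto simp: indicator_def split: if_splits)
  then show "E \<in> fam_A X sa_baire" unfolding fam_A_def using split_lambda_multiplier by blast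
qed

text \<open>Off \<open>F\<close> and its complementary set the split function lies strictly between
  0 and 1. Both sets are therefore level sets of a strongly affine Baire function, hence Baire and
  measure convex.\<close>

lemma fam_S_eq_good: "fam_S X sa_baire = {F \<inter> ext_points X | F. good_split_face F}"
proof (intro equalityI subsetI)
  fix E assume "E \<in> fam_S X sa_baire"
  then obtain F where F: "split_face X F" "split_lambda X F \<in> sa_baire" "E = F \<inter> ext_points X"
    unfolding fam_S_def monotone_limits_sa_baire by blast
  have FX: "F \<subseteq> X" using F(1) by (auto simp: split_face_def face_def extremal_def)
  let ?G = "compl_face X F"
  have mid: "split_lambda X F x \<noteq> 0 \<and> split_lambda X F x \<noteq> 1" if x: "x \<in> X - (F \<union> ?G)" for x
  proof -
    have ex1: "\<exists>!(t, y, z). t \<in> {0<..<1} \<and> y \<in> F \<and> z \<in> ?G \<and> x = t *\<^sub>R y + (1 - t) *\<^sub>R z"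
      using F(1) x unfolding split_face_def by blast
    then obtain t y z where t: "t \<in> {0<..<1}" "y \<in> F" "z \<in> ?G" "x = t *\<^sub>R y + (1 - t) *\<^sub>R z" by auto
    have "(THE t. t \<in> {0<..<1} \<and> (\<exists>y\<in>F. \<exists>z\<in>?G. x = t *\<^sub>R y + (1 - t) *\<^sub>R z)) = t"
    proof (rule the_equality)
      show "t \<in> {0<..<1} \<and> (\<exists>y\<in>F. \<exists>z\<in>?G. x = t *\<^sub>R y + (1 - t) *\<^sub>R z)" using t by blast
      fix s assume "s \<in> {0<..<1} \<and> (\<exists>y\<in>F. \<exists>z\<in>?G. x = s *\<^sub>R y + (1 - s) *\<^sub>R z)"
      then obtain v w where s: "s \<in> {0<..<1}" "v \<in> F" "w \<in> ?G" "x = s *\<^sub>R v + (1 - s) *\<^sub>R w" by blast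
      have "(s, v, w) = (t, y, z)" by (rule ex1E[OF ex1]) (use s t in auto)
      then show "s = t" by simp
    qed
    then have "split_lambda X F x = t" using x by (simp add: split_lambda_def)
    then show ?thesis using t(1) by simp
  qed
  have l1: "split_lambda X F x = 1" if "x \<in> F" for x
    using that FX by (auto simp: split_lambda_def)
  have l0: "split_lambda X F x = 0" if "x \<in> ?G" for x
    using that compl_face_subset[of F] compl_face_disjoint[of F] by (auto simp: split_lambda_def)
  have F_eq: "F = {x \<in> X. split_lambda X F x = 1}"
  proof (intro equalityI subsetI CollectI conjI)
    fix x assume "x \<in> {x \<in> X. split_lambda X F x = 1}"
    then show "x \<in> F" using mid[of x] l0[of x] by (cases "x \<in> ?G") auto
  qed (use FX l1 in auto)
  have G_eq: "?G = {x \<in> X. split_lambda X F x = 0}"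
  proof (intro equalityI subsetI CollectI conjI)
    fix x assume "x \<in> {x \<in> X. split_lambda X F x = 0}"
    then show "x \<in> ?G" using mid[of x] l1[of x] by (cases "x \<in> F") auto
  qed (use compl_face_subset[of F] l0 in auto)
  have "F \<in> sets (baire X)" "measure_convex X F" "?G \<in> sets (baire X)" "measure_convex X ?G"
    by (subst F_eq, rule level_set_baire[OF F(2)], subst F_eq, rule level_set_measure_convex[OF F(2)],
        subst G_eq, rule level_set_baire[OF F(2)], subst G_eq, rule level_set_measure_convex[OF F(2)])
  then have "good_split_face F" unfolding good_split_face_def using F(1) by blast
  then show "E \<in> {F \<inter> ext_points X | F. good_split_face F}" using F(3) by blast
next
  fix E assume "E \<in> {F \<inter> ext_points X | F. good_split_face F}"
  then obtain F where F: "good_split_face F" "E = F \<inter> ext_points X" by blast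
  interpret split_baire_face X F by (rule good_split_faceD[OF F(1)])
  show "E \<in> fam_S X sa_baire"
    unfolding fam_S_def monotone_limits_sa_baire using F(2) split split_lambda_sa_baire by blast
qed

text \<open>Here uniqueness of maximal measures takes the place of the multiplier property and makes
  the set where \<open>f\<close> is 1 a split face.\<close>

lemma fam_A_simplex:
  assumes "choquet_simplex X"
  shows "fam_A X sa_baire = {{x \<in> X. f x = 1} \<inter> ext_points X | f. f \<in> sa_baire \<and> f ` ext_points X \<subseteq> {0, 1}}"
proof (intro equalityI subsetI)
  fix E assume "E \<in> fam_A X sa_baire"
  then obtain m where m: "m \<in> multipliers X sa_baire" "E = {x \<in> X. m x > 0} \<inter> ext_points X" by (auto simp: fam_A_def)
  obtain f where f: "f \<in> sa_baire" "\<And>e. e \<in> ext_points X \<Longrightarrow> f e = (if 0 < m e then 1 else 0)"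
    using multiplier_good_split_face[OF A_c_subset_sa_baire order_refl sa_baire_add sa_baire_scale m(1)] by blast
  have "E = {x \<in> X. f x = 1} \<inter> ext_points X" unfolding m(2) by (rule level_set_ext[OF f(2)])
  moreover have "f ` ext_points X \<subseteq> {0, 1}" using f(2) by auto
  ultimately show "E \<in> {{x \<in> X. f x = 1} \<inter> ext_points X | f. f \<in> sa_baire \<and> f ` ext_points X \<subseteq> {0, 1}}"
    using f(1) by blast
next
  fix E assume "E \<in> {{x \<in> X. f x = 1} \<inter> ext_points X | f. f \<in> sa_baire \<and> f ` ext_points X \<subseteq> {0, 1}}"
  then obtain f where f: "f \<in> sa_baire" "f ` ext_points X \<subseteq> {0, 1}" "E = {x \<in> X. f x = 1} \<inter> ext_points X" by blast
  have "good_split_face {x \<in> X. f x = 1}"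
    by (rule good_split_face_indicator(1)[OF f(1)]) (use f(2) assms in auto)
  then show "E \<in> fam_A X sa_baire" unfolding fam_A_eq_good using f(3) by blast
qed

text \<open>With \<open>\<bar>u\<bar> \<le> B\<close> and step \<open>d = 2 B / (n + 1)\<close>, the sum \<open>\<Sum>k\<le>n. d \<cdot> 1\<^bsub>{u > k d - B}\<^esub> - B\<close> is within \<open>d\<close> of \<open>u\<close>.\<close>

lemma multipliers_mono:
  assumes H: "intermediate_function_space X H" "H \<subseteq> sa_baire"
  shows "multipliers X H \<subseteq> multipliers X sa_baire"
proof
  fix u assume u: "u \<in> multipliers X H"
  have Ac: "A_c X \<subseteq> H" and add: "\<And>f g. f \<in> H \<Longrightarrow> g \<in> H \<Longrightarrow> (\<lambda>x\<in>X. f x + g x) \<in> H"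
    and scale: "\<And>c f. f \<in> H \<Longrightarrow> (\<lambda>x\<in>X. c * f x) \<in> H"
    using H(1) by (auto simp: intermediate_function_space_def)
  have us: "u \<in> sa_baire" using u H(2) by (auto simp: multipliers_def)
  \<comment> \<open>\<open>u\<close> is known to multiply only \<open>H\<close>, but the indicator
    of \<open>{u > c}\<close> on the extreme points is the split function of a face and therefore
    multiplies all of \<open>sa_baire\<close>.\<close>
  have ind: "\<exists>b\<in>sa_baire. \<forall>e\<in>ext_points X. b e = (if c < u e then 1 else 0) * a e" if a: "a \<in> sa_baire" for a c
  proof -
    obtain f where f: "f \<in> sa_baire" "\<And>e. e \<in> ext_points X \<Longrightarrow> f e = (if c < u e then 1 else 0)"
      "good_split_face {x \<in> X. f x = 1}" "split_lambda X {x \<in> X. f x = 1} = f"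
      using multiplier_good_split_face[OF Ac H(2) add scale u] by blast
    have "f \<in> multipliers X sa_baire"
      using split_baire_face.split_lambda_multiplier[OF good_split_faceD[OF f(3)]] unfolding f(4) .
    then obtain b where b: "b \<in> sa_baire" "\<forall>e\<in>ext_points X. b e = f e * a e"
      using a unfolding multipliers_def by blast
    show ?thesis
    proof (rule bexI[OF _ b(1)], rule ballI)
      fix e assume e: "e \<in> ext_points X"
      show "b e = (if c < u e then 1 else 0) * a e" using bspec[OF b(2) e] unfolding f(2)[OF e] .
    qed
  qed
  have "\<exists>b\<in>sa_baire. \<forall>e\<in>ext_points X. b e = u e * a e" if a: "a \<in> sa_baire" for a
  proof -
    obtain B0 where B0: "B0 \<ge> 0" "\<And>x. x \<in> X \<Longrightarrow> \<bar>u x\<bar> \<le> B0" using sa_baire_bounded[OF us] by blast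
    \<comment> \<open>The added 1 makes \<open>B\<close>, and with it the step \<open>d n\<close>,
      strictly positive.\<close>
    define B where "B = B0 + 1"
    have B: "B > 0" "\<And>e. e \<in> ext_points X \<Longrightarrow> \<bar>u e\<bar> \<le> B" using B0 ext_in by (force simp: B_def)+
    obtain A where A: "A \<ge> 0" "\<And>x. x \<in> X \<Longrightarrow> \<bar>a x\<bar> \<le> A" using sa_baire_bounded[OF a] by blast
    define d where "d = (\<lambda>n. 2 * B * inverse (real (Suc n)))"
    define s where "s = (\<lambda>n r. (\<Sum>k<Suc n. d n * (if real k * d n - B < r then 1 else 0)) - B)"
    have d: "d n > 0" "real (Suc n) * d n = 2 * B" for n using B(1) by (simp_all add: d_def)
    have s_close: "\<bar>s n r - r\<bar> \<le> d n" if r: "\<bar>r\<bar> \<le> B" for n r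
    proof -
      \<comment> \<open>The first conjunct is the wanted estimate. The other two make the induction
        work: the partial sum is exact up to level \<open>r + B\<close>, and beyond it the sum stays
        at least \<open>r + B\<close> without further terms.\<close>
      have part: "\<bar>(\<Sum>k<j. d n * (if real k * d n - B < r then 1 else 0)) - min (r + B) (real j * d n)\<bar> \<le> d n \<and>
          (real j * d n \<le> r + B \<longrightarrow> (\<Sum>k<j. d n * (if real k * d n - B < r then 1 else 0)) = real j * d n) \<and>
          (r + B < real j * d n \<longrightarrow> r + B \<le> (\<Sum>k<j. d n * (if real k * d n - B < r then 1 else 0)))" for j
      proof (induction j)
        case 0
        then show ?case using r d(1)[of n] by auto
      next
        case (Suc j)
        have e: "real (Suc j) * d n = real j * d n + d n" by (simp add: algebra_simps)
        show ?case
        proof -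
          define S where "S = (\<Sum>k<j. d n * (if real k * d n - B < r then 1 else 0))"
          define p where "p = real j * d n"
          have IH: "\<bar>S - min (r + B) p\<bar> \<le> d n" "p \<le> r + B \<longrightarrow> S = p" "r + B < p \<longrightarrow> r + B \<le> S"
            using Suc unfolding S_def p_def by blast+
          have dn: "d n > 0" by (rule d(1))
          consider "r + B < p" | "p = r + B" | "p < r + B" by linarith
          then show ?thesis
            unfolding sum.lessThan_Suc e S_def[symmetric] p_def[symmetric]
          proof cases
            case 1
            then have "\<not> p - B < r" by linarith
            with 1 dn IH show "\<bar>S + d n * (if p - B < r then 1 else 0) - min (r + B) (p + d n)\<bar> \<le> d n \<and>
                (p + d n \<le> r + B \<longrightarrow> S + d n * (if p - B < r then 1 else 0) = p + d n) \<and>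
                (r + B < p + d n \<longrightarrow> r + B \<le> S + d n * (if p - B < r then 1 else 0))"
              by (simp add: min_def)
          next
            case 2
            then have "\<not> p - B < r" by linarith
            with 2 dn IH show "\<bar>S + d n * (if p - B < r then 1 else 0) - min (r + B) (p + d n)\<bar> \<le> d n \<and>
                (p + d n \<le> r + B \<longrightarrow> S + d n * (if p - B < r then 1 else 0) = p + d n) \<and>
                (r + B < p + d n \<longrightarrow> r + B \<le> S + d n * (if p - B < r then 1 else 0))"
              by (simp add: min_def)
          next
            case 3
            then have "p - B < r" "S = p" using IH by linarith+
            with 3 dn show "\<bar>S + d n * (if p - B < r then 1 else 0) - min (r + B) (p + d n)\<bar> \<le> d n \<and>
                (p + d n \<le> r + B \<longrightarrow> S + d n * (if p - B < r then 1 else 0) = p + d n) \<and>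
                (r + B < p + d n \<longrightarrow> r + B \<le> S + d n * (if p - B < r then 1 else 0))"
              by (simp add: min_def)
          qed
        qed
      qed
      have "min (r + B) (real (Suc n) * d n) = r + B" using r by (subst d(2)) auto
      then have "\<bar>(\<Sum>k<Suc n. d n * (if real k * d n - B < r then 1 else 0)) - (r + B)\<bar> \<le> d n"
        using conjunct1[OF part[of "Suc n"]] by (simp only:)
      then show ?thesis unfolding s_def by linarith
    qed
    have step: "\<exists>b\<in>sa_baire. \<forall>e\<in>ext_points X. b e = (\<Sum>k<m. d n * (if real k * d n - B < u e then 1 else 0)) * a e" for n m
    proof (induction m)
      case 0
      show ?case
        by (rule bexI[OF _ sa_baire_scale[OF a, of 0]]) (use ext_in in auto)
    next
      case (Suc m)
      obtain b where b: "b \<in> sa_baire"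
        "\<forall>e\<in>ext_points X. b e = (\<Sum>k<m. d n * (if real k * d n - B < u e then 1 else 0)) * a e" using Suc by blast
      obtain b' where b': "b' \<in> sa_baire" "\<forall>e\<in>ext_points X. b' e = (if real m * d n - B < u e then 1 else 0) * a e"
        using ind[OF a] by blast
      show ?case
        by (rule bexI[OF _ sa_baire_lincomb[OF b(1) b'(1), of 1 "d n"]])
          (use b(2) b'(2) ext_in in \<open>auto simp: algebra_simps\<close>)
    qed
    have "\<exists>b\<in>sa_baire. \<forall>e\<in>ext_points X. b e = s n (u e) * a e" for n
    proof -
      obtain b where b: "b \<in> sa_baire"
        "\<forall>e\<in>ext_points X. b e = (\<Sum>k<Suc n. d n * (if real k * d n - B < u e then 1 else 0)) * a e" using step by blast
      show ?thesis
        by (rule bexI[OF _ sa_baire_lincomb[OF b(1) a, of 1 "- B"]])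
          (use b(2) ext_in in \<open>auto simp: s_def algebra_simps simp del: sum.lessThan_Suc\<close>)
    qed
    then obtain b where b: "\<And>n. b n \<in> sa_baire" "\<And>n e. e \<in> ext_points X \<Longrightarrow> b n e = s n (u e) * a e" by metis
    have d0: "(\<lambda>n. d n) \<longlonglongrightarrow> 0"
      unfolding d_def using tendsto_mult_right_zero[OF LIMSEQ_inverse_real_of_nat] .
    have lim: "(\<lambda>n. b n e) \<longlonglongrightarrow> u e * a e" if e: "e \<in> ext_points X" for e
    proof -
      have "(\<lambda>n. s n (u e) - u e) \<longlonglongrightarrow> 0"
        by (rule tendsto_rabs_zero_cancel, rule real_tendsto_sandwich[OF _ _ tendsto_const d0])
          (use s_close[OF B(2)[OF e]] in \<open>auto intro!: always_eventually\<close>)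
      then have "(\<lambda>n. (s n (u e) - u e) + u e) \<longlonglongrightarrow> 0 + u e" by (intro tendsto_intros)
      then show ?thesis unfolding b(2)[OF e] by (intro tendsto_intros) simp
    qed
    have bound: "\<bar>b n e\<bar> \<le> (3 * B) * A" if e: "e \<in> ext_points X" for n e
    proof -
      have "d n \<le> 2 * B" unfolding d_def using B(1) by (simp add: inverse_le_1_iff mult_left_le)
      then have "\<bar>s n (u e)\<bar> \<le> 3 * B" using s_close[OF B(2)[OF e], of n] B(2)[OF e] by linarith
      then show ?thesis unfolding b(2)[OF e] abs_mult using A(1) A(2)[OF ext_in[OF e]] B(1) by (intro mult_mono) auto
    qed
    show ?thesis
    proof (rule sa_baire_limit_ext[OF b(1) bound lim])
      fix b' assume b': "b' \<in> sa_baire" "\<And>e. e \<in> ext_points X \<Longrightarrow> b' e = u e * a e"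
      show ?thesis by (rule bexI[OF _ b'(1)], rule ballI, rule b'(2))
    qed
  qed
  then show "u \<in> multipliers X sa_baire" using us by (simp add: multipliers_def)
qed

end

theorem theorem11p5:
  fixes X :: "'a::locally_convex_space set" and H :: "('a \<Rightarrow> real) set"
  assumes "compact X" and "convex X"
    and "H = A_sa X \<inter> Ba X"
  shows
    "(fam_A X H = fam_A_s X H \<and>
      fam_A_s X H = fam_S X H \<and>
      fam_S X H =
        {F \<inter> ext_points X | F. split_face X F \<and>
           F \<in> sets (baire X) \<and> measure_convex X F \<and>
           compl_face X F \<in> sets (baire X) \<and> measure_convex X (compl_face X F)} \<and>
      (choquet_simplex X \<longrightarrow>
         fam_A X H = fam_Z X H \<and>
         fam_Z X H =
           {{x \<in> X. f x = 1} \<inter> ext_points X | f.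
              f \<in> A_sa X \<inter> Ba X \<and> f ` ext_points X \<subseteq> {0, 1}})) \<and>
     (\<forall>H'. intermediate_function_space X H' \<and> H' \<subseteq> H \<longrightarrow> multipliers X H' \<subseteq> multipliers X H)"
proof -
  interpret compact_convex X by standard (use assms in auto)
  have H: "H = sa_baire" unfolding sa_baire_def by (rule assms(3))
  have As: "fam_A X sa_baire = fam_A_s X sa_baire"
    unfolding fam_A_def fam_A_s_def multipliers_eq_strong ..
  have Z: "fam_Z X sa_baire = {{x \<in> X. f x = 1} \<inter> ext_points X | f. f \<in> sa_baire \<and> f ` ext_points X \<subseteq> {0, 1}}"
    unfolding fam_Z_def monotone_limits_sa_baire ..
  show ?thesis
    unfolding H sa_baire_def[symmetric] good_split_face_def[symmetric]
  proof (intro conjI impI allI)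
    show "fam_A X sa_baire = fam_A_s X sa_baire" by (rule As)
    show "fam_A_s X sa_baire = fam_S X sa_baire" unfolding As[symmetric] fam_A_eq_good fam_S_eq_good ..
    show "fam_S X sa_baire = {F \<inter> ext_points X |F. good_split_face F}" by (rule fam_S_eq_good)
    show "fam_A X sa_baire = fam_Z X sa_baire" if "choquet_simplex X"
      unfolding Z by (rule fam_A_simplex[OF that])
    show "fam_Z X sa_baire = {{x \<in> X. f x = 1} \<inter> ext_points X |f. f \<in> sa_baire \<and> f ` ext_points X \<subseteq> {0, 1}}"
      by (rule Z)
    show "multipliers X H' \<subseteq> multipliers X sa_baire" if "intermediate_function_space X H' \<and> H' \<subseteq> sa_baire" for H'
      by (rule multipliers_mono) (use that in blast)+
  qed
qed

end
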